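(* Let $n\ge2$, $1\le q\le\infty$, $\sigma_q=1-\min\{1-\frac1q,\frac1q\}$ (with $1/\infty=0$) and $0\le\sigma<\sigma_q$. Then the Navier-Stokes initial value problem is ill-posed in $B^{-1,\sigma}_{\infty q}(\mathbb{R}^n)$ in the following precise sense. There exist constants $C,c,\delta_0,N_0>0$, depending only on $n,q,\sigma$, such that for every $0<\delta<\delta_0$ and every $N>N_0$ there exists $u_0\in S(\mathbb{R}^n)$ with $\nabla\cdot u_0=0$ and $$\|u_0\|_{B^{-1,\sigma}_{\infty q}}\le C$$ such that, if $u=u(\delta,t)$ denotes the solution of the Navier-Stokes initial value problem with initial data $\delta u_0$ (in case such a solution exists), then $$\|u(\delta,t)\|_{B^{-1,\sigma}_{\infty q}}\ge c\,(\ln N)^{\sigma_q-\sigma}$$ for some $0<t\le 1/N$.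
   Context: Function spaces are denoted the same way for scalar and $n$-vector valued functions; $\|\cdot\|_p$ is the norm of $L^p(\mathbb{R}^n)$, $S(\mathbb R^n)$ is the Schwartz space. Littlewood-Paley operators: fix a non-increasing $\phi\in C^\infty[0,\infty)$ with $0\le\phi\le1$, $\phi(t)=1$ for $0\le t\le 5/4$, $\phi(t)=0$ for $t\ge 3/2$. Put $\varphi(\xi)=\phi(|\xi|)$, $\psi(\xi)=\phi(|\xi|)-\phi(2|\xi|)$, $\psi_j(\xi)=\psi(2^{-j}\xi)$, and for $u\in S'(\mathbb{R}^n)$, $S_0u=\mathscr F^{-1}(\varphi\hat u)$, $\Delta_ju=\mathscr F^{-1}(\psi_j\hat u)$. For $s\in\mathbb R$, $\sigma\ge0$, $p,q\in[1,\infty]$, the space $B^{s,\sigma}_{pq}(\mathbb{R}^n)$ consists of all $u\in S'(\mathbb{R}^n)$ with finite norm $\|u\|_{B^{s,\sigma}_{pq}}=\|S_0u\|_p+\big\|\{2^{js}j^{\sigma}\|\Delta_ju\|_p\}_{j=1}^\infty\big\|_{\ell^q}$. The Navier-Stokes initial value problem with data $v_0$ is $\partial_tu-\Delta u+\mathbb P\nabla\cdot(u\otimes u)=0$ in $\mathbb R^n\times(0,\infty)$, $u(\cdot,0)=v_0$, where $\mathbb P$ is the Helmholtz-Weyl projection, i.e. the matrix Fourier multiplier with symbol $(\delta_{ij}-\xi_i\xi_j/|\xi|^2)_{i,j=1}^n$. For Schwartz divergence-free data, "the solution" means the (unique) bounded mild solution on $\mathbb R^n\times[0,1/N]$, i.e.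 the $u\in L^\infty(\mathbb R^n\times(0,1/N))$ satisfying $$u(t)=e^{t\Delta}v_0-\int_0^te^{(t-\tau)\Delta}\mathbb P\nabla\cdot[u(\tau)\otimes u(\tau)]\,d\tau,\qquad 0<t\le 1/N,$$ where $e^{s\Delta}\mathbb P\nabla\cdot$ ($s>0$) acts on bounded matrix functions by convolution with its $L^1$ kernel. *)

theory Defs
  imports "HOL-Analysis.Analysis" "HOL-Probability.Essential_Supremum"
begin

definition partial :: "'n::finite \<Rightarrow> (real^'n \<Rightarrow> 'b::real_normed_vector) \<Rightarrow> real^'n \<Rightarrow> 'b" where
  "partial i f x = frechet_derivative f (at x) (axis i 1)"

text \<open>Multi-indices are encoded as lists of coordinate directions.  Differentiability of every
  iterated partial derivative is smoothness, and makes the order of the directions irrelevant.\<close>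

definition schwartz :: "(real^'n::finite \<Rightarrow> 'b::real_normed_vector) \<Rightarrow> bool" where
  "schwartz f \<longleftrightarrow>
     (\<forall>is x. foldr partial is f differentiable (at x)) \<and>
     (\<forall>is (k::nat). bounded (range (\<lambda>x. (1 + norm x) ^ k *\<^sub>R foldr partial is f x)))"

definition divergence :: "(real^'n::finite \<Rightarrow> real^'n) \<Rightarrow> real^'n \<Rightarrow> real" where
  "divergence f x = (\<Sum>i\<in>UNIV. partial i f x $ i)"

definition fourier :: "(real^'n::finite \<Rightarrow> complex) \<Rightarrow> real^'n \<Rightarrow> complex" where
  "fourier f \<xi> = (LINT x|lborel. cis (- (x \<bullet> \<xi>)) * f x)"

definition inv_fourier :: "(real^'n::finite \<Rightarrow> complex) \<Rightarrow> real^'n \<Rightarrow> complex" where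
  "inv_fourier f x = (LINT \<xi>|lborel. cis (x \<bullet> \<xi>) * f \<xi>) / (2 * of_real pi) ^ CARD('n)"

text \<open>A \<open>\<complex>\<^sup>m\<close>-valued tempered distribution is encoded as a functional on functions, of which
  only the values on Schwartz functions are relevant.\<close>

type_synonym ('n, 'm) dist = "(real^'n \<Rightarrow> complex) \<Rightarrow> complex^'m"

definition regular_dist :: "(real^'n::finite \<Rightarrow> complex^'m::finite) \<Rightarrow> ('n, 'm) dist" where
  "regular_dist f \<eta> = (LINT x|lborel. \<eta> x *s f x)"

definition real_dist :: "(real^'n::finite \<Rightarrow> real^'m::finite) \<Rightarrow> ('n, 'm) dist" where
  "real_dist f = regular_dist (\<lambda>x. \<chi> i. complex_of_real (f x $ i))"

definition dist_fourier :: "('n::finite, 'm::finite) dist \<Rightarrow> ('n, 'm) dist" where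
  "dist_fourier T \<eta> = T (fourier \<eta>)"

definition dist_inv_fourier :: "('n::finite, 'm::finite) dist \<Rightarrow> ('n, 'm) dist" where
  "dist_inv_fourier T \<eta> = T (inv_fourier \<eta>)"

definition dist_mult :: "(real^'n::finite \<Rightarrow> real) \<Rightarrow> ('n, 'm::finite) dist \<Rightarrow> ('n, 'm) dist" where
  "dist_mult m T \<eta> = T (\<lambda>\<xi>. complex_of_real (m \<xi>) * \<eta> \<xi>)"

text \<open>Only used with exponents \<open>r > 0\<close>.\<close>

definition ennreal_powr :: "ennreal \<Rightarrow> real \<Rightarrow> ennreal" where
  "ennreal_powr a r = (if a = \<infinity> then \<infinity> else ennreal (enn2real a powr r))"

definition Lp_norm :: "ennreal \<Rightarrow> (real^'n::finite \<Rightarrow> 'b::real_normed_vector) \<Rightarrow> ennreal" where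
  "Lp_norm p f =
     (if p = \<infinity> then esssup lborel (\<lambda>x. ennreal (norm (f x)))
      else ennreal_powr (\<integral>\<^sup>+x. ennreal (norm (f x) powr enn2real p) \<partial>lborel) (enn2real (1 / p)))"

definition lq_norm :: "ennreal \<Rightarrow> (nat \<Rightarrow> ennreal) \<Rightarrow> ennreal" where
  "lq_norm q a =
     (if q = \<infinity> then (SUP k. a k)
      else ennreal_powr (\<Sum>k. ennreal_powr (a k) (enn2real q)) (enn2real (1 / q)))"

text \<open>The \<open>L\<^sup>p\<close> norm of a distribution is that of the function representing it, which is unique
  up to null sets, and \<open>\<infinity>\<close> (the infimum of the empty set) if no \<open>L\<^sup>p\<close> function represents it.\<close>

definition dist_Lp_norm :: "ennreal \<Rightarrow> ('n::finite, 'm::finite) dist \<Rightarrow> ennreal" where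
  "dist_Lp_norm p T =
     (INF f \<in> {f \<in> borel_measurable lborel. Lp_norm p f < \<infinity> \<and>
                 (\<forall>\<eta>. schwartz \<eta> \<longrightarrow> T \<eta> = regular_dist f \<eta>)}. Lp_norm p f)"

text \<open>On \<open>[0,\<infinity>)\<close>, smoothness is expressed with one-sided derivatives at \<open>0\<close>.\<close>

definition smooth_half_line :: "(real \<Rightarrow> real) \<Rightarrow> bool" where
  "smooth_half_line f \<longleftrightarrow>
     (\<exists>D :: nat \<Rightarrow> real \<Rightarrow> real. D 0 = f \<and>
        (\<forall>k. \<forall>t\<ge>0. (D k has_real_derivative D (Suc k) t) (at t within {0..})))"

definition LP_cutoff :: "(real \<Rightarrow> real) \<Rightarrow> bool" where
  "LP_cutoff \<phi> \<longleftrightarrow>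
     smooth_half_line \<phi> \<and> antimono_on {0..} \<phi> \<and>
     (\<forall>t\<ge>0. 0 \<le> \<phi> t \<and> \<phi> t \<le> 1) \<and>
     (\<forall>t. 0 \<le> t \<and> t \<le> 5/4 \<longrightarrow> \<phi> t = 1) \<and>
     (\<forall>t\<ge>3/2. \<phi> t = 0)"

definition LP_psi :: "(real \<Rightarrow> real) \<Rightarrow> real^'n::finite \<Rightarrow> real" where
  "LP_psi \<phi> \<xi> = \<phi> (norm \<xi>) - \<phi> (2 * norm \<xi>)"

definition LP_S0 :: "(real \<Rightarrow> real) \<Rightarrow> ('n::finite, 'm::finite) dist \<Rightarrow> ('n, 'm) dist" where
  "LP_S0 \<phi> T = dist_inv_fourier (dist_mult (\<lambda>\<xi>. \<phi> (norm \<xi>)) (dist_fourier T))"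

definition LP_Delta :: "(real \<Rightarrow> real) \<Rightarrow> nat \<Rightarrow> ('n::finite, 'm::finite) dist \<Rightarrow> ('n, 'm) dist" where
  "LP_Delta \<phi> j T =
     dist_inv_fourier (dist_mult (\<lambda>\<xi>. LP_psi \<phi> ((1 / 2 ^ j) *\<^sub>R \<xi>)) (dist_fourier T))"

text \<open>The norm of \<open>B\<^sup>s\<^sup>,\<^sup>\<sigma>\<^sub>p\<^sub>q\<close>, with value \<open>\<infinity>\<close> outside the space; the sequence index is
  shifted because \<open>j\<close> ranges over \<open>j \<ge> 1\<close>.\<close>

definition besov_norm ::
  "(real \<Rightarrow> real) \<Rightarrow> real \<Rightarrow> real \<Rightarrow> ennreal \<Rightarrow> ennreal \<Rightarrow> ('n::finite, 'm::finite) dist \<Rightarrow> ennreal" where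
  "besov_norm \<phi> s \<sigma> p q T =
     dist_Lp_norm p (LP_S0 \<phi> T) +
     lq_norm q (\<lambda>k. let j = Suc k in
       ennreal (2 powr (real j * s) * real j powr \<sigma>) * dist_Lp_norm p (LP_Delta \<phi> j T))"

definition sigma_crit :: "ennreal \<Rightarrow> real" where
  "sigma_crit q = 1 - min (1 - enn2real (1 / q)) (enn2real (1 / q))"

definition heat_semigroup :: "real \<Rightarrow> (real^'n::finite \<Rightarrow> real^'m::finite) \<Rightarrow> real^'n \<Rightarrow> real^'m" where
  "heat_semigroup t v x =
     (LINT y|lborel. ((4 * pi * t) powr (- real CARD('n) / 2) * exp (- (norm (x - y))\<^sup>2 / (4 * t))) *\<^sub>R v y)"

definition helmholtz_symbol :: "'n::finite \<Rightarrow> 'n \<Rightarrow> real^'n \<Rightarrow> real" where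
  "helmholtz_symbol i j \<xi> = (if i = j then 1 else 0) - \<xi> $ i * \<xi> $ j / (norm \<xi>)\<^sup>2"

text \<open>The kernel of \<open>e\<^sup>s\<^sup>\<Delta> \<P> \<nabla>\<cdot>\<close> is the inverse Fourier transform of the product of the symbols
  of the heat semigroup, of \<open>\<P>\<close> and of \<open>\<partial>\<^sub>k\<close>.  It is real because the symbol at \<open>-\<xi>\<close> is the
  complex conjugate of the symbol at \<open>\<xi>\<close>; \<open>Re\<close> only changes the type.\<close>

definition oseen_kernel :: "real \<Rightarrow> 'n::finite \<Rightarrow> 'n \<Rightarrow> 'n \<Rightarrow> real^'n \<Rightarrow> real" where
  "oseen_kernel s i j k x =
     Re (inv_fourier (\<lambda>\<xi>. of_real (exp (- s * (norm \<xi>)\<^sup>2) * helmholtz_symbol i j \<xi>) *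
                         (\<i> * of_real (\<xi> $ k))) x)"

definition heat_P_div :: "real \<Rightarrow> (real^'n::finite \<Rightarrow> real^'n^'n) \<Rightarrow> real^'n \<Rightarrow> real^'n" where
  "heat_P_div s F x =
     (\<chi> i. \<Sum>j\<in>UNIV. \<Sum>k\<in>UNIV. LINT y|lborel. oseen_kernel s i j k (x - y) * F y $ j $ k)"

definition tensor :: "real^'n::finite \<Rightarrow> real^'n \<Rightarrow> real^'n^'n" where
  "tensor a b = (\<chi> j k. a $ j * b $ k)"

text \<open>A class in \<open>L\<^sup>\<infinity>\<close> of the space-time strip satisfying the integral equation determines the
  slice at every single time \<open>t \<in> (0,T]\<close> up to a null set, because the equation is required for
  every such \<open>t\<close>.  The function \<open>u\<close> is a Borel representative having these slices.\<close>

definition bounded_mild_solution ::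
  "real \<Rightarrow> (real^'n::finite \<Rightarrow> real^'n) \<Rightarrow> (real \<Rightarrow> real^'n \<Rightarrow> real^'n) \<Rightarrow> bool" where
  "bounded_mild_solution T v0 u \<longleftrightarrow>
     (\<lambda>z. u (fst z) (snd z)) \<in> borel_measurable (restrict_space borel ({0<..T} \<times> UNIV)) \<and>
     (\<exists>M. AE z in lborel. fst z \<in> {0<..<T} \<longrightarrow> norm (u (fst z) (snd z)) \<le> M) \<and>
     (\<forall>t\<in>{0<..T}. AE x in lborel.
        u t x = heat_semigroup t v0 x -
          (LINT \<tau>:{0<..<t}|lborel. heat_P_div (t - \<tau>) (\<lambda>y. tensor (u \<tau> y) (u \<tau> y)) x))"

end

theory Submission
  imports Defs "HOL-Probability.Probability"
begin

text \<open>
  The initial data are a multiple of \<open>\<Sum>\<^sub>k v\<^sub>k\<close>, where \<open>k\<close> runs over \<open>K\<close> consecutive integers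
  above \<open>100 L\<close> and \<open>v\<^sub>k\<close> is the rotated gradient of \<open>g(x) sin(\<kappa> x\<^sub>a)\<close> with \<open>\<kappa> = 2\<^sup>k\<close>.  The common
  amplitude \<open>g\<close> is a sum of \<open>L\<close> modulated bumps with separated positions and the frequencies
  \<open>8\<^sup>l / 2\<close>, \<open>L \<le> l < 2 L\<close>; hence \<open>g\<close> is bounded uniformly in \<open>L\<close>.

  Under the flow \<open>v\<^sub>k\<close> lives for a time of order \<open>\<kappa>\<^sup>-\<^sup>2\<close>.  Its self-interaction has size \<open>\<kappa>\<^sup>2\<close>, and
  at low frequencies it is \<open>\<kappa>\<^sup>2 g\<^sup>2 / 2\<close> in one entry of the tensor, up to small errors.  Integrated over
  its lifetime, every \<open>v\<^sub>k\<close> thus contributes the same multiple of \<open>\<P> \<nabla>\<cdot> g\<^sup>2\<close>, whose component at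
  the frequency \<open>8\<^sup>l\<close> comes from the \<open>l\<close>-th bump alone and has size \<open>8\<^sup>l\<close>.  The solution
  at time \<open>4\<^bsup>-100L\<^esup>\<close> therefore has \<open>L\<close> Littlewood-Paley components proportional to \<open>K\<close>,
  whereas the initial data have \<open>K\<close> components of unit size, all weighted by \<open>L\<^sup>\<sigma>\<close>.  The choices \<open>K = 1\<close>
  for \<open>q < 2\<close> and \<open>K = L\<close> for \<open>q \<ge> 2\<close> give the growth \<open>L\<close> to the power \<open>\<sigma>\<^sub>q - \<sigma>\<close>.

  For an arbitrary bounded mild solution \<open>u\<close>, a bootstrap in short time steps shows that \<open>u\<close>
  differs from the explicit field \<open>U = \<alpha> \<Sum>\<^sub>k exp (- \<kappa>\<^sup>2 \<tau>) v\<^sub>k\<close> by at most \<open>2\<^bsup>O(L)\<^esup>\<close> with a small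
  exponent.  This is harmless because the time is only \<open>4\<^bsup>-100L\<^esup>\<close>, so that in Duhamel's formula, tested
  against a function concentrated at the frequency \<open>8\<^sup>l\<close>, \<open>u\<close> may be replaced by \<open>U\<close>.
\<close>

section \<open>Fourier transform and Schwartz functions\<close>

text \<open>The choice of K is forced by bookkeeping. With amplitude \<alpha> the data have norm of
  order \<alpha> L^\<sigma> K^(1/q), the quadratic response has norm of order \<alpha>^2 K
  L^\<sigma> L^(1/q). Normalising \<alpha> = \<delta> L^(-\<sigma>) K^(-1/q) leaves \<delta>^2
  L^(1/q - \<sigma>) K^(1 - 2/q): K should be large for q > 2 and small for q < 2. L is chosen after
  N and \<delta> and absorbs 1 / \<delta>^2, so c depends on neither. The obstacle is that u is only
  some bounded solution of the integral equation, with an uncontrolled bound. Two facts replace a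
  perturbation theory. Since sqrt \<tau> |U| is at most a multiple of \<delta>, uniformly in L and
  K, the linear term of the difference equation can be absorbed for small \<delta>. And the defect
  of U in the equation carries no power of the large frequencies, because |\<xi>|^2 is nearly
  constant on the spectrum of each piece and the pieces are divergence free. What remains is
  polynomial in L and 2^(6L), and loses against the square root 2^(-100L) of the time; the number
  100 is generous.\<close>

lemma cis_borel_measurable [measurable (raw)]:
  "f \<in> borel_measurable M \<Longrightarrow> (\<lambda>x. cis (f x)) \<in> borel_measurable M"
  unfolding cis_conv_exp by measurable

section \<open>Affine changes of variables and Fubini for Lebesgue measure\<close>

lemma nn_integral_lborel_affine:
  fixes f :: "'a::euclidean_space \<Rightarrow> ennreal"
  assumes [measurable]: "f \<in> borel_measurable borel" and "c \<noteq> 0"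
  shows "(\<integral>\<^sup>+x. f x \<partial>lborel) = ennreal (\<bar>c\<bar> ^ DIM('a)) * (\<integral>\<^sup>+x. f (t + c *\<^sub>R x) \<partial>lborel)"
  by (subst lborel_affine[OF assms(2), of t])
     (simp add: nn_integral_density nn_integral_distr nn_integral_cmult)

lemma integrable_lborel_affine:
  fixes f :: "'a::euclidean_space \<Rightarrow> 'b::{banach, second_countable_topology}"
  assumes f: "integrable lborel f" and "c \<noteq> 0"
  shows "integrable lborel (\<lambda>x. f (t + c *\<^sub>R x))"
proof -
  have [measurable]: "f \<in> borel_measurable borel" using f by auto
  have "(\<integral>\<^sup>+x. ennreal (norm (f x)) \<partial>lborel) < \<infinity>" using f by (simp add: integrable_iff_bounded)
  then show ?thesis
    unfolding integrable_iff_bounded using assms(2)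
    by (subst (asm) nn_integral_lborel_affine[where c=c and t=t]) (auto simp: ennreal_mult_less_top)
qed

lemma integral_lborel_affine:
  fixes f :: "'a::euclidean_space \<Rightarrow> 'b::{banach, second_countable_topology}"
  assumes f: "integrable lborel f" and "c \<noteq> 0"
  shows "(LINT x|lborel. f x) = \<bar>c\<bar> ^ DIM('a) *\<^sub>R (LINT x|lborel. f (t + c *\<^sub>R x))"
proof -
  have [measurable]: "f \<in> borel_measurable borel" using f by auto
  show ?thesis
    by (subst lborel_affine[OF assms(2), of t])
       (use integrable_lborel_affine[OF assms, of t] in \<open>simp add: integral_density integral_distr\<close>)
qed

lemma
  fixes f :: "'a::euclidean_space \<Rightarrow> 'b::{banach, second_countable_topology}"
  assumes f: "integrable lborel f"
  shows integrable_lborel_shift: "integrable lborel (\<lambda>x. f (x - a))"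
    and integral_lborel_shift: "(LINT x|lborel. f (x - a)) = (LINT x|lborel. f x)"
    and integrable_lborel_reflect: "integrable lborel (\<lambda>x. f (a - x))"
    and integral_lborel_reflect: "(LINT x|lborel. f (a - x)) = (LINT x|lborel. f x)"
  using integrable_lborel_affine[OF f, of 1 "-a"] integral_lborel_affine[OF f, of 1 "-a"]
    integrable_lborel_affine[OF f, of "-1" "a"] integral_lborel_affine[OF f, of "-1" "a"]
  by simp_all

lemma integrable_pair_prod:
  fixes a :: "'a::euclidean_space \<Rightarrow> real" and b :: "'b::euclidean_space \<Rightarrow> real"
  assumes a: "integrable lborel a" and b: "integrable lborel b"
  shows "integrable (lborel \<Otimes>\<^sub>M lborel) (\<lambda>(x, y). a x * b y)"
proof (rule lborel_pair.Fubini_integrable)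
  show "(\<lambda>(x, y). a x * b y) \<in> borel_measurable (lborel \<Otimes>\<^sub>M lborel)" using a b by measurable
  show "integrable lborel (\<lambda>x. LINT y|lborel. norm (case (x, y) of (x, y) \<Rightarrow> a x * b y))"
    using a by (simp add: abs_mult)
  show "AE x in lborel. integrable lborel (\<lambda>y. case (x, y) of (x, y) \<Rightarrow> a x * b y)"
    using b by simp
qed

lemma integrable_pair_conv:
  fixes a b :: "'a::euclidean_space \<Rightarrow> real"
  assumes a: "integrable lborel a" and b: "integrable lborel b"
  shows "integrable (lborel \<Otimes>\<^sub>M lborel) (\<lambda>(x, y). a x * b (x - y))"
proof (rule lborel_pair.Fubini_integrable)
  have [measurable]: "a \<in> borel_measurable borel" "b \<in> borel_measurable borel" using a b by auto
  show "(\<lambda>(x, y). a x * b (x - y)) \<in> borel_measurable (lborel \<Otimes>\<^sub>M lborel)" by measurable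
  have "(LINT y|lborel. norm (case (x, y) of (x, y) \<Rightarrow> a x * b (x - y))) = \<bar>a x\<bar> * (LINT y|lborel. \<bar>b y\<bar>)" for x
    using integral_lborel_reflect[OF integrable_abs[OF b], of x] by (simp add: abs_mult)
  then show "integrable lborel (\<lambda>x. LINT y|lborel. norm (case (x, y) of (x, y) \<Rightarrow> a x * b (x - y)))"
    using a by simp
  show "AE x in lborel. integrable lborel (\<lambda>y. case (x, y) of (x, y) \<Rightarrow> a x * b (x - y))"
    using integrable_lborel_reflect[OF b] by simp
qed

lemma integrable_pair_bound:
  fixes f :: "'a::euclidean_space \<Rightarrow> 'b::euclidean_space \<Rightarrow> 'c::{banach, second_countable_topology}"
  assumes "integrable (lborel \<Otimes>\<^sub>M lborel) (\<lambda>(x, y). g x y :: real)"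
    and "(\<lambda>(x, y). f x y) \<in> borel_measurable (lborel \<Otimes>\<^sub>M lborel)"
    and "\<And>x y. norm (f x y) \<le> g x y"
  shows "integrable (lborel \<Otimes>\<^sub>M lborel) (\<lambda>(x, y). f x y)"
  by (rule Bochner_Integration.integrable_bound[OF assms(1,2)])
     (use assms(3) in \<open>auto intro!: AE_I2 intro: order_trans[OF _ abs_ge_self]\<close>)

lemma fubini_prod:
  fixes f :: "'a::euclidean_space \<Rightarrow> 'b::euclidean_space \<Rightarrow> 'c::{banach, second_countable_topology}"
  assumes "integrable lborel a" "integrable lborel b"
    and "(\<lambda>(x, y). f x y) \<in> borel_measurable (lborel \<Otimes>\<^sub>M lborel)"
    and "\<And>x y. norm (f x y) \<le> a x * b y"
  shows "(LINT y|lborel. LINT x|lborel. f x y) = (LINT x|lborel. LINT y|lborel. f x y)"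
  by (rule lborel_pair.Fubini_integral, rule integrable_pair_bound[OF integrable_pair_prod[OF assms(1,2)] assms(3,4)])

section \<open>Product integrals, Gaussian integrals and an integrable majorant\<close>

lemma
  fixes f :: "'n::finite \<Rightarrow> real \<Rightarrow> complex"
  assumes f: "\<And>i. integrable lborel (f i)"
  shows integrable_vec_prod: "integrable lborel (\<lambda>x::real^'n. \<Prod>i\<in>UNIV. f i (x $ i))"
    and integral_vec_prod: "(LINT x|lborel. (\<Prod>i\<in>UNIV. f i ((x::real^'n) $ i))) = (\<Prod>i\<in>UNIV. LINT t|lborel. f i t)"
proof -
  interpret product_sigma_finite "\<lambda>_::real^'n. lborel :: real measure" ..
  \<comment> \<open>\<open>lborel\<close> is the image of a product measure indexed by the vectors
    of \<open>Basis\<close>; the definite description recovers the coordinate index from such a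
    vector, so that the factors can be reindexed.\<close>
  define g where "g b = f (THE i. b = axis i 1)" for b :: "real^'n"
  have the: "(THE j. axis i (1::real) = axis j 1) = i" for i :: 'n
    by (rule the_equality) (auto simp: axis_eq_axis)
  have B: "(Basis :: (real^'n) set) = range (\<lambda>i. axis i 1)"
    by (auto simp: Basis_vec_def)
  have inj: "inj (\<lambda>i::'n. axis i (1::real))" by (auto simp: inj_on_def axis_eq_axis)
  have *: "(\<Prod>i\<in>UNIV. f i (x $ i)) = (\<Prod>b\<in>Basis. g b (x \<bullet> b))" for x :: "real^'n"
    unfolding B by (subst prod.reindex[OF inj]) (simp add: g_def the inner_axis)
  have gi: "integrable lborel (g b)" for b unfolding g_def by (rule f)
  have fm: "f i \<in> borel_measurable borel" for i using f[of i] by auto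
  have **: "(\<Prod>i\<in>UNIV. f i ((\<Sum>b\<in>Basis. h b *\<^sub>R b) $ i)) = (\<Prod>b\<in>Basis. g b (h b))" for h :: "real^'n \<Rightarrow> real"
    unfolding * by (intro prod.cong refl) (simp add: inner_sum_left inner_Basis if_distrib cong: if_cong)
  have m1: "(\<lambda>x::real^'n. \<Prod>i\<in>UNIV. f i (x $ i)) \<in> borel_measurable borel"
    using fm by measurable
  have m2: "(\<lambda>h. \<Sum>b\<in>(Basis::(real^'n) set). h b *\<^sub>R b) \<in> measurable (Pi\<^sub>M Basis (\<lambda>_. lborel)) borel"
    by measurable
  show "integrable lborel (\<lambda>x::real^'n. \<Prod>i\<in>UNIV. f i (x $ i))"
    unfolding lborel_eq[where 'a="real^'n"]
    by (subst integrable_distr_eq[OF m2 m1], subst **) (rule product_integrable_prod, auto intro: gi)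
  show "(LINT x|lborel. (\<Prod>i\<in>UNIV. f i ((x::real^'n) $ i))) = (\<Prod>i\<in>UNIV. LINT t|lborel. f i t)"
    unfolding lborel_eq[where 'a="real^'n"]
    apply (subst integral_distr[OF m2 m1], subst **, subst product_integral_prod)
      apply (auto intro: gi)
    unfolding B by (subst prod.reindex[OF inj]) (simp add: g_def the)
qed

text \<open>A rescaling of the characteristic function of the standard normal distribution: with c^2
  = 2 s and u = t / c, replacing x by c x turns exp (- x^2 / 2) cis (x u) into the
  integrand.\<close>

lemma gaussian_integral_1:
  assumes "s > 0"
  shows "integrable lborel (\<lambda>x::real. complex_of_real (exp (- s * x\<^sup>2)) * cis (x * t))"
    and "(LINT x|lborel. complex_of_real (exp (- s * x\<^sup>2)) * cis (x * t)) =
      of_real (sqrt (pi / s) * exp (- t\<^sup>2 / (4 * s)))"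
proof -
  define c where "c = sqrt (2 * s)"
  have c: "c > 0" "c\<^sup>2 = 2 * s" using assms by (auto simp: c_def)
  define u where "u = t / c"
  define h where "h = (\<lambda>x::real. complex_of_real (exp (- x\<^sup>2 / 2)) * cis (x * u))"
  have nd: "integrable lborel (normal_density 0 1)" by simp
  have [measurable]: "h \<in> borel_measurable borel" unfolding h_def by measurable
  have "integrable lborel (\<lambda>x. sqrt (2 * pi) * normal_density 0 1 x)" using nd by simp
  then have hi: "integrable lborel h"
    by (rule Bochner_Integration.integrable_bound) (auto simp: h_def norm_mult std_normal_density_def)
  have "char std_normal_distribution u = (LINT x|lborel. std_normal_density x *\<^sub>R iexp (u * x))"
    unfolding char_def by (subst integral_density) auto
  also have "\<dots> = (LINT x|lborel. of_real (1 / sqrt (2 * pi)) * h x)"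
    unfolding h_def std_normal_density_def
    by (intro Bochner_Integration.integral_cong refl) (simp add: cis_conv_exp scaleR_conv_of_real mult_ac)
  also have "\<dots> = of_real (1 / sqrt (2 * pi)) * (LINT x|lborel. h x)" by simp
  finally have "(LINT x|lborel. h x) = of_real (sqrt (2 * pi)) * of_real (exp (-(u\<^sup>2) / 2))"
    unfolding char_std_normal_distribution by (simp add: field_simps)
  then have hv: "(LINT x|lborel. h x) = of_real (sqrt (2 * pi) * exp (-(u\<^sup>2) / 2))" by simp
  have eq: "h (0 + c * x) = complex_of_real (exp (- s * x\<^sup>2)) * cis (x * t)" for x
    using c by (simp add: h_def power_mult_distrib u_def field_simps)
  show "integrable lborel (\<lambda>x::real. complex_of_real (exp (- s * x\<^sup>2)) * cis (x * t))"
    using lborel_integrable_real_affine[OF hi, of c 0] c by (simp only: eq)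
  have "(LINT x|lborel. h x) = \<bar>c\<bar> *\<^sub>R (LINT x|lborel. h (0 + c * x))"
    by (rule lborel_integral_real_affine) (use c in auto)
  then have "(LINT x|lborel. complex_of_real (exp (- s * x\<^sup>2)) * cis (x * t)) = of_real (sqrt (2 * pi) * exp (-(u\<^sup>2) / 2) / c)"
    unfolding eq hv using c by (simp add: scaleR_conv_of_real field_simps)
  also have "sqrt (2 * pi) * exp (-(u\<^sup>2) / 2) / c = sqrt (pi / s) * exp (- t\<^sup>2 / (4 * s))"
  proof -
    have "sqrt (2 * pi) / c = sqrt (pi / s)" unfolding c_def using assms by (simp add: real_sqrt_divide[symmetric] del: real_sqrt_mult)
    moreover have "-(u\<^sup>2) / 2 = - t\<^sup>2 / (4 * s)" using c by (simp add: u_def power_divide)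
    ultimately show ?thesis by (metis times_divide_eq_left)
  qed
  finally show "(LINT x|lborel. complex_of_real (exp (- s * x\<^sup>2)) * cis (x * t)) =
      of_real (sqrt (pi / s) * exp (- t\<^sup>2 / (4 * s)))" .
qed

lemma norm_vec_sum_power2: "(norm (x::real^'n))\<^sup>2 = (\<Sum>i\<in>UNIV. (x $ i)\<^sup>2)"
  by (simp add: norm_vec_def L2_set_def sum_nonneg)

lemma cis_sum: "finite A \<Longrightarrow> cis (sum f A) = (\<Prod>i\<in>A. cis (f i))"
  by (induction A rule: finite_induct) (auto simp: cis_mult[symmetric])

lemma gaussian_integral:
  fixes x :: "real^'n"
  assumes "s > 0"
  shows "integrable lborel (\<lambda>\<xi>. cis (\<xi> \<bullet> x) * complex_of_real (exp (- s * (norm \<xi>)\<^sup>2)))"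
    and "(LINT \<xi>|lborel. cis (\<xi> \<bullet> x) * complex_of_real (exp (- s * (norm \<xi>)\<^sup>2))) =
      of_real (sqrt (pi / s) ^ CARD('n) * exp (- (norm x)\<^sup>2 / (4 * s)))"
proof -
  have eq: "cis (\<xi> \<bullet> x) * complex_of_real (exp (- s * (norm \<xi>)\<^sup>2)) =
     (\<Prod>i\<in>UNIV. complex_of_real (exp (- s * (\<xi> $ i)\<^sup>2)) * cis (\<xi> $ i * x $ i))" for \<xi> :: "real^'n"
    by (simp add: norm_vec_sum_power2 inner_vec_def cis_sum prod.distrib sum_distrib_left exp_sum
        sum_negf[symmetric] of_real_prod[symmetric] mult.commute del: of_real_prod)
  note i = gaussian_integral_1(1)[OF assms]
  show "integrable lborel (\<lambda>\<xi>. cis (\<xi> \<bullet> x) * complex_of_real (exp (- s * (norm \<xi>)\<^sup>2)))"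
    unfolding eq by (rule integrable_vec_prod) (rule i)
  show "(LINT \<xi>|lborel. cis (\<xi> \<bullet> x) * complex_of_real (exp (- s * (norm \<xi>)\<^sup>2))) =
      of_real (sqrt (pi / s) ^ CARD('n) * exp (- (norm x)\<^sup>2 / (4 * s)))"
    unfolding eq
    by (subst integral_vec_prod, rule i, subst gaussian_integral_1(2)[OF assms])
      (simp add: norm_vec_sum_power2 sum_negf[symmetric] exp_sum sum_divide_distrib prod.distrib of_real_prod[symmetric] del: of_real_prod)
qed

lemma integrable_inverse_one_plus_square: "integrable lborel (\<lambda>x::real. inverse (1 + x\<^sup>2))"
proof -
  let ?f = "\<lambda>x::real. inverse (1 + x\<^sup>2)"
  have 1: "set_integrable lborel {0<..} ?f"
  proof -
    have "einterval 0 \<infinity> = {0<..}" by (auto simp: einterval_def zero_ereal_def)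
    then show ?thesis
      using integrable_I0i_1_div_plus_square
      by (simp add: interval_lebesgue_integrable_def inverse_eq_divide)
  qed
  then have 2: "integrable lborel (\<lambda>x. indicator {0<..} x *\<^sub>R ?f x)" by (simp add: set_integrable_def)
  have 3: "integrable lborel (\<lambda>x. indicator {0<..} (0 + (-1) * x) *\<^sub>R ?f (0 + (-1) * x))"
    by (rule lborel_integrable_real_affine[OF 2]) simp
  have "integrable lborel (\<lambda>x. indicator {0<..} x *\<^sub>R ?f x + indicator {0<..} (0 + (-1) * x) *\<^sub>R ?f (0 + (-1) * x))"
    using 2 3 by (rule Bochner_Integration.integrable_add)
  moreover have "AE x in lborel. indicator {0<..} x *\<^sub>R ?f x + indicator {0<..} (0 + (-1) * x) *\<^sub>R ?f (0 + (-1) * x) = ?f x"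
    using AE_lborel_singleton[of "0::real"] by eventually_elim (auto simp: indicator_def)
  ultimately show ?thesis by (subst (asm) integrable_cong_AE) auto
qed

text \<open>In every coordinate 1 + x_i^2 \<le> (1 + |x|)^2, so the product of the n integrable
  functions 1 / (1 + x_i^2) is a majorant. This is where the exponent 2n comes from.\<close>

lemma integrable_decay: "integrable lborel (\<lambda>x::real^'n. inverse ((1 + norm x) ^ (2 * CARD('n))))"
proof -
  let ?f = "\<lambda>i t. complex_of_real (inverse (1 + t\<^sup>2))"
  have "integrable lborel (\<lambda>x::real^'n. \<Prod>i\<in>UNIV. ?f i (x $ i))"
    by (rule integrable_vec_prod) (simp only: complex_of_real_integrable_eq integrable_inverse_one_plus_square)
  then show ?thesis
  proof (rule Bochner_Integration.integrable_bound)
    show "AE x::real^'n in lborel. norm (inverse ((1 + norm x) ^ (2 * CARD('n)))) \<le> norm (\<Prod>i\<in>UNIV. ?f i (x $ i))"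
    proof (rule AE_I2)
      fix x :: "real^'n"
      have "1 + (x $ i)\<^sup>2 \<le> (1 + norm x)\<^sup>2" for i
        using component_le_norm_cart[of x i] norm_ge_zero[of x]
        by (simp add: power2_sum) (metis (no_types) abs_le_square_iff abs_norm_cancel add_increasing2 norm_ge_zero mult_nonneg_nonneg zero_le_numeral)
      then have "(\<Prod>i\<in>(UNIV::'n set). 1 + (x $ i)\<^sup>2) \<le> (\<Prod>i\<in>(UNIV::'n set). (1 + norm x)\<^sup>2)"
        by (intro prod_mono) auto
      moreover have "0 < (\<Prod>i\<in>(UNIV::'n set). 1 + (x $ i)\<^sup>2)" by (intro prod_pos) (simp add: add_pos_nonneg)
      ultimately have "inverse (\<Prod>i\<in>(UNIV::'n set). (1 + norm x)\<^sup>2) \<le> inverse (\<Prod>i\<in>(UNIV::'n set). 1 + (x $ i)\<^sup>2)"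
        by (rule le_imp_inverse_le)
      then show "norm (inverse ((1 + norm x) ^ (2 * CARD('n)))) \<le> norm (\<Prod>i\<in>UNIV. ?f i (x $ i))"
        by (simp add: power_mult prod_inversef prod_norm[symmetric] norm_inverse norm_power del: of_real_add of_real_power of_real_inverse)
           (simp add: prod_inversef[symmetric] norm_inverse o_def flip: power_mult)
    qed
  qed simp
qed

text \<open>Unnormalised and with the positive sign in the phase. Thus \<open>fourier\<close> is
  \<open>ft\<close> at the reflected point and \<open>inv_fourier\<close> is \<open>ft\<close>
  divided by (2 \<pi>)^n; one operator serves both directions, and inversion reads
  \<open>ft (ft f) x\<close> = (2 \<pi>)^n f (- x).\<close>

definition ft :: "(real^'n \<Rightarrow> complex) \<Rightarrow> real^'n \<Rightarrow> complex" where
  "ft f x = (LINT \<xi>|lborel. cis (\<xi> \<bullet> x) * f \<xi>)"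

lemma integrable_cis_mult:
  fixes f :: "real^'n \<Rightarrow> complex"
  assumes "integrable lborel f"
  shows "integrable lborel (\<lambda>\<xi>. cis (\<xi> \<bullet> x) * f \<xi>)"
  by (rule Bochner_Integration.integrable_bound[OF assms]) (use assms in \<open>auto simp: norm_mult\<close>)

lemma norm_ft_le: "norm (ft f x) \<le> (LINT \<xi>|lborel. norm (f \<xi>))"
  unfolding ft_def by (rule order_trans[OF integral_norm_bound]) (simp add: norm_mult)

lemma ft_measurable [measurable]:
  assumes [measurable]: "f \<in> borel_measurable borel"
  shows "ft f \<in> borel_measurable borel"
  unfolding ft_def by measurable

text \<open>The multiplication formula. It stands in for Plancherel: every pairing below is moved to
  the frequency side by it.\<close>

lemma ft_swap:
  fixes f g :: "real^'n \<Rightarrow> complex"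
  assumes f: "integrable lborel f" and g: "integrable lborel g"
  shows "(LINT x|lborel. ft f x * g x) = (LINT \<xi>|lborel. f \<xi> * ft g \<xi>)"
proof -
  have [measurable]: "f \<in> borel_measurable borel" "g \<in> borel_measurable borel" using f g by auto
  have "(LINT x|lborel. ft f x * g x) = (LINT x|lborel. LINT \<xi>|lborel. cis (\<xi> \<bullet> x) * f \<xi> * g x)"
    unfolding ft_def by (simp add: integrable_cis_mult[OF f])
  also have "\<dots> = (LINT \<xi>|lborel. LINT x|lborel. cis (\<xi> \<bullet> x) * f \<xi> * g x)"
    by (rule fubini_prod[OF integrable_norm[OF f] integrable_norm[OF g]]) (auto simp: norm_mult)
  also have "\<dots> = (LINT \<xi>|lborel. f \<xi> * ft g \<xi>)"
    unfolding ft_def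
    by (subst Bochner_Integration.integral_mult_right_zero[symmetric])
       (simp add: mult_ac inner_commute)
  finally show ?thesis .
qed

lemma gauss_kernel_integral:
  fixes x :: "real^'n"
  assumes "s > 0"
  shows "integrable lborel (\<lambda>y::real^'n. exp (- (norm y)\<^sup>2 / (4 * s)))"
    and "(LINT y|lborel. exp (- (norm (y::real^'n))\<^sup>2 / (4 * s))) = sqrt (4 * pi * s) ^ CARD('n)"
proof -
  have s: "1 / (4 * s) > 0" using assms by simp
  note g = gaussian_integral[OF s, of "0::real^'n"]
  have eq: "- (1 / (4 * s)) * (norm y)\<^sup>2 = - (norm y)\<^sup>2 / (4 * s)" for y :: "real^'n" by simp
  have "integrable lborel (\<lambda>y::real^'n. complex_of_real (exp (- (norm y)\<^sup>2 / (4 * s))))"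
    using g(1) unfolding eq by simp
  then show "integrable lborel (\<lambda>y::real^'n. exp (- (norm y)\<^sup>2 / (4 * s)))"
    by (simp only: complex_of_real_integrable_eq)
  have "complex_of_real (LINT y|lborel. exp (- (norm (y::real^'n))\<^sup>2 / (4 * s))) = of_real (sqrt (4 * pi * s) ^ CARD('n))"
    using g(2) unfolding eq by (simp add: mult_ac)
  then show "(LINT y|lborel. exp (- (norm (y::real^'n))\<^sup>2 / (4 * s))) = sqrt (4 * pi * s) ^ CARD('n)"
    by (simp only: of_real_eq_iff)
qed

text \<open>Damping by \<open>exp (- s |\<xi>|\<^sup>2)\<close> turns the inversion integral into an average against a Gaussian
  of width \<open>\<surd>s\<close>; both sides converge as \<open>s\<close> tends to \<open>0\<close>.\<close>

theorem fourier_inversion: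
  fixes f :: "real^'n \<Rightarrow> complex"
  assumes f: "integrable lborel f" and ff: "integrable lborel (ft f)"
    and bd: "\<And>y. norm (f y) \<le> B" and cont: "isCont f (- x)"
  shows "ft (ft f) x = of_real ((2 * pi) ^ CARD('n)) * f (- x)"
proof -
  have [measurable]: "f \<in> borel_measurable borel" using f by auto
  define s where "s k = inverse (real (Suc k))" for k
  have s0: "s k > 0" for k by (simp add: s_def)
  have s_lim: "s \<longlonglongrightarrow> 0" unfolding s_def by (rule LIMSEQ_inverse_real_of_nat)
  define g where "g k \<xi> = cis (\<xi> \<bullet> x) * complex_of_real (exp (- s k * (norm \<xi>)\<^sup>2))" for k and \<xi> :: "real^'n"
  have gi: "integrable lborel (g k)" for k
    unfolding g_def by (rule gaussian_integral(1)[OF s0])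
  have ftg: "ft (g k) y = of_real (sqrt (pi / s k) ^ CARD('n) * exp (- (norm (x + y))\<^sup>2 / (4 * s k)))" for k y
    unfolding ft_def g_def using gaussian_integral(2)[OF s0, of "x + y" k]
    by (simp add: inner_add_right cis_mult[symmetric] mult_ac)
  have A: "(LINT \<xi>|lborel. ft f \<xi> * g k \<xi>) = of_real ((2 * pi) ^ CARD('n)) *
     (LINT z|lborel. of_real (exp (- (norm z)\<^sup>2 / 4) / sqrt (4 * pi) ^ CARD('n)) * f (- x + sqrt (s k) *\<^sub>R z))" for k
  proof -
    let ?h = "\<lambda>y. f y * of_real (sqrt (pi / s k) ^ CARD('n) * exp (- (norm (x + y))\<^sup>2 / (4 * s k)))"
    have "integrable lborel (\<lambda>y. (norm (f y)) * (sqrt (pi / s k) ^ CARD('n)))" using f by simp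
    then have hi: "integrable lborel ?h"
      by (rule Bochner_Integration.integrable_bound)
         (auto intro!: AE_I2 mult_left_mono simp: norm_mult norm_power s_def)
    have "(LINT \<xi>|lborel. ft f \<xi> * g k \<xi>) = (LINT y|lborel. ?h y)"
      by (subst ft_swap[OF f gi]) (simp add: ftg)
    also have "\<dots> = \<bar>sqrt (s k)\<bar> ^ DIM(real^'n) *\<^sub>R (LINT z|lborel. ?h (- x + sqrt (s k) *\<^sub>R z))"
      by (rule integral_lborel_affine[OF hi]) (use s0[of k] in auto)
    also have "\<dots> = (LINT z|lborel. of_real ((2 * pi) ^ CARD('n)) *
       (of_real (exp (- (norm z)\<^sup>2 / 4) / sqrt (4 * pi) ^ CARD('n)) * f (- x + sqrt (s k) *\<^sub>R z)))"
    proof (subst integral_scaleR_right[symmetric], rule Bochner_Integration.integral_cong[OF refl])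
      fix z :: "real^'n"
      have e: "(norm (sqrt (s k) *\<^sub>R z))\<^sup>2 / (4 * s k) = (norm z)\<^sup>2 / 4"
        using s0[of k] by (simp add: power_mult_distrib)
      have "sqrt (s k) * sqrt (pi / s k) = 2 * pi / sqrt (4 * pi)"
        using s0[of k] real_div_sqrt[of pi] by (simp add: real_sqrt_divide real_sqrt_mult)
      then have "sqrt (s k) ^ CARD('n) * sqrt (pi / s k) ^ CARD('n) = (2 * pi) ^ CARD('n) / sqrt (4 * pi) ^ CARD('n)"
        by (metis power_mult_distrib power_divide)
      then have *: "complex_of_real (sqrt (s k) ^ CARD('n)) * of_real (sqrt (pi / s k) ^ CARD('n)) = of_real ((2 * pi) ^ CARD('n)) / of_real (sqrt (4 * pi) ^ CARD('n))"
        by (metis of_real_mult of_real_divide)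
      have "\<bar>sqrt (s k)\<bar> ^ DIM(real^'n) *\<^sub>R ?h (- x + sqrt (s k) *\<^sub>R z) = 
        (complex_of_real (sqrt (s k) ^ CARD('n)) * of_real (sqrt (pi / s k) ^ CARD('n))) * (of_real (exp (- (norm z)\<^sup>2 / 4)) * f (- x + sqrt (s k) *\<^sub>R z))"
        using e s0[of k] by (simp add: scaleR_conv_of_real mult_ac)
      then show "\<bar>sqrt (s k)\<bar> ^ DIM(real^'n) *\<^sub>R ?h (- x + sqrt (s k) *\<^sub>R z) = of_real ((2 * pi) ^ CARD('n)) *
       (of_real (exp (- (norm z)\<^sup>2 / 4) / sqrt (4 * pi) ^ CARD('n)) * f (- x + sqrt (s k) *\<^sub>R z))"
        unfolding * by simp
    qed
    finally show ?thesis by simp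
  qed
  have L1: "(\<lambda>k. LINT \<xi>|lborel. ft f \<xi> * g k \<xi>) \<longlonglongrightarrow> (LINT \<xi>|lborel. ft f \<xi> * cis (\<xi> \<bullet> x))"
  proof (rule integral_dominated_convergence[where w="\<lambda>\<xi>. norm (ft f \<xi>)"])
    show "(\<lambda>\<xi>. ft f \<xi> * g k \<xi>) \<in> borel_measurable lborel" for k unfolding g_def by measurable
    show "AE \<xi> in lborel. (\<lambda>k. ft f \<xi> * g k \<xi>) \<longlonglongrightarrow> ft f \<xi> * cis (\<xi> \<bullet> x)"
    proof (rule AE_I2)
      fix \<xi> :: "real^'n"
      have "(\<lambda>k. ft f \<xi> * g k \<xi>) \<longlonglongrightarrow> ft f \<xi> * (cis (\<xi> \<bullet> x) * complex_of_real (exp (- 0 * (norm \<xi>)\<^sup>2)))"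
        unfolding g_def by (intro tendsto_intros s_lim)
      then show "(\<lambda>k. ft f \<xi> * g k \<xi>) \<longlonglongrightarrow> ft f \<xi> * cis (\<xi> \<bullet> x)" by simp
    qed
    show "AE \<xi> in lborel. norm (ft f \<xi> * g k \<xi>) \<le> norm (ft f \<xi>)" for k
      using s0[of k] by (auto intro!: AE_I2 mult_left_le simp: norm_mult g_def)
  qed (use ff in auto)
  have gk: "integrable lborel (\<lambda>z::real^'n. exp (- (norm z)\<^sup>2 / 4))"
    "(LINT z|lborel. exp (- (norm (z::real^'n))\<^sup>2 / 4)) = sqrt (4 * pi) ^ CARD('n)"
    using gauss_kernel_integral[of 1, where 'n='n] by auto
  \<comment> \<open>After the substitution the Gaussian is fixed and only the argument of f moves
    with k; continuity at - x gives the pointwise limit and B the majorant.\<close>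
  have L2: "(\<lambda>k. LINT z|lborel. of_real (exp (- (norm z)\<^sup>2 / 4) / sqrt (4 * pi) ^ CARD('n)) * f (- x + sqrt (s k) *\<^sub>R z))
     \<longlonglongrightarrow> (LINT z|lborel. of_real (exp (- (norm (z::real^'n))\<^sup>2 / 4) / sqrt (4 * pi) ^ CARD('n)) * f (- x))"
  proof (rule integral_dominated_convergence[where w="\<lambda>z. exp (- (norm z)\<^sup>2 / 4) / sqrt (4 * pi) ^ CARD('n) * B"])
    show "AE z::real^'n in lborel. (\<lambda>k. of_real (exp (- (norm z)\<^sup>2 / 4) / sqrt (4 * pi) ^ CARD('n)) * f (- x + sqrt (s k) *\<^sub>R z))
       \<longlonglongrightarrow> of_real (exp (- (norm z)\<^sup>2 / 4) / sqrt (4 * pi) ^ CARD('n)) * f (- x)"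
    proof (intro AE_I2 tendsto_intros)
      fix z :: "real^'n"
      have "(\<lambda>k. - x + sqrt (s k) *\<^sub>R z) \<longlonglongrightarrow> - x + sqrt 0 *\<^sub>R z"
        by (intro tendsto_intros s_lim)
      then show "(\<lambda>k. f (- x + sqrt (s k) *\<^sub>R z)) \<longlonglongrightarrow> f (- x)"
        using isCont_tendsto_compose[OF cont] by simp
    qed
    show "AE z::real^'n in lborel. norm (of_real (exp (- (norm z)\<^sup>2 / 4) / sqrt (4 * pi) ^ CARD('n)) * f (- x + sqrt (s k) *\<^sub>R z))
      \<le> exp (- (norm z)\<^sup>2 / 4) / sqrt (4 * pi) ^ CARD('n) * B" for k
      by (intro AE_I2) (use bd in \<open>auto simp: norm_mult norm_divide norm_power intro!: mult_left_mono divide_right_mono\<close>)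
  qed (use gk in auto)
  have "(LINT z|lborel. of_real (exp (- (norm (z::real^'n))\<^sup>2 / 4) / sqrt (4 * pi) ^ CARD('n)) * f (- x)) = f (- x)"
  proof -
    have "(LINT z|lborel. complex_of_real (exp (- (norm (z::real^'n))\<^sup>2 / 4) / sqrt (4 * pi) ^ CARD('n)) * f (- x)) = 
      of_real ((LINT z|lborel. exp (- (norm (z::real^'n))\<^sup>2 / 4)) / sqrt (4 * pi) ^ CARD('n)) * f (-x)"
      by (simp only: integral_mult_left_zero integral_complex_of_real integral_divide_zero)
    then show ?thesis unfolding gk by simp
  qed
  with L2 have L2': "(\<lambda>k. LINT \<xi>|lborel. ft f \<xi> * g k \<xi>) \<longlonglongrightarrow> of_real ((2 * pi) ^ CARD('n)) * f (- x)"
    unfolding A by (intro tendsto_intros) simp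
  have "(LINT \<xi>|lborel. ft f \<xi> * cis (\<xi> \<bullet> x)) = ft (ft f) x" by (simp add: ft_def mult.commute)
  then show ?thesis using LIMSEQ_unique[OF L1 L2'] by simp
qed

section \<open>Schwartz functions: differentiation and closure properties\<close>

lemma integral_norm_le:
  fixes f :: "'a \<Rightarrow> 'b::{banach, second_countable_topology}"
  assumes "integrable M f" "integrable M g" "\<And>x. norm (f x) \<le> g x"
  shows "norm (integral\<^sup>L M f) \<le> integral\<^sup>L M g"
  by (rule order_trans[OF integral_norm_bound integral_mono]) (use assms in auto)

lemma cis_inner_has_derivative:
  "((\<lambda>x. cis (x \<bullet> a)) has_derivative (\<lambda>v. \<i> * of_real (v \<bullet> a) * cis (x \<bullet> a))) (at x)"
proof -
  have 1: "((\<lambda>x. \<i> * complex_of_real (x \<bullet> a)) has_derivative (\<lambda>v. \<i> * of_real (v \<bullet> a))) (at x)"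
    by (auto intro!: derivative_eq_intros)
  have "((\<lambda>x. exp (\<i> * complex_of_real (x \<bullet> a))) has_derivative
      (\<lambda>v. exp (\<i> * complex_of_real (x \<bullet> a)) * (\<i> * of_real (v \<bullet> a)))) (at x)"
    by (rule has_derivative_compose[OF 1, of exp]) (rule has_field_derivative_imp_has_derivative[OF DERIV_exp])
  then show ?thesis unfolding cis_conv_exp by (simp add: mult.commute)
qed

lemmas vec_nth_has_derivative = bounded_linear.has_derivative[OF bounded_linear_vec_nth has_derivative_ident]

lemma partial_eq:
  assumes "(f has_derivative D) (at x)"
  shows "partial i f x = D (axis i 1)"
  using frechet_derivative_at[OF assms] by (simp add: partial_def)

text \<open>Coinduction instead of induction over multi-indices: it suffices to exhibit a class that
  is stable under first partial derivatives and whose members are differentiable and decay. For an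
  operation on Schwartz functions the class consists of its results, enlarged when the product rule
  leads out of it.\<close>

lemma schwartz_coinduct [consumes 1, case_names differentiable partial decay]:
  fixes f :: "real^'n \<Rightarrow> 'b::real_normed_vector"
  assumes "f \<in> X"
    and diff: "\<And>g x. g \<in> X \<Longrightarrow> g differentiable (at x)"
    and part: "\<And>g i. g \<in> X \<Longrightarrow> partial i g \<in> X"
    and dec: "\<And>g k. g \<in> X \<Longrightarrow> \<exists>B. \<forall>x. (1 + norm x) ^ k * norm (g x) \<le> B"
  shows "schwartz f"
proof -
  have X: "foldr partial is f \<in> X" for "is" by (induction "is") (use assms(1) part in auto)
  have "bounded (range (\<lambda>x. (1 + norm x) ^ k *\<^sub>R foldr partial is f x))" for "is" and k :: nat
  proof -
    obtain B where "\<forall>x. (1 + norm x) ^ k * norm (foldr partial is f x) \<le> B" using dec[OF X] by blast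
    then show ?thesis by (auto intro!: boundedI[where B=B])
  qed
  then show ?thesis using diff[OF X] by (simp add: schwartz_def)
qed

lemma schwartz_differentiable: "schwartz f \<Longrightarrow> f differentiable (at x)"
  unfolding schwartz_def by (metis foldr.simps(1) id_apply)

lemma schwartz_has_derivative: "schwartz f \<Longrightarrow> (f has_derivative (frechet_derivative f (at x))) (at x)"
  using schwartz_differentiable frechet_derivative_works by blast

lemma schwartz_partial: "schwartz f \<Longrightarrow> schwartz (partial i f)"
proof -
  have *: "foldr partial is (partial i f) = foldr partial (is @ [i]) f" for "is" by simp
  show "schwartz f \<Longrightarrow> schwartz (partial i f)" unfolding schwartz_def * by blast
qed

lemma schwartz_decay:
  assumes "schwartz f"
  obtains B where "B > 0" "\<And>x. (1 + norm x) ^ k * norm (f x) \<le> B"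
proof -
  have "bounded (range (\<lambda>x. (1 + norm x) ^ k *\<^sub>R foldr partial [] f x))"
    using assms unfolding schwartz_def by blast
  then obtain B where "B > 0" "\<forall>x\<in>range (\<lambda>x. (1 + norm x) ^ k *\<^sub>R f x). norm x \<le> B"
    by (auto simp: bounded_pos)
  then have "\<And>x. (1 + norm x) ^ k * norm (f x) \<le> B" by auto
  with \<open>B > 0\<close> show thesis by (rule that)
qed

lemma schwartz_decay_ex: "schwartz f \<Longrightarrow> \<exists>B. \<forall>x. (1 + norm x) ^ k * norm (f x) \<le> B"
  by (meson schwartz_decay)

lemma schwartz_isCont: "schwartz f \<Longrightarrow> isCont f x"
  by (rule differentiable_imp_continuous_within, rule schwartz_differentiable)

lemma schwartz_measurable [measurable_dest]:
  "schwartz f \<Longrightarrow> f \<in> borel_measurable borel"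
  by (intro borel_measurable_continuous_onI continuous_at_imp_continuous_on ballI schwartz_isCont)

lemma schwartz_bounded:
  assumes "schwartz f" obtains B where "B > 0" "\<And>x. norm (f x) \<le> B"
  using schwartz_decay[OF assms, of 0] by auto

lemma schwartz_integrable:
  fixes f :: "real^'n \<Rightarrow> 'b::{banach, second_countable_topology}"
  assumes f: "schwartz f"
  shows "integrable lborel f"
proof -
  obtain B where B: "B > 0" "\<And>x. (1 + norm x) ^ (2 * CARD('n)) * norm (f x) \<le> B"
    using schwartz_decay[OF f] by blast
  have "integrable lborel (\<lambda>x::real^'n. B * inverse ((1 + norm x) ^ (2 * CARD('n))))"
    using integrable_decay[where 'n='n] by simp
  then show ?thesis
  proof (rule Bochner_Integration.integrable_bound)
    show "f \<in> borel_measurable lborel" using f by measurable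
    show "AE x in lborel. norm (f x) \<le> norm (B * inverse ((1 + norm x) ^ (2 * CARD('n))))"
    proof (rule AE_I2)
      fix x :: "real^'n"
      have "norm (f x) \<le> B / (1 + norm x) ^ (2 * CARD('n))"
        using B(2)[of x] by (subst pos_le_divide_eq) (auto simp: mult_ac add_pos_nonneg intro!: zero_less_power)
      then show "norm (f x) \<le> norm (B * inverse ((1 + norm x) ^ (2 * CARD('n))))"
        using B(1) by (simp add: divide_inverse abs_mult)
    qed
  qed
qed

lemma schwartz_bounded_linear:
  assumes h: "bounded_linear h" and f: "schwartz f"
  shows "schwartz (\<lambda>x. h (f x))"
proof -
  have "(\<lambda>x. h (f x)) \<in> {\<lambda>x. h (f x) | f. schwartz f}" using f by blast
  then show ?thesis
  proof (coinduct rule: schwartz_coinduct)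
    case (differentiable g x)
    then show ?case
      using bounded_linear.has_derivative[OF h schwartz_has_derivative] by (auto simp: differentiable_def)
  next
    case (partial g i)
    then obtain f where g: "g = (\<lambda>x. h (f x))" and f: "schwartz f" by blast
    have "partial i g = (\<lambda>x. h (partial i f x))"
      unfolding g by (rule ext, subst partial_eq[OF bounded_linear.has_derivative[OF h schwartz_has_derivative[OF f]]])
        (simp add: partial_def)
    then show ?case using schwartz_partial[OF f] by blast
  next
    case (decay g k)
    then obtain f where g: "g = (\<lambda>x. h (f x))" and f: "schwartz f" by blast
    obtain B where B: "B > 0" "\<And>x. (1 + norm x) ^ k * norm (f x) \<le> B"
      using schwartz_decay[OF f] by blast
    obtain K where K: "K > 0" "\<And>x. norm (h x) \<le> norm x * K" using bounded_linear.pos_bounded[OF h] by blast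
    have "(1 + norm x) ^ k * norm (g x) \<le> B * K" for x
    proof -
      have "(1 + norm x) ^ k * norm (g x) \<le> (1 + norm x) ^ k * (norm (f x) * K)"
        unfolding g by (intro mult_left_mono K) auto
      also have "\<dots> \<le> B * K" using mult_right_mono[OF B(2)[of x], of K] K by (simp add: mult_ac)
      finally show ?thesis .
    qed
    then show ?case by blast
  qed
qed

lemma schwartz_add:
  fixes f g :: "real^'n \<Rightarrow> 'b::real_normed_vector"
  assumes "schwartz f" "schwartz g"
  shows "schwartz (\<lambda>x. f x + g x)"
proof -
  have "(\<lambda>x. f x + g x) \<in> {\<lambda>x. f x + g x | f g. schwartz f \<and> schwartz g}" using assms by blast
  then show ?thesis
  proof (coinduct rule: schwartz_coinduct)
    case (differentiable h x)
    then obtain f g where h: "h = (\<lambda>x. f x + g x)" and "schwartz f" "schwartz g" by blast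
    then show ?case unfolding h by (intro differentiable_add schwartz_differentiable)
  next
    case (partial h i)
    then obtain f g where h: "h = (\<lambda>x. f x + g x)" and f: "schwartz f" and g: "schwartz g" by blast
    have "partial i h = (\<lambda>x. partial i f x + partial i g x)"
      unfolding h by (rule ext, subst partial_eq[OF has_derivative_add[OF schwartz_has_derivative[OF f] schwartz_has_derivative[OF g]]])
        (simp add: partial_def)
    then show ?case using schwartz_partial[OF f] schwartz_partial[OF g] by blast
  next
    case (decay h k)
    then obtain f g where h: "h = (\<lambda>x. f x + g x)" and f: "schwartz f" and g: "schwartz g" by blast
    obtain B where B: "\<And>x. (1 + norm x) ^ k * norm (f x) \<le> B"
      using schwartz_decay[OF f] by blast
    obtain C where C: "\<And>x. (1 + norm x) ^ k * norm (g x) \<le> C"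
      using schwartz_decay[OF g] by blast
    have "(1 + norm x) ^ k * norm (h x) \<le> B + C" for x
    proof -
      have "(1 + norm x) ^ k * norm (h x) \<le> (1 + norm x) ^ k * (norm (f x) + norm (g x))"
        unfolding h by (intro mult_left_mono norm_triangle_ineq) auto
      then show ?thesis using B[of x] C[of x] by (simp add: algebra_simps)
    qed
    then show ?case by blast
  qed
qed

lemma schwartz_zero: "schwartz (\<lambda>x::real^'n. 0 :: 'b::real_normed_vector)"
proof -
  have "(\<lambda>x::real^'n. 0 :: 'b) \<in> {\<lambda>x. 0}" by simp
  then show ?thesis
  proof (coinduct rule: schwartz_coinduct)
    case (differentiable g x)
    then have "g = (\<lambda>x. 0)" by simp
    then show ?case by (simp only: differentiable_const)
  next
    case (partial g i)
    then have "g = (\<lambda>x. 0)" by simp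
    then show ?case by (simp add: partial_def[abs_def])
  next
    case (decay g k)
    then show ?case by auto
  qed
qed

lemma schwartz_sum: "(\<And>a. a \<in> A \<Longrightarrow> schwartz (f a)) \<Longrightarrow> schwartz (\<lambda>x. \<Sum>a\<in>A. f a x)"
  by (induction A rule: infinite_finite_induct) (auto intro: schwartz_zero schwartz_add)

lemma schwartz_cmult: "schwartz f \<Longrightarrow> schwartz (\<lambda>x. (c::complex) * f x)"
  by (rule schwartz_bounded_linear) (rule bounded_linear_mult_right)

text \<open>The derivative of x_j f contains f itself without the coordinate factor, so the products
  x_j f alone are not stable; the class therefore carries an additional Schwartz summand g.\<close>

lemma schwartz_coord:
  fixes f :: "real^'n \<Rightarrow> complex"
  assumes "schwartz f"
  shows "schwartz (\<lambda>x. of_real (x $ j) * f x)"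
proof -
  have "(\<lambda>x. of_real (x $ j) * f x) \<in> {\<lambda>x. of_real (x $ j) * f x + g x | f g. schwartz f \<and> schwartz g}"
    using assms schwartz_zero by force
  then show ?thesis
  proof (coinduct rule: schwartz_coinduct)
    case (differentiable h x)
    then obtain f g where h: "h = (\<lambda>x. of_real (x $ j) * f x + g x)" and f: "schwartz f" and g: "schwartz g" by blast
    have d: "(h has_derivative (\<lambda>v. of_real (x $ j) * frechet_derivative f (at x) v + of_real (v $ j) * f x + frechet_derivative g (at x) v)) (at x)" for x
      unfolding h by (auto intro!: derivative_eq_intros schwartz_has_derivative vec_nth_has_derivative f g)
    then show ?case by (auto simp: differentiable_def)
  next
    case (partial h i)
    then obtain f g where h: "h = (\<lambda>x. of_real (x $ j) * f x + g x)" and f: "schwartz f" and g: "schwartz g" by blast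
    have d: "(h has_derivative (\<lambda>v. of_real (x $ j) * frechet_derivative f (at x) v + of_real (v $ j) * f x + frechet_derivative g (at x) v)) (at x)" for x
      unfolding h by (auto intro!: derivative_eq_intros schwartz_has_derivative vec_nth_has_derivative f g)
    have "partial i h = (\<lambda>x. of_real (x $ j) * partial i f x + (of_real (axis i 1 $ j) * f x + partial i g x))"
      by (rule ext, subst partial_eq[OF d]) (simp add: partial_def)
    moreover have "schwartz (\<lambda>x. of_real (axis i 1 $ j) * f x + partial i g x)"
      by (intro schwartz_add schwartz_partial schwartz_cmult f g)
    ultimately show ?case using schwartz_partial[OF f, of i]
      by (intro CollectI exI[of _ "partial i f"] exI[of _ "\<lambda>x. of_real (axis i 1 $ j) * f x + partial i g x"]) auto
  next
    case (decay h k)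
    then obtain f g where h: "h = (\<lambda>x. of_real (x $ j) * f x + g x)" and f: "schwartz f" and g: "schwartz g" by blast
    obtain B where B: "\<And>x. (1 + norm x) ^ Suc k * norm (f x) \<le> B"
      using schwartz_decay[OF f] by blast
    obtain C where C: "\<And>x. (1 + norm x) ^ k * norm (g x) \<le> C"
      using schwartz_decay[OF g] by blast
    have "(1 + norm x) ^ k * norm (h x) \<le> B + C" for x
    proof -
      have "norm (h x) \<le> (1 + norm x) * norm (f x) + norm (g x)"
        unfolding h
        by (rule order_trans[OF norm_triangle_ineq], rule add_right_mono, subst norm_mult, rule mult_right_mono)
           (use component_le_norm_cart[of x j] in auto)
      then have "(1 + norm x) ^ k * norm (h x) \<le> (1 + norm x) ^ k * ((1 + norm x) * norm (f x) + norm (g x))"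
        by (intro mult_left_mono) auto
      then show ?thesis using B[of x] C[of x] by (simp add: algebra_simps)
    qed
    then show ?case by blast
  qed
qed

lemma schwartz_cis:
  fixes f :: "real^'n \<Rightarrow> complex"
  assumes "schwartz f"
  shows "schwartz (\<lambda>x. cis (x \<bullet> a) * f x)"
proof -
  have "(\<lambda>x. cis (x \<bullet> a) * f x) \<in> {\<lambda>x. cis (x \<bullet> a) * f x | f. schwartz f}" using assms by blast
  then show ?thesis
  proof (coinduct rule: schwartz_coinduct)
    case (differentiable h x)
    then obtain f where h: "h = (\<lambda>x. cis (x \<bullet> a) * f x)" and f: "schwartz f" by blast
    then show ?case unfolding h differentiable_def
      using has_derivative_mult[OF cis_inner_has_derivative schwartz_has_derivative[OF f]] by blast
  next
    case (partial h i)
    then obtain f where h: "h = (\<lambda>x. cis (x \<bullet> a) * f x)" and f: "schwartz f" by blast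
    have d: "(h has_derivative (\<lambda>v. cis (x \<bullet> a) * (frechet_derivative f (at x) v + (\<i> * of_real (v \<bullet> a)) * f x))) (at x)" for x
      unfolding h using has_derivative_mult[OF cis_inner_has_derivative schwartz_has_derivative[OF f]]
      by (simp add: algebra_simps)
    have "partial i h = (\<lambda>x. cis (x \<bullet> a) * (partial i f x + (\<i> * of_real (axis i 1 \<bullet> a)) * f x))"
      by (rule ext, subst partial_eq[OF d]) (simp add: partial_def)
    moreover have "schwartz (\<lambda>x. partial i f x + (\<i> * of_real (axis i 1 \<bullet> a)) * f x)"
      by (intro schwartz_add schwartz_partial schwartz_cmult f)
    ultimately show ?case by (intro CollectI exI[of _ "\<lambda>x. partial i f x + (\<i> * of_real (axis i 1 \<bullet> a)) * f x"]) auto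
  next
    case (decay h k)
    then show ?case using schwartz_decay_ex by (auto simp: norm_mult)
  qed
qed

text \<open>Submultiplicativity of the weight 1 + |x|, which makes polynomial decay invariant under
  translations.\<close>

lemma one_plus_norm_le: "1 + norm x \<le> (1 + norm (x - a)) * (1 + norm a)"
proof -
  have "(1 + norm (x - a)) * (1 + norm a) = 1 + norm (x - a) + norm a + norm (x - a) * norm a"
    by (simp add: algebra_simps)
  moreover have "norm x \<le> norm (x - a) + norm a" using norm_triangle_ineq[of "x - a" a] by simp
  moreover have "0 \<le> norm (x - a) * norm a" by simp
  ultimately show ?thesis by linarith
qed

lemma schwartz_shift:
  fixes f :: "real^'n \<Rightarrow> 'b::real_normed_vector"
  assumes "schwartz f"
  shows "schwartz (\<lambda>x. f (x - a))"
proof -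
  have "(\<lambda>x. f (x - a)) \<in> {\<lambda>x. f (x - a) | f. schwartz f}" using assms by blast
  then show ?thesis
  proof (coinduct rule: schwartz_coinduct)
    case (differentiable h x)
    then obtain f where h: "h = (\<lambda>x. f (x - a))" and f: "schwartz f" by blast
    have d: "(h has_derivative (\<lambda>v. frechet_derivative f (at (x - a)) v)) (at x)" for x
      unfolding h by (rule has_derivative_compose[where f="\<lambda>x. x - a", OF _ schwartz_has_derivative[OF f], where f'="\<lambda>v. v"])
        (auto intro!: derivative_eq_intros)
    then show ?case by (auto simp: differentiable_def)
  next
    case (partial h i)
    then obtain f where h: "h = (\<lambda>x. f (x - a))" and f: "schwartz f" by blast
    have d: "(h has_derivative (\<lambda>v. frechet_derivative f (at (x - a)) v)) (at x)" for x
      unfolding h by (rule has_derivative_compose[where f="\<lambda>x. x - a", OF _ schwartz_has_derivative[OF f], where f'="\<lambda>v. v"])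
        (auto intro!: derivative_eq_intros)
    have "partial i h = (\<lambda>x. partial i f (x - a))"
      by (rule ext, subst partial_eq[OF d]) (simp add: partial_def)
    then show ?case using schwartz_partial[OF f] by blast
  next
    case (decay h k)
    then obtain f where h: "h = (\<lambda>x. f (x - a))" and f: "schwartz f" by blast
    obtain B where B: "\<And>x. (1 + norm x) ^ k * norm (f x) \<le> B"
      using schwartz_decay[OF f] by blast
    have "(1 + norm x) ^ k * norm (h x) \<le> (1 + norm a) ^ k * B" for x
    proof -
      have "(1 + norm x) ^ k * norm (h x) \<le> ((1 + norm (x - a)) * (1 + norm a)) ^ k * norm (h x)"
        by (intro mult_right_mono power_mono one_plus_norm_le) auto
      also have "\<dots> = (1 + norm a) ^ k * ((1 + norm (x - a)) ^ k * norm (f (x - a)))"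
        by (simp add: power_mult_distrib h mult_ac)
      also have "\<dots> \<le> (1 + norm a) ^ k * B" by (intro mult_left_mono B) auto
      finally show ?thesis .
    qed
    then show ?case by blast
  qed
qed

lemma schwartz_scale:
  fixes f :: "real^'n \<Rightarrow> 'b::real_normed_vector"
  assumes "schwartz f" and c: "c \<noteq> 0"
  shows "schwartz (\<lambda>x. f (c *\<^sub>R x))"
proof -
  have "(\<lambda>x. f (c *\<^sub>R x)) \<in> {\<lambda>x. f (c *\<^sub>R x) | f. schwartz f}" using assms by blast
  then show ?thesis
  proof (coinduct rule: schwartz_coinduct)
    case (differentiable h x)
    then obtain f where h: "h = (\<lambda>x. f (c *\<^sub>R x))" and f: "schwartz f" by blast
    have d: "(h has_derivative (\<lambda>v. frechet_derivative f (at (c *\<^sub>R x)) (c *\<^sub>R v))) (at x)" for x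
      unfolding h by (rule has_derivative_compose[where f="\<lambda>x. c *\<^sub>R x", OF _ schwartz_has_derivative[OF f], where f'="\<lambda>v. c *\<^sub>R v"])
        (auto intro!: derivative_eq_intros)
    then show ?case by (auto simp: differentiable_def)
  next
    case (partial h i)
    then obtain f where h: "h = (\<lambda>x. f (c *\<^sub>R x))" and f: "schwartz f" by blast
    have d: "(h has_derivative (\<lambda>v. frechet_derivative f (at (c *\<^sub>R x)) (c *\<^sub>R v))) (at x)" for x
      unfolding h by (rule has_derivative_compose[where f="\<lambda>x. c *\<^sub>R x", OF _ schwartz_has_derivative[OF f], where f'="\<lambda>v. c *\<^sub>R v"])
        (auto intro!: derivative_eq_intros)
    have "partial i h = (\<lambda>x. c *\<^sub>R partial i f (c *\<^sub>R x))"
      by (rule ext, subst partial_eq[OF d])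
         (simp add: partial_def linear_cmul[OF linear_frechet_derivative[OF schwartz_differentiable[OF f]]])
    moreover have "schwartz (\<lambda>x. c *\<^sub>R partial i f x)"
      by (rule schwartz_bounded_linear[OF bounded_linear_scaleR_right schwartz_partial[OF f]])
    ultimately show ?case by (intro CollectI exI[of _ "\<lambda>x. c *\<^sub>R partial i f x"]) auto
  next
    case (decay h k)
    then obtain f where h: "h = (\<lambda>x. f (c *\<^sub>R x))" and f: "schwartz f" by blast
    obtain B where B: "\<And>x. (1 + norm x) ^ k * norm (f x) \<le> B"
      using schwartz_decay[OF f] by blast
    have "(1 + norm x) ^ k * norm (h x) \<le> (1 + inverse \<bar>c\<bar>) ^ k * B" for x
    proof -
      have "1 + norm x \<le> (1 + norm (c *\<^sub>R x)) * (1 + inverse \<bar>c\<bar>)"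
        using c by (simp add: field_simps)
      then have "(1 + norm x) ^ k * norm (h x) \<le> ((1 + norm (c *\<^sub>R x)) * (1 + inverse \<bar>c\<bar>)) ^ k * norm (h x)"
        by (intro mult_right_mono power_mono) auto
      also have "\<dots> = (1 + inverse \<bar>c\<bar>) ^ k * ((1 + norm (c *\<^sub>R x)) ^ k * norm (f (c *\<^sub>R x)))"
        by (simp add: power_mult_distrib h mult_ac)
      also have "\<dots> \<le> (1 + inverse \<bar>c\<bar>) ^ k * B" by (intro mult_left_mono B) auto
      finally show ?thesis .
    qed
    then show ?case by blast
  qed
qed

text \<open>By translation invariance every difference quotient of g has integral zero, and the
  quotients converge to the derivative under an integrable majorant. This replaces an integration by
  parts along the coordinate line.\<close>

lemma integral_partial_zero:
  fixes g :: "real^'n \<Rightarrow> complex"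
  assumes g: "schwartz g"
  shows "(LINT x|lborel. partial j g x) = 0"
proof -
  define e where "e = (axis j 1 :: real^'n)"
  have ne: "norm e = 1" by (simp add: e_def)
  have [measurable]: "g \<in> borel_measurable borel" using g by measurable
  define h where "h k = inverse (real (Suc k))" for k
  have h0: "h k > 0" "h k \<le> 1" for k by (auto simp: h_def field_simps)
  have h_lim: "h \<longlonglongrightarrow> 0" unfolding h_def by (rule LIMSEQ_inverse_real_of_nat)
  obtain B where B: "B > 0" "\<And>x. (1 + norm x) ^ (2 * CARD('n)) * norm (partial j g x) \<le> B"
    using schwartz_decay[OF schwartz_partial[OF g]] by blast
  have d1: "((\<lambda>s. g (x + s *\<^sub>R e)) has_derivative (\<lambda>s. s *\<^sub>R partial j g (x + s0 *\<^sub>R e))) (at s0)" for x s0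
  proof -
    have "((\<lambda>s. g (x + s *\<^sub>R e)) has_derivative (\<lambda>s. frechet_derivative g (at (x + s0 *\<^sub>R e)) (s *\<^sub>R e))) (at s0)"
      by (rule has_derivative_compose[where f="\<lambda>s. x + s *\<^sub>R e", OF _ schwartz_has_derivative[OF g], where f'="\<lambda>s. s *\<^sub>R e"])
        (auto intro!: derivative_eq_intros)
    then show ?thesis
      by (simp add: linear_cmul[OF linear_frechet_derivative[OF schwartz_differentiable[OF g]]] partial_def e_def)
  qed
  have bd: "norm ((g (x + h k *\<^sub>R e) - g x) /\<^sub>R h k) \<le> 2 ^ (2 * CARD('n)) * B * inverse ((1 + norm x) ^ (2 * CARD('n)))" for x k
  proof -
    have "\<exists>s\<in>{0<..<h k}. norm (g (x + h k *\<^sub>R e) - g (x + 0 *\<^sub>R e)) \<le> norm ((h k - 0) *\<^sub>R partial j g (x + s *\<^sub>R e))"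
      by (rule mvt_general[OF h0(1)])
         (use d1 in \<open>auto intro!: continuous_at_imp_continuous_on has_derivative_continuous\<close>)
    then obtain s where s: "0 < s" "s < h k" "norm (g (x + h k *\<^sub>R e) - g x) \<le> h k * norm (partial j g (x + s *\<^sub>R e))"
      using h0[of k] by auto
    have "norm (s *\<^sub>R e) \<le> 1" using s h0[of k] ne by simp
    \<comment> \<open>The mean value point lies within distance 1 of x, because all increments are
      at most 1. Hence the weights at both points agree up to a factor 2, and the majorant does not
      depend on k.\<close>
    then have *: "1 + norm x \<le> 2 * (1 + norm (x + s *\<^sub>R e))"
    proof -
      have "norm x \<le> norm (x + s *\<^sub>R e) + norm (s *\<^sub>R e)"
        using norm_triangle_ineq4[of "x + s *\<^sub>R e" "s *\<^sub>R e"] by (simp only: add_diff_cancel_right')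
      with \<open>norm (s *\<^sub>R e) \<le> 1\<close> norm_ge_zero[of "x + s *\<^sub>R e"] show ?thesis by argo
    qed
    have "(1 + norm x) ^ (2 * CARD('n)) * norm (partial j g (x + s *\<^sub>R e)) \<le> (2 * (1 + norm (x + s *\<^sub>R e))) ^ (2 * CARD('n)) * norm (partial j g (x + s *\<^sub>R e))"
      by (intro mult_right_mono power_mono *) auto
    also have "\<dots> \<le> 2 ^ (2 * CARD('n)) * B"
      unfolding power_mult_distrib mult.assoc by (intro mult_left_mono B) auto
    finally have "norm (partial j g (x + s *\<^sub>R e)) \<le> 2 ^ (2 * CARD('n)) * B / (1 + norm x) ^ (2 * CARD('n))"
      by (subst pos_le_divide_eq) (auto simp: mult_ac add_pos_nonneg intro!: zero_less_power)
    moreover have "norm ((g (x + h k *\<^sub>R e) - g x) /\<^sub>R h k) \<le> norm (partial j g (x + s *\<^sub>R e))"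
      using s(3) h0(1)[of k] by (simp add: divide_inverse_commute[symmetric] pos_divide_le_eq mult.commute)
    ultimately show ?thesis by (simp add: divide_inverse)
  qed
  have "(\<lambda>k. LINT x|lborel. (g (x + h k *\<^sub>R e) - g x) /\<^sub>R h k) \<longlonglongrightarrow> (LINT x|lborel. partial j g x)"
  proof (rule integral_dominated_convergence[where w="\<lambda>x. 2 ^ (2 * CARD('n)) * B * inverse ((1 + norm x) ^ (2 * CARD('n)))"])
    show "partial j g \<in> borel_measurable lborel" using schwartz_partial[OF g] by measurable
    show "AE x in lborel. (\<lambda>k. (g (x + h k *\<^sub>R e) - g x) /\<^sub>R h k) \<longlonglongrightarrow> partial j g x"
    proof (rule AE_I2)
      fix x
      have 1: "((\<lambda>s. norm (g (x + s *\<^sub>R e) - g x - s *\<^sub>R partial j g x) / norm s) \<longlongrightarrow> 0) (at 0)"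
        using d1[of x 0] unfolding has_derivative_at by simp
      have 2: "norm (g (x + s *\<^sub>R e) - g x - s *\<^sub>R partial j g x) / norm s = norm ((g (x + s *\<^sub>R e) - g x) /\<^sub>R s - partial j g x)"
        if "s \<noteq> 0" for s
      proof -
        have "(g (x + s *\<^sub>R e) - g x) /\<^sub>R s - partial j g x = (g (x + s *\<^sub>R e) - g x - s *\<^sub>R partial j g x) /\<^sub>R s"
          using that by (simp add: scaleR_diff_right)
        then show ?thesis using that by (simp only: norm_scaleR real_norm_def abs_inverse) (simp add: divide_inverse mult.commute)
      qed
      have "((\<lambda>s. norm ((g (x + s *\<^sub>R e) - g x) /\<^sub>R s - partial j g x)) \<longlongrightarrow> 0) (at 0)"
        by (rule Lim_transform_eventually[OF 1]) (use 2 in \<open>auto simp: eventually_at_filter\<close>)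
      then have "((\<lambda>s. (g (x + s *\<^sub>R e) - g x) /\<^sub>R s) \<longlongrightarrow> partial j g x) (at 0)"
        by (rule LIM_zero_cancel[OF tendsto_norm_zero_cancel])
      moreover have "filterlim h (at 0) sequentially"
        using h_lim h0 by (auto simp: filterlim_at order_less_imp_not_eq2)
      ultimately show "(\<lambda>k. (g (x + h k *\<^sub>R e) - g x) /\<^sub>R h k) \<longlonglongrightarrow> partial j g x"
        by (rule filterlim_compose)
    qed
    show "integrable lborel (\<lambda>x::real^'n. 2 ^ (2 * CARD('n)) * B * inverse ((1 + norm x) ^ (2 * CARD('n))))"
      using integrable_decay[where 'n='n] by simp
  qed (use bd in auto)
  moreover have "(LINT x|lborel. (g (x + h k *\<^sub>R e) - g x) /\<^sub>R h k) = 0" for k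
  proof -
    note gi = schwartz_integrable[OF g]
    have 1: "integrable lborel (\<lambda>x. g (x + h k *\<^sub>R e))" "(LINT x|lborel. g (x + h k *\<^sub>R e)) = (LINT x|lborel. g x)"
      using integrable_lborel_shift[OF gi, of "- (h k *\<^sub>R e)"] integral_lborel_shift[OF gi, of "- (h k *\<^sub>R e)"] by simp_all
    show ?thesis unfolding integral_scaleR_right by (subst Bochner_Integration.integral_diff[OF 1(1) gi]) (simp add: 1(2))
  qed
  ultimately have "(\<lambda>k. 0) \<longlonglongrightarrow> (LINT x|lborel. partial j g x)" by (simp only:)
  then show ?thesis by (metis LIMSEQ_const_iff)
qed

text \<open>The derivative of cis (\<xi> \<bullet> x) f \<xi> in \<xi> has integral zero; the
  product rule splits this integral into the two sides.\<close>

lemma ft_partial: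
  fixes f :: "real^'n \<Rightarrow> complex"
  assumes f: "schwartz f"
  shows "ft (partial j f) x = - \<i> * of_real (x $ j) * ft f x"
proof -
  define h where "h = (\<lambda>\<xi>. cis (\<xi> \<bullet> x) * f \<xi>)"
  have d: "(h has_derivative (\<lambda>v. cis (\<xi> \<bullet> x) * frechet_derivative f (at \<xi>) v + (\<i> * of_real (v \<bullet> x)) * (cis (\<xi> \<bullet> x) * f \<xi>))) (at \<xi>)" for \<xi>
    unfolding h_def using has_derivative_mult[OF cis_inner_has_derivative schwartz_has_derivative[OF f]]
    by (simp add: algebra_simps)
  have p: "partial j h = (\<lambda>\<xi>. cis (\<xi> \<bullet> x) * partial j f \<xi> + (\<i> * of_real (x $ j)) * (cis (\<xi> \<bullet> x) * f \<xi>))"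
    by (rule ext, subst partial_eq[OF d]) (simp add: partial_def inner_axis')
  have "schwartz h" unfolding h_def by (rule schwartz_cis[OF f])
  then have "(LINT \<xi>|lborel. partial j h \<xi>) = 0" by (rule integral_partial_zero)
  then have "ft (partial j f) x + (\<i> * of_real (x $ j)) * ft f x = 0"
    unfolding p ft_def
    by (subst (asm) Bochner_Integration.integral_add)
       (use integrable_cis_mult[OF schwartz_integrable[OF f]] integrable_cis_mult[OF schwartz_integrable[OF schwartz_partial[OF f]]] in auto)
  then show ?thesis by (simp add: eq_neg_iff_add_eq_0)
qed

lemma ft_coord: "schwartz f \<Longrightarrow> of_real (x $ j) * ft f x = \<i> * ft (partial j f) x"
  by (simp add: ft_partial mult.assoc[symmetric])

lemma ft_cmult: "ft (\<lambda>\<xi>. c * f \<xi>) x = c * ft f x"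
  unfolding ft_def by (subst integral_mult_right_zero[symmetric]) (simp add: mult_ac)

lemma ft_add: "integrable lborel f \<Longrightarrow> integrable lborel g \<Longrightarrow> ft (\<lambda>\<xi>. f \<xi> + g \<xi>) x = ft f x + ft g x"
  unfolding ft_def by (simp add: distrib_left integrable_cis_mult)

lemma ft_diff: "integrable lborel f \<Longrightarrow> integrable lborel g \<Longrightarrow> ft (\<lambda>\<xi>. f \<xi> - g \<xi>) x = ft f x - ft g x"
  unfolding ft_def by (simp add: right_diff_distrib integrable_cis_mult)

lemma ft_sum: "(\<And>a. a \<in> A \<Longrightarrow> integrable lborel (f a)) \<Longrightarrow> ft (\<lambda>\<xi>. \<Sum>a\<in>A. f a \<xi>) x = (\<Sum>a\<in>A. ft (f a) x)"
  unfolding ft_def by (simp add: sum_distrib_left integrable_cis_mult)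

lemma cis_taylor1: "cmod (cis t - 1 - \<i> * of_real t) \<le> t\<^sup>2"
proof -
  have "cmod (cis t - 1 - \<i> * of_real t) \<le> \<bar>t\<bar>^2 / 2"
    using iexp_approx1[of t 1] by (simp add: cis_conv_exp algebra_simps numeral_2_eq_2)
  also have "\<dots> \<le> t\<^sup>2" by simp
  finally show ?thesis .
qed

text \<open>The quadratic Taylor bound for \<open>cis\<close> controls the remainder by the second
  moment of f times |v|^2, uniformly in x. This yields the full derivative at once, without passing
  through continuity of partial derivatives.\<close>

lemma ft_has_derivative:
  fixes f :: "real^'n \<Rightarrow> complex"
  assumes f: "schwartz f"
  shows "(ft f has_derivative (\<lambda>v. \<Sum>j\<in>UNIV. of_real (v $ j) * ft (\<lambda>\<xi>. \<i> * of_real (\<xi> $ j) * f \<xi>) x)) (at x)"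
proof -
  have fm[measurable]: "f \<in> borel_measurable borel" using f by measurable
  have fj: "schwartz (\<lambda>\<xi>. \<i> * of_real (\<xi> $ j) * f \<xi>)" for j
    using schwartz_cmult[OF schwartz_coord[OF f], of \<i> j] by (simp add: mult_ac)
  note fji = schwartz_integrable[OF fj]
  have "schwartz (\<lambda>\<xi>. \<Sum>j\<in>UNIV. of_real (\<xi> $ j) * (of_real (\<xi> $ j) * f \<xi>))"
    by (intro schwartz_sum schwartz_coord f)
  moreover have "(\<Sum>j\<in>UNIV. of_real (\<xi> $ j) * (of_real (\<xi> $ j) * f \<xi>)) = of_real ((norm \<xi>)\<^sup>2) * f \<xi>" for \<xi> :: "real^'n"
  proof -
    have r: "(norm \<xi>)\<^sup>2 = (\<Sum>j\<in>UNIV. \<xi> $ j * \<xi> $ j)"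
      unfolding norm_vec_sum_power2 by (simp add: power2_eq_square)
    have "complex_of_real ((norm \<xi>)\<^sup>2) = (\<Sum>j\<in>UNIV. of_real (\<xi> $ j) * of_real (\<xi> $ j))"
      by (subst r) simp
    then show ?thesis by (simp only: sum_distrib_right mult.assoc)
  qed
  ultimately have "schwartz (\<lambda>\<xi>. of_real ((norm \<xi>)\<^sup>2) * f \<xi>)" by simp
  then have i2: "integrable lborel (\<lambda>\<xi>. (norm \<xi>)\<^sup>2 * norm (f \<xi>))"
    using integrable_norm[OF schwartz_integrable] by (force simp: norm_mult norm_power)
  define C where "C = (LINT \<xi>|lborel. (norm \<xi>)\<^sup>2 * norm (f \<xi>))"
  let ?L = "\<lambda>v. \<Sum>j\<in>UNIV. of_real (v $ j) * ft (\<lambda>\<xi>. \<i> * of_real (\<xi> $ j) * f \<xi>) x"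
  have L: "?L v = (LINT \<xi>|lborel. cis (\<xi> \<bullet> x) * (\<i> * of_real (\<xi> \<bullet> v)) * f \<xi>)" for v
  proof -
    have "?L v = (\<Sum>j\<in>UNIV. (LINT \<xi>|lborel. of_real (v $ j) * (cis (\<xi> \<bullet> x) * (\<i> * of_real (\<xi> $ j) * f \<xi>))))"
      by (simp add: ft_def)
    also have "\<dots> = (LINT \<xi>|lborel. (\<Sum>j\<in>UNIV. of_real (v $ j) * (cis (\<xi> \<bullet> x) * (\<i> * of_real (\<xi> $ j) * f \<xi>))))"
      by (subst Bochner_Integration.integral_sum) (auto intro!: integrable_mult_right integrable_cis_mult fji)
    also have "\<dots> = (LINT \<xi>|lborel. cis (\<xi> \<bullet> x) * (\<i> * of_real (\<xi> \<bullet> v)) * f \<xi>)"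
      by (simp add: inner_vec_def sum_distrib_left sum_distrib_right mult_ac)
    finally show ?thesis .
  qed
  have Li: "integrable lborel (\<lambda>\<xi>. cis (\<xi> \<bullet> x) * (\<i> * of_real (\<xi> \<bullet> v)) * f \<xi>)" for v
  proof -
    have "integrable lborel (\<lambda>\<xi>. (\<Sum>j\<in>UNIV. of_real (v $ j) * (cis (\<xi> \<bullet> x) * (\<i> * of_real (\<xi> $ j) * f \<xi>))))"
      by (auto intro!: Bochner_Integration.integrable_sum integrable_mult_right integrable_cis_mult fji)
    then show ?thesis by (simp add: inner_vec_def sum_distrib_left sum_distrib_right mult_ac)
  qed
  note fi = integrable_cis_mult[OF schwartz_integrable[OF f]]
  have rem: "norm (ft f (x + v) - ft f x - ?L v) \<le> C * (norm v)\<^sup>2" for v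
  proof -
    have "ft f (x + v) - ft f x - ?L v = (LINT \<xi>|lborel. cis (\<xi> \<bullet> x) * (cis (\<xi> \<bullet> v) - 1 - \<i> * of_real (\<xi> \<bullet> v)) * f \<xi>)"
    proof -
      have "ft f (x + v) - ft f x - ?L v = (LINT \<xi>|lborel. cis (\<xi> \<bullet> (x + v)) * f \<xi> - cis (\<xi> \<bullet> x) * f \<xi> - cis (\<xi> \<bullet> x) * (\<i> * of_real (\<xi> \<bullet> v)) * f \<xi>)"
        unfolding L using fi Li[of v] by (simp add: ft_def)
      then show ?thesis by (simp add: inner_add_right cis_mult[symmetric] algebra_simps)
    qed
    also have "norm \<dots> \<le> (LINT \<xi>|lborel. (norm v)\<^sup>2 * ((norm \<xi>)\<^sup>2 * norm (f \<xi>)))"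
    proof (rule integral_norm_le)
      fix \<xi> :: "real^'n"
      have "(\<xi> \<bullet> v)\<^sup>2 \<le> (norm \<xi> * norm v)\<^sup>2"
        using Cauchy_Schwarz_ineq2[of \<xi> v] by (intro abs_le_square_iff[THEN iffD1]) (simp add: abs_mult)
      then have "cmod (cis (\<xi> \<bullet> v) - 1 - \<i> * of_real (\<xi> \<bullet> v)) \<le> (norm \<xi>)\<^sup>2 * (norm v)\<^sup>2"
        using cis_taylor1[of "\<xi> \<bullet> v"] by (simp add: power_mult_distrib)
      from mult_right_mono[OF this norm_ge_zero[of "f \<xi>"]]
      show "norm (cis (\<xi> \<bullet> x) * (cis (\<xi> \<bullet> v) - 1 - \<i> * of_real (\<xi> \<bullet> v)) * f \<xi>) \<le> (norm v)\<^sup>2 * ((norm \<xi>)\<^sup>2 * norm (f \<xi>))"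
        by (simp add: norm_mult mult_ac)
    next
      show "integrable lborel (\<lambda>\<xi>. (norm v)\<^sup>2 * ((norm \<xi>)\<^sup>2 * norm (f \<xi>)))" by (rule integrable_mult_right[OF i2])
    qed (use fi[of "x+v"] fi[of x] Li[of v] in \<open>auto simp: inner_add_right cis_mult[symmetric] algebra_simps\<close>)
    also have "\<dots> = C * (norm v)\<^sup>2" by (simp add: C_def)
    finally show ?thesis .
  qed
  have bl: "bounded_linear ?L"
    by (intro bounded_linear_sum bounded_linear_mult_left bounded_linear_of_real[THEN bounded_linear_compose] bounded_linear_vec_nth bounded_linear_compose[OF bounded_linear_mult_left])
  show ?thesis
    unfolding has_derivative_at
  proof (intro conjI bl)
    show "(\<lambda>v. norm (ft f (x + v) - ft f x - ?L v) / norm v) \<midarrow>0\<rightarrow> 0"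
    proof (rule tendsto_sandwich[where f="\<lambda>_. 0" and h="\<lambda>v. C * norm v"])
      show "\<forall>\<^sub>F v in at 0. norm (ft f (x + v) - ft f x - ?L v) / norm v \<le> C * norm v"
        by (rule eventually_mono[OF eventually_at_filter[THEN iffD2, OF always_eventually]], 
            auto simp: pos_divide_le_eq power2_eq_square mult.assoc[symmetric])
           (use rem in \<open>simp add: pos_divide_le_eq power2_eq_square mult.assoc\<close>)
      show "(\<lambda>v. C * norm v) \<midarrow>0\<rightarrow> 0" by (auto intro!: tendsto_eq_intros)
    qed auto
  qed
qed

text \<open>The transforms of Schwartz functions form a class stable under partial derivatives,
  since differentiating multiplies by a coordinate under the transform. Decay is by induction on the
  exponent: a factor x_j is traded for a derivative of f, and |x| is at most the sum of the
  |x_j|.\<close>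

lemma schwartz_ft:
  fixes f :: "real^'n \<Rightarrow> complex"
  assumes "schwartz f"
  shows "schwartz (ft f)" and partial_ft: "partial j (ft f) = ft (\<lambda>\<xi>. \<i> * of_real (\<xi> $ j) * f \<xi>)"
proof -
  have fj: "schwartz (\<lambda>\<xi>. \<i> * of_real (\<xi> $ j) * f \<xi>)" if "schwartz f" for j and f :: "real^'n \<Rightarrow> complex"
    using schwartz_cmult[OF schwartz_coord[OF that], of \<i> j] by (simp add: mult_ac)
  have p: "partial j (ft f) = ft (\<lambda>\<xi>. \<i> * of_real (\<xi> $ j) * f \<xi>)" if "schwartz f" for j and f :: "real^'n \<Rightarrow> complex"
    by (rule ext, subst partial_eq[OF ft_has_derivative[OF that]]) (simp add: axis_def if_distrib[of of_real] if_distrib[of "\<lambda>z. z * _"] cong: if_cong)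
  then show "partial j (ft f) = ft (\<lambda>\<xi>. \<i> * of_real (\<xi> $ j) * f \<xi>)" using assms by blast
  have dec: "\<exists>B. \<forall>x. (1 + norm x) ^ k * norm (ft f x) \<le> B" if "schwartz f" for k and f :: "real^'n \<Rightarrow> complex"
    using that
  proof (induction k arbitrary: f)
    case 0
    then show ?case using norm_ft_le[of f] by auto
  next
    case (Suc k)
    obtain B where B: "\<And>x. (1 + norm x) ^ k * norm (ft f x) \<le> B" using Suc by blast
    have "\<forall>j. \<exists>B. \<forall>x. (1 + norm x) ^ k * norm (ft (partial j f) x) \<le> B"
      using Suc schwartz_partial by blast
    then obtain C where C: "\<And>j x. (1 + norm x) ^ k * norm (ft (partial j f) x) \<le> C j" by metis
    have "(1 + norm x) ^ Suc k * norm (ft f x) \<le> B + (\<Sum>j\<in>UNIV. C j)" for x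
    proof -
      have "norm x * norm (ft f x) \<le> (\<Sum>j\<in>UNIV. \<bar>x $ j\<bar>) * norm (ft f x)"
        by (intro mult_right_mono norm_le_l1_cart) auto
      also have "\<dots> = (\<Sum>j\<in>UNIV. norm (ft (partial j f) x))"
        using ft_coord[OF Suc.prems, of x, THEN arg_cong[where f=norm]] by (simp add: sum_distrib_right norm_mult)
      finally have "(1 + norm x) ^ k * (norm x * norm (ft f x)) \<le> (1 + norm x) ^ k * (\<Sum>j\<in>UNIV. norm (ft (partial j f) x))"
        by (intro mult_left_mono) auto
      also have "\<dots> \<le> (\<Sum>j\<in>UNIV. C j)" unfolding sum_distrib_left by (intro sum_mono C)
      finally show ?thesis using B[of x] by (simp add: algebra_simps)
    qed
    then show ?case by blast
  qed
  have "ft f \<in> {ft f | f. schwartz f}" using assms by blast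
  then show "schwartz (ft f)"
  proof (coinduct rule: schwartz_coinduct)
    case (differentiable g x)
    then show ?case using ft_has_derivative unfolding differentiable_def by blast
  next
    case (partial g i)
    then show ?case using p fj by blast
  next
    case (decay g k)
    then show ?case using dec by blast
  qed
qed

lemmas schwartz_ft_integrable = schwartz_integrable[OF schwartz_ft(1)]

lemma schwartz_inversion:
  fixes f :: "real^'n \<Rightarrow> complex"
  assumes "schwartz f"
  shows "ft (ft f) x = of_real ((2 * pi) ^ CARD('n)) * f (- x)"
proof -
  obtain B where "\<And>x. norm (f x) \<le> B" using schwartz_bounded[OF assms] by blast
  then show ?thesis
    by (rule fourier_inversion[OF schwartz_integrable[OF assms] schwartz_ft_integrable[OF assms]])
       (rule schwartz_isCont[OF assms])
qed

text \<open>The functions produced by differentiating a radial profile repeatedly: polynomials in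
  the coordinates times some \<open>h k\<close> of |x|^2. It serves as the coinduction class for
  radial functions.\<close>

inductive_set radial_span :: "(nat \<Rightarrow> real \<Rightarrow> real) \<Rightarrow> (real^'n \<Rightarrow> complex) set" for h where
  base: "(\<lambda>x. of_real (h k ((norm x)\<^sup>2))) \<in> radial_span h"
| coord: "f \<in> radial_span h \<Longrightarrow> (\<lambda>x. of_real (x $ j) * f x) \<in> radial_span h"
| add: "f \<in> radial_span h \<Longrightarrow> g \<in> radial_span h \<Longrightarrow> (\<lambda>x. f x + g x) \<in> radial_span h"
| cmult: "f \<in> radial_span h \<Longrightarrow> (\<lambda>x. c * f x) \<in> radial_span h"

text \<open>The profile is a function of t = |x|^2, with \<open>h k\<close> as its derivative of
  order k. As |x|^2 is smooth, no condition at the origin arises, unlike for functions of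
  |x|.\<close>

lemma schwartz_radial:
  fixes h :: "nat \<Rightarrow> real \<Rightarrow> real"
  assumes der: "\<And>k t. t \<ge> 0 \<Longrightarrow> (h k has_real_derivative h (Suc k) t) (at t)"
    and bd: "\<And>k m. \<exists>B. \<forall>t\<ge>0. (1 + t) ^ m * \<bar>h k t\<bar> \<le> B"
  shows "schwartz (\<lambda>x::real^'n. complex_of_real (h 0 ((norm x)\<^sup>2)))"
proof -
  have D: "\<exists>f'. (\<forall>x. (f has_derivative (\<lambda>v. \<Sum>i\<in>UNIV. of_real (v $ i) * f' i x)) (at x)) \<and> (\<forall>i. f' i \<in> radial_span h)"
    if "f \<in> radial_span h" for f :: "real^'n \<Rightarrow> complex"
    using that
  proof induction
    case (base k)
    let ?f' = "\<lambda>i x. 2 * (of_real (x $ i) * complex_of_real (h (Suc k) ((norm x)\<^sup>2)))"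
    have "((\<lambda>x. complex_of_real (h k ((norm x)\<^sup>2))) has_derivative (\<lambda>v. \<Sum>i\<in>UNIV. of_real (v $ i) * ?f' i x)) (at x)" for x :: "real^'n"
    proof -
      have 1: "((\<lambda>x. (norm x)\<^sup>2) has_derivative (\<lambda>v. 2 * (x \<bullet> v))) (at x)" for x :: "real^'n"
        unfolding power2_norm_eq_inner by (auto intro!: derivative_eq_intros simp: inner_commute)
      have 2: "(h k has_derivative (\<lambda>t. h (Suc k) ((norm x)\<^sup>2) * t)) (at ((norm x)\<^sup>2))"
        using der[of "(norm x)\<^sup>2" k] by (simp add: has_field_derivative_def)
      have "((\<lambda>x. complex_of_real (h k ((norm x)\<^sup>2))) has_derivative (\<lambda>v. complex_of_real (h (Suc k) ((norm x)\<^sup>2) * (2 * (x \<bullet> v))))) (at x)"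
        by (rule bounded_linear.has_derivative[OF bounded_linear_of_real has_derivative_compose[OF 1 2]])
      also have "(\<lambda>v. complex_of_real (h (Suc k) ((norm x)\<^sup>2) * (2 * (x \<bullet> v)))) = (\<lambda>v. \<Sum>i\<in>UNIV. of_real (v $ i) * ?f' i x)"
        by (simp add: inner_vec_def sum_distrib_left mult_ac fun_eq_iff)
      finally show ?thesis .
    qed
    moreover have "?f' i \<in> radial_span h" for i by (intro radial_span.intros)
    ultimately show ?case by (intro exI[of _ ?f']) blast
  next
    case (coord f j)
    then obtain f' where f': "\<And>x. (f has_derivative (\<lambda>v. \<Sum>i\<in>UNIV. of_real (v $ i) * f' i x)) (at x)" "\<And>i. f' i \<in> radial_span h" by blast
    let ?g = "\<lambda>i x. of_real (x $ j) * f' i x + of_real (if i = j then 1 else 0) * f x"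
    have "((\<lambda>x. of_real (x $ j) * f x) has_derivative (\<lambda>v. \<Sum>i\<in>UNIV. of_real (v $ i) * ?g i x)) (at x)" for x
    proof -
      have "((\<lambda>x. of_real (x $ j) * f x) has_derivative (\<lambda>v. of_real (x $ j) * (\<Sum>i\<in>UNIV. of_real (v $ i) * f' i x) + of_real (v $ j) * f x)) (at x)"
        by (auto intro!: derivative_eq_intros vec_nth_has_derivative f')
      also have "(\<lambda>v. of_real (x $ j) * (\<Sum>i\<in>UNIV. of_real (v $ i) * f' i x) + of_real (v $ j) * f x) = (\<lambda>v. \<Sum>i\<in>UNIV. of_real (v $ i) * ?g i x)"
        by (simp add: distrib_left sum.distrib sum_distrib_left mult_ac fun_eq_iff if_distrib[of of_real] if_distrib[of "\<lambda>z. _ * z"] cong: if_cong)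
      finally show ?thesis .
    qed
    moreover have "?g i \<in> radial_span h" for i by (intro radial_span.intros f' coord.hyps)
    ultimately show ?case by (intro exI[of _ ?g]) blast
  next
    case (add f g)
    then obtain f' g' where "\<And>x. (f has_derivative (\<lambda>v. \<Sum>i\<in>UNIV. of_real (v $ i) * f' i x)) (at x)" "\<And>i. f' i \<in> radial_span h"
      "\<And>x. (g has_derivative (\<lambda>v. \<Sum>i\<in>UNIV. of_real (v $ i) * g' i x)) (at x)" "\<And>i. g' i \<in> radial_span h" by blast
    then show ?case
      by (intro exI[of _ "\<lambda>i x. f' i x + g' i x"])
         (auto intro!: radial_span.intros derivative_eq_intros simp: distrib_left sum.distrib)
  next
    case (cmult f c)
    then obtain f' where "\<And>x. (f has_derivative (\<lambda>v. \<Sum>i\<in>UNIV. of_real (v $ i) * f' i x)) (at x)" "\<And>i. f' i \<in> radial_span h" by blast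
    then show ?case
      by (intro exI[of _ "\<lambda>i x. c * f' i x"])
         (auto intro!: radial_span.intros derivative_eq_intros simp: sum_distrib_left mult_ac)
  qed
  have B: "\<exists>B. \<forall>x. (1 + norm x) ^ k * norm (f x) \<le> B" if "f \<in> radial_span h" for f :: "real^'n \<Rightarrow> complex" and k
    using that
  proof (induction arbitrary: k)
    case (base l)
    obtain B where B: "\<And>t. t \<ge> 0 \<Longrightarrow> (1 + t) ^ k * \<bar>h l t\<bar> \<le> B" using bd by blast
    have "(1 + norm x) ^ k * norm (complex_of_real (h l ((norm x)\<^sup>2))) \<le> 2 ^ k * B" for x :: "real^'n"
    proof -
      have "2 * norm x \<le> 1 + (norm x)\<^sup>2" using sum_squares_bound[of 1 "norm x"] by simp
      then have "1 + norm x \<le> 2 * (1 + (norm x)\<^sup>2)" using zero_le_power2[of "norm x"] by argo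
      then have "(1 + norm x) ^ k * \<bar>h l ((norm x)\<^sup>2)\<bar> \<le> (2 * (1 + (norm x)\<^sup>2)) ^ k * \<bar>h l ((norm x)\<^sup>2)\<bar>"
        by (intro mult_right_mono power_mono) auto
      also have "\<dots> \<le> 2 ^ k * B" unfolding power_mult_distrib mult.assoc by (intro mult_left_mono B) auto
      finally show ?thesis by simp
    qed
    then show ?case by blast
  next
    case (coord f j)
    obtain B where B: "\<And>x. (1 + norm x) ^ Suc k * norm (f x) \<le> B" using coord.IH by blast
    have "(1 + norm x) ^ k * norm (of_real (x $ j) * f x) \<le> B" for x
    proof -
      have "(1 + norm x) ^ k * norm (of_real (x $ j) * f x) \<le> (1 + norm x) ^ k * ((1 + norm x) * norm (f x))"
        unfolding norm_mult by (intro mult_left_mono mult_right_mono) (use component_le_norm_cart[of x j] in auto)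
      then show ?thesis using B[of x] by (simp add: mult_ac)
    qed
    then show ?case by blast
  next
    case (add f g)
    obtain B C where B: "\<And>x. (1 + norm x) ^ k * norm (f x) \<le> B" "\<And>x. (1 + norm x) ^ k * norm (g x) \<le> C" using add.IH by blast
    have "(1 + norm x) ^ k * norm (f x + g x) \<le> B + C" for x
    proof -
      have "(1 + norm x) ^ k * norm (f x + g x) \<le> (1 + norm x) ^ k * (norm (f x) + norm (g x))"
        by (intro mult_left_mono norm_triangle_ineq) auto
      then show ?thesis using B[of x] by (simp add: algebra_simps)
    qed
    then show ?case by blast
  next
    case (cmult f c)
    obtain B where B: "\<And>x. (1 + norm x) ^ k * norm (f x) \<le> B" using cmult.IH by blast
    have "(1 + norm x) ^ k * norm (c * f x) \<le> norm c * B" for x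
      using mult_left_mono[OF B[of x] norm_ge_zero[of c]] by (simp add: norm_mult mult_ac)
    then show ?case by blast
  qed
  have "(\<lambda>x::real^'n. complex_of_real (h 0 ((norm x)\<^sup>2))) \<in> radial_span h" by (rule radial_span.base)
  then show ?thesis
  proof (coinduct rule: schwartz_coinduct)
    case (differentiable g x)
    then show ?case using D unfolding differentiable_def by blast
  next
    case (partial g i)
    then obtain f' where f': "\<And>x. (g has_derivative (\<lambda>v. \<Sum>i\<in>UNIV. of_real (v $ i) * f' i x)) (at x)" "\<And>i. f' i \<in> radial_span h"
      using D by blast
    have "partial i g = f' i"
      by (rule ext, subst partial_eq[OF f'(1)]) (simp add: axis_def if_distrib[of of_real] if_distrib[of "\<lambda>z. z * _"] cong: if_cong)
    then show ?case using f'(2) by simp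
  next
    case (decay g k)
    then show ?case using B by blast
  qed
qed

lemma power_le_fact_exp: "x \<ge> 0 \<Longrightarrow> x ^ m \<le> fact m * exp (x::real)"
proof -
  assume x: "x \<ge> 0"
  have "(\<Sum>n\<in>{m}. x ^ n /\<^sub>R fact n) \<le> (\<Sum>n. x ^ n /\<^sub>R fact n)"
    by (rule sum_le_suminf[OF summable_exp_generic]) (use x in auto)
  then show ?thesis by (simp add: exp_def field_simps)
qed

lemma schwartz_gaussian:
  assumes s: "s > 0"
  shows "schwartz (\<lambda>x::real^'n. complex_of_real (exp (- s * (norm x)\<^sup>2)))"
proof -
  define h where "h k t = (- s) ^ k * exp (- s * t)" for k :: nat and t :: real
  have "schwartz (\<lambda>x::real^'n. complex_of_real (h 0 ((norm x)\<^sup>2)))"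
  proof (rule schwartz_radial)
    show "(h k has_real_derivative h (Suc k) t) (at t)" for k t
      unfolding h_def by (auto intro!: derivative_eq_intros)
    show "\<exists>B. \<forall>t\<ge>0. (1 + t) ^ m * \<bar>h k t\<bar> \<le> B" for k m
    proof (intro exI allI impI)
      fix t :: real assume t: "t \<ge> 0"
      have "(s * (1 + t)) ^ m \<le> fact m * exp (s * (1 + t))" using s t by (intro power_le_fact_exp) auto
      then have "(1 + t) ^ m \<le> fact m * exp s * exp (s * t) / s ^ m"
      proof -
        have "exp (s * (1 + t)) = exp s * exp (s * t)" by (simp add: distrib_left exp_add)
        with \<open>(s * (1 + t)) ^ m \<le> fact m * exp (s * (1 + t))\<close>
        have "s ^ m * (1 + t) ^ m \<le> fact m * exp s * exp (s * t)" by (simp add: power_mult_distrib)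
        then show ?thesis using s by (subst pos_le_divide_eq) (auto simp: mult_ac)
      qed
      then have "(1 + t) ^ m * (s ^ k * exp (- s * t)) \<le> (fact m * exp s * exp (s * t) / s ^ m) * (s ^ k * exp (- s * t))"
        using s by (intro mult_right_mono) auto
      also have "\<dots> = fact m * exp s / s ^ m * s ^ k" by (simp add: exp_minus field_simps)
      finally show "(1 + t) ^ m * \<bar>h k t\<bar> \<le> fact m * exp s / s ^ m * s ^ k"
        using s by (simp add: h_def abs_mult power_abs)
    qed
  qed
  then show ?thesis by (simp add: h_def)
qed

text \<open>The argument 1 + 8 t with t = |\<xi>|^2 never falls below 1, so it avoids the end point
  0, where only one-sided derivatives of the cutoff are given. Beyond 3/2 all derivatives vanish by
  uniqueness of derivatives, so decay reduces to boundedness for t \<le> 1.\<close>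

lemma LP_cutoff_schwartz:
  assumes "LP_cutoff \<phi>"
  shows "schwartz (\<lambda>\<xi>::real^'n. complex_of_real (\<phi> (1 + 8 * (norm \<xi>)\<^sup>2)))"
proof -
  obtain D :: "nat \<Rightarrow> real \<Rightarrow> real" where D0: "D 0 = \<phi>"
    and D: "\<And>k t. t \<ge> 0 \<Longrightarrow> (D k has_real_derivative D (Suc k) t) (at t within {0..})"
    using assms unfolding LP_cutoff_def smooth_half_line_def by blast
  have D': "(D k has_real_derivative D (Suc k) t) (at t)" if "t > 0" for k t
    using D[of t k] that at_within_interior[of t "{0..}"] by (simp add: interior_real_atLeast)
  have Z: "D k t = 0" if "t > 3/2" for k t
    using that
  proof (induction k arbitrary: t)
    case 0
    then show ?case using assms by (simp add: LP_cutoff_def D0)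
  next
    case (Suc k)
    have "(D k has_real_derivative 0) (at t)"
      by (rule has_field_derivative_transform_within_open[of "\<lambda>_. 0" _ _ "{3/2<..}"]) (use Suc in auto)
    moreover have "(D k has_real_derivative D (Suc k) t) (at t)" using D' Suc.prems by simp
    ultimately show ?case using DERIV_unique by blast
  qed
  define h where "h k t = 8 ^ k * D k (1 + 8 * t)" for k :: nat and t :: real
  have "schwartz (\<lambda>x::real^'n. complex_of_real (h 0 ((norm x)\<^sup>2)))"
  proof (rule schwartz_radial)
    show "(h k has_real_derivative h (Suc k) t) (at t)" if "t \<ge> 0" for k t
    proof -
      have "((\<lambda>t. D k (1 + 8 * t)) has_real_derivative D (Suc k) (1 + 8 * t) * 8) (at t)"
      proof (rule DERIV_chain2[OF D'])
        show "((\<lambda>t. 1 + 8 * t) has_real_derivative 8) (at t)" by (auto intro!: derivative_eq_intros)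
      qed (use that in simp)
      from DERIV_cmult[OF this, of "8 ^ k"]
      have "((\<lambda>t. 8 ^ k * D k (1 + 8 * t)) has_real_derivative 8 ^ k * (D (Suc k) (1 + 8 * t) * 8)) (at t)" .
      moreover have "(\<lambda>t. 8 ^ k * D k (1 + 8 * t)) = h k" by (rule ext) (simp only: h_def)
      moreover have "8 ^ k * (D (Suc k) (1 + 8 * t) * 8) = h (Suc k) t" by (simp only: h_def power_Suc mult_ac)
      ultimately show ?thesis by (simp only:)
    qed
    show "\<exists>B. \<forall>t\<ge>0. (1 + t) ^ m * \<bar>h k t\<bar> \<le> B" for k m
    proof -
      have "isCont (D k) t" if "t \<in> {0<..}" for t using DERIV_isCont[OF D'[of t k]] that by simp
      then have "continuous_on {0<..} (D k)" by (intro continuous_at_imp_continuous_on) blast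
      moreover have "continuous_on {0..1} (\<lambda>t::real. 1 + 8 * t)" by (intro continuous_intros)
      ultimately have "continuous_on {0..1} (\<lambda>t. D k (1 + 8 * t))"
        by (rule continuous_on_compose2) auto
      then have "continuous_on {0..1} (\<lambda>t. (1 + t) ^ m * \<bar>8 ^ k * D k (1 + 8 * t)\<bar>)"
        by (intro continuous_on_mult continuous_on_rabs continuous_on_power continuous_on_add continuous_on_const continuous_on_id)
      then have "continuous_on {0..1} (\<lambda>t. (1 + t) ^ m * \<bar>h k t\<bar>)" by (simp only: h_def)
      then have "bounded ((\<lambda>t. (1 + t) ^ m * \<bar>h k t\<bar>) ` {0..1})"
        by (intro compact_imp_bounded compact_continuous_image) auto
      then obtain B where B: "B > 0" "\<And>t. t \<in> {0..1} \<Longrightarrow> \<bar>(1 + t) ^ m * \<bar>h k t\<bar>\<bar> \<le> B"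
        unfolding bounded_pos by auto
      have "(1 + t) ^ m * \<bar>h k t\<bar> \<le> B" if "t \<ge> 0" for t
      proof (cases "t \<le> 1")
        case True
        then show ?thesis using B(2)[of t] that by auto
      next
        case False
        then show ?thesis using B(1) Z[of "1 + 8 * t" k] by (simp add: h_def)
      qed
      then show ?thesis by blast
    qed
  qed
  then show ?thesis by (simp add: h_def D0)
qed

section \<open>Shifts, scalings, convolutions and products under the transform\<close>

lemma ft_shift:
  assumes "integrable lborel f"
  shows "ft (\<lambda>\<xi>. f (\<xi> - a)) x = cis (a \<bullet> x) * ft f x"
proof -
  have "ft (\<lambda>\<xi>. f (\<xi> - a)) x = (LINT \<xi>|lborel. cis (a \<bullet> x) * (cis ((\<xi> - a) \<bullet> x) * f (\<xi> - a)))"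
    unfolding ft_def by (simp add: inner_diff_left mult.assoc[symmetric] cis_mult)
  also have "\<dots> = cis (a \<bullet> x) * ft f x"
    using integral_lborel_shift[OF integrable_cis_mult[OF assms, of x], of a] by (simp add: ft_def)
  finally show ?thesis .
qed

lemma ft_modulate: "ft (\<lambda>\<xi>. cis (\<xi> \<bullet> a) * f \<xi>) x = ft f (x + a)"
  unfolding ft_def by (simp add: inner_add_right mult.assoc[symmetric] cis_mult)

lemma ft_scale:
  fixes f :: "real^'n \<Rightarrow> complex"
  assumes f: "integrable lborel f" and c: "c > 0"
  shows "ft (\<lambda>\<xi>. f (c *\<^sub>R \<xi>)) x = of_real (inverse c ^ CARD('n)) * ft f (inverse c *\<^sub>R x)"
proof -
  have "ft f (inverse c *\<^sub>R x) = \<bar>c\<bar> ^ DIM(real^'n) *\<^sub>R (LINT \<xi>|lborel. cis ((0 + c *\<^sub>R \<xi>) \<bullet> (inverse c *\<^sub>R x)) * f (0 + c *\<^sub>R \<xi>))"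
    unfolding ft_def by (rule integral_lborel_affine[OF integrable_cis_mult[OF f]]) (use c in auto)
  also have "\<dots> = of_real (c ^ CARD('n)) * ft (\<lambda>\<xi>. f (c *\<^sub>R \<xi>)) x"
    using c by (simp add: ft_def scaleR_conv_of_real[where 'a=complex] mult.assoc[symmetric])
  finally show ?thesis using c by (simp add: field_simps)
qed

text \<open>The factor c^(-n) of the scaled transform cancels the Jacobian. This invariance gives
  every kernel bound below its dependence on time or frequency: the kernels are rescalings of a
  fixed one.\<close>

lemma integral_norm_ft_scale:
  fixes f :: "real^'n \<Rightarrow> complex"
  assumes f: "integrable lborel f" and ff: "integrable lborel (ft f)" and c: "c > 0"
  shows "(LINT x|lborel. norm (ft (\<lambda>\<xi>. f (c *\<^sub>R \<xi>)) x)) = (LINT x|lborel. norm (ft f x))"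
proof -
  have "(LINT x|lborel. norm (ft f x)) = \<bar>inverse c\<bar> ^ DIM(real^'n) *\<^sub>R (LINT x|lborel. norm (ft f (0 + inverse c *\<^sub>R x)))"
    by (rule integral_lborel_affine[OF integrable_norm[OF ff]]) (use c in auto)
  also have "\<dots> = (LINT x|lborel. norm (ft (\<lambda>\<xi>. f (c *\<^sub>R \<xi>)) x))"
    unfolding ft_scale[OF f c] using c by (simp add: norm_mult norm_power norm_inverse)
  finally show ?thesis ..
qed

text \<open>A function with f (- \<xi>) = cnj (f \<xi>) therefore has a real transform. This is used
  for the Oseen kernel, the bump profile and the building blocks of the data.\<close>

lemma cnj_ft:
  assumes "integrable lborel f"
  shows "cnj (ft f x) = ft (\<lambda>\<xi>. cnj (f (- \<xi>))) x"
proof -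
  have "cnj (ft f x) = (LINT \<xi>|lborel. cnj (cis (\<xi> \<bullet> x) * f \<xi>))"
    unfolding ft_def by (rule Bochner_Integration.integral_cnj[symmetric])
  also have "\<dots> = (LINT \<xi>|lborel. cis (- \<xi> \<bullet> x) * cnj (f \<xi>))" by (simp add: cis_cnj)
  also have "\<dots> = (LINT \<xi>|lborel. cis (- (0 - \<xi>) \<bullet> x) * cnj (f (0 - \<xi>)))"
    by (rule integral_lborel_reflect[symmetric])
       (use integrable_cis_mult[OF integrable_cnj[OF assms], of "-x"] in simp)
  finally show ?thesis by (simp add: ft_def)
qed

text \<open>Fubini with m as the transform of K. Only integrability of K enters, so the Oseen
  kernel, whose symbol is not smooth at the origin, is covered. The second claim moves a further
  frequency \<zeta> onto the kernel and prepares the case of a product of two transforms.\<close>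

lemma conv_ft:
  fixes K f :: "real^'n \<Rightarrow> complex"
  assumes K: "integrable lborel K" and f: "integrable lborel f"
    and m: "\<And>\<xi>. (LINT y|lborel. K y * cis (- \<xi> \<bullet> y)) = m \<xi>"
  shows "(LINT y|lborel. K (x - y) * ft f y) = ft (\<lambda>\<xi>. m \<xi> * f \<xi>) x"
    and "ft (\<lambda>y. cis (y \<bullet> \<zeta>) * K (x - y)) \<xi> = cis ((\<xi> + \<zeta>) \<bullet> x) * m (\<xi> + \<zeta>)"
proof -
  have A: "ft (\<lambda>y. cis (y \<bullet> \<zeta>) * K (x - y)) \<xi> = cis ((\<xi> + \<zeta>) \<bullet> x) * m (\<xi> + \<zeta>)" for \<zeta> \<xi>
  proof -
    have i: "integrable lborel (\<lambda>y. cis ((\<xi> + \<zeta>) \<bullet> x) * (K y * cis (- (\<xi> + \<zeta>) \<bullet> y)))"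
      using integrable_cis_mult[OF K, of "- (\<xi> + \<zeta>)"] by (simp add: mult.commute inner_commute)
    have "ft (\<lambda>y. cis (y \<bullet> \<zeta>) * K (x - y)) \<xi> = (LINT y|lborel. cis ((\<xi> + \<zeta>) \<bullet> x) * (K (x - y) * cis (- (\<xi> + \<zeta>) \<bullet> (x - y))))"
      unfolding ft_def
      by (rule Bochner_Integration.integral_cong[OF refl])
         (simp add: mult.assoc[symmetric] cis_mult inner_commute algebra_simps inner_diff_left inner_add_left inner_diff_right inner_add_right)
    also have "\<dots> = cis ((\<xi> + \<zeta>) \<bullet> x) * m (\<xi> + \<zeta>)"
      by (subst integral_lborel_reflect[OF i]) (simp only: integral_mult_right_zero m)
    finally show ?thesis .
  qed
  then show "ft (\<lambda>y. cis (y \<bullet> \<zeta>) * K (x - y)) \<xi> = cis ((\<xi> + \<zeta>) \<bullet> x) * m (\<xi> + \<zeta>)" .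
  have "(LINT y|lborel. ft f y * K (x - y)) = (LINT \<xi>|lborel. f \<xi> * ft (\<lambda>y. K (x - y)) \<xi>)"
    by (rule ft_swap[OF f integrable_lborel_reflect[OF K]])
  also have "\<dots> = ft (\<lambda>\<xi>. m \<xi> * f \<xi>) x"
    using A[of 0] by (simp add: ft_def mult_ac)
  finally show "(LINT y|lborel. K (x - y) * ft f y) = ft (\<lambda>\<xi>. m \<xi> * f \<xi>) x"
    by (simp add: mult.commute)
qed

lemma integrable_mult_ft:
  fixes g f :: "real^'n \<Rightarrow> complex"
  assumes g: "integrable lborel g" and f: "integrable lborel f"
  shows "integrable lborel (\<lambda>y. g y * ft f y)"
proof -
  have [measurable]: "f \<in> borel_measurable borel" "g \<in> borel_measurable borel" using f g by auto
  have "integrable lborel (\<lambda>y. norm (g y) * (LINT \<xi>|lborel. norm (f \<xi>)))" using g by simp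
  then show ?thesis
    by (rule Bochner_Integration.integrable_bound)
       (auto intro!: AE_I2 mult_left_mono order_trans[OF norm_ft_le] simp: norm_mult)
qed

text \<open>Frequencies of a product add, so the symbol is evaluated at \<xi> + \<zeta>. The
  iterated integral takes the place of the convolution of f and g and keeps the supports of both
  visible.\<close>

lemma conv_ft_prod:
  fixes K f g :: "real^'n \<Rightarrow> complex"
  assumes K: "integrable lborel K" and f: "integrable lborel f" and g: "integrable lborel g"
    and m: "\<And>\<xi>. (LINT y|lborel. K y * cis (- \<xi> \<bullet> y)) = m \<xi>"
  shows "(LINT y|lborel. K (x - y) * (ft f y * ft g y)) =
    (LINT \<zeta>|lborel. g \<zeta> * (LINT \<xi>|lborel. f \<xi> * (cis ((\<xi> + \<zeta>) \<bullet> x) * m (\<xi> + \<zeta>))))"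
proof -
  have Kr: "integrable lborel (\<lambda>y. K (x - y))" by (rule integrable_lborel_reflect[OF K])
  have "(LINT y|lborel. K (x - y) * (ft f y * ft g y)) = (LINT y|lborel. ft g y * (K (x - y) * ft f y))"
    by (simp add: mult_ac)
  also have "\<dots> = (LINT \<zeta>|lborel. g \<zeta> * ft (\<lambda>y. K (x - y) * ft f y) \<zeta>)"
    by (rule ft_swap[OF g integrable_mult_ft[OF Kr f]])
  also have "\<dots> = (LINT \<zeta>|lborel. g \<zeta> * (LINT \<xi>|lborel. f \<xi> * ft (\<lambda>y. cis (y \<bullet> \<zeta>) * K (x - y)) \<xi>))"
  proof (rule Bochner_Integration.integral_cong[OF refl], rule arg_cong[where f="(*) _"])
    fix \<zeta>
    have "ft (\<lambda>y. K (x - y) * ft f y) \<zeta> = (LINT y|lborel. ft f y * (cis (y \<bullet> \<zeta>) * K (x - y)))"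
      unfolding ft_def[of "\<lambda>y. K (x - y) * ft f y"] by (simp add: mult_ac)
    then show "ft (\<lambda>y. K (x - y) * ft f y) \<zeta> = (LINT \<xi>|lborel. f \<xi> * ft (\<lambda>y. cis (y \<bullet> \<zeta>) * K (x - y)) \<xi>)"
      by (simp only: ft_swap[OF f integrable_cis_mult[OF Kr]])
  qed
  finally show ?thesis by (simp only: conv_ft(2)[OF K f m])
qed

text \<open>The product formula at the point 0 with the reflected transform of q as kernel. Pairing
  a product of two fields with a test function then depends on q only at - (\<xi> + \<zeta>), where
  support arguments apply. Inversion for q is a hypothesis so that Gaussian multiples of Schwartz
  functions and their differences can be inserted.\<close>

lemma triple_ft:
  fixes f g q :: "real^'n \<Rightarrow> complex"
  assumes f: "integrable lborel f" and g: "integrable lborel g"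
    and qi: "integrable lborel (ft q)" and inv: "\<And>x. ft (ft q) x = of_real ((2 * pi) ^ CARD('n)) * q (- x)"
  shows "(LINT y|lborel. ft f y * ft g y * ft q y) =
    of_real ((2 * pi) ^ CARD('n)) * (LINT \<zeta>|lborel. g \<zeta> * (LINT \<xi>|lborel. f \<xi> * q (- (\<xi> + \<zeta>))))"
proof -
  have K: "integrable lborel (\<lambda>y. ft q (- y))" using integrable_lborel_reflect[OF qi, of 0] by simp
  have m: "(LINT y|lborel. ft q (- y) * cis (- \<xi> \<bullet> y)) = of_real ((2 * pi) ^ CARD('n)) * q (- \<xi>)" for \<xi>
  proof -
    have "(LINT y|lborel. ft q (- y) * cis (- \<xi> \<bullet> y)) = (LINT y|lborel. ft q (0 - y) * cis (\<xi> \<bullet> (0 - y)))" by simp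
    also have "\<dots> = (LINT y|lborel. ft q y * cis (\<xi> \<bullet> y))"
      by (rule integral_lborel_reflect) (use integrable_cis_mult[OF qi, of \<xi>] in \<open>simp add: mult.commute inner_commute\<close>)
    also have "\<dots> = ft (ft q) \<xi>" by (simp add: ft_def mult.commute inner_commute)
    finally show ?thesis by (simp only: inv)
  qed
  define c where "c = complex_of_real ((2 * pi) ^ CARD('n))"
  have e: "g \<zeta> * (LINT \<xi>|lborel. f \<xi> * (cis ((\<xi> + \<zeta>) \<bullet> 0) * (c * q (- (\<xi> + \<zeta>))))) = c * (g \<zeta> * (LINT \<xi>|lborel. f \<xi> * q (- (\<xi> + \<zeta>))))" for \<zeta>
  proof -
    have "(\<lambda>\<xi>. f \<xi> * (cis ((\<xi> + \<zeta>) \<bullet> 0) * (c * q (- (\<xi> + \<zeta>))))) = (\<lambda>\<xi>. c * (f \<xi> * q (- (\<xi> + \<zeta>))))"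
      by (simp add: fun_eq_iff)
    then show ?thesis by (simp only: integral_mult_right_zero mult.left_commute)
  qed
  have "(LINT y|lborel. ft q (- (0 - y)) * (ft f y * ft g y)) = c * (LINT \<zeta>|lborel. g \<zeta> * (LINT \<xi>|lborel. f \<xi> * q (- (\<xi> + \<zeta>))))"
    unfolding conv_ft_prod[OF K f g m, of 0] c_def[symmetric] e integral_mult_right_zero ..
  then show ?thesis by (simp add: mult.commute[of "ft q _"] c_def)
qed

lemma integral_norm_conv_le:
  fixes K g :: "real^'n \<Rightarrow> complex"
  assumes K: "integrable lborel K" and g: "integrable lborel g"
  shows "(LINT x|lborel. norm (LINT y|lborel. K (x - y) * g y)) \<le> (LINT x|lborel. norm (K x)) * (LINT y|lborel. norm (g y))"
proof -
  have [measurable]: "K \<in> borel_measurable borel" "g \<in> borel_measurable borel" using K g by auto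
  have "integrable (lborel \<Otimes>\<^sub>M lborel) (\<lambda>(y, x). norm (g y) * norm (K (- (y - x))))"
    using integrable_pair_conv[OF integrable_norm[OF g] integrable_norm[OF integrable_lborel_reflect[OF K, of 0]]] by simp
  then have I: "integrable (lborel \<Otimes>\<^sub>M lborel) (\<lambda>(y, x). norm (g y) * norm (K (x - y)))" by simp
  have "integrable (lborel \<Otimes>\<^sub>M lborel) (\<lambda>(y, x). K (x - y) * g y)"
    by (rule integrable_pair_bound[OF I]) (auto simp: norm_mult mult.commute)
  then have 1: "integrable lborel (\<lambda>x. LINT y|lborel. K (x - y) * g y)" by (rule lborel_pair.integrable_snd)
  note 2 = lborel_pair.integrable_snd[OF I]
  have "(LINT x|lborel. norm (LINT y|lborel. K (x - y) * g y)) \<le> (LINT x|lborel. (LINT y|lborel. norm (g y) * norm (K (x - y))))"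
    by (rule integral_mono[OF integrable_norm[OF 1] 2])
       (rule order_trans[OF integral_norm_bound], simp add: norm_mult mult.commute)
  also have "\<dots> = (LINT y|lborel. (LINT x|lborel. norm (g y) * norm (K (x - y))))"
    by (rule lborel_pair.Fubini_integral[OF I])
  also have "\<dots> = (LINT x|lborel. norm (K x)) * (LINT y|lborel. norm (g y))"
    using integral_lborel_shift[OF integrable_norm[OF K]] by (simp add: mult.commute)
  finally show ?thesis .
qed

section \<open>Heat and Oseen kernels\<close>

definition heat_kernel :: "real \<Rightarrow> real^'n \<Rightarrow> real" where
  "heat_kernel t z = (4 * pi * t) powr (- real CARD('n) / 2) * exp (- (norm z)\<^sup>2 / (4 * t))"

lemma heat_kernel:
  assumes t: "t > 0"
  shows heat_kernel_integrable: "integrable lborel (heat_kernel t :: real^'n \<Rightarrow> real)"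
    and heat_kernel_integral: "(LINT z|lborel. heat_kernel t (z::real^'n)) = 1"
    and heat_kernel_ft: "(LINT y|lborel. complex_of_real (heat_kernel t y) * cis (- \<xi> \<bullet> y)) = of_real (exp (- t * (norm (\<xi>::real^'n))\<^sup>2))"
    and heat_kernel_nonneg: "heat_kernel t z \<ge> 0"
proof -
  have c: "(4 * pi * t) powr (- real CARD('n) / 2) * sqrt (4 * pi * t) ^ CARD('n) = 1"
    using t by (simp add: powr_half_sqrt[symmetric] powr_realpow[symmetric] powr_powr powr_add[symmetric])
  show "integrable lborel (heat_kernel t :: real^'n \<Rightarrow> real)"
    unfolding heat_kernel_def using gauss_kernel_integral(1)[OF t, where 'n='n] by simp
  show "(LINT z|lborel. heat_kernel t (z::real^'n)) = 1"
    unfolding heat_kernel_def using gauss_kernel_integral(2)[OF t, where 'n='n] c by simp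
  show "heat_kernel t z \<ge> 0" by (simp add: heat_kernel_def)
  have s: "1 / (4 * t) > 0" using t by simp
  have "(LINT y|lborel. complex_of_real (heat_kernel t y) * cis (- \<xi> \<bullet> y)) =
    (LINT y|lborel. of_real ((4 * pi * t) powr (- real CARD('n) / 2)) * (cis (y \<bullet> - \<xi>) * complex_of_real (exp (- (1 / (4 * t)) * (norm y)\<^sup>2))))"
    unfolding heat_kernel_def by (intro Bochner_Integration.integral_cong refl) (simp add: inner_commute mult_ac)
  also have "\<dots> = of_real ((4 * pi * t) powr (- real CARD('n) / 2) * sqrt (4 * pi * t) ^ CARD('n) * exp (- t * (norm \<xi>)\<^sup>2))"
    unfolding integral_mult_right_zero gaussian_integral(2)[OF s, of "-\<xi>"]
    using t by (simp add: mult_ac)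
  finally show "(LINT y|lborel. complex_of_real (heat_kernel t y) * cis (- \<xi> \<bullet> y)) = of_real (exp (- t * (norm (\<xi>::real^'n))\<^sup>2))"
    unfolding c by simp
qed

lemma heat_ft:
  fixes f :: "real^'n \<Rightarrow> complex"
  assumes t: "t > 0" and f: "integrable lborel f"
  shows "(LINT y|lborel. of_real (heat_kernel t (x - y)) * ft f y) = ft (\<lambda>\<xi>. of_real (exp (- t * (norm \<xi>)\<^sup>2)) * f \<xi>) x"
  by (rule conv_ft(1)[of "\<lambda>y. of_real (heat_kernel t y)", OF _ f heat_kernel_ft[OF t]])
     (use heat_kernel_integrable[OF t, where 'n='n] in simp)

text \<open>The Gaussian factor acts as convolution with a probability density, which does not
  increase the integral of the modulus. The bound is uniform as s tends to 0; the value s = 0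
  itself, where the kernel degenerates, is treated apart.\<close>

lemma integral_norm_ft_gaussian_le:
  fixes q :: "real^'n \<Rightarrow> complex"
  assumes s: "s \<ge> 0" and q: "schwartz q"
  shows "(LINT x|lborel. norm (ft (\<lambda>\<xi>. of_real (exp (- s * (norm \<xi>)\<^sup>2)) * q \<xi>) x)) \<le> (LINT x|lborel. norm (ft q x))"
    and "integrable lborel (ft (\<lambda>\<xi>. of_real (exp (- s * (norm \<xi>)\<^sup>2)) * q \<xi>))"
proof -
  note qi = schwartz_ft_integrable[OF q]
  have "(LINT x|lborel. norm (ft (\<lambda>\<xi>. of_real (exp (- s * (norm \<xi>)\<^sup>2)) * q \<xi>) x)) \<le> (LINT x|lborel. norm (ft q x)) \<and>
    integrable lborel (ft (\<lambda>\<xi>. of_real (exp (- s * (norm \<xi>)\<^sup>2)) * q \<xi>))"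
  proof (cases "s = 0")
    case True
    then show ?thesis using qi by simp
  next
    case False
    then have s: "s > 0" using s by simp
    have K: "integrable lborel (\<lambda>y::real^'n. complex_of_real (heat_kernel s y))" using heat_kernel_integrable[OF s, where 'n='n] by simp
    have eq: "ft (\<lambda>\<xi>. of_real (exp (- s * (norm \<xi>)\<^sup>2)) * q \<xi>) = (\<lambda>x. LINT y|lborel. of_real (heat_kernel s (x - y)) * ft q y)"
      by (rule ext) (rule heat_ft[OF s schwartz_integrable[OF q], symmetric])
    have [measurable]: "ft q \<in> borel_measurable borel" using qi by auto
    have [measurable]: "(heat_kernel s :: real^'n \<Rightarrow> real) \<in> borel_measurable borel" using heat_kernel_integrable[OF s] by auto
    have I: "integrable (lborel \<Otimes>\<^sub>M lborel) (\<lambda>(y, x). norm (ft q y) * heat_kernel s (- (y - x)))"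
      using integrable_pair_conv[OF integrable_norm[OF qi] integrable_lborel_reflect[OF heat_kernel_integrable[OF s], of 0]] by simp
    have "integrable (lborel \<Otimes>\<^sub>M lborel) (\<lambda>(y, x). of_real (heat_kernel s (x - y)) * ft q y)"
      by (rule integrable_pair_bound[OF I]) (auto simp: norm_mult mult.commute heat_kernel_nonneg[OF s])
    from lborel_pair.integrable_snd[OF this] have "integrable lborel (ft (\<lambda>\<xi>. of_real (exp (- s * (norm \<xi>)\<^sup>2)) * q \<xi>))"
      unfolding eq .
    moreover have "(LINT x::real^'n|lborel. norm (complex_of_real (heat_kernel s x))) = 1"
      using heat_kernel_integral[OF s, where 'n='n] heat_kernel_nonneg[OF s, where 'a='n] by simp
    ultimately show ?thesis unfolding eq using integral_norm_conv_le[OF K qi] by simp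
  qed
  then show "(LINT x|lborel. norm (ft (\<lambda>\<xi>. of_real (exp (- s * (norm \<xi>)\<^sup>2)) * q \<xi>) x)) \<le> (LINT x|lborel. norm (ft q x))"
    and "integrable lborel (ft (\<lambda>\<xi>. of_real (exp (- s * (norm \<xi>)\<^sup>2)) * q \<xi>))" by auto
qed

section \<open>The Oseen kernel: symbol, integrability and scaling\<close>

definition oseen_symbol :: "real \<Rightarrow> 'n::finite \<Rightarrow> 'n \<Rightarrow> 'n \<Rightarrow> real^'n \<Rightarrow> complex" where
  "oseen_symbol s i j k \<xi> =
     of_real (exp (- s * (norm \<xi>)\<^sup>2) * helmholtz_symbol i j \<xi>) * (\<i> * of_real (\<xi> $ k))"

lemma abs_helmholtz_symbol_le: "\<bar>helmholtz_symbol i j \<xi>\<bar> \<le> 2"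
proof -
  have "\<bar>\<xi> $ i * \<xi> $ j\<bar> \<le> norm \<xi> * norm \<xi>"
    unfolding abs_mult by (intro mult_mono component_le_norm_cart) auto
  then have "\<bar>\<xi> $ i * \<xi> $ j / (norm \<xi>)\<^sup>2\<bar> \<le> 1"
    by (simp add: power2_eq_square abs_mult divide_le_eq)
  moreover have "\<bar>a\<bar> \<le> 1 \<Longrightarrow> \<bar>(if P then 1 else 0) - a\<bar> \<le> 2" for a :: real and P by (cases P) auto
  ultimately show ?thesis unfolding helmholtz_symbol_def by blast
qed

lemma helmholtz_symbol_measurable [measurable]: "helmholtz_symbol i j \<in> borel_measurable borel"
  unfolding helmholtz_symbol_def[abs_def] by measurable

lemma norm_oseen_symbol_le: "norm (oseen_symbol s i j k \<xi>) \<le> 2 * norm \<xi> * exp (- s * (norm \<xi>)\<^sup>2)"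
proof -
  have "\<bar>helmholtz_symbol i j \<xi>\<bar> * \<bar>\<xi> $ k\<bar> \<le> 2 * norm \<xi>"
    by (intro mult_mono abs_helmholtz_symbol_le component_le_norm_cart) auto
  from mult_left_mono[OF this, of "exp (- s * (norm \<xi>)\<^sup>2)"] show ?thesis
    by (simp add: oseen_symbol_def norm_mult mult_ac)
qed

lemma gaussian_deriv_schwartz:
  assumes "s > 0"
  shows "schwartz (\<lambda>\<xi>::real^'n. \<i> * of_real (\<xi> $ k) * of_real (exp (- s * (norm \<xi>)\<^sup>2)))"
    and "schwartz (\<lambda>\<xi>::real^'n. \<i> * of_real (\<xi> $ i) * of_real (\<xi> $ j) * of_real (\<xi> $ k) * of_real (exp (- s * (norm \<xi>)\<^sup>2)))"
  using schwartz_cmult[OF schwartz_coord[OF schwartz_gaussian[OF assms]], of \<i>]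
    schwartz_cmult[OF schwartz_coord[OF schwartz_coord[OF schwartz_coord[OF schwartz_gaussian[OF assms]]]], of \<i> i j k]
  by (simp_all add: mult_ac)

lemma integrable_norm_gaussian:
  assumes "s > 0"
  shows "integrable lborel (\<lambda>\<xi>::real^'n. norm \<xi> * exp (- s * (norm \<xi>)\<^sup>2))"
proof -
  have "integrable lborel (\<lambda>\<xi>::real^'n. \<Sum>k\<in>UNIV. norm (\<i> * of_real (\<xi> $ k) * of_real (exp (- s * (norm \<xi>)\<^sup>2))))"
    by (intro Bochner_Integration.integrable_sum integrable_norm schwartz_integrable gaussian_deriv_schwartz assms)
  then show ?thesis
  proof (rule Bochner_Integration.integrable_bound)
    show "AE \<xi>::real^'n in lborel. norm (norm \<xi> * exp (- s * (norm \<xi>)\<^sup>2)) \<le> norm (\<Sum>k\<in>UNIV. norm (\<i> * of_real (\<xi> $ k) * complex_of_real (exp (- s * (norm \<xi>)\<^sup>2))))"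
    proof (rule AE_I2)
      fix \<xi> :: "real^'n"
      have "norm \<xi> * exp (- s * (norm \<xi>)\<^sup>2) \<le> (\<Sum>k\<in>UNIV. \<bar>\<xi> $ k\<bar>) * exp (- s * (norm \<xi>)\<^sup>2)"
        by (intro mult_right_mono norm_le_l1_cart) auto
      then show "norm (norm \<xi> * exp (- s * (norm \<xi>)\<^sup>2)) \<le> norm (\<Sum>k\<in>UNIV. norm (\<i> * of_real (\<xi> $ k) * complex_of_real (exp (- s * (norm \<xi>)\<^sup>2))))"
        by (simp add: norm_mult sum_distrib_right sum_nonneg)
    qed
  qed simp
qed

lemma oseen_symbol_measurable [measurable]: "oseen_symbol s i j k \<in> borel_measurable borel"
  unfolding oseen_symbol_def[abs_def] by measurable

lemma oseen_symbol_integrable: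
  assumes "s > 0"
  shows "integrable lborel (oseen_symbol s i j k)"
proof (rule Bochner_Integration.integrable_bound)
  show "integrable lborel (\<lambda>\<xi>::real^'a. 2 * (norm \<xi> * exp (- s * (norm \<xi>)\<^sup>2)))"
    using integrable_norm_gaussian[OF assms] by simp
qed (use norm_oseen_symbol_le[of s i j k] in \<open>auto simp: mult.assoc\<close>)

text \<open>The Helmholtz symbol jumps at the origin, but the derivative factor \<xi>_k makes the
  product vanish there. Continuity everywhere is what allows Fourier inversion to return the symbol
  as the transform of the kernel.\<close>

lemma oseen_symbol_isCont:
  fixes \<xi> :: "real^'n"
  assumes "s > 0"
  shows "isCont (oseen_symbol s i j k) \<xi>"
proof (cases "\<xi> = 0")
  case True
  have "((\<lambda>\<eta>::real^'n. 2 * norm \<eta> * exp (- s * (norm \<eta>)\<^sup>2)) \<longlongrightarrow> 2 * norm (0::real^'n) * exp (- s * (norm (0::real^'n))\<^sup>2)) (at 0)"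
    by (intro tendsto_intros)
  then have "((\<lambda>\<eta>::real^'n. 2 * norm \<eta> * exp (- s * (norm \<eta>)\<^sup>2)) \<longlongrightarrow> 0) (at 0)" by simp
  then have "(oseen_symbol s i j k \<longlongrightarrow> 0) (at 0)"
    by (rule Lim_null_comparison[rotated]) (use norm_oseen_symbol_le[of s i j k] in auto)
  then show ?thesis using True by (simp add: isCont_def oseen_symbol_def)
next
  case False
  then show ?thesis
    unfolding oseen_symbol_def[abs_def] helmholtz_symbol_def by (auto intro!: continuous_intros)
qed

lemma oseen_symbol_bounded:
  assumes "s > 0"
  shows "norm (oseen_symbol s i j k \<xi>) \<le> 2 * (1 + 1 / s)"
proof -
  have "norm \<xi> * exp (- s * (norm \<xi>)\<^sup>2) \<le> 1 + 1 / s"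
  proof -
    have "s * (norm \<xi>)\<^sup>2 \<le> exp (s * (norm \<xi>)\<^sup>2)"
      using exp_ge_add_one_self[of "s * (norm \<xi>)\<^sup>2"] by linarith
    then have "(norm \<xi>)\<^sup>2 * exp (- s * (norm \<xi>)\<^sup>2) \<le> 1 / s"
      using assms by (simp add: exp_minus field_simps)
    moreover have "norm \<xi> \<le> 1 + (norm \<xi>)\<^sup>2"
    proof -
      have "2 * norm \<xi> \<le> 1 + (norm \<xi>)\<^sup>2" using sum_squares_bound[of 1 "norm \<xi>"] by simp
      then show ?thesis using zero_le_power2[of "norm \<xi>"] by linarith
    qed
    ultimately have "norm \<xi> * exp (- s * (norm \<xi>)\<^sup>2) \<le> (1 + (norm \<xi>)\<^sup>2) * exp (- s * (norm \<xi>)\<^sup>2)"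
      by (intro mult_right_mono) auto
    also have "\<dots> = exp (- s * (norm \<xi>)\<^sup>2) + (norm \<xi>)\<^sup>2 * exp (- s * (norm \<xi>)\<^sup>2)" by (simp add: algebra_simps)
    also have "\<dots> \<le> 1 + 1 / s" using \<open>(norm \<xi>)\<^sup>2 * exp (- s * (norm \<xi>)\<^sup>2) \<le> 1 / s\<close> assms by (intro add_mono) auto
    finally show ?thesis .
  qed
  then show ?thesis using norm_oseen_symbol_le[of s i j k \<xi>] by argo
qed

lemma has_bochner_integral_exp_tail:
  fixes a s :: real
  assumes a: "a > 0"
  shows "has_bochner_integral lborel (\<lambda>r. indicator {s..} r * exp (- r * a)) (exp (- s * a) / a)"
proof (rule has_bochner_integral_nn_integral)
  have lim: "((\<lambda>r. - exp (- r * a) / a) \<longlongrightarrow> - 0 / a) at_top"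
  proof (intro tendsto_intros)
    show "((\<lambda>r. exp (- r * a)) \<longlongrightarrow> 0) at_top"
      using a by (auto intro!: filterlim_compose[OF exp_at_bot] filterlim_tendsto_pos_mult_at_bot
         filterlim_tendsto_pos_mult_at_top filterlim_ident simp: filterlim_uminus_at_bot mult.commute[of _ a])
  qed (use a in auto)
  have "(\<integral>\<^sup>+r. ennreal (exp (- r * a)) * indicator {s..} r \<partial>lborel) = ennreal (- 0 / a - (- exp (- s * a) / a))"
    by (rule nn_integral_FTC_atLeast[OF _ _ _ lim]) (use a in \<open>auto intro!: derivative_eq_intros\<close>)
  then show "(\<integral>\<^sup>+r. ennreal (indicator {s..} r * exp (- r * a)) \<partial>lborel) = ennreal (exp (- s * a) / a)"
    by (simp add: indicator_mult_ennreal mult.commute)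
qed (use a in auto)

text \<open>The integrand is, up to a constant, the integral of the modulus of a third Gaussian
  derivative at time r; its tail beyond s has the size s^(-1/2) expected of the Oseen
  kernel.\<close>

lemma has_bochner_integral_powr_tail:
  fixes s :: real
  assumes s: "s > 0"
  shows "has_bochner_integral lborel (\<lambda>r. indicator {s..} r * r powr (-3/2)) (2 / sqrt s)"
proof (rule has_bochner_integral_nn_integral)
  have lim: "((\<lambda>r::real. - 2 * r powr (-1/2)) \<longlongrightarrow> - 2 * 0) at_top"
    by (intro tendsto_intros tendsto_neg_powr filterlim_ident) simp
  have "(\<integral>\<^sup>+r. ennreal (r powr (-3/2)) * indicator {s..} r \<partial>lborel) = ennreal (- 2 * 0 - (- 2 * s powr (-1/2)))"
    by (rule nn_integral_FTC_atLeast[OF _ _ _ lim]) (use s in \<open>auto intro!: derivative_eq_intros\<close>)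
  moreover have "s powr (-1/2) = 1 / sqrt s" using s by (simp add: powr_minus_divide powr_half_sqrt)
  ultimately show "(\<integral>\<^sup>+r. ennreal (indicator {s..} r * r powr (-3/2)) \<partial>lborel) = ennreal (2 / sqrt s)"
    by (simp add: indicator_mult_ennreal mult.commute)
qed (use s in auto)

lemma vec_nth_measurable [measurable (raw)]:
  fixes f :: "'a \<Rightarrow> ('b::topological_space)^'n"
  assumes "f \<in> borel_measurable M"
  shows "(\<lambda>x. f x $ i) \<in> borel_measurable M"
  by (rule measurable_compose[OF assms]) (intro borel_measurable_continuous_onI continuous_intros)

definition gaussian_deriv3 :: "real \<Rightarrow> 'n::finite \<Rightarrow> 'n \<Rightarrow> 'n \<Rightarrow> real^'n \<Rightarrow> complex" where
  "gaussian_deriv3 r i j k \<xi> = \<i> * of_real (\<xi> $ i) * of_real (\<xi> $ j) * of_real (\<xi> $ k) * of_real (exp (- r * (norm \<xi>)\<^sup>2))"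

text \<open>This splits the symbol of the Oseen kernel into Gaussian derivatives, by
  \<open>exp (- s |\<xi>|\<^sup>2) / |\<xi>|\<^sup>2 = \<integral>\<^sub>s exp (- r |\<xi>|\<^sup>2) dr\<close>; no singularity at \<open>\<xi> = 0\<close> remains.\<close>

lemma oseen_symbol_eq:
  assumes "s > 0"
  shows "oseen_symbol s i j k \<xi> =
    (if i = j then 1 else 0) * (\<i> * of_real (\<xi> $ k) * of_real (exp (- s * (norm \<xi>)\<^sup>2)))
      - (LINT r|lborel. of_real (indicator {s..} r) * gaussian_deriv3 r i j k \<xi>)"
proof (cases "\<xi> = 0")
  case True
  then show ?thesis by (simp add: oseen_symbol_def gaussian_deriv3_def)
next
  case False
  have "(LINT r|lborel. of_real (indicator {s..} r) * gaussian_deriv3 r i j k \<xi>) =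
    (LINT r|lborel. (\<i> * of_real (\<xi> $ i) * of_real (\<xi> $ j) * of_real (\<xi> $ k)) * complex_of_real (indicator {s..} r * exp (- r * (norm \<xi>)\<^sup>2)))"
    by (intro Bochner_Integration.integral_cong refl) (simp add: gaussian_deriv3_def mult_ac)
  also have "\<dots> = (\<i> * of_real (\<xi> $ i) * of_real (\<xi> $ j) * of_real (\<xi> $ k)) * complex_of_real (exp (- s * (norm \<xi>)\<^sup>2) / (norm \<xi>)\<^sup>2)"
    unfolding integral_mult_right_zero integral_complex_of_real
    using has_bochner_integral_exp_tail[of "(norm \<xi>)\<^sup>2" s] False by (simp add: has_bochner_integral_integral_eq)
  finally have e: "(LINT r|lborel. of_real (indicator {s..} r) * gaussian_deriv3 r i j k \<xi>) = \<dots>" .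
  show ?thesis
    unfolding e oseen_symbol_def helmholtz_symbol_def by (simp add: algebra_simps)
qed

lemma gaussian_deriv3_schwartz: "r > 0 \<Longrightarrow> schwartz (gaussian_deriv3 r i j k)"
  unfolding gaussian_deriv3_def[abs_def] by (rule gaussian_deriv_schwartz(2))

text \<open>The cubic prefactor is homogeneous, so the function at r is r^(-3/2) times the function
  at 1 evaluated at sqrt r \<xi>, and the dilation does not change the integral.\<close>

lemma integral_norm_ft_gaussian_deriv3:
  assumes r: "r > 0"
  shows "(LINT x|lborel. norm (ft (gaussian_deriv3 r i j k) x)) =
    r powr (-3/2) * (LINT x|lborel. norm (ft (gaussian_deriv3 1 i j k) x))"
proof -
  have g1: "schwartz (gaussian_deriv3 1 i j k)" by (rule gaussian_deriv3_schwartz) simp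
  have p: "r powr (-3/2) = inverse (sqrt r ^ 3)"
  proof -
    have "sqrt r ^ 3 = r powr (3/2)" using r by (simp add: powr_half_sqrt[symmetric] powr_power)
    then show ?thesis using powr_minus[of r "3/2"] by simp
  qed
  have "gaussian_deriv3 r i j k \<xi> = of_real (r powr (-3/2)) * gaussian_deriv3 1 i j k (sqrt r *\<^sub>R \<xi>)" for \<xi>
  proof -
    have "(norm (sqrt r *\<^sub>R \<xi>))\<^sup>2 = r * (norm \<xi>)\<^sup>2" using r by (simp add: power_mult_distrib)
    then have "gaussian_deriv3 1 i j k (sqrt r *\<^sub>R \<xi>) = of_real (sqrt r ^ 3) * gaussian_deriv3 r i j k \<xi>"
      unfolding gaussian_deriv3_def by (simp only: power3_eq_cube mult_ac vector_scaleR_component of_real_mult minus_mult_left[symmetric] mult_1_left mult_1_right minus_mult_right real_scaleR_def)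
    moreover have "complex_of_real (sqrt r ^ 3) \<noteq> 0" using r by simp
    ultimately show ?thesis unfolding p by simp
  qed
  then have "gaussian_deriv3 r i j k = (\<lambda>\<xi>. of_real (r powr (-3/2)) * gaussian_deriv3 1 i j k (sqrt r *\<^sub>R \<xi>))"
    by (rule ext)
  then have "(LINT x|lborel. norm (ft (gaussian_deriv3 r i j k) x)) =
    r powr (-3/2) * (LINT x|lborel. norm (ft (\<lambda>\<xi>. gaussian_deriv3 1 i j k (sqrt r *\<^sub>R \<xi>)) x))"
    by (simp only: ft_cmult norm_mult integral_mult_right_zero norm_of_real) simp
  then show ?thesis
    using integral_norm_ft_scale[OF schwartz_integrable[OF g1] schwartz_ft_integrable[OF g1], of "sqrt r"] r by simp
qed

lemma integral_norm_ft_gaussian_deriv1: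
  assumes s: "s > 0"
  shows "(LINT x|lborel. norm (ft (\<lambda>\<xi>::real^'n. \<i> * of_real (\<xi> $ k) * of_real (exp (- s * (norm \<xi>)\<^sup>2))) x)) =
    (LINT x|lborel. norm (ft (\<lambda>\<xi>::real^'n. \<i> * of_real (\<xi> $ k) * of_real (exp (- 1 * (norm \<xi>)\<^sup>2))) x)) / sqrt s"
proof -
  define g where "g = (\<lambda>\<xi>::real^'n. \<i> * of_real (\<xi> $ k) * complex_of_real (exp (- 1 * (norm \<xi>)\<^sup>2)))"
  have g: "schwartz g" unfolding g_def by (rule gaussian_deriv_schwartz(1)) simp
  have "\<i> * of_real (\<xi> $ k) * of_real (exp (- s * (norm \<xi>)\<^sup>2)) = of_real (inverse (sqrt s)) * g (sqrt s *\<^sub>R \<xi>)" for \<xi> :: "real^'n"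
  proof -
    have "(norm (sqrt s *\<^sub>R \<xi>))\<^sup>2 = s * (norm \<xi>)\<^sup>2" using s by (simp add: power_mult_distrib)
    then have "of_real (inverse (sqrt s)) * g (sqrt s *\<^sub>R \<xi>) = complex_of_real (inverse (sqrt s) * sqrt s) * (\<i> * of_real (\<xi> $ k) * of_real (exp (- s * (norm \<xi>)\<^sup>2)))"
      by (simp add: g_def mult_ac)
    then show ?thesis using s by simp
  qed
  then have "(LINT x|lborel. norm (ft (\<lambda>\<xi>::real^'n. \<i> * of_real (\<xi> $ k) * of_real (exp (- s * (norm \<xi>)\<^sup>2))) x)) =
    inverse (sqrt s) * (LINT x|lborel. norm (ft (\<lambda>\<xi>. g (sqrt s *\<^sub>R \<xi>)) x))"
    using s by (simp only: ft_cmult norm_mult integral_mult_right_zero norm_of_real) simp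
  then show ?thesis
    using integral_norm_ft_scale[OF schwartz_integrable[OF g] schwartz_ft_integrable[OF g], of "sqrt s"] s
    by (simp add: g_def divide_inverse mult.commute)
qed

text \<open>Fubini in (\<xi>, r). Integrating the modulus in r first gives |\<xi>_i \<xi>_j \<xi>_k|
  exp (- s |\<xi>|^2) / |\<xi>|^2, which is at most |\<xi>| exp (- s |\<xi>|^2) and hence
  integrable.\<close>

lemma ft_oseen_symbol:
  fixes x :: "real^'n"
  assumes s: "s > 0"
  shows "ft (oseen_symbol s i j k) x =
    (if i = j then 1 else 0) * ft (\<lambda>\<xi>. \<i> * of_real (\<xi> $ k) * of_real (exp (- s * (norm \<xi>)\<^sup>2))) x
      - (LINT r|lborel. of_real (indicator {s..} r) * ft (gaussian_deriv3 r i j k) x)"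
proof -
  define h where "h = (\<lambda>(\<xi>::real^'n) r. complex_of_real (indicator {s..} r) * gaussian_deriv3 r i j k \<xi>)"
  have hm[measurable]: "(\<lambda>z. h (fst z) (snd z)) \<in> borel_measurable (borel \<Otimes>\<^sub>M borel)"
    unfolding h_def gaussian_deriv3_def by measurable
  have nh: "norm (h \<xi> r) = \<bar>\<xi> $ i * \<xi> $ j * \<xi> $ k\<bar> * (indicator {s..} r * exp (- r * (norm \<xi>)\<^sup>2))" for \<xi> r
    by (simp add: h_def gaussian_deriv3_def norm_mult abs_mult)
  have I: "integrable (lborel \<Otimes>\<^sub>M lborel) (\<lambda>(\<xi>, r). cis (\<xi> \<bullet> x) * h \<xi> r)"
  proof (rule lborel_pair.Fubini_integrable)
    show "(\<lambda>(\<xi>, r). cis (\<xi> \<bullet> x) * h \<xi> r) \<in> borel_measurable (lborel \<Otimes>\<^sub>M lborel)"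
      using hm by (simp add: split_beta')
    have e: "(LINT r|lborel. norm (case (\<xi>, r) of (\<xi>, r) \<Rightarrow> cis (\<xi> \<bullet> x) * h \<xi> r)) =
      \<bar>\<xi> $ i * \<xi> $ j * \<xi> $ k\<bar> * (exp (- s * (norm \<xi>)\<^sup>2) / (norm \<xi>)\<^sup>2)" if "\<xi> \<noteq> 0" for \<xi>
      using has_bochner_integral_exp_tail[of "(norm \<xi>)\<^sup>2" s] that
      by (simp add: norm_mult nh has_bochner_integral_integral_eq)
    show "integrable lborel (\<lambda>\<xi>. LINT r|lborel. norm (case (\<xi>, r) of (\<xi>, r) \<Rightarrow> cis (\<xi> \<bullet> x) * h \<xi> r))"
    proof (rule Bochner_Integration.integrable_bound[OF integrable_norm_gaussian[OF s]])
      show "AE \<xi> in lborel. norm (LINT r|lborel. norm (case (\<xi>, r) of (\<xi>, r) \<Rightarrow> cis (\<xi> \<bullet> x) * h \<xi> r)) \<le> norm (norm \<xi> * exp (- s * (norm \<xi>)\<^sup>2))"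
        using AE_lborel_singleton[of "0::real^'n"]
      proof eventually_elim
        case (elim \<xi>)
        have "\<bar>\<xi> $ i * \<xi> $ j * \<xi> $ k\<bar> \<le> norm \<xi> * norm \<xi> * norm \<xi>"
          unfolding abs_mult by (intro mult_mono component_le_norm_cart) auto
        then have "\<bar>\<xi> $ i * \<xi> $ j * \<xi> $ k\<bar> * (exp (- s * (norm \<xi>)\<^sup>2) / (norm \<xi>)\<^sup>2) \<le> norm \<xi> * norm \<xi> * norm \<xi> * (exp (- s * (norm \<xi>)\<^sup>2) / (norm \<xi>)\<^sup>2)"
          by (intro mult_right_mono) auto
        also have "\<dots> = norm \<xi> * exp (- s * (norm \<xi>)\<^sup>2)" using elim by (simp add: power2_eq_square)
        finally show ?case unfolding e[OF elim] by (simp add: abs_mult)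
      qed
    qed (use hm in \<open>simp add: split_beta'\<close>)
    show "AE \<xi> in lborel. integrable lborel (\<lambda>r. case (\<xi>, r) of (\<xi>, r) \<Rightarrow> cis (\<xi> \<bullet> x) * h \<xi> r)"
      using AE_lborel_singleton[of "0::real^'n"]
    proof eventually_elim
      case (elim \<xi>)
      have "integrable lborel (\<lambda>r. norm (h \<xi> r))"
        unfolding nh using has_bochner_integral_exp_tail[of "(norm \<xi>)\<^sup>2" s] elim by (auto simp: has_bochner_integral_iff)
      then show ?case
        by (rule Bochner_Integration.integrable_bound) (auto simp: norm_mult h_def gaussian_deriv3_def)
    qed
  qed
  have i2: "integrable lborel (\<lambda>\<xi>. LINT r|lborel. cis (\<xi> \<bullet> x) * h \<xi> r)" by (rule lborel_pair.integrable_fst[OF I])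
  have "(LINT r|lborel. of_real (indicator {s..} r) * ft (gaussian_deriv3 r i j k) x) = (LINT r|lborel. LINT \<xi>|lborel. cis (\<xi> \<bullet> x) * h \<xi> r)"
  proof (intro Bochner_Integration.integral_cong refl)
    fix r
    show "of_real (indicator {s..} r) * ft (gaussian_deriv3 r i j k) x = (LINT \<xi>|lborel. cis (\<xi> \<bullet> x) * h \<xi> r)"
      unfolding ft_def h_def integral_mult_right_zero[symmetric] by (simp add: mult_ac)
  qed
  also have "\<dots> = (LINT \<xi>|lborel. LINT r|lborel. cis (\<xi> \<bullet> x) * h \<xi> r)" by (rule lborel_pair.Fubini_integral[OF I])
  finally have 1: "(LINT r|lborel. of_real (indicator {s..} r) * ft (gaussian_deriv3 r i j k) x) = (LINT \<xi>|lborel. LINT r|lborel. cis (\<xi> \<bullet> x) * h \<xi> r)" .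
  define d where "d = (if i = j then 1 else 0 :: complex)"
  define g where "g = (\<lambda>\<xi>::real^'n. \<i> * of_real (\<xi> $ k) * complex_of_real (exp (- s * (norm \<xi>)\<^sup>2)))"
  have g: "integrable lborel g" unfolding g_def by (rule schwartz_integrable[OF gaussian_deriv_schwartz(1)[OF s]])
  have "ft (oseen_symbol s i j k) x = (LINT \<xi>|lborel. d * (cis (\<xi> \<bullet> x) * g \<xi>) - (LINT r|lborel. cis (\<xi> \<bullet> x) * h \<xi> r))"
    unfolding ft_def
  proof (intro Bochner_Integration.integral_cong refl)
    fix \<xi> :: "real^'n"
    show "cis (\<xi> \<bullet> x) * oseen_symbol s i j k \<xi> = d * (cis (\<xi> \<bullet> x) * g \<xi>) - (LINT r|lborel. cis (\<xi> \<bullet> x) * h \<xi> r)"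
      unfolding oseen_symbol_eq[OF s] d_def g_def h_def integral_mult_right_zero by (simp add: algebra_simps)
  qed
  also have "\<dots> = d * ft g x - (LINT \<xi>|lborel. LINT r|lborel. cis (\<xi> \<bullet> x) * h \<xi> r)"
    using integrable_cis_mult[OF g] i2 by (subst Bochner_Integration.integral_diff) (auto simp: ft_def)
  finally show ?thesis unfolding 1 d_def g_def .
qed

text \<open>Both parts of the decomposition scale like s^(-1/2): the first Gaussian derivative
  directly, the third derivatives after integration of r^(-3/2) over r \<ge> s. Thus a kernel with
  slowly decaying tail is estimated through Gaussians only, with one constant for all s and all
  indices.\<close>

lemma ft_oseen_symbol_L1:
  obtains C where "C > 0"
    "\<And>s i j (k::'n::finite). s > 0 \<Longrightarrow> integrable lborel (ft (oseen_symbol s i j k))"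
    "\<And>s i j (k::'n). s > 0 \<Longrightarrow> (LINT x|lborel. norm (ft (oseen_symbol s i j k) x)) \<le> C / sqrt s"
proof -
  define C1 where "C1 k = (LINT x|lborel. norm (ft (\<lambda>\<xi>::real^'n. \<i> * of_real (\<xi> $ k) * of_real (exp (- 1 * (norm \<xi>)\<^sup>2))) x))" for k :: 'n
  define C3 where "C3 i j k = (LINT x|lborel. norm (ft (gaussian_deriv3 1 i j k) x))" for i j k :: 'n
  have C0: "C1 k \<ge> 0" "C3 i j k \<ge> 0" for i j k by (auto simp: C1_def C3_def)
  define C where "C = 1 + (\<Sum>k\<in>UNIV. C1 k) + 2 * (\<Sum>i\<in>UNIV. \<Sum>j\<in>UNIV. \<Sum>k\<in>UNIV. C3 i j k)"
  have "C > 0" unfolding C_def by (intro add_pos_nonneg mult_nonneg_nonneg sum_nonneg C0) auto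
  have Cle: "C1 k + 2 * C3 i j k \<le> C" for i j k
  proof -
    have "C1 k \<le> (\<Sum>k\<in>UNIV. C1 k)" by (intro member_le_sum C0) auto
    moreover have "C3 i j k \<le> (\<Sum>k\<in>UNIV. C3 i j k)" by (intro member_le_sum C0) auto
    moreover have "(\<Sum>k\<in>UNIV. C3 i j k) \<le> (\<Sum>j\<in>UNIV. \<Sum>k\<in>UNIV. C3 i j k)" by (rule member_le_sum[of j UNIV "\<lambda>j. \<Sum>k\<in>UNIV. C3 i j k"]) (auto intro!: sum_nonneg C0)
    moreover have "(\<Sum>j\<in>UNIV. \<Sum>k\<in>UNIV. C3 i j k) \<le> (\<Sum>i\<in>UNIV. \<Sum>j\<in>UNIV. \<Sum>k\<in>UNIV. C3 i j k)" by (rule member_le_sum[of i UNIV "\<lambda>i. \<Sum>j\<in>UNIV. \<Sum>k\<in>UNIV. C3 i j k"]) (auto intro!: sum_nonneg C0)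
    ultimately show ?thesis unfolding C_def by linarith
  qed
  have main: "integrable lborel (ft (oseen_symbol s i j k)) \<and> (LINT x|lborel. norm (ft (oseen_symbol s i j k) x)) \<le> C / sqrt s"
    if s: "s > 0" for s and i j k :: 'n
  proof -
    define d where "d = (if i = j then 1 else 0 :: complex)"
    have d: "norm d \<le> 1" by (simp add: d_def)
    define a where "a = ft (\<lambda>\<xi>::real^'n. \<i> * of_real (\<xi> $ k) * complex_of_real (exp (- s * (norm \<xi>)\<^sup>2)))"
    have a: "integrable lborel a" unfolding a_def by (rule schwartz_ft_integrable[OF gaussian_deriv_schwartz(1)[OF s]])
    define g where "g = (\<lambda>r x. complex_of_real (indicator {s..} r) * ft (gaussian_deriv3 r i j k) x)"
    have gm[measurable]: "(\<lambda>z. g (fst z) (snd z)) \<in> borel_measurable (borel \<Otimes>\<^sub>M borel)"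
      unfolding g_def ft_def gaussian_deriv3_def by measurable
    have ng: "(LINT x|lborel. norm (g r x)) = C3 i j k * (indicator {s..} r * r powr (-3/2))" for r
    proof (cases "r \<ge> s")
      case True
      then have "r > 0" using s by simp
      have "(LINT x|lborel. norm (g r x)) = (LINT x|lborel. norm (ft (gaussian_deriv3 r i j k) x))"
        using True by (simp add: g_def)
      also have "\<dots> = r powr (-3/2) * C3 i j k" unfolding C3_def by (rule integral_norm_ft_gaussian_deriv3[OF \<open>r > 0\<close>])
      finally show ?thesis using True by simp
    qed (simp add: g_def)
    have gi: "integrable lborel (g r)" for r
    proof (cases "r \<ge> s")
      case True
      then have "r > 0" using s by simp
      then show ?thesis unfolding g_def 
        by (intro integrable_mult_right schwartz_ft_integrable[OF gaussian_deriv3_schwartz])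
    qed (simp add: g_def)
    note pt = has_bochner_integral_powr_tail[OF s]
    have I: "integrable (lborel \<Otimes>\<^sub>M lborel) (\<lambda>(r, x). g r x)"
    proof (rule lborel_pair.Fubini_integrable)
      show "(\<lambda>(r, x). g r x) \<in> borel_measurable (lborel \<Otimes>\<^sub>M lborel)" using gm by (simp add: split_beta')
      show "integrable lborel (\<lambda>r. LINT x|lborel. norm (case (r, x) of (r, x) \<Rightarrow> g r x))"
        using pt by (simp add: ng has_bochner_integral_iff)
      show "AE r in lborel. integrable lborel (\<lambda>x. case (r, x) of (r, x) \<Rightarrow> g r x)" using gi by simp
    qed
    note bi = lborel_pair.integrable_snd[OF I]
    have In: "integrable (lborel \<Otimes>\<^sub>M lborel) (\<lambda>(r, x). norm (g r x))" using integrable_norm[OF I] by (simp add: split_beta')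
    have eq: "ft (oseen_symbol s i j k) x = d * a x - (LINT r|lborel. g r x)" for x
      unfolding ft_oseen_symbol[OF s] d_def a_def g_def ..
    have eq': "ft (oseen_symbol s i j k) = (\<lambda>x. d * a x - (LINT r|lborel. g r x))" by (rule ext) (rule eq)
    have i: "integrable lborel (ft (oseen_symbol s i j k))" unfolding eq' using a bi by simp
    have "(LINT x|lborel. norm (ft (oseen_symbol s i j k) x)) \<le> (LINT x|lborel. norm (a x) + (LINT r|lborel. norm (g r x)))"
    proof (rule integral_mono[OF integrable_norm[OF i]])
      show "integrable lborel (\<lambda>x. norm (a x) + (LINT r|lborel. norm (g r x)))"
        using a lborel_pair.integrable_snd[OF In] by simp
      fix x
      have "norm (d * a x) \<le> norm (a x)" using d mult_right_mono[OF d, of "norm (a x)"] by (simp add: norm_mult)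
      moreover have "norm (LINT r|lborel. g r x) \<le> (LINT r|lborel. norm (g r x))" by (rule integral_norm_bound)
      ultimately show "norm (ft (oseen_symbol s i j k) x) \<le> norm (a x) + (LINT r|lborel. norm (g r x))"
        unfolding eq using norm_triangle_ineq4[of "d * a x" "LINT r|lborel. g r x"] by linarith
    qed
    also have "\<dots> = (LINT x|lborel. norm (a x)) + (LINT x|lborel. (LINT r|lborel. norm (g r x)))"
      using a lborel_pair.integrable_snd[OF In] by simp
    also have "(LINT x|lborel. (LINT r|lborel. norm (g r x))) = (LINT r|lborel. (LINT x|lborel. norm (g r x)))"
      by (rule lborel_pair.Fubini_integral[OF In])
    also have "\<dots> = C3 i j k * (2 / sqrt s)" unfolding ng using pt by (simp add: has_bochner_integral_iff)
    also have "(LINT x|lborel. norm (a x)) = C1 k / sqrt s"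
      unfolding a_def C1_def by (rule integral_norm_ft_gaussian_deriv1[OF s])
    also have "C1 k / sqrt s + C3 i j k * (2 / sqrt s) = (C1 k + 2 * C3 i j k) / sqrt s" by (simp add: add_divide_distrib)
    also have "\<dots> \<le> C / sqrt s" using Cle s by (intro divide_right_mono) auto
    finally show ?thesis using i by blast
  qed
  show thesis by (rule that[OF \<open>C > 0\<close>]) (use main in blast)+
qed

lemma oseen_kernel_eq:
  fixes x :: "real^'n"
  assumes s: "s > 0"
  shows "complex_of_real (oseen_kernel s i j k x) = ft (oseen_symbol s i j k) x / of_real ((2 * pi) ^ CARD('n))"
proof -
  have "(\<lambda>\<xi>. cnj (oseen_symbol s i j k (- \<xi>))) = oseen_symbol s i j k"
    by (rule ext) (simp add: oseen_symbol_def helmholtz_symbol_def)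
  then have "cnj (ft (oseen_symbol s i j k) x) = ft (oseen_symbol s i j k) x"
    by (simp only: cnj_ft[OF oseen_symbol_integrable[OF s]])
  then have R: "ft (oseen_symbol s i j k) x \<in> \<real>" by (simp add: Reals_cnj_iff)
  have "inv_fourier (\<lambda>\<xi>. of_real (exp (- s * (norm \<xi>)\<^sup>2) * helmholtz_symbol i j \<xi>) * (\<i> * of_real (\<xi> $ k))) x =
    ft (oseen_symbol s i j k) x / of_real ((2 * pi) ^ CARD('n))"
    unfolding inv_fourier_def ft_def oseen_symbol_def by (simp add: inner_commute)
  then show ?thesis unfolding oseen_kernel_def using R
    by (metis Reals_divide Reals_of_real of_real_Re)
qed

lemma oseen_kernel_L1:
  obtains C where "C > 0"
    "\<And>s i j (k::'n::finite). s > 0 \<Longrightarrow> integrable lborel (oseen_kernel s i j k)"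
    "\<And>s i j (k::'n). s > 0 \<Longrightarrow> (LINT x|lborel. \<bar>oseen_kernel s i j k x\<bar>) \<le> C / sqrt s"
proof -
  obtain C where C: "C > 0" "\<And>s i j (k::'n). s > 0 \<Longrightarrow> integrable lborel (ft (oseen_symbol s i j k))"
    "\<And>s i j (k::'n). s > 0 \<Longrightarrow> (LINT x|lborel. norm (ft (oseen_symbol s i j k) x)) \<le> C / sqrt s"
    using ft_oseen_symbol_L1 by blast
  have i: "integrable lborel (oseen_kernel s i j k)" if "s > 0" for s and i j k :: 'n
  proof -
    have "integrable lborel (\<lambda>x. complex_of_real (oseen_kernel s i j k x))"
      unfolding oseen_kernel_eq[OF that] using C(2)[OF that] by simp
    then show ?thesis by (simp only: complex_of_real_integrable_eq)
  qed
  show thesis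
  proof (rule that[OF C(1) i])
    fix s :: real and i j k :: 'n assume s: "s > 0"
    have p: "(2 * pi) ^ CARD('n) \<ge> (1::real)" using pi_ge_two by (intro one_le_power) linarith
    have "\<bar>oseen_kernel s i j k x\<bar> \<le> norm (ft (oseen_symbol s i j k) x)" for x
    proof -
      have "\<bar>oseen_kernel s i j k x\<bar> = norm (ft (oseen_symbol s i j k) x) / (2 * pi) ^ CARD('n)"
        using oseen_kernel_eq[OF s, of i j k x] by (metis norm_divide norm_of_real abs_of_nonneg order_trans[OF zero_le_one p])
      also have "\<dots> \<le> norm (ft (oseen_symbol s i j k) x)" using p by (simp add: divide_le_eq mult_left_mono[of 1] mult_le_cancel_left1 order_less_le_trans[OF zero_less_one])
      finally show ?thesis .
    qed
    then show "(LINT x|lborel. \<bar>oseen_kernel s i j k x\<bar>) \<le> C / sqrt s"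
      by (intro order_trans[OF integral_mono C(3)[OF s]]) (use i[OF s] C(2)[OF s] in auto)
  qed auto
qed

lemma oseen_kernel_ft:
  fixes \<xi> :: "real^'n"
  assumes s: "s > 0"
  shows "(LINT y|lborel. complex_of_real (oseen_kernel s i j k y) * cis (- \<xi> \<bullet> y)) = oseen_symbol s i j k \<xi>"
proof -
  define c where "c = complex_of_real ((2 * pi) ^ CARD('n))"
  have c: "c \<noteq> 0" by (simp add: c_def)
  obtain C where C: "integrable lborel (ft (oseen_symbol s i j k))" using ft_oseen_symbol_L1 s by metis
  have "(LINT y|lborel. complex_of_real (oseen_kernel s i j k y) * cis (- \<xi> \<bullet> y)) = (LINT y|lborel. cis (y \<bullet> - \<xi>) * ft (oseen_symbol s i j k) y / c)"
    unfolding oseen_kernel_eq[OF s] c_def by (simp add: inner_commute mult.commute)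
  also have "\<dots> = ft (ft (oseen_symbol s i j k)) (- \<xi>) / c" by (simp add: ft_def)
  also have "\<dots> = oseen_symbol s i j k \<xi>"
    using c by (subst fourier_inversion[OF oseen_symbol_integrable[OF s] C oseen_symbol_bounded[OF s] oseen_symbol_isCont[OF s]]) (simp add: c_def)
  finally show ?thesis .
qed

lemma oseen_kernel_measurable [measurable]:
  "(\<lambda>z. oseen_kernel (fst z) i j k (snd z)) \<in> borel_measurable (borel \<Otimes>\<^sub>M borel)"
  unfolding oseen_kernel_def inv_fourier_def helmholtz_symbol_def by measurable

lemma vec_lambda_measurable [measurable (raw)]:
  fixes f :: "'a \<Rightarrow> 'n::finite \<Rightarrow> 'b::euclidean_space"
  assumes "\<And>i. (\<lambda>x. f x i) \<in> borel_measurable M"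
  shows "(\<lambda>x. \<chi> i. f x i) \<in> borel_measurable M"
  by (subst borel_measurable_euclidean_space) (use assms in \<open>auto simp: Basis_vec_def inner_axis\<close>)

lemma oseen_kernel_measurable' [measurable (raw)]:
  assumes "f \<in> borel_measurable M" "g \<in> borel_measurable M"
  shows "(\<lambda>z. oseen_kernel (f z) i j k (g z)) \<in> borel_measurable M"
  using measurable_compose[OF measurable_Pair[OF assms] oseen_kernel_measurable] by simp

text \<open>Fixed by choice, so that later constants can be defined from it; it depends on the
  dimension type alone.\<close>

definition oseen_const :: "'n::finite itself \<Rightarrow> real" where
  "oseen_const _ = (SOME C. C > 0 \<and> (\<forall>s>0. \<forall>i j (k::'n). integrable lborel (oseen_kernel s i j k) \<and>
     (LINT x|lborel. \<bar>oseen_kernel s i j k x\<bar>) \<le> C / sqrt s))"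

lemma oseen_const:
  shows oseen_const_pos: "oseen_const TYPE('n::finite) > 0"
    and oseen_kernel_integrable: "s > 0 \<Longrightarrow> integrable lborel (oseen_kernel s i j (k::'n))"
    and integral_oseen_kernel_le: "s > 0 \<Longrightarrow> (LINT x|lborel. \<bar>oseen_kernel s i j (k::'n) x\<bar>) \<le> oseen_const TYPE('n) / sqrt s"
proof -
  have "\<exists>C. C > 0 \<and> (\<forall>s>0. \<forall>i j (k::'n). integrable lborel (oseen_kernel s i j k) \<and>
     (LINT x|lborel. \<bar>oseen_kernel s i j k x\<bar>) \<le> C / sqrt s)"
    using oseen_kernel_L1[where 'n='n] by metis
  then have *: "oseen_const TYPE('n) > 0 \<and> (\<forall>s>0. \<forall>i j (k::'n). integrable lborel (oseen_kernel s i j k) \<and>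
     (LINT x|lborel. \<bar>oseen_kernel s i j k x\<bar>) \<le> oseen_const TYPE('n) / sqrt s)"
    unfolding oseen_const_def by (rule someI_ex)
  show "oseen_const TYPE('n::finite) > 0"
    and "s > 0 \<Longrightarrow> integrable lborel (oseen_kernel s i j (k::'n))"
    and "s > 0 \<Longrightarrow> (LINT x|lborel. \<bar>oseen_kernel s i j (k::'n) x\<bar>) \<le> oseen_const TYPE('n) / sqrt s"
    using * by blast+
qed

text \<open>The bound on f is required almost everywhere, because differences of a mild solution and
  an explicit field are controlled only up to null sets.\<close>

lemma
  fixes f :: "real^'n \<Rightarrow> real"
  assumes s: "s > 0" and f[measurable]: "f \<in> borel_measurable borel" and B: "AE y in lborel. \<bar>f y\<bar> \<le> B"
  shows integrable_oseen_conv: "integrable lborel (\<lambda>y. oseen_kernel s i j k (x - y) * f y)"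
    and abs_oseen_conv_le: "\<bar>LINT y|lborel. oseen_kernel s i j k (x - y) * f y\<bar> \<le> B * oseen_const TYPE('n) / sqrt s"
proof -
  note K = oseen_kernel_integrable[OF s, of i j k]
  note K1 = integrable_lborel_reflect[OF integrable_abs[OF K], of x]
  have b: "AE y in lborel. norm (oseen_kernel s i j k (x - y) * f y) \<le> B * \<bar>oseen_kernel s i j k (x - y)\<bar>"
    using B by eventually_elim (simp add: abs_mult mult.commute mult_right_mono)
  have i2: "integrable lborel (\<lambda>y. B * \<bar>oseen_kernel s i j k (x - y)\<bar>)" using K1 by simp
  show i1: "integrable lborel (\<lambda>y. oseen_kernel s i j k (x - y) * f y)"
    by (rule Bochner_Integration.integrable_bound[OF i2]) (use b in \<open>auto elim: eventually_mono\<close>)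
  have B0: "B \<ge> 0"
  proof (rule ccontr)
    assume "\<not> B \<ge> 0"
    then have "AE y::real^'n in lborel. False" using B by (auto elim!: eventually_mono)
    then show False by (simp add: AE_iff_measurable[OF _ refl])
  qed
  have "\<bar>LINT y|lborel. oseen_kernel s i j k (x - y) * f y\<bar> \<le> (LINT y|lborel. norm (oseen_kernel s i j k (x - y) * f y))"
    using integral_norm_bound[of lborel "\<lambda>y. oseen_kernel s i j k (x - y) * f y"] by simp
  also have "\<dots> \<le> (LINT y|lborel. B * \<bar>oseen_kernel s i j k (x - y)\<bar>)"
    by (rule integral_mono_AE[OF integrable_norm[OF i1] i2 b])
  also have "\<dots> = B * (LINT y|lborel. \<bar>oseen_kernel s i j k y\<bar>)"
    using integral_lborel_reflect[OF integrable_abs[OF K], of x] by simp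
  also have "\<dots> \<le> B * (oseen_const TYPE('n) / sqrt s)" by (intro mult_left_mono integral_oseen_kernel_le s B0)
  finally show "\<bar>LINT y|lborel. oseen_kernel s i j k (x - y) * f y\<bar> \<le> B * oseen_const TYPE('n) / sqrt s" by simp
qed

text \<open>Two factors n come from the double sum in each component, the third from estimating the
  norm by the sum of the components.\<close>

definition heat_P_div_const :: "'n::finite itself \<Rightarrow> real" where
  "heat_P_div_const _ = real CARD('n) ^ 3 * oseen_const TYPE('n)"

lemma heat_P_div_const_pos: "heat_P_div_const TYPE('n::finite) > 0"
  using oseen_const_pos[where 'n='n] by (simp add: heat_P_div_const_def)

lemma abs_sum_le_card: "(\<And>i. \<bar>f i\<bar> \<le> (B::real)) \<Longrightarrow> \<bar>\<Sum>i\<in>(UNIV::'n::finite set). f i\<bar> \<le> real CARD('n) * B"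
  by (rule order_trans[OF sum_abs order_trans[OF sum_bounded_above[of UNIV _ B]]]) auto

lemma norm_heat_P_div_le:
  fixes F :: "real^'n \<Rightarrow> real^'n^'n"
  assumes s: "s > 0" and F[measurable]: "\<And>j k. (\<lambda>y. F y $ j $ k) \<in> borel_measurable borel"
    and B: "\<And>j k. AE y in lborel. \<bar>F y $ j $ k\<bar> \<le> B"
  shows "norm (heat_P_div s F x) \<le> heat_P_div_const TYPE('n) * B / sqrt s"
proof -
  have "\<bar>heat_P_div s F x $ i\<bar> \<le> real CARD('n) * (real CARD('n) * (B * oseen_const TYPE('n) / sqrt s))" for i
    unfolding heat_P_div_def by (simp only: vec_lambda_beta) (intro abs_sum_le_card abs_oseen_conv_le s F B)
  then have "(\<Sum>i\<in>UNIV. \<bar>heat_P_div s F x $ i\<bar>) \<le> real CARD('n) * (real CARD('n) * (real CARD('n) * (B * oseen_const TYPE('n) / sqrt s)))"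
    by (rule order_trans[OF sum_bounded_above]) auto
  then show ?thesis
    using norm_le_l1_cart[of "heat_P_div s F x"] by (simp add: heat_P_div_const_def power3_eq_cube mult_ac)
qed

lemma heat_P_div_diff:
  fixes F G :: "real^'n \<Rightarrow> real^'n^'n"
  assumes s: "s > 0" and F[measurable]: "\<And>j k. (\<lambda>y. F y $ j $ k) \<in> borel_measurable borel"
    and G[measurable]: "\<And>j k. (\<lambda>y. G y $ j $ k) \<in> borel_measurable borel"
    and B: "\<And>j k. AE y in lborel. \<bar>F y $ j $ k\<bar> \<le> B" "\<And>j k. AE y in lborel. \<bar>G y $ j $ k\<bar> \<le> B'"
  shows "heat_P_div s F x - heat_P_div s G x = heat_P_div s (\<lambda>y. F y - G y) x"
  unfolding heat_P_div_def vec_eq_iff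
  by (simp add: sum_subtractf[symmetric] right_diff_distrib
     Bochner_Integration.integral_diff[OF integrable_oseen_conv[OF s F B(1)] integrable_oseen_conv[OF s G B(2)]])

lemma heat_P_div_measurable:
  fixes F :: "real \<Rightarrow> real^'n \<Rightarrow> real^'n^'n"
  assumes [measurable]: "\<And>j k. (\<lambda>z. F (fst z) (snd z) $ j $ k) \<in> borel_measurable (borel \<Otimes>\<^sub>M borel)"
    and [measurable]: "f \<in> borel_measurable M" "g \<in> borel_measurable M" "h \<in> borel_measurable M"
  shows "(\<lambda>z. heat_P_div (f z) (F (g z)) (h z)) \<in> borel_measurable M"
proof -
  have [measurable]: "(\<lambda>z. F (g' z) (h' z) $ j $ k) \<in> borel_measurable N"
    if "g' \<in> borel_measurable N" "h' \<in> borel_measurable N" for N :: "'z measure" and g' h' j k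
    using measurable_compose[OF measurable_Pair[OF that] assms(1)[of j k]] by simp
  have "(\<lambda>z. F (g (fst z)) (snd z) $ j $ k) \<in> borel_measurable (M \<Otimes>\<^sub>M lborel)" for j k
  proof -
    have "(\<lambda>z. (g (fst z), snd z)) \<in> measurable (M \<Otimes>\<^sub>M lborel) (borel \<Otimes>\<^sub>M borel)" by measurable
    from measurable_compose[OF this assms(1)[of j k]] show ?thesis by simp
  qed
  then have [measurable]: "(\<lambda>(z, y). F (g z) y $ j $ k) \<in> borel_measurable (M \<Otimes>\<^sub>M lborel)" for j k
    by (simp add: split_beta')
  show ?thesis unfolding heat_P_div_def by measurable
qed

section \<open>Singular time integrals and differences of tensors\<close>

lemma has_bochner_integral_inverse_sqrt:
  fixes s :: real
  assumes s: "s \<ge> 0"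
  shows "has_bochner_integral lborel (\<lambda>\<tau>. indicator {0<..<s} \<tau> / sqrt \<tau>) (2 * sqrt s)"
proof (rule has_bochner_integral_nn_integral)
  have "((\<lambda>\<tau>. \<tau> powr (-1/2)) has_integral s powr (-1/2 + 1) / (-1/2 + 1)) {0..s}"
    by (rule has_integral_powr_from_0) (use s in auto)
  then have hi: "((\<lambda>\<tau>. \<tau> powr (-1/2)) has_integral 2 * sqrt s) {0..s}"
    using s by (simp add: powr_half_sqrt mult.commute)
  have "(\<integral>\<^sup>+\<tau>. ennreal (indicator {0..s} \<tau> * \<tau> powr (-1/2)) \<partial>lborel) = ennreal (2 * sqrt s)"
    using nn_integral_has_integral_lebesgue[OF _ hi] by simp
  moreover have "(\<integral>\<^sup>+\<tau>. ennreal (indicator {0<..<s} \<tau> / sqrt \<tau>) \<partial>lborel) = (\<integral>\<^sup>+\<tau>. ennreal (indicator {0..s} \<tau> * \<tau> powr (-1/2)) \<partial>lborel)"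
  proof (rule nn_integral_cong_AE)
    show "AE \<tau> in lborel. ennreal (indicator {0<..<s} \<tau> / sqrt \<tau>) = ennreal (indicator {0..s} \<tau> * \<tau> powr (-1/2))"
      using AE_lborel_singleton[of 0] AE_lborel_singleton[of s]
      by eventually_elim (auto simp: indicator_def powr_minus_divide powr_half_sqrt)
  qed
  ultimately show "(\<integral>\<^sup>+\<tau>. ennreal (indicator {0<..<s} \<tau> / sqrt \<tau>) \<partial>lborel) = ennreal (2 * sqrt s)" by simp
qed (use s in \<open>auto simp: indicator_def\<close>)

lemma has_bochner_integral_inverse_sqrt_reflect:
  fixes a s :: real
  assumes "a \<le> s"
  shows "has_bochner_integral lborel (\<lambda>\<tau>. indicator {a<..<s} \<tau> / sqrt (s - \<tau>)) (2 * sqrt (s - a))"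
proof -
  have h: "has_bochner_integral lborel (\<lambda>\<tau>. indicator {0<..<s-a} \<tau> / sqrt \<tau>) (2 * sqrt (s - a))"
    by (rule has_bochner_integral_inverse_sqrt) (use assms in simp)
  then have i: "integrable lborel (\<lambda>\<tau>. indicator {0<..<s-a} \<tau> / sqrt \<tau>)" by (simp add: has_bochner_integral_iff)
  have e: "indicator {0<..<s-a} (s - \<tau>) / sqrt (s - \<tau>) = (indicator {a<..<s} \<tau> / sqrt (s - \<tau>) :: real)" for \<tau>
    by (auto simp: indicator_def)
  show ?thesis
    using integrable_lborel_reflect[OF i, of s] integral_lborel_reflect[OF i, of s] h
    unfolding e by (simp add: has_bochner_integral_iff)
qed

text \<open>From sqrt s \<le> 2 (sqrt \<tau> + sqrt (s - \<tau>)) the two singularities separate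
  into integrable ones. The point is that the bound does not depend on s: by scaling, a kernel of
  size (s - \<tau>)^(-1/2) against a field of size \<tau>^(-1/2) costs only a constant. The exact
  value is \<pi>.\<close>

lemma beta_integral:
  fixes s :: real
  assumes s: "s > 0"
  shows "integrable lborel (\<lambda>\<tau>. indicator {0<..<s} \<tau> / (sqrt (s - \<tau>) * sqrt \<tau>))"
    and "(LINT \<tau>|lborel. indicator {0<..<s} \<tau> / (sqrt (s - \<tau>) * sqrt \<tau>)) \<le> 8"
proof -
  have h1: "has_bochner_integral lborel (\<lambda>\<tau>. indicator {0<..<s} \<tau> / sqrt \<tau>) (2 * sqrt s)"
    by (rule has_bochner_integral_inverse_sqrt) (use s in simp)
  have h2: "has_bochner_integral lborel (\<lambda>\<tau>. indicator {0<..<s} \<tau> / sqrt (s - \<tau>)) (2 * sqrt s)"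
    using has_bochner_integral_inverse_sqrt_reflect[of 0 s] s by simp
  have h: "has_bochner_integral lborel (\<lambda>\<tau>. 2 / sqrt s * (indicator {0<..<s} \<tau> / sqrt \<tau> + indicator {0<..<s} \<tau> / sqrt (s - \<tau>))) (2 / sqrt s * (2 * sqrt s + 2 * sqrt s))"
    by (intro has_bochner_integral_mult_right has_bochner_integral_add h1 h2)
  have v: "2 / sqrt s * (2 * sqrt s + 2 * sqrt s) = 8" using s by simp
  have b: "norm (indicator {0<..<s} \<tau> / (sqrt (s - \<tau>) * sqrt \<tau>)) \<le> 2 / sqrt s * (indicator {0<..<s} \<tau> / sqrt \<tau> + indicator {0<..<s} \<tau> / sqrt (s - \<tau>) :: real)" for \<tau>
  proof (cases "\<tau> \<in> {0<..<s}")
    case True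
    then have t: "0 < \<tau>" "\<tau> < s" by auto
    have "sqrt s \<le> 2 * (sqrt \<tau> + sqrt (s - \<tau>))"
    proof -
      have "sqrt (\<tau> + (s - \<tau>)) \<le> sqrt \<tau> + sqrt (s - \<tau>)" using t by (intro sqrt_add_le_add_sqrt) auto
      moreover have "0 \<le> sqrt \<tau> + sqrt (s - \<tau>)" using t by simp
      ultimately show ?thesis by simp
    qed
    then have "1 / (sqrt (s - \<tau>) * sqrt \<tau>) \<le> (2 * (sqrt \<tau> + sqrt (s - \<tau>)) / sqrt s) / (sqrt (s - \<tau>) * sqrt \<tau>)"
      using t s by (intro divide_right_mono) auto
    also have "\<dots> = 2 / sqrt s * (1 / sqrt \<tau> + 1 / sqrt (s - \<tau>))" using t s by (simp add: field_simps)
    finally show ?thesis using True by simp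
  qed simp
  show i: "integrable lborel (\<lambda>\<tau>. indicator {0<..<s} \<tau> / (sqrt (s - \<tau>) * sqrt \<tau>))"
  proof (rule Bochner_Integration.integrable_bound)
    show "integrable lborel (\<lambda>\<tau>. 2 / sqrt s * (indicator {0<..<s} \<tau> / sqrt \<tau> + indicator {0<..<s} \<tau> / sqrt (s - \<tau>)))"
      using h by (simp only: has_bochner_integral_iff)
    show "AE \<tau> in lborel. norm (indicator {0<..<s} \<tau> / (sqrt (s - \<tau>) * sqrt \<tau>)) \<le> norm (2 / sqrt s * (indicator {0<..<s} \<tau> / sqrt \<tau> + indicator {0<..<s} \<tau> / sqrt (s - \<tau>)))"
      unfolding real_norm_def[of "2 / sqrt s * _"] by (intro AE_I2 order_trans[OF b abs_ge_self])
  qed measurable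
  have "(LINT \<tau>|lborel. indicator {0<..<s} \<tau> / (sqrt (s - \<tau>) * sqrt \<tau>)) \<le>
     (LINT \<tau>|lborel. 2 / sqrt s * (indicator {0<..<s} \<tau> / sqrt \<tau> + indicator {0<..<s} \<tau> / sqrt (s - \<tau>)))"
    by (rule integral_mono[OF i]) (use h b in \<open>auto simp: has_bochner_integral_iff intro: order_trans[OF abs_ge_self]\<close>)
  also have "\<dots> = 8" using h v by (simp only: has_bochner_integral_iff)
  finally show "(LINT \<tau>|lborel. indicator {0<..<s} \<tau> / (sqrt (s - \<tau>) * sqrt \<tau>)) \<le> 8" .
qed

lemma tensor_component: "tensor a b $ j $ k = a $ j * b $ k"
  by (simp add: tensor_def)

lemma abs_tensor_le: "norm a \<le> A \<Longrightarrow> norm b \<le> B \<Longrightarrow> \<bar>tensor a b $ j $ k\<bar> \<le> A * B"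
  unfolding tensor_component abs_mult
  by (intro mult_mono order_trans[OF component_le_norm_cart]) (auto intro: order_trans[OF norm_ge_zero])

text \<open>Expanded around b, so that only |b| and |a - b| occur. With b the explicit field and a
  the solution, the unknown size of the solution stays out of the estimate.\<close>

lemma abs_tensor_diff_le:
  "\<bar>(tensor a a - tensor b b) $ j $ k\<bar> \<le> 2 * norm b * norm (a - b) + (norm (a - b))\<^sup>2"
proof -
  have "(tensor a a - tensor b b) $ j $ k = (a - b) $ j * b $ k + b $ j * (a - b) $ k + (a - b) $ j * (a - b) $ k"
    by (simp add: tensor_component algebra_simps)
  also have "\<bar>\<dots>\<bar> \<le> \<bar>(a - b) $ j\<bar> * \<bar>b $ k\<bar> + \<bar>b $ j\<bar> * \<bar>(a - b) $ k\<bar> + \<bar>(a - b) $ j\<bar> * \<bar>(a - b) $ k\<bar>"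
    unfolding abs_mult[symmetric] by linarith
  also have "\<dots> \<le> norm (a - b) * norm b + norm b * norm (a - b) + norm (a - b) * norm (a - b)"
    by (intro add_mono mult_mono component_le_norm_cart) auto
  finally show ?thesis by (simp add: power2_eq_square mult_ac)
qed

section \<open>Bounded mild solutions\<close>

text \<open>The bound on u holds only almost everywhere on the strip. Truncation gives a function w
  that is Borel and bounded everywhere; by Fubini it agrees with u in almost every slice, so it may
  replace u under the time integral. The slice on the left-hand side remains that of u itself, since
  the norm is finally taken at one specific time.\<close>

lemma bounded_mild_solution_representative:
  fixes u :: "real \<Rightarrow> real^'n \<Rightarrow> real^'n"
  assumes u: "bounded_mild_solution T v0 u"
  obtains w M where "(\<lambda>z. w (fst z) (snd z)) \<in> borel_measurable (borel \<Otimes>\<^sub>M borel)" "M > 0"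
    "\<And>\<tau> y. norm (w \<tau> y) \<le> M"
    "AE \<tau> in lborel. \<tau> \<in> {0<..<T} \<longrightarrow> (AE y in lborel. w \<tau> y = u \<tau> y)"
    "\<And>t. t \<in> {0<..T} \<Longrightarrow> AE x in lborel. u t x = heat_semigroup t v0 x -
       (LINT \<tau>:{0<..<t}|lborel. heat_P_div (t - \<tau>) (\<lambda>y. tensor (w \<tau> y) (w \<tau> y)) x)"
    "\<And>t. t \<in> {0<..T} \<Longrightarrow> u t \<in> borel_measurable borel"
proof -
  define \<Omega> where "\<Omega> = ({0<..T} \<times> UNIV :: (real \<times> (real^'n)) set)"
  define u0 where "u0 \<tau> y = (if \<tau> \<in> {0<..T} then u \<tau> y else 0)" for \<tau> y
  have \<Omega>: "\<Omega> \<inter> space borel \<in> sets (borel :: (real \<times> (real^'n)) measure)"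
    unfolding \<Omega>_def by (auto intro!: borel_Times)
  have "(\<lambda>z. u (fst z) (snd z)) \<in> borel_measurable (restrict_space borel \<Omega>)"
    using u unfolding bounded_mild_solution_def \<Omega>_def by blast
  then have "(\<lambda>z. if z \<in> \<Omega> then u (fst z) (snd z) else 0) \<in> borel_measurable borel"
    by (subst (asm) measurable_restrict_space_iff[OF \<Omega>, of 0]) auto
  moreover have "(\<lambda>z. if z \<in> \<Omega> then u (fst z) (snd z) else 0) = (\<lambda>z. u0 (fst z) (snd z))"
    by (auto simp: fun_eq_iff \<Omega>_def u0_def)
  ultimately have u0m: "(\<lambda>z. u0 (fst z) (snd z)) \<in> borel_measurable (borel \<Otimes>\<^sub>M borel)"
    by (simp add: borel_prod)
  obtain M' where M': "AE z in lborel. fst z \<in> {0<..<T} \<longrightarrow> norm (u (fst z) (snd z)) \<le> M'"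
    using u unfolding bounded_mild_solution_def by blast
  define M where "M = \<bar>M'\<bar> + 1"
  \<comment> \<open>The truncation changes u on a null set of the open strip only, because M exceeds
    the essential bound M'.\<close>
  define w where "w \<tau> y = (if norm (u0 \<tau> y) \<le> M then u0 \<tau> y else 0)" for \<tau> y
  have wm: "(\<lambda>z. w (fst z) (snd z)) \<in> borel_measurable (borel \<Otimes>\<^sub>M borel)"
    unfolding w_def using u0m by measurable
  have "AE z in lborel \<Otimes>\<^sub>M lborel. fst z \<in> {0<..<T} \<longrightarrow> norm (u (fst z) (snd z)) \<le> M'"
    using M' unfolding lborel_prod .
  from lborel_pair.AE_pair[OF this]
  have ae: "AE \<tau> in lborel. \<tau> \<in> {0<..<T} \<longrightarrow> (AE y in lborel. w \<tau> y = u \<tau> y)"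
  proof eventually_elim
    case (elim \<tau>)
    show ?case
    proof
      assume t: "\<tau> \<in> {0<..<T}"
      show "AE y in lborel. w \<tau> y = u \<tau> y"
        using elim by eventually_elim (use t in \<open>auto simp: w_def u0_def M_def\<close>)
    qed
  qed
  have tm: "(\<lambda>z. tensor (f (fst z) (snd z)) (f (fst z) (snd z)) $ j $ k) \<in> borel_measurable (borel \<Otimes>\<^sub>M borel)"
    if [measurable]: "(\<lambda>z. f (fst z) (snd z)) \<in> borel_measurable (borel \<Otimes>\<^sub>M borel)" for f :: "real \<Rightarrow> real^'n \<Rightarrow> real^'n" and j k
    unfolding tensor_component by measurable
  have eq: "AE x in lborel. u t x = heat_semigroup t v0 x -
       (LINT \<tau>:{0<..<t}|lborel. heat_P_div (t - \<tau>) (\<lambda>y. tensor (w \<tau> y) (w \<tau> y)) x)" if t: "t \<in> {0<..T}" for t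
  proof -
    have "(LINT \<tau>:{0<..<t}|lborel. heat_P_div (t - \<tau>) (\<lambda>y. tensor (u \<tau> y) (u \<tau> y)) x) =
       (LINT \<tau>:{0<..<t}|lborel. heat_P_div (t - \<tau>) (\<lambda>y. tensor (w \<tau> y) (w \<tau> y)) x)" for x
    proof -
      have "(LINT \<tau>:{0<..<t}|lborel. heat_P_div (t - \<tau>) (\<lambda>y. tensor (u \<tau> y) (u \<tau> y)) x) =
         (LINT \<tau>:{0<..<t}|lborel. heat_P_div (t - \<tau>) (\<lambda>y. tensor (u0 \<tau> y) (u0 \<tau> y)) x)"
        unfolding set_lebesgue_integral_def
        by (intro Bochner_Integration.integral_cong refl) (use t in \<open>auto simp: indicator_def u0_def\<close>)
      also have "\<dots> = (LINT \<tau>:{0<..<t}|lborel. heat_P_div (t - \<tau>) (\<lambda>y. tensor (w \<tau> y) (w \<tau> y)) x)"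
        unfolding set_lebesgue_integral_def
      proof (rule integral_cong_AE)
        have m: "(\<lambda>\<tau>. heat_P_div (t - \<tau>) (\<lambda>y. tensor (f \<tau> y) (f \<tau> y)) x) \<in> borel_measurable lborel"
          if "(\<lambda>z. f (fst z) (snd z)) \<in> borel_measurable (borel \<Otimes>\<^sub>M borel)" for f :: "real \<Rightarrow> real^'n \<Rightarrow> real^'n"
          by (rule heat_P_div_measurable[where F="\<lambda>\<tau> y. tensor (f \<tau> y) (f \<tau> y)" and g="\<lambda>\<tau>. \<tau>", OF tm[OF that]]) auto
        show "(\<lambda>\<tau>. indicat_real {0<..<t} \<tau> *\<^sub>R heat_P_div (t - \<tau>) (\<lambda>y. tensor (u0 \<tau> y) (u0 \<tau> y)) x) \<in> borel_measurable lborel"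
          using m[OF u0m] by measurable
        show "(\<lambda>\<tau>. indicat_real {0<..<t} \<tau> *\<^sub>R heat_P_div (t - \<tau>) (\<lambda>y. tensor (w \<tau> y) (w \<tau> y)) x) \<in> borel_measurable lborel"
          using m[OF wm] by measurable
        show "AE \<tau> in lborel. indicat_real {0<..<t} \<tau> *\<^sub>R heat_P_div (t - \<tau>) (\<lambda>y. tensor (u0 \<tau> y) (u0 \<tau> y)) x =
          indicat_real {0<..<t} \<tau> *\<^sub>R heat_P_div (t - \<tau>) (\<lambda>y. tensor (w \<tau> y) (w \<tau> y)) x"
          using ae
        proof eventually_elim
          case (elim \<tau>)
          show ?case
          proof (cases "\<tau> \<in> {0<..<t}")
            case True
            then have "\<tau> \<in> {0<..<T}" using t by auto
            with elim have a: "AE y in lborel. u0 \<tau> y = w \<tau> y" by (auto simp: u0_def)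
            have sm: "f \<tau> \<in> borel_measurable borel"
              if "(\<lambda>z. f (fst z) (snd z)) \<in> borel_measurable (borel \<Otimes>\<^sub>M borel)" for f :: "real \<Rightarrow> real^'n \<Rightarrow> real^'n"
              using measurable_compose[OF measurable_Pair1'[of \<tau> borel borel] that] by simp
            note [measurable] = sm[OF u0m] sm[OF wm]
            have "heat_P_div (t - \<tau>) (\<lambda>y. tensor (u0 \<tau> y) (u0 \<tau> y)) x = heat_P_div (t - \<tau>) (\<lambda>y. tensor (w \<tau> y) (w \<tau> y)) x"
              unfolding heat_P_div_def tensor_component vec_eq_iff vec_lambda_beta
            proof (intro allI sum.cong refl integral_cong_AE)
              fix i j k
              show "AE y in lborel. oseen_kernel (t - \<tau>) i j k (x - y) * (u0 \<tau> y $ j * u0 \<tau> y $ k) =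
                oseen_kernel (t - \<tau>) i j k (x - y) * (w \<tau> y $ j * w \<tau> y $ k)"
                using a by eventually_elim simp
            qed measurable
            then show ?thesis by simp
          qed simp
        qed
      qed
      finally show ?thesis .
    qed
    moreover have "AE x in lborel. u t x = heat_semigroup t v0 x -
       (LINT \<tau>:{0<..<t}|lborel. heat_P_div (t - \<tau>) (\<lambda>y. tensor (u \<tau> y) (u \<tau> y)) x)"
      using u t unfolding bounded_mild_solution_def by blast
    ultimately show ?thesis by (simp only:)
  qed
  have um: "u t \<in> borel_measurable borel" if "t \<in> {0<..T}" for t
  proof -
    have "u0 t \<in> borel_measurable borel" using measurable_compose[OF measurable_Pair1'[of t borel borel] u0m] by simp
    moreover have "u0 t = u t" using that by (auto simp: u0_def)
    ultimately show ?thesis by simp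
  qed
  show thesis
    by (rule that[OF wm _ _ ae eq um]) (auto simp: w_def M_def)
qed

lemma section_measurable:
  assumes "(\<lambda>z. f (fst z) (snd z)) \<in> borel_measurable (borel \<Otimes>\<^sub>M borel)"
  shows "f \<tau> \<in> borel_measurable borel"
  using measurable_compose[OF measurable_Pair1'[of \<tau> borel borel] assms] by simp

lemma integrable_heat_P_div:
  fixes F :: "real \<Rightarrow> real^'n \<Rightarrow> real^'n^'n"
  assumes F: "\<And>j k. (\<lambda>z. F (fst z) (snd z) $ j $ k) \<in> borel_measurable (borel \<Otimes>\<^sub>M borel)"
    and B: "\<And>\<tau> y j k. \<bar>F \<tau> y $ j $ k\<bar> \<le> B" and s: "s > 0"
  shows "integrable lborel (\<lambda>\<tau>. indicator {0<..<s} \<tau> *\<^sub>R heat_P_div (s - \<tau>) (F \<tau>) x)"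
proof (rule Bochner_Integration.integrable_bound)
  show "integrable lborel (\<lambda>\<tau>. heat_P_div_const TYPE('n) * B * (indicator {0<..<s} \<tau> / sqrt (s - \<tau>)))"
    using has_bochner_integral_inverse_sqrt_reflect[of 0 s] s unfolding has_bochner_integral_iff by (intro integrable_mult_right) simp
  have "(\<lambda>\<tau>. heat_P_div (s - \<tau>) (F \<tau>) x) \<in> borel_measurable lborel"
    by (rule heat_P_div_measurable[where g="\<lambda>\<tau>. \<tau>", OF F]) auto
  then show "(\<lambda>\<tau>. indicat_real {0<..<s} \<tau> *\<^sub>R heat_P_div (s - \<tau>) (F \<tau>) x) \<in> borel_measurable lborel"
    by measurable
  show "AE \<tau> in lborel. norm (indicat_real {0<..<s} \<tau> *\<^sub>R heat_P_div (s - \<tau>) (F \<tau>) x)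
    \<le> norm (heat_P_div_const TYPE('n) * B * (indicator {0<..<s} \<tau> / sqrt (s - \<tau>)))"
  proof (rule AE_I2)
    fix \<tau>
    show "norm (indicat_real {0<..<s} \<tau> *\<^sub>R heat_P_div (s - \<tau>) (F \<tau>) x)
      \<le> norm (heat_P_div_const TYPE('n) * B * (indicator {0<..<s} \<tau> / sqrt (s - \<tau>)))"
    proof (cases "\<tau> \<in> {0<..<s}")
      case True
      then have "norm (heat_P_div (s - \<tau>) (F \<tau>) x) \<le> heat_P_div_const TYPE('n) * B / sqrt (s - \<tau>)"
        by (intro norm_heat_P_div_le section_measurable[where f="\<lambda>\<tau> y. F \<tau> y $ _ $ _"] F AE_I2 B) auto
      also have "\<dots> \<le> \<bar>heat_P_div_const TYPE('n) * B\<bar> / sqrt (s - \<tau>)"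
        using True by (intro divide_right_mono abs_ge_self) auto
      finally show ?thesis using True by simp
    qed simp
  qed
qed

lemma tensor_measurable:
  assumes [measurable]: "(\<lambda>z. f (fst z) (snd z)) \<in> borel_measurable (borel \<Otimes>\<^sub>M borel)"
  shows "(\<lambda>z. tensor (f (fst z) (snd z)) (f (fst z) (snd z)) $ j $ k) \<in> borel_measurable (borel \<Otimes>\<^sub>M borel)"
  unfolding tensor_component by measurable

text \<open>A bootstrap in steps of length \<open>h\<close>.  On the last step only the crude bound \<open>M\<close> is known,
  but there its contribution is \<open>O(\<surd>h)\<close>, so that the bound \<open>2 A\<close> propagates.\<close>

lemma mild_solution_close:
  fixes u w U :: "real \<Rightarrow> real^'n \<Rightarrow> real^'n"
  assumes w: "(\<lambda>z. w (fst z) (snd z)) \<in> borel_measurable (borel \<Otimes>\<^sub>M borel)"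
    and M: "\<And>\<tau> y. norm (w \<tau> y) \<le> M"
    and ae: "AE \<tau> in lborel. \<tau> \<in> {0<..<T} \<longrightarrow> (AE y in lborel. w \<tau> y = u \<tau> y)"
    and eq: "\<And>s. s \<in> {0<..T} \<Longrightarrow> AE x in lborel. u s x = heat_semigroup s v0 x -
       (LINT \<tau>:{0<..<s}|lborel. heat_P_div (s - \<tau>) (\<lambda>y. tensor (w \<tau> y) (w \<tau> y)) x)"
    and U: "(\<lambda>z. U (fst z) (snd z)) \<in> borel_measurable (borel \<Otimes>\<^sub>M borel)"
    and B0: "\<And>\<tau> y. norm (U \<tau> y) \<le> B0"
    and \<alpha>: "\<And>\<tau> y. \<tau> > 0 \<Longrightarrow> norm (U \<tau> y) \<le> \<alpha> / sqrt \<tau>"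
    and base: "\<And>s x. s \<in> {0<..t} \<Longrightarrow> norm (heat_semigroup s v0 x -
       (LINT \<tau>:{0<..<s}|lborel. heat_P_div (s - \<tau>) (\<lambda>y. tensor (U \<tau> y) (U \<tau> y)) x) - U s x) \<le> A"
    and t: "0 < t" "t \<le> T" and A: "A > 0" and \<alpha>0: "\<alpha> \<ge> 0"
    and small1: "128 * heat_P_div_const TYPE('n) * \<alpha> \<le> 1"
    and small2: "32 * heat_P_div_const TYPE('n) * A * sqrt t \<le> 1"
    and s: "s \<in> {0<..t}"
  shows "AE x in lborel. norm (u s x - U s x) \<le> 2 * A"
proof -
  define CB where "CB = heat_P_div_const TYPE('n)"
  have CB: "CB > 0" unfolding CB_def by (rule heat_P_div_const_pos)
  define FW where "FW \<tau> y = tensor (w \<tau> y) (w \<tau> y)" for \<tau> y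
  define FU where "FU \<tau> y = tensor (U \<tau> y) (U \<tau> y)" for \<tau> y
  note FWm = tensor_measurable[OF w, folded FW_def]
  note FUm = tensor_measurable[OF U, folded FU_def]
  note FWs = section_measurable[where f="\<lambda>\<tau> y. FW \<tau> y $ _ $ _", OF FWm]
  note FUs = section_measurable[where f="\<lambda>\<tau> y. FU \<tau> y $ _ $ _", OF FUm]
  have FWb: "\<bar>FW \<tau> y $ j $ k\<bar> \<le> M * M" for \<tau> y j k unfolding FW_def by (intro abs_tensor_le M)
  have FUb: "\<bar>FU \<tau> y $ j $ k\<bar> \<le> B0 * B0" for \<tau> y j k unfolding FU_def by (intro abs_tensor_le B0)
  define M2 where "M2 = M * M + B0 * B0"
  have M2: "M2 \<ge> 0" by (simp add: M2_def)
  \<comment> \<open>Length of one time step: with the crude bound M2 for the difference of the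
    tensors, the last step contributes at most A / 2. The summand 1 keeps the denominator
    positive.\<close>
  define h where "h = (A / (4 * CB * (M2 + 1)))\<^sup>2"
  have h: "h > 0" using A CB M2 by (simp add: h_def)
  have sh: "CB * M2 * (2 * sqrt h) \<le> A / 2"
  proof -
    define D where "D = M2 + 1"
    have D: "D > 0" using M2 by (simp add: D_def)
    have "sqrt h = A / (4 * CB * D)" using A CB D by (simp add: h_def D_def)
    then have "CB * M2 * (2 * sqrt h) = A / 2 * (M2 / D)" using CB D by (simp add: field_simps)
    then have "CB * M2 * (2 * sqrt h) = A / 2 * (M2 / (M2 + 1))" by (simp add: D_def)
    also have "\<dots> \<le> A / 2 * 1" using A M2 by (intro mult_left_mono) auto
    finally show ?thesis by simp
  qed
  have claim: "\<forall>s. 0 < s \<and> s \<le> t \<and> s \<le> real k * h \<longrightarrow> (AE x in lborel. norm (u s x - U s x) \<le> 2 * A)" for k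
  proof (induction k)
    case 0
    then show ?case by simp
  next
    case (Suc k)
    show ?case
    proof (intro allI impI)
      fix s assume s: "0 < s \<and> s \<le> t \<and> s \<le> real (Suc k) * h"
      define a where "a = real k * h"
      have a0: "a \<ge> 0" using h by (simp add: a_def)
      show "AE x in lborel. norm (u s x - U s x) \<le> 2 * A"
      proof (cases "s \<le> a")
        case True
        then show ?thesis using Suc s unfolding a_def by blast
      next
        case False
        have sa: "s - a \<le> h" using s by (simp add: a_def algebra_simps)
        \<comment> \<open>Majorant of the integrand: the linear term with U of size \<alpha> / sqrt
          \<tau>, the quadratic term, and the crude term on the last step (a, s).\<close>
        define g where "g \<tau> = CB * (4 * A * \<alpha> * (indicator {0<..<s} \<tau> / (sqrt (s - \<tau>) * sqrt \<tau>))
           + 4 * A\<^sup>2 * (indicator {0<..<s} \<tau> / sqrt (s - \<tau>)) + M2 * (indicator {a<..<s} \<tau> / sqrt (s - \<tau>)))" for \<tau>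
        note i1 = beta_integral[of s]
        have i2: "has_bochner_integral lborel (\<lambda>\<tau>. indicator {0<..<s} \<tau> / sqrt (s - \<tau>)) (2 * sqrt s)"
          using has_bochner_integral_inverse_sqrt_reflect[of 0 s] s by simp
        have i3: "has_bochner_integral lborel (\<lambda>\<tau>. indicator {a<..<s} \<tau> / sqrt (s - \<tau>)) (2 * sqrt (s - a))"
          using has_bochner_integral_inverse_sqrt_reflect[of a s] False by simp
        have "has_bochner_integral lborel g (CB * (4 * A * \<alpha> * (LINT \<tau>|lborel. indicator {0<..<s} \<tau> / (sqrt (s - \<tau>) * sqrt \<tau>)) + 4 * A\<^sup>2 * (2 * sqrt s) + M2 * (2 * sqrt (s - a))))"
          unfolding g_def
          by (intro has_bochner_integral_mult_right has_bochner_integral_add i2 i3 has_bochner_integral_integrable i1(1)) (use s in simp)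
        then have gi: "integrable lborel g" and "(LINT \<tau>|lborel. g \<tau>) = CB * (4 * A * \<alpha> * (LINT \<tau>|lborel. indicator {0<..<s} \<tau> / (sqrt (s - \<tau>) * sqrt \<tau>)) + 4 * A\<^sup>2 * (2 * sqrt s) + M2 * (2 * sqrt (s - a)))"
          by (simp_all add: has_bochner_integral_iff)
        note this(2)
        also have "\<dots> \<le> CB * (4 * A * \<alpha> * 8 + 4 * A\<^sup>2 * (2 * sqrt t) + M2 * (2 * sqrt h))"
          using s sa CB A \<alpha>0 M2 i1(2) by (intro mult_left_mono add_mono) auto
        \<comment> \<open>The three terms take the shares A / 4, A / 4 and A / 2, by
          \<open>small1\<close>, \<open>small2\<close> and the choice of h.\<close>
        also have "\<dots> \<le> A"
        proof -
          have "CB * (4 * A * \<alpha> * 8) = A / 4 * (128 * CB * \<alpha>)" by simp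
          also have "\<dots> \<le> A / 4 * 1" using small1 A unfolding CB_def by (intro mult_left_mono) auto
          finally have 1: "CB * (4 * A * \<alpha> * 8) \<le> A / 4" by simp
          have "CB * (4 * A\<^sup>2 * (2 * sqrt t)) = A / 4 * (32 * CB * A * sqrt t)" by (simp add: power2_eq_square)
          also have "\<dots> \<le> A / 4 * 1" using small2 A unfolding CB_def by (intro mult_left_mono) auto
          finally have 2: "CB * (4 * A\<^sup>2 * (2 * sqrt t)) \<le> A / 4" by simp
          have "CB * (4 * A * \<alpha> * 8 + 4 * A\<^sup>2 * (2 * sqrt t) + M2 * (2 * sqrt h)) =
             CB * (4 * A * \<alpha> * 8) + CB * (4 * A\<^sup>2 * (2 * sqrt t)) + CB * M2 * (2 * sqrt h)" by (simp add: algebra_simps)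
          then show ?thesis using 1 2 sh by linarith
        qed
        finally have gA: "(LINT \<tau>|lborel. g \<tau>) \<le> A" .
        have bd: "AE \<tau> in lborel. norm (indicat_real {0<..<s} \<tau> *\<^sub>R heat_P_div (s - \<tau>) (FW \<tau>) x - indicat_real {0<..<s} \<tau> *\<^sub>R heat_P_div (s - \<tau>) (FU \<tau>) x) \<le> g \<tau>" for x
          using ae
        proof eventually_elim
          case (elim \<tau>)
          show ?case
          proof (cases "\<tau> \<in> {0<..<s}")
            case True
            then have st: "s - \<tau> > 0" "\<tau> > 0" and tT: "\<tau> \<in> {0<..<T}" using s t by auto
            have wu: "AE y in lborel. w \<tau> y = u \<tau> y" using elim tT by blast
            define b where "b = 4 * A * \<alpha> / sqrt \<tau> + 4 * A\<^sup>2 + M2 * indicator {a<..<s} \<tau>"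
            have "AE y in lborel. \<bar>(FW \<tau> y - FU \<tau> y) $ j $ k'\<bar> \<le> b" for j k'
            \<comment> \<open>Up to the time a the induction hypothesis supplies the distance 2 A;
              afterwards only the uniform bounds on both fields are available.\<close>
            proof (cases "\<tau> \<le> a")
              case True
              then have "AE x in lborel. norm (u \<tau> x - U \<tau> x) \<le> 2 * A" using Suc st s \<open>\<tau> \<in> {0<..<s}\<close> unfolding a_def by auto
              then show ?thesis using wu
              proof eventually_elim
                case (elim y)
                have "\<bar>(FW \<tau> y - FU \<tau> y) $ j $ k'\<bar> \<le> 2 * norm (U \<tau> y) * norm (w \<tau> y - U \<tau> y) + (norm (w \<tau> y - U \<tau> y))\<^sup>2"
                  unfolding FW_def FU_def by (rule abs_tensor_diff_le)
                also have "\<dots> \<le> 2 * (\<alpha> / sqrt \<tau>) * (2 * A) + (2 * A)\<^sup>2"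
                  using elim \<alpha>[OF st(2), of y] A \<alpha>0 st by (intro add_mono mult_mono power_mono) auto
                also have "\<dots> \<le> b"
                proof -
                  have "0 \<le> M2 * indicator {a<..<s} \<tau>" using M2 by simp
                  then show ?thesis by (simp add: b_def power2_eq_square mult_ac)
                qed
                finally show ?case .
              qed
            next
              case False
              have "\<bar>(FW \<tau> y - FU \<tau> y) $ j $ k'\<bar> \<le> b" for y
              proof -
                have "\<bar>(FW \<tau> y - FU \<tau> y) $ j $ k'\<bar> \<le> M2"
                  using FWb[of \<tau> y j k'] FUb[of \<tau> y j k'] unfolding M2_def by (simp add: abs_le_iff)
                also have "\<dots> \<le> b" using False True A \<alpha>0 st by (simp add: b_def)
                finally show ?thesis .
              qed
              then show ?thesis by simp
            qed
            then have "norm (heat_P_div (s - \<tau>) (\<lambda>y. FW \<tau> y - FU \<tau> y) x) \<le> heat_P_div_const TYPE('n) * b / sqrt (s - \<tau>)"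
              by (intro norm_heat_P_div_le st) (use FWs FUs in simp)
            moreover have "heat_P_div (s - \<tau>) (FW \<tau>) x - heat_P_div (s - \<tau>) (FU \<tau>) x = heat_P_div (s - \<tau>) (\<lambda>y. FW \<tau> y - FU \<tau> y) x"
              by (rule heat_P_div_diff[OF st(1) FWs FUs AE_I2[OF FWb] AE_I2[OF FUb]])
            moreover have "CB * b / sqrt (s - \<tau>) = g \<tau>"
              using True st by (simp add: g_def b_def field_simps)
            ultimately show ?thesis using True by (simp add: CB_def)
          next
            case False
            then have "\<tau> \<notin> {a<..<s}" using a0 by auto
            then show ?thesis using False by (simp add: g_def)
          qed
        qed
        have sT: "s \<in> {0<..T}" "s \<in> {0<..t}" using s t by auto
        note iW = integrable_heat_P_div[OF FWm FWb, of s]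
        note iU = integrable_heat_P_div[OF FUm FUb, of s]
        show ?thesis
          using eq[OF sT(1)]
        proof eventually_elim
          case (elim x)
          have iW: "integrable lborel (\<lambda>\<tau>. indicat_real {0<..<s} \<tau> *\<^sub>R heat_P_div (s - \<tau>) (FW \<tau>) x)"
            and iU: "integrable lborel (\<lambda>\<tau>. indicat_real {0<..<s} \<tau> *\<^sub>R heat_P_div (s - \<tau>) (FU \<tau>) x)"
            using s by (auto intro!: integrable_heat_P_div[OF FWm FWb] integrable_heat_P_div[OF FUm FUb])
          define IW where "IW = (LINT \<tau>:{0<..<s}|lborel. heat_P_div (s - \<tau>) (FW \<tau>) x)"
          define IU where "IU = (LINT \<tau>:{0<..<s}|lborel. heat_P_div (s - \<tau>) (FU \<tau>) x)"
          have "norm (IW - IU) \<le> (LINT \<tau>|lborel. g \<tau>)"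
            unfolding IW_def IU_def set_lebesgue_integral_def Bochner_Integration.integral_diff[OF iW iU, symmetric]
            by (rule order_trans[OF integral_norm_bound integral_mono_AE]) (use iW iU gi bd in auto)
          then have n1: "norm (IW - IU) \<le> A" using gA by linarith
          have n2: "norm (heat_semigroup s v0 x - IU - U s x) \<le> A"
            using base[OF sT(2), of x] by (simp add: IU_def FU_def[abs_def])
          \<comment> \<open>The defect of U in the equation contributes A through
            \<open>base\<close>, the difference of the two quadratic terms another A.\<close>
          have e: "u s x - U s x = (heat_semigroup s v0 x - IU - U s x) - (IW - IU)"
            using elim by (simp add: IW_def FW_def[abs_def])
          show ?case unfolding e
            using norm_triangle_ineq4[of "heat_semigroup s v0 x - IU - U s x" "IW - IU"] n1 n2 by argo
        qed
      qed
    qed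
  qed
  obtain k where "s / h \<le> real k" using real_arch_simple by blast
  then have "s \<le> real k * h" using h by (simp add: divide_le_eq)
  then show ?thesis using claim[of k] s by auto
qed

lemma test_oseen_conv:
  fixes \<eta> :: "real^'n \<Rightarrow> complex"
  assumes s: "s > 0" and \<eta>: "integrable lborel \<eta>"
    and f[measurable]: "f \<in> borel_measurable borel" and B: "\<And>y. \<bar>f y\<bar> \<le> B"
  shows "(LINT x|lborel. \<eta> x * of_real (LINT y|lborel. oseen_kernel s i j k (x - y) * f y)) =
    (LINT y|lborel. of_real (f y) * (LINT x|lborel. of_real (oseen_kernel s i j k (x - y)) * \<eta> x))"
proof -
  have [measurable]: "\<eta> \<in> borel_measurable borel" using \<eta> by auto
  note K = oseen_kernel_integrable[OF s, of i j k]
  have [measurable]: "oseen_kernel s i j k \<in> borel_measurable borel" using K by auto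
  have I: "integrable (lborel \<Otimes>\<^sub>M lborel) (\<lambda>(x, y). (B * norm (\<eta> x)) * \<bar>oseen_kernel s i j k (x - y)\<bar>)"
    by (rule integrable_pair_conv) (use \<eta> K in auto)
  have J: "integrable (lborel \<Otimes>\<^sub>M lborel) (\<lambda>(x, y). \<eta> x * of_real (oseen_kernel s i j k (x - y) * f y))"
  proof (rule integrable_pair_bound[OF I])
    fix x y
    show "norm (\<eta> x * of_real (oseen_kernel s i j k (x - y) * f y)) \<le> B * norm (\<eta> x) * \<bar>oseen_kernel s i j k (x - y)\<bar>"
      using mult_left_mono[OF B[of y], of "norm (\<eta> x) * \<bar>oseen_kernel s i j k (x - y)\<bar>"]
      by (simp add: norm_mult abs_mult mult_ac)
  qed measurable
  have "(LINT x|lborel. \<eta> x * of_real (LINT y|lborel. oseen_kernel s i j k (x - y) * f y)) =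
    (LINT x|lborel. LINT y|lborel. \<eta> x * of_real (oseen_kernel s i j k (x - y) * f y))"
    by (simp only: integral_mult_right_zero integral_complex_of_real)
  also have "\<dots> = (LINT y|lborel. LINT x|lborel. \<eta> x * of_real (oseen_kernel s i j k (x - y) * f y))"
    by (rule lborel_pair.Fubini_integral[OF J, symmetric])
  also have "\<dots> = (LINT y|lborel. of_real (f y) * (LINT x|lborel. of_real (oseen_kernel s i j k (x - y)) * \<eta> x))"
    unfolding integral_mult_right_zero[symmetric] by (simp add: mult_ac)
  finally show ?thesis .
qed

text \<open>Fubini moves the Oseen kernel onto the test function. As F need only be bounded and
  measurable, the formula applies to the solution as well as to the explicit field, and the two
  results can be subtracted under the time integral.\<close>

lemma test_duhamel:
  fixes F :: "real \<Rightarrow> real^'n \<Rightarrow> real^'n^'n" and \<eta> :: "real^'n \<Rightarrow> complex" and i :: 'n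
  assumes F: "\<And>j k. (\<lambda>z. F (fst z) (snd z) $ j $ k) \<in> borel_measurable (borel \<Otimes>\<^sub>M borel)"
    and B: "\<And>\<tau> y j k. \<bar>F \<tau> y $ j $ k\<bar> \<le> B" and s: "s > 0" and \<eta>: "integrable lborel \<eta>"
  defines "H \<equiv> \<lambda>\<tau>. (\<Sum>j\<in>UNIV. \<Sum>k\<in>UNIV. LINT y|lborel. of_real (F \<tau> y $ j $ k) *
      (LINT x|lborel. of_real (oseen_kernel (s - \<tau>) i j k (x - y)) * \<eta> x))"
  shows "integrable lborel (\<lambda>\<tau>. of_real (indicator {0<..<s} \<tau>) * H \<tau>)"
    and "(LINT x|lborel. \<eta> x * of_real ((LINT \<tau>:{0<..<s}|lborel. heat_P_div (s - \<tau>) (F \<tau>) x) $ i)) =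
    (LINT \<tau>|lborel. of_real (indicator {0<..<s} \<tau>) * H \<tau>)"
proof -
  have [measurable]: "\<eta> \<in> borel_measurable borel" using \<eta> by auto
  have hm: "(\<lambda>z. heat_P_div (s - snd z) (F (snd z)) (fst z)) \<in> borel_measurable (lborel \<Otimes>\<^sub>M lborel)"
    by (rule heat_P_div_measurable[OF F]) auto
  have J: "integrable (lborel \<Otimes>\<^sub>M lborel) (\<lambda>(x, \<tau>). \<eta> x * of_real (indicator {0<..<s} \<tau> * heat_P_div (s - \<tau>) (F \<tau>) x $ i))"
  proof (rule integrable_pair_bound[OF integrable_pair_prod])
    show "integrable lborel (\<lambda>x. norm (\<eta> x))" using \<eta> by simp
    show "integrable lborel (\<lambda>\<tau>. heat_P_div_const TYPE('n) * B * (indicator {0<..<s} \<tau> / sqrt (s - \<tau>)))"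
      using has_bochner_integral_inverse_sqrt_reflect[of 0 s] s unfolding has_bochner_integral_iff by (intro integrable_mult_right) simp
    show "(\<lambda>(x, \<tau>). \<eta> x * of_real (indicator {0<..<s} \<tau> * heat_P_div (s - \<tau>) (F \<tau>) x $ i)) \<in> borel_measurable (lborel \<Otimes>\<^sub>M lborel)"
      unfolding split_beta' using hm by measurable
    fix x \<tau>
    show "norm (\<eta> x * of_real (indicator {0<..<s} \<tau> * heat_P_div (s - \<tau>) (F \<tau>) x $ i)) \<le> norm (\<eta> x) * (heat_P_div_const TYPE('n) * B * (indicator {0<..<s} \<tau> / sqrt (s - \<tau>)))"
    proof (cases "\<tau> \<in> {0<..<s}")
      case True
      then have "norm (heat_P_div (s - \<tau>) (F \<tau>) x) \<le> heat_P_div_const TYPE('n) * B / sqrt (s - \<tau>)"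
        by (intro norm_heat_P_div_le section_measurable[where f="\<lambda>\<tau> y. F \<tau> y $ _ $ _"] F AE_I2 B) auto
      then have "\<bar>heat_P_div (s - \<tau>) (F \<tau>) x $ i\<bar> \<le> heat_P_div_const TYPE('n) * B / sqrt (s - \<tau>)"
        by (rule order_trans[OF component_le_norm_cart])
      from mult_left_mono[OF this norm_ge_zero[of "\<eta> x"]] show ?thesis using True by (simp add: norm_mult)
    qed simp
  qed
  have e: "(LINT x|lborel. \<eta> x * of_real (indicator {0<..<s} \<tau> * heat_P_div (s - \<tau>) (F \<tau>) x $ i)) = of_real (indicator {0<..<s} \<tau>) * H \<tau>" for \<tau>
  proof (cases "\<tau> \<in> {0<..<s}")
    case True
    then have st: "s - \<tau> > 0" by simp
    note Fs = section_measurable[where f="\<lambda>\<tau> y. F \<tau> y $ _ $ _", OF F]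
    have ii: "integrable lborel (\<lambda>x. \<eta> x * of_real (LINT y|lborel. oseen_kernel (s - \<tau>) i j k (x - y) * F \<tau> y $ j $ k))" for j k
    proof (rule Bochner_Integration.integrable_bound)
      show "integrable lborel (\<lambda>x. norm (\<eta> x) * (B * oseen_const TYPE('n) / sqrt (s - \<tau>)))" using \<eta> by simp
      have [measurable]: "(\<lambda>y. F \<tau> y $ j $ k) \<in> borel_measurable borel" by (rule Fs)
      show "(\<lambda>x. \<eta> x * of_real (LINT y|lborel. oseen_kernel (s - \<tau>) i j k (x - y) * F \<tau> y $ j $ k)) \<in> borel_measurable lborel"
        by measurable
      show "AE x in lborel. norm (\<eta> x * of_real (LINT y|lborel. oseen_kernel (s - \<tau>) i j k (x - y) * F \<tau> y $ j $ k)) \<le> norm (norm (\<eta> x) * (B * oseen_const TYPE('n) / sqrt (s - \<tau>)))"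
      proof (rule AE_I2)
        fix x
        have "\<bar>LINT y|lborel. oseen_kernel (s - \<tau>) i j k (x - y) * F \<tau> y $ j $ k\<bar> \<le> B * oseen_const TYPE('n) / sqrt (s - \<tau>)"
          by (intro abs_oseen_conv_le st Fs AE_I2 B)
        from mult_left_mono[OF order_trans[OF this abs_ge_self] norm_ge_zero[of "\<eta> x"]]
        show "norm (\<eta> x * of_real (LINT y|lborel. oseen_kernel (s - \<tau>) i j k (x - y) * F \<tau> y $ j $ k)) \<le> norm (norm (\<eta> x) * (B * oseen_const TYPE('n) / sqrt (s - \<tau>)))"
          by (simp add: norm_mult abs_mult)
      qed
    qed
    have "(LINT x|lborel. \<eta> x * of_real (heat_P_div (s - \<tau>) (F \<tau>) x $ i)) =
      (LINT x|lborel. (\<Sum>j\<in>UNIV. \<Sum>k\<in>UNIV. \<eta> x * of_real (LINT y|lborel. oseen_kernel (s - \<tau>) i j k (x - y) * F \<tau> y $ j $ k)))"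
      unfolding heat_P_div_def by (simp only: vec_lambda_beta of_real_sum sum_distrib_left)
    also have "\<dots> = (\<Sum>j\<in>UNIV. \<Sum>k\<in>UNIV. LINT x|lborel. \<eta> x * of_real (LINT y|lborel. oseen_kernel (s - \<tau>) i j k (x - y) * F \<tau> y $ j $ k))"
      using ii by (simp add: Bochner_Integration.integral_sum Bochner_Integration.integrable_sum)
    also have "\<dots> = H \<tau>"
      unfolding H_def by (intro sum.cong refl test_oseen_conv[where B=B] st \<eta> Fs B)
    finally show ?thesis using True by simp
  qed simp
  show "integrable lborel (\<lambda>\<tau>. of_real (indicator {0<..<s} \<tau>) * H \<tau>)"
    using lborel_pair.integrable_snd[OF J] by (simp only: e)
  have c: "(LINT \<tau>:{0<..<s}|lborel. heat_P_div (s - \<tau>) (F \<tau>) x) $ i = (LINT \<tau>|lborel. indicator {0<..<s} \<tau> * heat_P_div (s - \<tau>) (F \<tau>) x $ i)" for x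
    unfolding set_lebesgue_integral_def
    by (subst integral_bounded_linear[OF bounded_linear_vec_nth integrable_heat_P_div[OF F B s], symmetric]) simp
  have "(LINT x|lborel. \<eta> x * of_real ((LINT \<tau>:{0<..<s}|lborel. heat_P_div (s - \<tau>) (F \<tau>) x) $ i)) =
    (LINT x|lborel. LINT \<tau>|lborel. \<eta> x * of_real (indicator {0<..<s} \<tau> * heat_P_div (s - \<tau>) (F \<tau>) x $ i))"
    unfolding c by (simp only: integral_mult_right_zero integral_complex_of_real)
  also have "\<dots> = (LINT \<tau>|lborel. LINT x|lborel. \<eta> x * of_real (indicator {0<..<s} \<tau> * heat_P_div (s - \<tau>) (F \<tau>) x $ i))"
    by (rule lborel_pair.Fubini_integral[OF J, symmetric])
  finally show "(LINT x|lborel. \<eta> x * of_real ((LINT \<tau>:{0<..<s}|lborel. heat_P_div (s - \<tau>) (F \<tau>) x) $ i)) =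
    (LINT \<tau>|lborel. of_real (indicator {0<..<s} \<tau>) * H \<tau>)" by (simp only: e)
qed

section \<open>The initial data\<close>

lemma inverse_square_le:
  fixes a :: real
  assumes "a \<ge> 0"
  shows "1 / (1 + a)\<^sup>2 \<le> 1 / ((a + 1/2) * (a + 3/2))"
proof -
  have "(1 + a)\<^sup>2 = (a + 1/2) * (a + 3/2) + 1/4" by (simp add: power2_eq_square field_simps)
  moreover have "(a + 1/2) * (a + 3/2) > 0" using assms by (intro mult_pos_pos) auto
  ultimately show ?thesis by (intro frac_le) auto
qed

text \<open>The majorant 1 / ((a + 1/2) (a + 3/2)) of 1 / (1 + a)^2 is the difference of 1 / (a +
  1/2) and 1 / (a + 3/2), so the sum over the points to the right of y telescopes. The remaining
  boundary term is kept to carry the induction.\<close>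

lemma sum_inverse_square_right:
  fixes y :: real
  assumes "y \<le> real m"
  shows "(\<Sum>l\<in>{m..<m+k}. 1 / (1 + \<bar>y - real l\<bar>)\<^sup>2) \<le> 2 - 1 / (real (m + k) - y + 1/2)"
proof (induction k)
  case 0
  have "1 / (real m - y + 1/2) \<le> 1 / (1/2)" using assms by (intro divide_left_mono) auto
  then show ?case by simp
next
  case (Suc k)
  define a where "a = real (m + k) - y"
  have a: "a \<ge> 0" using assms by (simp add: a_def)
  have "1 / (1 + a)\<^sup>2 \<le> 1 / ((a + 1/2) * (a + 3/2))"
    by (rule inverse_square_le[OF a])
  also have "\<dots> = 1 / (a + 1/2) - 1 / (a + 3/2)" using a by (simp add: field_simps)
  finally have "1 / (1 + \<bar>y - real (m + k)\<bar>)\<^sup>2 \<le> 1 / (a + 1/2) - 1 / (a + 3/2)"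
    using a by (simp add: a_def)
  moreover have "(\<Sum>l\<in>{m..<m + Suc k}. 1 / (1 + \<bar>y - real l\<bar>)\<^sup>2) = (\<Sum>l\<in>{m..<m+k}. 1 / (1 + \<bar>y - real l\<bar>)\<^sup>2) + 1 / (1 + \<bar>y - real (m + k)\<bar>)\<^sup>2"
    by simp
  moreover have "real (m + Suc k) - y + 1/2 = a + 3/2" "real (m + k) - y + 1/2 = a + 1/2" by (auto simp: a_def)
  ultimately show ?case using Suc by (simp only:)
qed

text \<open>The same telescoping for the points to the left of y. The largest index is m + k - 1,
  which explains the 1 in the hypothesis.\<close>

lemma sum_inverse_square_left:
  fixes y :: real
  assumes "real (m + k) \<le> y + 1"
  shows "(\<Sum>l\<in>{m..<m+k}. 1 / (1 + \<bar>y - real l\<bar>)\<^sup>2) \<le> 1 / (y - real (m + k) + 3/2)"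
  using assms
proof (induction k)
  case 0
  then show ?case by simp
next
  case (Suc k)
  define a where "a = y - real (m + k)"
  have a: "a \<ge> 0" using Suc.prems by (simp add: a_def)
  have "1 / (1 + a)\<^sup>2 \<le> 1 / ((a + 1/2) * (a + 3/2))"
    by (rule inverse_square_le[OF a])
  also have "\<dots> = 1 / (a + 1/2) - 1 / (a + 3/2)" using a by (simp add: field_simps)
  finally have "1 / (1 + \<bar>y - real (m + k)\<bar>)\<^sup>2 \<le> 1 / (a + 1/2) - 1 / (a + 3/2)"
    using a by (simp add: a_def)
  moreover have "(\<Sum>l\<in>{m..<m + Suc k}. 1 / (1 + \<bar>y - real l\<bar>)\<^sup>2) = (\<Sum>l\<in>{m..<m+k}. 1 / (1 + \<bar>y - real l\<bar>)\<^sup>2) + 1 / (1 + \<bar>y - real (m + k)\<bar>)\<^sup>2"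
    by simp
  moreover have "y - real (m + Suc k) + 3/2 = a + 1/2" "y - real (m + k) + 3/2 = a + 3/2" by (auto simp: a_def)
  moreover have "(\<Sum>l\<in>{m..<m+k}. 1 / (1 + \<bar>y - real l\<bar>)\<^sup>2) \<le> 1 / (y - real (m + k) + 3/2)"
    using Suc by simp
  ultimately show ?case by (simp only:)
qed

lemma sum_inverse_square_le:
  fixes y :: real
  shows "(\<Sum>l\<in>{m..<m+k}. 1 / (1 + \<bar>y - real l\<bar>)\<^sup>2) \<le> 4"
proof -
  define q where "q = nat \<lceil>y\<rceil>"
  \<comment> \<open>The ceiling of y clipped to the index range: it separates the points to the left
    of y from those to the right.\<close>
  define p where "p = min (m + k) (max m q)"
  have p: "m \<le> p" "p \<le> m + k" by (auto simp: p_def)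
  have 1: "(\<Sum>l\<in>{m..<p}. 1 / (1 + \<bar>y - real l\<bar>)\<^sup>2) \<le> 2"
  proof (cases "p = m")
    case False
    then have "p \<le> q" by (auto simp: p_def)
    then have "p \<le> nat \<lceil>y\<rceil>" by (simp only: q_def)
    moreover have "p > 0" using False p by simp
    ultimately have "real p \<le> y + 1"
      by (cases "y \<ge> 0") (auto simp: le_nat_iff intro: order_trans[OF _ of_int_ceiling_le_add_one] dest: of_int_le_iff[where 'a=real, THEN iffD2])
    then have "real (m + (p - m)) \<le> y + 1" using p by simp
    from sum_inverse_square_left[OF this] have "(\<Sum>l\<in>{m..<p}. 1 / (1 + \<bar>y - real l\<bar>)\<^sup>2) \<le> 1 / (y - real p + 3/2)"
      using p by simp
    also have "\<dots> \<le> 1 / (1/2)" using \<open>real p \<le> y + 1\<close> by (intro divide_left_mono) auto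
    finally show ?thesis by simp
  qed simp
  have 2: "(\<Sum>l\<in>{p..<m+k}. 1 / (1 + \<bar>y - real l\<bar>)\<^sup>2) \<le> 2"
  proof (cases "p = m + k")
    case False
    then have "real q \<le> real p" by (auto simp: p_def)
    then have yp: "y \<le> real p" using real_nat_ceiling_ge[of y] unfolding q_def by linarith
    have "(\<Sum>l\<in>{p..<p+(m+k-p)}. 1 / (1 + \<bar>y - real l\<bar>)\<^sup>2) \<le> 2 - 1 / (real (p + (m+k-p)) - y + 1/2)"
      by (rule sum_inverse_square_right[OF yp])
    also have "\<dots> \<le> 2"
    proof -
      have "y \<le> real (p + (m + k - p))" using yp by simp
      then show ?thesis by (simp del: of_nat_add)
    qed
    finally show ?thesis using p by simp
  qed simp
  have "(\<Sum>l\<in>{m..<m+k}. 1 / (1 + \<bar>y - real l\<bar>)\<^sup>2) = (\<Sum>l\<in>{m..<p}. 1 / (1 + \<bar>y - real l\<bar>)\<^sup>2) + (\<Sum>l\<in>{p..<m+k}. 1 / (1 + \<bar>y - real l\<bar>)\<^sup>2)"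
    by (rule sum.atLeastLessThan_concat[OF p, symmetric])
  then show ?thesis using 1 2 by linarith
qed

text \<open>Comparison with the increments \<open>h (2 x) - h x\<close> of \<open>h x = - 4 / (1 + x)\<close>, which telescope.\<close>

lemma sum_dyadic_exp_le:
  assumes \<tau>: "\<tau> > 0"
  shows "(\<Sum>k\<in>{m..<m+n}. 2 ^ k * exp (- (4 ^ k) * \<tau>)) \<le> 4 / sqrt \<tau>"
proof -
  define y where "y = sqrt \<tau>"
  have y: "y > 0" "y\<^sup>2 = \<tau>" using \<tau> by (auto simp: y_def)
  have f: "x * exp (- x\<^sup>2) \<le> 4 / (1 + x) - 4 / (1 + 2 * x)" if x: "x > 0" for x :: real
  proof -
    have "1 + x\<^sup>2 \<le> exp (x\<^sup>2)" by (rule exp_ge_add_one_self)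
    then have "x * exp (- x\<^sup>2) \<le> x * (1 / (1 + x\<^sup>2))"
      using x by (intro mult_left_mono) (auto simp: exp_minus field_simps add_pos_nonneg)
    also have "\<dots> \<le> x * (4 / ((1 + x) * (1 + 2 * x)))"
    proof (intro mult_left_mono)
      \<comment> \<open>The difference of the two sides of the next inequality is 2 (x - 3/4)^2 +
        15/8.\<close>
      have "0 \<le> 2 * (x - 3/4)\<^sup>2" by simp
      then have "(1 + x) * (1 + 2 * x) \<le> 4 * (1 + x\<^sup>2)" by (simp add: power2_eq_square algebra_simps)
      then show "1 / (1 + x\<^sup>2) \<le> 4 / ((1 + x) * (1 + 2 * x))"
        using x by (simp add: divide_simps add_pos_nonneg)
    qed (use x in simp)
    also have "\<dots> = 4 / (1 + x) - 4 / (1 + 2 * x)" using x by (simp add: field_simps)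
    finally show ?thesis .
  qed
  have "(\<Sum>k\<in>{m..<m+n}. 2 ^ k * y * exp (- (2 ^ k * y)\<^sup>2)) \<le> (\<Sum>k\<in>{m..<m+n}. 4 / (1 + 2 ^ k * y) - 4 / (1 + 2 ^ Suc k * y))"
    by (intro sum_mono order_trans[OF f]) (use y in \<open>auto simp: mult_ac\<close>)
  also have "\<dots> = 4 / (1 + 2 ^ m * y) - 4 / (1 + 2 ^ (m + n) * y)"
    by (induction n) (auto simp: algebra_simps)
  also have "\<dots> \<le> 4 / (1 + 2 ^ m * y)" using y by simp
  also have "\<dots> \<le> 4" 
  proof -
    have "0 < 1 + 2 ^ m * y" using y by (simp add: add_pos_pos)
    then show ?thesis using divide_left_mono[of 1 "1 + 2 ^ m * y" 4] y by simp
  qed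
  finally have *: "(\<Sum>k\<in>{m..<m+n}. 2 ^ k * y * exp (- (2 ^ k * y)\<^sup>2)) \<le> 4" .
  have "2 ^ k * y * exp (- (2 ^ k * y)\<^sup>2) = (2 ^ k * exp (- (4 ^ k) * \<tau>)) * y" for k :: nat
  proof -
    have "(2 ^ k)\<^sup>2 = (4::real) ^ k" by (simp add: power2_eq_square flip: power_mult_distrib)
    then show ?thesis using y by (simp add: power_mult_distrib)
  qed
  with * have "(\<Sum>k\<in>{m..<m+n}. 2 ^ k * exp (- (4 ^ k) * \<tau>)) * y \<le> 4"
    by (simp only: sum_distrib_right)
  then show ?thesis using y by (simp add: y_def[symmetric] pos_le_divide_eq)
qed

text \<open>Everything that does not depend on the parameters L and K, in particular all constants.
  The data oscillate along the axis a, while their velocity points essentially along the axis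
  b.\<close>

locale bump =
  fixes \<phi> :: "real \<Rightarrow> real" and a b :: "'n::finite"
  assumes cutoff: "LP_cutoff \<phi>" and ab: "a \<noteq> b"
begin

text \<open>The argument \<open>1 + 8 |\<xi>|\<^sup>2\<close> instead of \<open>|\<xi>|\<close> only shrinks the support to radius \<open>1/4\<close>.\<close>

definition chir :: "real^'n \<Rightarrow> real" where "chir \<xi> = \<phi> (1 + 8 * (norm \<xi>)\<^sup>2)"

definition chi :: "real^'n \<Rightarrow> complex" where "chi \<xi> = of_real (chir \<xi>)"

lemma chi_schwartz: "schwartz chi"
  using LP_cutoff_schwartz[OF cutoff, where 'n='n] by (simp add: chi_def[abs_def] chir_def)

lemma chir_nonneg: "0 \<le> chir \<xi>" and chir_le_1: "chir \<xi> \<le> 1"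
  using cutoff unfolding LP_cutoff_def chir_def by auto

lemma chir_minus: "chir (- \<xi>) = chir \<xi>"
  by (simp add: chir_def)

lemma chi_minus: "chi (- \<xi>) = chi \<xi>"
  by (simp add: chi_def chir_minus)

lemma chir_zero: "norm \<xi> > 1/4 \<Longrightarrow> chir \<xi> = 0"
proof -
  assume "norm \<xi> > 1/4"
  then have "(1/4)\<^sup>2 \<le> (norm \<xi>)\<^sup>2" by (intro power_mono) auto
  then have "3/2 \<le> 1 + 8 * (norm \<xi>)\<^sup>2" by (simp add: power2_eq_square)
  then show ?thesis using cutoff unfolding LP_cutoff_def chir_def by auto
qed

lemma chir_one: "norm \<xi> \<le> 1/6 \<Longrightarrow> chir \<xi> = 1"
proof -
  assume "norm \<xi> \<le> 1/6"
  then have "(norm \<xi>)\<^sup>2 \<le> (1/6)\<^sup>2" by (intro power_mono) auto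
  then have "1 + 8 * (norm \<xi>)\<^sup>2 \<le> 5/4" by (simp add: power2_eq_square)
  then show ?thesis using cutoff unfolding LP_cutoff_def chir_def by auto
qed

lemma chi_zero: "norm \<xi> > 1/4 \<Longrightarrow> chi \<xi> = 0"
  by (simp add: chi_def chir_zero)

definition c0 :: real where "c0 = (LINT \<xi>|lborel. chir (\<xi> :: real^'n))"

lemma chir_integrable: "integrable lborel chir"
proof -
  have "integrable lborel chi" by (rule schwartz_integrable[OF chi_schwartz])
  then show ?thesis unfolding chi_def[abs_def] by (simp only: complex_of_real_integrable_eq)
qed

lemma chir_measurable [measurable]: "chir \<in> borel_measurable borel"
  using chir_integrable by auto

lemma c0_pos: "c0 > 0"
proof -
  have "0 < measure lborel (ball (0::real^'n) (1/6))" by (rule content_ball_pos) simp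
  also have "\<dots> = (LINT \<xi>|lborel. indicator (ball 0 (1/6)) (\<xi>::real^'n))" by simp
  also have "\<dots> \<le> c0" unfolding c0_def
  proof (rule integral_mono)
    show "integrable lborel (indicator (ball 0 (1/6)) :: real^'n \<Rightarrow> real)"
      using emeasure_lborel_ball_finite[of "0::real^'n" "1/6"] by simp
    show "integrable lborel chir" by (rule chir_integrable)
    fix \<xi> :: "real^'n"
    show "indicator (ball 0 (1/6)) \<xi> \<le> chir \<xi>"
      using chir_one[of \<xi>] chir_nonneg[of \<xi>] by (auto simp: indicator_def)
  qed
  finally show ?thesis .
qed

lemma integral_norm_chi: "(LINT \<xi>|lborel. norm (chi \<xi>)) = c0"
  using chir_nonneg by (simp add: chi_def c0_def)

definition theta :: "real^'n \<Rightarrow> real" where "theta x = Re (ft chi x)"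

lemma of_real_theta: "of_real (theta x) = ft chi x"
proof -
  have "(\<lambda>\<xi>. cnj (chi (- \<xi>))) = chi" by (rule ext) (simp add: chi_def chir_minus)
  then have "cnj (ft chi x) = ft chi x" by (simp only: cnj_ft[OF schwartz_integrable[OF chi_schwartz]])
  then show ?thesis by (simp add: theta_def Reals_cnj_iff)
qed

definition Ct :: real where "Ct = (SOME C. C > 0 \<and> (\<forall>x. (1 + norm x)\<^sup>2 * \<bar>theta x\<bar> \<le> C))"

lemma Ct_pos: "Ct > 0" and theta_decay: "(1 + norm x)\<^sup>2 * \<bar>theta x\<bar> \<le> Ct"
proof -
  obtain B where B: "B > 0" "\<And>x. (1 + norm x)\<^sup>2 * norm (ft chi x) \<le> B"
    using schwartz_decay[OF schwartz_ft(1)[OF chi_schwartz]] by blast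
  have "\<exists>C. C > 0 \<and> (\<forall>x. (1 + norm x)\<^sup>2 * \<bar>theta x\<bar> \<le> C)"
    using B by (intro exI[of _ B]) (simp add: of_real_theta[symmetric])
  from someI_ex[OF this] have "Ct > 0 \<and> (\<forall>x. (1 + norm x)\<^sup>2 * \<bar>theta x\<bar> \<le> Ct)" unfolding Ct_def .
  then show "Ct > 0" "(1 + norm x)\<^sup>2 * \<bar>theta x\<bar> \<le> Ct" by auto
qed

definition e1 :: "real^'n" where "e1 = axis a 1"

text \<open>Any unit vector with nonzero components along both axes would do.\<close>

definition \<zeta> :: "real^'n" where "\<zeta> = (3/5) *\<^sub>R axis a 1 + (4/5) *\<^sub>R axis b 1"

lemma norm_e1 [simp]: "norm e1 = 1" by (simp add: e1_def)

lemma e1_a [simp]: "e1 $ a = 1" and e1_other [simp]: "i \<noteq> a \<Longrightarrow> e1 $ i = 0"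
  by (auto simp: e1_def axis_def)

lemma zeta_a [simp]: "\<zeta> $ a = 3/5" and zeta_b [simp]: "\<zeta> $ b = 4/5"
  using ab by (auto simp: \<zeta>_def axis_def)

lemma norm_zeta [simp]: "norm \<zeta> = 1"
proof -
  have "(norm \<zeta>)\<^sup>2 = \<zeta> \<bullet> \<zeta>" by (rule power2_norm_eq_inner)
  also have "\<dots> = 1" using ab
    unfolding \<zeta>_def by (simp add: inner_add_left inner_add_right inner_axis_axis)
  finally show ?thesis by (simp add: power2_eq_1_iff) (metis norm_ge_zero not_one_le_zero le_minus_one_simps(3))
qed

text \<open>Unit spacing is enough: the bump profile decays quadratically along the axis a, so the
  sum of all bumps is bounded independently of their number.\<close>

definition pos :: "nat \<Rightarrow> real^'n" where "pos l = real l *\<^sub>R e1"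

definition frq :: "nat \<Rightarrow> real^'n" where "frq l = (2 ^ (3 * l) / 2) *\<^sub>R \<zeta>"

lemma norm_frq: "norm (frq l) = 2 ^ (3 * l) / 2"
  by (simp add: frq_def)

definition gl :: "nat \<Rightarrow> real^'n \<Rightarrow> real" where
  "gl l x = theta (x - pos l) * cos (frq l \<bullet> (x - pos l))"

definition Gl :: "nat \<Rightarrow> real^'n \<Rightarrow> complex" where
  "Gl l \<xi> = (1/2) * (cis (\<xi> \<bullet> - pos l) * (chi (\<xi> - frq l) + chi (\<xi> - - frq l)))"

lemma Gl_schwartz: "schwartz (Gl l)"
  unfolding Gl_def[abs_def] by (intro schwartz_cmult schwartz_cis schwartz_add schwartz_shift chi_schwartz)

lemma ft_Gl: "ft (Gl l) x = of_real (gl l x)"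
proof -
  note ci = schwartz_integrable[OF chi_schwartz]
  have "ft (Gl l) x = (1/2) * (cis (frq l \<bullet> (x - pos l)) * ft chi (x - pos l) + cis (- frq l \<bullet> (x - pos l)) * ft chi (x - pos l))"
    unfolding Gl_def[abs_def] ft_cmult ft_modulate
    by (subst ft_add) (auto simp: ft_shift[OF ci] ft_shift[OF ci, of "- frq l", simplified] intro!: schwartz_integrable schwartz_shift chi_schwartz schwartz_shift[of chi "- frq l", simplified])
  also have "\<dots> = of_real (gl l x)"
  proof -
    define z where "z = frq l \<bullet> (x - pos l)"
    have "(1/2) * (cis z * of_real (theta (x - pos l)) + cis (- z) * of_real (theta (x - pos l))) = complex_of_real (theta (x - pos l) * cos z)"
      by (simp add: complex_eq_iff)
    then show ?thesis by (simp add: gl_def of_real_theta z_def del: inner_diff_right)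
  qed
  finally show ?thesis .
qed

lemma Gl_zero:
  assumes "norm \<xi> > 2 ^ (3 * l)"
  shows "Gl l \<xi> = 0"
proof -
  have p: "(1::real) \<le> 2 ^ (3 * l)" by simp
  have "norm \<xi> \<le> norm (\<xi> - frq l) + norm (frq l)" using norm_triangle_ineq[of "\<xi> - frq l" "frq l"] by simp
  moreover have "norm \<xi> \<le> norm (\<xi> - - frq l) + norm (frq l)" using norm_triangle_ineq[of "\<xi> + frq l" "- frq l"] by simp
  ultimately have "norm (\<xi> - frq l) > 1/4" "norm (\<xi> - - frq l) > 1/4"
    using assms p unfolding norm_frq by linarith+
  then show ?thesis by (simp add: Gl_def chi_zero)
qed

lemma cnj_Gl: "cnj (Gl l (- \<xi>)) = Gl l \<xi>"
  using chi_minus[of "\<xi> + frq l"] chi_minus[of "\<xi> - frq l"]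
  by (simp add: Gl_def cis_cnj) (simp add: chi_def algebra_simps)

lemma integral_norm_Gl: "(LINT \<xi>|lborel. norm (Gl l \<xi>)) \<le> c0"
proof -
  have i: "integrable lborel (\<lambda>\<xi>. norm (chi (\<xi> - v)))" for v
    by (intro integrable_norm schwartz_integrable schwartz_shift chi_schwartz)
  have j: "(LINT \<xi>|lborel. norm (chi (\<xi> - v))) = c0" for v
    using integral_lborel_shift[OF integrable_norm[OF schwartz_integrable[OF chi_schwartz]], of v] integral_norm_chi by simp
  have "(LINT \<xi>|lborel. norm (Gl l \<xi>)) \<le> (LINT \<xi>|lborel. (1/2) * (norm (chi (\<xi> - frq l)) + norm (chi (\<xi> - - frq l))))"
  proof (rule integral_mono)
    show "integrable lborel (\<lambda>\<xi>. norm (Gl l \<xi>))" by (intro integrable_norm schwartz_integrable Gl_schwartz)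
    show "integrable lborel (\<lambda>\<xi>. (1/2) * (norm (chi (\<xi> - frq l)) + norm (chi (\<xi> - - frq l))))"
      by (intro integrable_mult_right Bochner_Integration.integrable_add i)
    show "norm (Gl l \<xi>) \<le> (1/2) * (norm (chi (\<xi> - frq l)) + norm (chi (\<xi> - - frq l)))" for \<xi>
      using norm_triangle_ineq[of "chi (\<xi> - frq l)" "chi (\<xi> - - frq l)"] by (simp add: Gl_def norm_mult)
  qed
  also have "\<dots> = (1/2) * (c0 + c0)"
    by (subst integral_mult_right_zero, subst Bochner_Integration.integral_add[OF i i]) (simp only: j)
  finally show ?thesis by simp
qed

lemma abs_gl_le: "\<bar>gl l x\<bar> \<le> Ct * (1 / (1 + \<bar>x $ a - real l\<bar>)\<^sup>2)"
proof -
  have "\<bar>gl l x\<bar> \<le> \<bar>theta (x - pos l)\<bar>" by (simp add: gl_def abs_mult mult_left_le)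
  also have "\<dots> \<le> Ct / (1 + norm (x - pos l))\<^sup>2"
  proof -
    have "0 < (1 + norm (x - pos l))\<^sup>2" by (intro zero_less_power add_pos_nonneg) auto
    then show ?thesis using theta_decay[of "x - pos l"] by (simp only: pos_le_divide_eq mult.commute)
  qed
  also have "\<dots> \<le> Ct / (1 + \<bar>x $ a - real l\<bar>)\<^sup>2"
  proof (intro divide_left_mono power_mono)
    show "1 + \<bar>x $ a - real l\<bar> \<le> 1 + norm (x - pos l)"
      using component_le_norm_cart[of "x - pos l" a] by (simp add: pos_def)
  qed (use Ct_pos in \<open>auto intro!: mult_pos_pos zero_less_power add_pos_nonneg\<close>)
  finally show ?thesis by simp
qed

text \<open>Bounds a building block relative to its frequency: \<open>4 * Ct\<close> stems from the
  amplitude, \<open>c0\<close> absorbs the terms of relative size \<rho> L /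
  \<open>kap k\<close>.\<close>

definition C1 :: real where "C1 = 4 * Ct + c0"

lemma C1_pos: "C1 > 0" using Ct_pos c0_pos by (simp add: C1_def)

text \<open>Constant in the distance between a solution and U: \<open>12 * c0\<close> for replacing
  the heat flow by scalar factors, \<open>32 * c0^2\<close> for the Duhamel term of U.\<close>

definition CA :: real where "CA = real CARD('n) * (12 * c0 + 32 * c0\<^sup>2)"

lemma CA_pos: "CA > 0" using c0_pos by (simp add: CA_def add_pos_pos)

text \<open>Half of the constant of the resonant term. The factor 1/64 in that term consists of 1/2
  from the mean of cos^2 and 1/32 from the product of two bumps; the other half is spent on
  errors.\<close>

definition c1 :: real where "c1 = (2 * pi) ^ CARD('n) * c0\<^sup>2 / 128"

lemma c1_pos: "c1 > 0" using c0_pos by (simp add: c1_def)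

end

locale inflation = bump \<phi> a b for \<phi> :: "real \<Rightarrow> real" and a b :: "'n::finite" +
  fixes L K :: nat
  assumes L: "L \<ge> 1" and K: "1 \<le> K" "K \<le> L"
begin

text \<open>Exceeds all frequencies of the amplitude, since 8^l = 2^(3 l) with l < 2 L. It is the
  unit in which the low frequencies are measured.\<close>

definition \<rho> :: real where "\<rho> = 2 ^ (6 * L)"

lemma rho_ge: "\<rho> \<ge> 64"
proof -
  have "(2::real) ^ 6 \<le> 2 ^ (6 * L)" using L by (intro power_increasing) auto
  then show ?thesis by (simp add: \<rho>_def)
qed

section \<open>The amplitude as a sum of modulated bumps\<close>

definition g :: "real^'n \<Rightarrow> real" where "g x = (\<Sum>l\<in>{L..<L+L}. gl l x)"

definition G :: "real^'n \<Rightarrow> complex" where "G \<xi> = (\<Sum>l\<in>{L..<L+L}. Gl l \<xi>)"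

lemma G_schwartz: "schwartz G"
  unfolding G_def[abs_def] by (intro schwartz_sum Gl_schwartz)

lemma ft_G: "ft G x = of_real (g x)"
  unfolding G_def[abs_def] by (subst ft_sum) (auto simp: ft_Gl g_def intro: schwartz_integrable Gl_schwartz)

lemma G_zero: "norm \<xi> > \<rho> \<Longrightarrow> G \<xi> = 0"
  unfolding G_def
proof (rule sum.neutral, rule ballI)
  fix l assume "norm \<xi> > \<rho>" "l \<in> {L..<L+L}"
  moreover from this have "(2::real) ^ (3 * l) \<le> \<rho>" unfolding \<rho>_def by (intro power_increasing) auto
  ultimately show "Gl l \<xi> = 0" by (intro Gl_zero) simp
qed

lemma cnj_G: "cnj (G (- \<xi>)) = G \<xi>"
  by (simp add: G_def cnj_Gl)

lemma integral_norm_G: "(LINT \<xi>|lborel. norm (G \<xi>)) \<le> real L * c0"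
proof -
  have i: "integrable lborel (\<lambda>\<xi>. norm (Gl l \<xi>))" for l by (intro integrable_norm schwartz_integrable Gl_schwartz)
  have "(LINT \<xi>|lborel. norm (G \<xi>)) \<le> (LINT \<xi>|lborel. (\<Sum>l\<in>{L..<L+L}. norm (Gl l \<xi>)))"
  proof (rule integral_mono)
    show "integrable lborel (\<lambda>\<xi>. norm (G \<xi>))" by (intro integrable_norm schwartz_integrable G_schwartz)
    show "integrable lborel (\<lambda>\<xi>. \<Sum>l\<in>{L..<L+L}. norm (Gl l \<xi>))" by (intro Bochner_Integration.integrable_sum i)
    show "norm (G \<xi>) \<le> (\<Sum>l\<in>{L..<L+L}. norm (Gl l \<xi>))" for \<xi> unfolding G_def by (rule norm_sum)
  qed
  also have "\<dots> = (\<Sum>l\<in>{L..<L+L}. (LINT \<xi>|lborel. norm (Gl l \<xi>)))" by (rule Bochner_Integration.integral_sum) (rule i)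
  also have "\<dots> \<le> (\<Sum>l\<in>{L..<L+L}. c0)" by (intro sum_mono integral_norm_Gl)
  finally show ?thesis by simp
qed

lemma abs_g_le: "\<bar>g x\<bar> \<le> 4 * Ct"
proof -
  have "\<bar>g x\<bar> \<le> (\<Sum>l\<in>{L..<L+L}. Ct * (1 / (1 + \<bar>x $ a - real l\<bar>)\<^sup>2))"
    unfolding g_def by (intro order_trans[OF sum_abs] sum_mono abs_gl_le)
  also have "\<dots> = Ct * (\<Sum>l\<in>{L..<L+L}. 1 / (1 + \<bar>x $ a - real l\<bar>)\<^sup>2)" by (simp only: sum_distrib_left)
  also have "\<dots> \<le> Ct * 4" using Ct_pos by (intro mult_left_mono sum_inverse_square_le) auto
  finally show ?thesis by simp
qed

section \<open>High-frequency building blocks and their size\<close>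

definition kap :: "nat \<Rightarrow> real" where "kap k = 2 ^ k"

definition ks :: "nat set" where "ks = {100 * L + 1..<100 * L + 1 + K}"

lemma finite_ks [simp]: "finite ks" by (simp add: ks_def)

lemma card_ks [simp]: "card ks = K" by (simp add: ks_def)

lemma kap_pos [simp]: "kap k > 0" by (simp add: kap_def)

lemma kap_square: "(kap k)\<^sup>2 = 4 ^ k"
  by (simp add: kap_def power2_eq_square flip: power_mult_distrib)

text \<open>The gap between the exponents 6 L and 100 L also absorbs the factor L \<le> 2^L, and 64
  \<le> \<rho>. Every later separation of high from low frequencies rests on this.\<close>

lemma rho_kap:
  assumes "k \<in> ks"
  shows "\<rho> * real L * 64 \<le> kap k" and "\<rho> * 64 \<le> kap k"
proof -
  have "real L \<le> 2 ^ L" by (simp add: of_nat_less_two_power less_imp_le)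
  then have "\<rho> * real L * 64 \<le> 2 ^ (6 * L) * 2 ^ L * 2 ^ (6 * L)"
    using rho_ge by (intro mult_mono) (auto simp: \<rho>_def)
  also have "\<dots> = 2 ^ (13 * L)" by (simp flip: power_add)
  also have "\<dots> \<le> kap k" unfolding kap_def using assms by (intro power_increasing) (auto simp: ks_def)
  finally show 1: "\<rho> * real L * 64 \<le> kap k" .
  have "\<rho> * 1 * 64 \<le> \<rho> * real L * 64" using L rho_ge by (intro mult_mono) auto
  then show "\<rho> * 64 \<le> kap k" using 1 by simp
qed

text \<open>Frequency side of the stream function g(x) sin (\<open>kap k\<close> x_a): the sine
  becomes a difference of two shifts of G.\<close>

definition Psi :: "nat \<Rightarrow> real^'n \<Rightarrow> complex" where
  "Psi k \<xi> = (1 / (2 * \<i>)) * (G (\<xi> - kap k *\<^sub>R e1) + (-1) * G (\<xi> - (- kap k *\<^sub>R e1)))"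

lemma Psi_schwartz: "schwartz (Psi k)"
  unfolding Psi_def[abs_def] by (intro schwartz_cmult schwartz_add schwartz_shift G_schwartz)

lemma Psi_support:
  assumes "Psi k \<xi> \<noteq> 0"
  shows "norm (\<xi> - kap k *\<^sub>R e1) \<le> \<rho> \<or> norm (\<xi> + kap k *\<^sub>R e1) \<le> \<rho>"
  using assms G_zero[of "\<xi> - kap k *\<^sub>R e1"] G_zero[of "\<xi> + kap k *\<^sub>R e1"] unfolding Psi_def by fastforce

lemma Psi_norm:
  assumes "Psi k \<xi> \<noteq> 0"
  shows "kap k - \<rho> \<le> norm \<xi>" "norm \<xi> \<le> kap k + \<rho>" "\<bar>\<xi> $ b\<bar> \<le> \<rho>"
proof -
  have n: "norm (kap k *\<^sub>R e1) = kap k" by (simp add: less_imp_le)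
  from Psi_support[OF assms] have "kap k - \<rho> \<le> norm \<xi> \<and> norm \<xi> \<le> kap k + \<rho> \<and> \<bar>\<xi> $ b\<bar> \<le> \<rho>"
  proof
    assume h: "norm (\<xi> - kap k *\<^sub>R e1) \<le> \<rho>"
    have "\<bar>\<xi> $ b\<bar> \<le> \<rho>" using component_le_norm_cart[of "\<xi> - kap k *\<^sub>R e1" b] h ab by (simp add: e1_def axis_def)
    then show ?thesis
      using h n norm_triangle_ineq2[of \<xi> "kap k *\<^sub>R e1"] norm_triangle_ineq2[of "kap k *\<^sub>R e1" \<xi>]
      by (simp add: norm_minus_commute)
  next
    assume h: "norm (\<xi> + kap k *\<^sub>R e1) \<le> \<rho>"
    have "\<bar>\<xi> $ b\<bar> \<le> \<rho>" using component_le_norm_cart[of "\<xi> + kap k *\<^sub>R e1" b] h ab by (simp add: e1_def axis_def)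
    then show ?thesis
      using h n norm_triangle_ineq2[of \<xi> "- kap k *\<^sub>R e1"] norm_triangle_ineq2[of "- kap k *\<^sub>R e1" \<xi>]
      by (simp add: norm_minus_commute)
  qed
  then show "kap k - \<rho> \<le> norm \<xi>" "norm \<xi> \<le> kap k + \<rho>" "\<bar>\<xi> $ b\<bar> \<le> \<rho>" by auto
qed

lemma cnj_Psi: "cnj (Psi k (- \<xi>)) = Psi k \<xi>"
proof -
  have "cnj (G (- \<xi> - kap k *\<^sub>R e1)) = G (\<xi> + kap k *\<^sub>R e1)" "cnj (G (kap k *\<^sub>R e1 - \<xi>)) = G (\<xi> - kap k *\<^sub>R e1)"
    using cnj_G[of "\<xi> + kap k *\<^sub>R e1"] cnj_G[of "\<xi> - kap k *\<^sub>R e1"] by simp_all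
  then show ?thesis by (simp add: Psi_def algebra_simps)
qed

lemma integral_norm_Psi: "(LINT \<xi>|lborel. norm (Psi k \<xi>)) \<le> real L * c0"
proof -
  have i: "integrable lborel (\<lambda>\<xi>. norm (G (\<xi> - v)))" for v
    by (intro integrable_norm schwartz_integrable schwartz_shift G_schwartz)
  have j: "(LINT \<xi>|lborel. norm (G (\<xi> - v))) \<le> real L * c0" for v
    using integral_lborel_shift[OF integrable_norm[OF schwartz_integrable[OF G_schwartz]], of v] integral_norm_G by simp
  have "(LINT \<xi>|lborel. norm (Psi k \<xi>)) \<le> (LINT \<xi>|lborel. (1/2) * (norm (G (\<xi> - kap k *\<^sub>R e1)) + norm (G (\<xi> - (- kap k *\<^sub>R e1)))))"
  proof (rule integral_mono)
    show "integrable lborel (\<lambda>\<xi>. norm (Psi k \<xi>))" by (intro integrable_norm schwartz_integrable Psi_schwartz)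
    show "integrable lborel (\<lambda>\<xi>. (1/2) * (norm (G (\<xi> - kap k *\<^sub>R e1)) + norm (G (\<xi> - (- kap k *\<^sub>R e1)))))"
      by (intro integrable_mult_right Bochner_Integration.integrable_add i)
    show "norm (Psi k \<xi>) \<le> (1/2) * (norm (G (\<xi> - kap k *\<^sub>R e1)) + norm (G (\<xi> - (- kap k *\<^sub>R e1))))" for \<xi>
      using norm_triangle_ineq4[of "G (\<xi> - kap k *\<^sub>R e1)" "G (\<xi> - (- kap k *\<^sub>R e1))"] by (simp add: Psi_def norm_mult norm_divide)
  qed
  also have "\<dots> = (1/2) * ((LINT \<xi>|lborel. norm (G (\<xi> - kap k *\<^sub>R e1))) + (LINT \<xi>|lborel. norm (G (\<xi> - (- kap k *\<^sub>R e1)))))"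
    by (subst integral_mult_right_zero, subst Bochner_Integration.integral_add[OF i i]) simp
  also have "\<dots> \<le> (1/2) * (real L * c0 + real L * c0)" by (intro mult_left_mono add_mono j) auto
  finally show ?thesis by simp
qed

text \<open>Symbol of the rotated gradient (- \<partial>_b, \<partial>_a) in the plane of the axes a
  and b. It is orthogonal to \<xi>, hence the fields are divergence free in every dimension.\<close>

definition perp :: "'n \<Rightarrow> real^'n \<Rightarrow> complex" where
  "perp i \<xi> = (if i = a then - \<i> * of_real (\<xi> $ b) else if i = b then \<i> * of_real (\<xi> $ a) else 0)"

definition V :: "nat \<Rightarrow> 'n \<Rightarrow> real^'n \<Rightarrow> complex" where "V k i \<xi> = perp i \<xi> * Psi k \<xi>"

definition v :: "nat \<Rightarrow> real^'n \<Rightarrow> real^'n" where "v k x = (\<chi> i. Re (ft (V k i) x))"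

lemma V_schwartz: "schwartz (V k i)"
proof -
  have "schwartz (\<lambda>\<xi>. c * (of_real (\<xi> $ j) * Psi k \<xi>))" for c j by (intro schwartz_cmult schwartz_coord Psi_schwartz)
  note s = this[of "- \<i>" b] this[of "\<i>" a]
  consider "i = a" | "i = b" | "i \<noteq> a" "i \<noteq> b" by blast
  then show ?thesis
  proof cases
    case 1
    then show ?thesis using s(1) unfolding V_def[abs_def] perp_def by (simp add: mult.assoc)
  next
    case 2
    then show ?thesis using s(2) ab unfolding V_def[abs_def] perp_def by (simp add: mult.assoc)
  next
    case 3
    then show ?thesis using schwartz_zero unfolding V_def[abs_def] perp_def by simp
  qed
qed

lemma norm_perp_le: "norm (perp i \<xi>) \<le> norm \<xi>"
  using component_le_norm_cart[of \<xi> a] component_le_norm_cart[of \<xi> b] by (simp add: perp_def norm_mult)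

lemma norm_V_le:
  assumes "k \<in> ks"
  shows "norm (V k i \<xi>) \<le> 2 * kap k * norm (Psi k \<xi>)"
proof (cases "Psi k \<xi> = 0")
  case False
  have "norm \<xi> \<le> 2 * kap k" using Psi_norm(2)[OF False] rho_kap[OF assms] rho_ge by linarith
  then show ?thesis unfolding V_def norm_mult by (intro mult_right_mono order_trans[OF norm_perp_le]) auto
qed (simp add: V_def)

lemma of_real_v: "of_real (v k x $ i) = ft (V k i) x"
proof -
  have "cnj (V k i (- \<xi>)) = V k i \<xi>" for \<xi>
    unfolding V_def complex_cnj_mult cnj_Psi by (simp add: perp_def)
  then have "cnj (ft (V k i) x) = ft (V k i) x" by (simp only: cnj_ft[OF schwartz_integrable[OF V_schwartz]])
  then show ?thesis by (simp add: v_def Reals_cnj_iff)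
qed

lemma v_other: "i \<noteq> a \<Longrightarrow> i \<noteq> b \<Longrightarrow> v k x $ i = 0"
  by (simp add: v_def V_def perp_def ft_def)

text \<open>The multiplier is estimated through the product with f, that is, only on the support of
  f; all frequency localised bounds come from here. If the product is not integrable, its transform
  is 0 by the convention for integrals.\<close>

lemma norm_ft_le_support:
  assumes f: "schwartz f" and B: "\<And>\<xi>. norm (m \<xi> * f \<xi>) \<le> B * norm (f \<xi>)"
  shows "norm (ft (\<lambda>\<xi>. m \<xi> * f \<xi>) x) \<le> B * (LINT \<xi>|lborel. norm (f \<xi>))"
proof (cases "integrable lborel (\<lambda>\<xi>. m \<xi> * f \<xi>)")
  case True
  have "norm (ft (\<lambda>\<xi>. m \<xi> * f \<xi>) x) \<le> (LINT \<xi>|lborel. norm (m \<xi> * f \<xi>))" by (rule norm_ft_le)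
  also have "\<dots> \<le> (LINT \<xi>|lborel. B * norm (f \<xi>))"
    by (intro integral_mono[OF integrable_norm[OF True]] B integrable_mult_right integrable_norm schwartz_integrable f)
  finally show ?thesis by simp
next
  case False
  have "\<not> integrable lborel (\<lambda>\<xi>. cis (\<xi> \<bullet> x) * (m \<xi> * f \<xi>))"
  proof
    assume "integrable lborel (\<lambda>\<xi>. cis (\<xi> \<bullet> x) * (m \<xi> * f \<xi>))"
    from integrable_cis_mult[OF this, of "- x"] show False using False
      by (simp add: mult.assoc[symmetric] cis_mult)
  qed
  then have z: "ft (\<lambda>\<xi>. m \<xi> * f \<xi>) x = 0" unfolding ft_def by (rule not_integrable_integral_eq)
  have "0 \<le> (LINT \<xi>|lborel. B * norm (f \<xi>))"
    by (rule integral_nonneg_AE) (use order_trans[OF norm_ge_zero B] in auto)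
  then show ?thesis unfolding z by simp
qed

text \<open>This component carries the factor \<xi>_b. The spectrum lies within \<rho> of the points
  \<plusminus> \<open>kap k\<close> times \<open>e1\<close>, which have no b-coordinate, so no power
  of \<open>kap k\<close> appears.\<close>

lemma abs_v_a_le: "\<bar>v k x $ a\<bar> \<le> \<rho> * (real L * c0)"
proof -
  have "\<bar>v k x $ a\<bar> = norm (ft (V k a) x)" by (simp add: of_real_v[symmetric])
  also have "\<dots> \<le> \<rho> * (LINT \<xi>|lborel. norm (Psi k \<xi>))"
    unfolding V_def[abs_def]
  proof (rule norm_ft_le_support[OF Psi_schwartz])
    show "norm (perp a \<xi> * Psi k \<xi>) \<le> \<rho> * norm (Psi k \<xi>)" for \<xi>
      using Psi_norm(3)[of k \<xi>] by (cases "Psi k \<xi> = 0") (auto simp: perp_def norm_mult intro!: mult_right_mono)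
  qed
  also have "\<dots> \<le> \<rho> * (real L * c0)" using rho_ge by (intro mult_left_mono integral_norm_Psi) auto
  finally show ?thesis .
qed

definition Ga :: "real^'n \<Rightarrow> complex" where "Ga \<xi> = \<i> * (of_real (\<xi> $ a) * G \<xi>)"

lemma Ga_schwartz: "schwartz Ga"
  unfolding Ga_def[abs_def] by (intro schwartz_cmult schwartz_coord G_schwartz)

lemma norm_ft_Ga_le: "norm (ft Ga x) \<le> \<rho> * (real L * c0)"
proof -
  have "norm (ft (\<lambda>\<xi>. (\<i> * of_real (\<xi> $ a)) * G \<xi>) x) \<le> \<rho> * (LINT \<xi>|lborel. norm (G \<xi>))"
  proof (rule norm_ft_le_support[OF G_schwartz])
    fix \<xi>
    show "norm (\<i> * of_real (\<xi> $ a) * G \<xi>) \<le> \<rho> * norm (G \<xi>)"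
    proof (cases "G \<xi> = 0")
      case False
      then have "norm \<xi> \<le> \<rho>" using G_zero[of \<xi>] by fastforce
      then have "\<bar>\<xi> $ a\<bar> \<le> \<rho>" using component_le_norm_cart[of \<xi> a] by linarith
      then show ?thesis by (simp add: norm_mult mult_right_mono)
    qed simp
  qed
  also have "\<dots> \<le> \<rho> * (real L * c0)" using rho_ge by (intro mult_left_mono integral_norm_G) auto
  finally show ?thesis by (simp add: Ga_def[abs_def] mult.assoc)
qed

text \<open>The product rule for the derivative of g sin (\<open>kap k\<close> x_a) along the axis
  a, carried out on the frequency side; \<open>ft Ga\<close> is the derivative of g.\<close>

lemma v_b_eq:
  "of_real (v k x $ b) = of_real (kap k * g x * cos (kap k * x $ a)) + ft Ga x * of_real (sin (kap k * x $ a))"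
proof -
  define w where "w = kap k *\<^sub>R e1"
  have wx: "w \<bullet> x = kap k * x $ a" by (simp add: w_def e1_def inner_axis')
  have wa: "w $ a = kap k" by (simp add: w_def)
  have V: "V k b = (\<lambda>\<xi>. (1 / (2 * \<i>)) * ((Ga (\<xi> - w) + (\<i> * of_real (kap k)) * G (\<xi> - w)) + (-1) * (Ga (\<xi> - (- w)) + (- (\<i> * of_real (kap k))) * G (\<xi> - (- w)))))"
    using ab by (rule_tac ext) (simp add: V_def perp_def Psi_def Ga_def w_def[symmetric] wa algebra_simps)
  note i = schwartz_integrable[OF schwartz_shift[OF Ga_schwartz]] schwartz_integrable[OF schwartz_shift[OF G_schwartz]]
  have "ft (V k b) x = (1 / (2 * \<i>)) * ((cis (w \<bullet> x) * ft Ga x + (\<i> * of_real (kap k)) * (cis (w \<bullet> x) * of_real (g x))) + (-1) * (cis (- w \<bullet> x) * ft Ga x + (- (\<i> * of_real (kap k))) * (cis (- w \<bullet> x) * of_real (g x))))"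
    unfolding V ft_cmult
    by (subst ft_add, (intro i Bochner_Integration.integrable_add integrable_mult_right)+, subst ft_add, (intro i integrable_mult_right)+,
        subst ft_cmult, subst ft_cmult, subst ft_add, (intro i integrable_mult_right)+, subst ft_cmult,
        simp only: ft_shift[OF schwartz_integrable[OF Ga_schwartz]] ft_shift[OF schwartz_integrable[OF G_schwartz]] ft_G)
  also have "\<dots> = of_real (kap k * g x * cos (kap k * x $ a)) + ft Ga x * of_real (sin (kap k * x $ a))"
  proof -
    have "(cis (w \<bullet> x) * ft Ga x + (\<i> * of_real (kap k)) * (cis (w \<bullet> x) * of_real (g x))) + (-1) * (cis (- w \<bullet> x) * ft Ga x + (- (\<i> * of_real (kap k))) * (cis (- w \<bullet> x) * of_real (g x))) =
      (2 * \<i>) * (of_real (kap k * g x * cos (kap k * x $ a)) + ft Ga x * of_real (sin (kap k * x $ a)))"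
      unfolding wx inner_minus_left by (simp add: complex_eq_iff algebra_simps)
    then show ?thesis by (simp only:) simp
  qed
  finally show ?thesis by (simp add: of_real_v)
qed

lemma v_b_approx: "\<bar>v k x $ b - kap k * g x * cos (kap k * x $ a)\<bar> \<le> \<rho> * (real L * c0)"
proof -
  have "complex_of_real (v k x $ b - kap k * g x * cos (kap k * x $ a)) = ft Ga x * of_real (sin (kap k * x $ a))"
    using v_b_eq[of k x] by simp
  then have "\<bar>v k x $ b - kap k * g x * cos (kap k * x $ a)\<bar> = norm (ft Ga x) * \<bar>sin (kap k * x $ a)\<bar>"
    by (metis norm_mult norm_of_real)
  also have "\<dots> \<le> norm (ft Ga x) * 1" by (intro mult_left_mono) auto
  finally show ?thesis using norm_ft_Ga_le[of x] by simp
qed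

text \<open>Only the cosine term of the b-component is of order \<open>kap k\<close>, and its
  amplitude is bounded by \<open>4 * Ct\<close> independently of L. A bound through the integral of
  the transform would lose a factor L.\<close>

lemma norm_v_le:
  assumes "k \<in> ks"
  shows "norm (v k x) \<le> C1 * kap k" and "\<bar>v k x $ b\<bar> \<le> C1 * kap k"
proof -
  have r: "\<rho> * (real L * c0) \<le> kap k * c0 / 64"
    using mult_right_mono[OF rho_kap(1)[OF assms], of c0] c0_pos by (simp add: mult_ac)
  have "\<bar>kap k * g x * cos (kap k * x $ a)\<bar> \<le> kap k * \<bar>g x\<bar> * 1"
    unfolding abs_mult by (intro mult_mono) (auto simp: less_imp_le)
  also have "\<dots> \<le> kap k * (4 * Ct)" using abs_g_le[of x] by (simp add: mult_left_mono)
  finally have vb: "\<bar>v k x $ b\<bar> \<le> kap k * (4 * Ct) + kap k * c0 / 64" using v_b_approx[of k x] r by linarith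
  have kc: "kap k * c0 > 0" using c0_pos by simp
  show "\<bar>v k x $ b\<bar> \<le> C1 * kap k" using vb kc unfolding C1_def by (simp add: algebra_simps)
  have "norm (v k x) \<le> (\<Sum>i\<in>UNIV. \<bar>v k x $ i\<bar>)" by (rule norm_le_l1_cart)
  also have "\<dots> = (\<Sum>i\<in>{a, b}. \<bar>v k x $ i\<bar>)" by (rule sum.mono_neutral_right) (auto simp: v_other)
  also have "\<dots> = \<bar>v k x $ a\<bar> + \<bar>v k x $ b\<bar>" using ab by simp
  also have "\<dots> \<le> C1 * kap k" using vb abs_v_a_le[of k x] r kc unfolding C1_def by (simp add: algebra_simps)
  finally show "norm (v k x) \<le> C1 * kap k" .
qed

lemma v_measurable [measurable]: "v k \<in> borel_measurable borel"
proof -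
  have [measurable]: "ft (V k i) \<in> borel_measurable borel" for i using schwartz_ft_integrable[OF V_schwartz] by auto
  show ?thesis unfolding v_def[abs_def] by measurable
qed

end

lemma integral_norm_le':
  fixes f :: "'a \<Rightarrow> 'b::{banach, second_countable_topology}"
  assumes "integrable M g" "\<And>x. norm (f x) \<le> g x"
  shows "norm (integral\<^sup>L M f) \<le> integral\<^sup>L M g"
proof (cases "integrable M f")
  case True
  then show ?thesis using assms by (rule integral_norm_le)
next
  case False
  have "0 \<le> integral\<^sup>L M g" by (rule integral_nonneg_AE) (use order_trans[OF norm_ge_zero assms(2)] in auto)
  then show ?thesis using not_integrable_integral_eq[OF False] by simp
qed

lemma heat_semigroup_component:
  fixes f :: "real^'n \<Rightarrow> real^'m"
  assumes t: "t > 0" and [measurable]: "f \<in> borel_measurable borel" and B: "\<And>y. norm (f y) \<le> B"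
    and F: "integrable lborel F" "\<And>y. of_real (f y $ i) = ft F y"
  shows "of_real (heat_semigroup t f x $ i) = ft (\<lambda>\<xi>. of_real (exp (- t * (norm \<xi>)\<^sup>2)) * F \<xi>) x"
proof -
  note K = integrable_lborel_reflect[OF heat_kernel_integrable[OF t, where 'n='n], of x]
  have I: "integrable lborel (\<lambda>y. heat_kernel t (x - y) *\<^sub>R f y)"
  proof (rule Bochner_Integration.integrable_bound)
    show "integrable lborel (\<lambda>y. heat_kernel t (x - y) * B)" using K by simp
    show "AE y in lborel. norm (heat_kernel t (x - y) *\<^sub>R f y) \<le> norm (heat_kernel t (x - y) * B)"
      using B heat_kernel_nonneg[OF t] by (intro AE_I2) (auto simp: abs_mult intro!: mult_left_mono order_trans[OF _ abs_ge_self])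
  qed (use K in measurable)
  have "heat_semigroup t f x = (LINT y|lborel. heat_kernel t (x - y) *\<^sub>R f y)"
    unfolding heat_semigroup_def heat_kernel_def by simp
  then have "heat_semigroup t f x $ i = (LINT y|lborel. heat_kernel t (x - y) * f y $ i)"
    by (simp add: integral_bounded_linear[OF bounded_linear_vec_nth I, symmetric])
  then have "complex_of_real (heat_semigroup t f x $ i) = (LINT y|lborel. complex_of_real (heat_kernel t (x - y) * f y $ i))"
    by (simp only: integral_complex_of_real)
  also have "\<dots> = (LINT y|lborel. of_real (heat_kernel t (x - y)) * ft F y)" by (simp add: F(2))
  also have "\<dots> = ft (\<lambda>\<xi>. of_real (exp (- t * (norm \<xi>)\<^sup>2)) * F \<xi>) x" by (rule heat_ft[OF t F(1)])
  finally show ?thesis .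
qed

lemma mult_exp_minus_le_1: "(x::real) * exp (- x) \<le> 1"
proof -
  have "x \<le> exp x" using exp_ge_add_one_self[of x] by linarith
  then show ?thesis by (simp add: exp_minus field_simps)
qed

text \<open>The derivative of exp (- s A) in A is at most s exp (- s m) in modulus, and s m exp (- s
  m) \<le> 1; so the bound is uniform in the time s.\<close>

lemma abs_exp_diff_le:
  fixes A B m s :: real
  assumes s: "s \<ge> 0" and m: "m > 0" "m \<le> A" "m \<le> B"
  shows "\<bar>exp (- s * A) - exp (- s * B)\<bar> \<le> \<bar>A - B\<bar> / m"
proof -
  have *: "exp (- s * A) - exp (- s * B) \<le> (B - A) / m" if "A \<le> B" "m \<le> A" for A B
  proof -
    have "exp (- s * B) = exp (- s * A) * exp (- (s * (B - A)))" by (simp add: exp_add[symmetric] algebra_simps)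
    then have "exp (- s * A) - exp (- s * B) = exp (- s * A) * (1 - exp (- (s * (B - A))))" by (simp add: algebra_simps)
    also have "\<dots> \<le> exp (- s * m) * (s * (B - A))"
    proof (intro mult_mono)
      show "exp (- s * A) \<le> exp (- s * m)" using s that by (simp add: mult_left_mono)
      show "1 - exp (- (s * (B - A))) \<le> s * (B - A)" using exp_ge_add_one_self[of "- (s * (B - A))"] by simp
    qed (use s that in auto)
    also have "\<dots> = (s * m * exp (- (s * m))) * ((B - A) / m)" using m by simp
    also have "\<dots> \<le> 1 * ((B - A) / m)" using that m by (intro mult_right_mono mult_exp_minus_le_1) auto
    finally show ?thesis by simp
  qed
  show ?thesis
  proof (cases "A \<le> B")
    case True
    then have "exp (- s * B) \<le> exp (- s * A)" using s by (simp add: mult_left_mono)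
    then show ?thesis using *[of A B] True m by simp
  next
    case False
    then have "exp (- s * A) \<le> exp (- s * B)" using s by (simp add: mult_left_mono)
    then show ?thesis using *[of B A] False m by simp
  qed
qed

lemma exp_interval_integral_le:
  fixes c s :: real
  assumes c: "c > 0"
  shows "integrable lborel (\<lambda>\<tau>. indicator {0<..<s} \<tau> * exp (- c * \<tau>))"
    and "(LINT \<tau>|lborel. indicator {0<..<s} \<tau> * exp (- c * \<tau>)) \<le> 1 / c"
proof -
  have h: "has_bochner_integral lborel (\<lambda>\<tau>. indicator {0..} \<tau> * exp (- \<tau> * c)) (1 / c)"
    using has_bochner_integral_exp_tail[OF c, of 0] by simp
  show i: "integrable lborel (\<lambda>\<tau>. indicator {0<..<s} \<tau> * exp (- c * \<tau>))"
    by (rule Bochner_Integration.integrable_bound[of lborel "\<lambda>\<tau>. indicator {0..} \<tau> * exp (- \<tau> * c)"])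
       (use h in \<open>auto simp: has_bochner_integral_iff indicator_def mult.commute\<close>)
  have "(LINT \<tau>|lborel. indicator {0<..<s} \<tau> * exp (- c * \<tau>)) \<le> (LINT \<tau>|lborel. indicator {0..} \<tau> * exp (- \<tau> * c))"
    by (rule integral_mono[OF i]) (use h in \<open>auto simp: has_bochner_integral_iff indicator_def mult.commute\<close>)
  then show "(LINT \<tau>|lborel. indicator {0<..<s} \<tau> * exp (- c * \<tau>)) \<le> 1 / c"
    using h by (simp add: has_bochner_integral_iff)
qed

section \<open>The explicit field and its defect in the integral equation\<close>

context inflation
begin

definition v0 :: "real \<Rightarrow> real^'n \<Rightarrow> real^'n" where "v0 \<alpha> x = \<alpha> *\<^sub>R (\<Sum>k\<in>ks. v k x)"

text \<open>The factors \<open>exp (- (kap k)\<^sup>2 \<tau>)\<close> differ from the heat flow of \<open>v k\<close>, but keep the amplitude \<open>g\<close> common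
  to all \<open>k\<close> at all times; the error is controlled since the spectrum of \<open>v k\<close> is close to \<open>\<plusminus> kap k e1\<close>.\<close>

definition cf :: "real \<Rightarrow> real \<Rightarrow> nat \<Rightarrow> real" where "cf \<alpha> \<tau> k = \<alpha> * exp (- (kap k)\<^sup>2 * max 0 \<tau>)"

definition U :: "real \<Rightarrow> real \<Rightarrow> real^'n \<Rightarrow> real^'n" where "U \<alpha> \<tau> x = (\<Sum>k\<in>ks. cf \<alpha> \<tau> k *\<^sub>R v k x)"

lemma U_component: "U \<alpha> \<tau> x $ i = (\<Sum>k\<in>ks. cf \<alpha> \<tau> k * v k x $ i)"
  by (simp add: U_def)

lemma U_measurable: "(\<lambda>z. U \<alpha> (fst z) (snd z)) \<in> borel_measurable (borel \<Otimes>\<^sub>M borel)"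
  unfolding U_def cf_def by measurable

lemma norm_U_le_sum:
  assumes "\<alpha> \<ge> 0"
  shows "norm (U \<alpha> \<tau> x) \<le> (\<Sum>k\<in>ks. cf \<alpha> \<tau> k * (C1 * kap k))"
  unfolding U_def
proof (rule sum_norm_le)
  fix k assume k: "k \<in> ks"
  have c: "cf \<alpha> \<tau> k \<ge> 0" using assms by (simp add: cf_def)
  show "norm (cf \<alpha> \<tau> k *\<^sub>R v k x) \<le> cf \<alpha> \<tau> k * (C1 * kap k)"
    using mult_left_mono[OF norm_v_le(1)[OF k] c] c by simp
qed

text \<open>The blocks have size \<open>kap k\<close> and die at time \<open>kap k\<close>^(-2), so
  at each time the sum is dominated by the block with \<open>kap k\<close> near 1 / sqrt \<tau>. The
  constant is independent of L and K; this smallness for small \<alpha> drives the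
  bootstrap.\<close>

lemma norm_U_le:
  assumes "\<alpha> \<ge> 0" "\<tau> > 0"
  shows "norm (U \<alpha> \<tau> x) \<le> (4 * C1 * \<alpha>) / sqrt \<tau>"
proof -
  have "norm (U \<alpha> \<tau> x) \<le> (\<Sum>k\<in>ks. cf \<alpha> \<tau> k * (C1 * kap k))" by (rule norm_U_le_sum[OF assms(1)])
  also have "\<dots> = \<alpha> * C1 * (\<Sum>k\<in>ks. 2 ^ k * exp (- (4 ^ k) * \<tau>))"
    unfolding sum_distrib_left cf_def kap_square using assms by (simp add: kap_def mult_ac)
  also have "\<dots> \<le> \<alpha> * C1 * (4 / sqrt \<tau>)"
    unfolding ks_def using assms C1_pos by (intro mult_left_mono sum_dyadic_exp_le) auto
  finally show ?thesis by (simp add: mult_ac)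
qed

text \<open>A bound that is uniform in time but grows with L; it serves only integrability and
  Fubini.\<close>

definition UB :: "real \<Rightarrow> real" where "UB \<alpha> = (\<Sum>k\<in>ks. \<alpha> * (C1 * kap k))"

lemma norm_U_le_UB:
  assumes "\<alpha> \<ge> 0"
  shows "norm (U \<alpha> \<tau> x) \<le> UB \<alpha>"
proof -
  have "(\<Sum>k\<in>ks. cf \<alpha> \<tau> k * (C1 * kap k)) \<le> UB \<alpha>"
    unfolding UB_def
  proof (rule sum_mono)
    fix k
    have "cf \<alpha> \<tau> k \<le> \<alpha>" using assms by (simp add: cf_def mult_left_le)
    then show "cf \<alpha> \<tau> k * (C1 * kap k) \<le> \<alpha> * (C1 * kap k)"
      using C1_pos by (intro mult_right_mono) (auto simp: less_imp_le)
  qed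
  then show ?thesis using norm_U_le_sum[OF assms, of \<tau> x] by linarith
qed

lemma v0_measurable [measurable]: "v0 \<alpha> \<in> borel_measurable borel"
  unfolding v0_def[abs_def] by measurable

lemma norm_v0_le: "\<alpha> \<ge> 0 \<Longrightarrow> norm (v0 \<alpha> x) \<le> UB \<alpha>"
  using norm_U_le_UB[of \<alpha> 0 x] by (simp add: U_def v0_def cf_def scaleR_sum_right)

lemma of_real_v0: "of_real (v0 \<alpha> x $ i) = ft (\<lambda>\<xi>. \<Sum>k\<in>ks. of_real \<alpha> * V k i \<xi>) x"
  by (subst ft_sum) (auto simp: ft_cmult of_real_v[symmetric] v0_def sum_distrib_left intro!: integrable_mult_right[OF schwartz_integrable[OF V_schwartz]])

lemma integrable_exp_V: "s \<ge> 0 \<Longrightarrow> integrable lborel (\<lambda>\<xi>. of_real (exp (- s * (norm \<xi>)\<^sup>2)) * V k i \<xi>)"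
proof -
  assume s: "s \<ge> 0"
  have [measurable]: "V k i \<in> borel_measurable borel" using V_schwartz by measurable
  show ?thesis
    by (rule Bochner_Integration.integrable_bound[OF schwartz_integrable[OF V_schwartz[of k i]]])
       (use s in \<open>auto simp: norm_mult mult_right_le_one_le mult_left_le_one_le\<close>)
qed

lemma heat_v0_component:
  assumes "s > 0" "\<alpha> \<ge> 0"
  shows "of_real (heat_semigroup s (v0 \<alpha>) x $ i) = (\<Sum>k\<in>ks. of_real \<alpha> * ft (\<lambda>\<xi>. of_real (exp (- s * (norm \<xi>)\<^sup>2)) * V k i \<xi>) x)"
proof -
  have F: "integrable lborel (\<lambda>\<xi>. \<Sum>k\<in>ks. of_real \<alpha> * V k i \<xi>)"
    by (intro Bochner_Integration.integrable_sum integrable_mult_right schwartz_integrable V_schwartz)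
  have "of_real (heat_semigroup s (v0 \<alpha>) x $ i) = ft (\<lambda>\<xi>. of_real (exp (- s * (norm \<xi>)\<^sup>2)) * (\<Sum>k\<in>ks. of_real \<alpha> * V k i \<xi>)) x"
    by (rule heat_semigroup_component[OF assms(1) v0_measurable norm_v0_le[OF assms(2)] F of_real_v0])
  also have "(\<lambda>\<xi>. of_real (exp (- s * (norm \<xi>)\<^sup>2)) * (\<Sum>k\<in>ks. of_real \<alpha> * V k i \<xi>)) =
    (\<lambda>\<xi>. \<Sum>k\<in>ks. of_real \<alpha> * (of_real (exp (- s * (norm \<xi>)\<^sup>2)) * V k i \<xi>))"
    by (simp add: sum_distrib_left mult_ac)
  also have "ft \<dots> x = (\<Sum>k\<in>ks. of_real \<alpha> * ft (\<lambda>\<xi>. of_real (exp (- s * (norm \<xi>)\<^sup>2)) * V k i \<xi>) x)"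
    using assms by (subst ft_sum) (auto simp only: ft_cmult intro!: integrable_mult_right integrable_exp_V)
  finally show ?thesis .
qed

text \<open>On the spectrum of a block with \<kappa> = \<open>kap k\<close>, |\<xi>|^2 differs from
  \<kappa>^2 by at most 3 \<rho> \<kappa>. Both are at least \<kappa>^2 / 2, so the two exponential
  factors differ by at most 6 \<rho> / \<kappa> at every time. The rotated gradient contributes 2
  \<kappa>, and \<kappa> cancels.\<close>

lemma heat_v0_minus_U:
  assumes s: "s > 0" and \<alpha>: "\<alpha> \<ge> 0"
  shows "norm (heat_semigroup s (v0 \<alpha>) x - U \<alpha> s x) \<le> real CARD('n) * (\<alpha> * real K * (12 * \<rho> * (real L * c0)))"
proof -
  have comp: "\<bar>(heat_semigroup s (v0 \<alpha>) x - U \<alpha> s x) $ i\<bar> \<le> \<alpha> * real K * (12 * \<rho> * (real L * c0))" for i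
  proof -
    define m where "m k \<xi> = (complex_of_real (exp (- s * (norm \<xi>)\<^sup>2) - exp (- s * (kap k)\<^sup>2))) * perp i \<xi>" for k and \<xi> :: "real^'n"
    have d: "of_real (exp (- s * (kap k)\<^sup>2)) * ft (V k i) x = ft (\<lambda>\<xi>. of_real (exp (- s * (kap k)\<^sup>2)) * V k i \<xi>) x" for k
      by (simp only: ft_cmult)
    have "complex_of_real ((heat_semigroup s (v0 \<alpha>) x - U \<alpha> s x) $ i) =
      (\<Sum>k\<in>ks. of_real \<alpha> * ft (\<lambda>\<xi>. of_real (exp (- s * (norm \<xi>)\<^sup>2)) * V k i \<xi>) x) - (\<Sum>k\<in>ks. of_real \<alpha> * (of_real (exp (- s * (kap k)\<^sup>2)) * ft (V k i) x))"
      using s heat_v0_component[OF s \<alpha>, of x i] by (simp add: U_component cf_def of_real_v[symmetric] mult_ac)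
    also have "\<dots> = (\<Sum>k\<in>ks. of_real \<alpha> * ft (\<lambda>\<xi>. m k \<xi> * Psi k \<xi>) x)"
    proof -
      have "ft (\<lambda>\<xi>. of_real (exp (- s * (norm \<xi>)\<^sup>2)) * V k i \<xi>) x - ft (\<lambda>\<xi>. of_real (exp (- s * (kap k)\<^sup>2)) * V k i \<xi>) x = ft (\<lambda>\<xi>. m k \<xi> * Psi k \<xi>) x" for k
        using s by (subst ft_diff[symmetric, OF integrable_exp_V integrable_mult_right[OF schwartz_integrable[OF V_schwartz]]])
          (simp_all add: m_def V_def algebra_simps)
      then show ?thesis unfolding sum_subtractf[symmetric] right_diff_distrib[symmetric] d by simp
    qed
    also have "norm \<dots> \<le> (\<Sum>k\<in>ks. \<alpha> * (12 * \<rho> * (real L * c0)))"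
    proof (rule sum_norm_le)
      fix k assume k: "k \<in> ks"
      have "norm (ft (\<lambda>\<xi>. m k \<xi> * Psi k \<xi>) x) \<le> (12 * \<rho>) * (LINT \<xi>|lborel. norm (Psi k \<xi>))"
      proof (rule norm_ft_le_support[OF Psi_schwartz])
        fix \<xi>
        show "norm (m k \<xi> * Psi k \<xi>) \<le> 12 * \<rho> * norm (Psi k \<xi>)"
        proof (cases "Psi k \<xi> = 0")
          case False
          note P = Psi_norm[OF False] and rk = rho_kap(2)[OF k] and rg = rho_ge
          define \<kappa> where "\<kappa> = kap k"
          have k0: "\<kappa> > 0" by (simp add: \<kappa>_def)
          define A where "A = (norm \<xi>)\<^sup>2"
          have A1: "\<kappa>\<^sup>2 / 2 \<le> A"
          proof -
            have "(63/64 * \<kappa>)\<^sup>2 \<le> A" unfolding A_def by (rule power_mono) (use P rk k0 in \<open>auto simp: \<kappa>_def\<close>)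
            moreover have "\<kappa>\<^sup>2 / 2 \<le> (63/64 * \<kappa>)\<^sup>2" by (simp add: power_mult_distrib power2_eq_square)
            ultimately show ?thesis by linarith
          qed
          have A2: "\<bar>A - \<kappa>\<^sup>2\<bar> \<le> 3 * \<rho> * \<kappa>"
          proof -
            have "A - \<kappa>\<^sup>2 = (norm \<xi> - \<kappa>) * (norm \<xi> + \<kappa>)" by (simp add: A_def power2_eq_square algebra_simps)
            moreover have "\<bar>norm \<xi> - \<kappa>\<bar> * \<bar>norm \<xi> + \<kappa>\<bar> \<le> \<rho> * (3 * \<kappa>)"
              using P rk rg k0 by (intro mult_mono) (auto simp: \<kappa>_def)
            ultimately show ?thesis by (simp add: abs_mult mult_ac)
          qed
          have "\<bar>exp (- s * A) - exp (- s * \<kappa>\<^sup>2)\<bar> \<le> \<bar>A - \<kappa>\<^sup>2\<bar> / (\<kappa>\<^sup>2 / 2)"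
            using s k0 A1 by (intro abs_exp_diff_le) auto
          also have "\<dots> \<le> (3 * \<rho> * \<kappa>) / (\<kappa>\<^sup>2 / 2)" using k0 by (intro divide_right_mono A2) auto
          also have "\<dots> = 6 * \<rho> / \<kappa>" using k0 by (simp add: power2_eq_square)
          finally have e: "\<bar>exp (- s * A) - exp (- s * \<kappa>\<^sup>2)\<bar> \<le> 6 * \<rho> / \<kappa>" .
          have "norm (perp i \<xi>) \<le> 2 * \<kappa>" using norm_perp_le[of i \<xi>] P rk rg by (simp add: \<kappa>_def)
          with e have "\<bar>exp (- s * A) - exp (- s * \<kappa>\<^sup>2)\<bar> * norm (perp i \<xi>) \<le> (6 * \<rho> / \<kappa>) * (2 * \<kappa>)"
            using rg k0 by (intro mult_mono) auto
          also have "(6 * \<rho> / \<kappa>) * (2 * \<kappa>) = 12 * \<rho>" using k0 by simp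
          finally have "norm (m k \<xi>) \<le> 12 * \<rho>" by (simp add: m_def norm_mult A_def \<kappa>_def del: of_real_diff)
          then show ?thesis by (simp add: norm_mult mult_right_mono)
        qed simp
      qed
      also have "\<dots> \<le> 12 * \<rho> * (real L * c0)" using rho_ge by (intro mult_left_mono integral_norm_Psi) auto
      finally have "norm (ft (\<lambda>\<xi>. m k \<xi> * Psi k \<xi>) x) \<le> 12 * \<rho> * (real L * c0)" .
      from mult_left_mono[OF this \<alpha>] show "norm (of_real \<alpha> * ft (\<lambda>\<xi>. m k \<xi> * Psi k \<xi>) x) \<le> \<alpha> * (12 * \<rho> * (real L * c0))"
        using \<alpha> by (simp add: norm_mult)
    qed
    finally show ?thesis by (simp only: norm_of_real) (simp add: mult_ac)
  qed
  have "norm (heat_semigroup s (v0 \<alpha>) x - U \<alpha> s x) \<le> (\<Sum>i\<in>UNIV. \<bar>(heat_semigroup s (v0 \<alpha>) x - U \<alpha> s x) $ i\<bar>)"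
    by (rule norm_le_l1_cart)
  also have "\<dots> \<le> real CARD('n) * (\<alpha> * real K * (12 * \<rho> * (real L * c0)))"
    using sum_bounded_above[of UNIV "\<lambda>i. \<bar>(heat_semigroup s (v0 \<alpha>) x - U \<alpha> s x) $ i\<bar>", OF comp] by simp
  finally show ?thesis .
qed

text \<open>The cancellation that makes the bound independent of the large frequencies: \<open>V k'\<close> is divergence
  free, so that only the component of \<open>\<xi>\<close> transversal to \<open>\<zeta>'\<close> enters, which is at most \<open>\<rho>\<close>.\<close>

lemma perp_contract: "(\<Sum>l\<in>UNIV. of_real ((\<xi> + \<zeta>') $ l) * perp l \<zeta>') = \<i> * of_real (\<zeta>' $ a * \<xi> $ b - \<zeta>' $ b * \<xi> $ a)"
proof -
  have "(\<Sum>l\<in>UNIV. of_real ((\<xi> + \<zeta>') $ l) * perp l \<zeta>') = (\<Sum>l\<in>{a, b}. of_real ((\<xi> + \<zeta>') $ l) * perp l \<zeta>')"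
    by (rule sum.mono_neutral_right) (auto simp: perp_def)
  then show ?thesis using ab by (simp add: perp_def algebra_simps)
qed

lemma norm_sum_perp_le:
  assumes "\<And>j. norm (p j) \<le> (2::real)"
  shows "norm (\<Sum>j\<in>UNIV. (p j :: complex) * perp j \<xi>) \<le> 4 * norm \<xi>"
proof -
  have "(\<Sum>j\<in>UNIV. p j * perp j \<xi>) = (\<Sum>j\<in>{a, b}. p j * perp j \<xi>)"
    by (rule sum.mono_neutral_right) (auto simp: perp_def)
  also have "\<dots> = p a * perp a \<xi> + p b * perp b \<xi>" using ab by simp
  also have "norm \<dots> \<le> norm (p a) * norm (perp a \<xi>) + norm (p b) * norm (perp b \<xi>)"
    by (rule order_trans[OF norm_triangle_ineq]) (simp add: norm_mult)
  also have "\<dots> \<le> 2 * norm \<xi> + 2 * norm \<xi>"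
    by (intro add_mono mult_mono assms norm_perp_le) auto
  finally show ?thesis by simp
qed

text \<open>A naive count gives (\<kappa> + \<kappa>') \<kappa> \<kappa>' for the divergence of the
  product of blocks at \<kappa> and \<kappa>'. As the second block is divergence free, the
  derivative contracts with it to at most 2 \<rho> (\<kappa> + \<kappa>'). The Gaussian factor is
  bounded by 1, so no singularity in r remains.\<close>

lemma oseen_pair_bound:
  assumes r: "r > 0" and k: "k \<in> ks" and k': "k' \<in> ks"
  shows "\<bar>\<Sum>j\<in>UNIV. \<Sum>l\<in>UNIV. LINT y|lborel. oseen_kernel r i j l (x - y) * (v k y $ j * v k' y $ l)\<bar>
     \<le> 32 * \<rho> * ((kap k)\<^sup>2 + (kap k')\<^sup>2) * (real L * c0)\<^sup>2"
proof -
  have Vi: "integrable lborel (V k j)" for k j by (rule schwartz_integrable[OF V_schwartz])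
  have [measurable]: "V k j \<in> borel_measurable borel" for k j using V_schwartz by measurable
  have Pi: "integrable lborel (\<lambda>\<xi>. norm (Psi k \<xi>))" for k by (rule integrable_norm[OF schwartz_integrable[OF Psi_schwartz]])
  have Ki: "integrable lborel (\<lambda>y. complex_of_real (oseen_kernel r i j l y))" for j l
    using oseen_kernel_integrable[OF r, of i j l] by (simp only: complex_of_real_integrable_eq)
  define S where "S j l \<eta> = cis (\<eta> \<bullet> x) * oseen_symbol r i j l \<eta>" for j l \<eta>
  have [measurable]: "S j l \<in> borel_measurable borel" for j l unfolding S_def[abs_def] by measurable
  have Sb: "norm (S j l \<eta>) \<le> 2 * (1 + 1 / r)" for j l \<eta>
    unfolding S_def using oseen_symbol_bounded[OF r, of i j l \<eta>] by (simp add: norm_mult)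
  have in1: "integrable lborel (\<lambda>\<xi>. V k j \<xi> * S j l (\<xi> + \<zeta>'))" for j l \<zeta>'
  proof (rule Bochner_Integration.integrable_bound)
    show "integrable lborel (\<lambda>\<xi>. norm (V k j \<xi>) * (2 * (1 + 1 / r)))" using Vi by simp
    show "AE \<xi> in lborel. norm (V k j \<xi> * S j l (\<xi> + \<zeta>')) \<le> norm (norm (V k j \<xi>) * (2 * (1 + 1 / r)))"
      using Sb r by (intro AE_I2) (auto simp: norm_mult intro!: mult_left_mono)
  qed measurable
  have in1b: "norm (LINT \<xi>|lborel. V k j \<xi> * S j l (\<xi> + \<zeta>')) \<le> (LINT \<xi>|lborel. norm (V k j \<xi>)) * (2 * (1 + 1 / r))" for j l \<zeta>'
  proof -
    have "norm (LINT \<xi>|lborel. V k j \<xi> * S j l (\<xi> + \<zeta>')) \<le> (LINT \<xi>|lborel. norm (V k j \<xi>) * (2 * (1 + 1 / r)))"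
      by (rule integral_norm_le') (use Vi Sb in \<open>auto simp: norm_mult intro!: mult_left_mono\<close>)
    then show ?thesis by simp
  qed
  have in2: "integrable lborel (\<lambda>\<zeta>'. V k' l \<zeta>' * (LINT \<xi>|lborel. V k j \<xi> * S j l (\<xi> + \<zeta>')))" for j l
  proof (rule Bochner_Integration.integrable_bound)
    show "integrable lborel (\<lambda>\<zeta>'. norm (V k' l \<zeta>') * ((LINT \<xi>|lborel. norm (V k j \<xi>)) * (2 * (1 + 1 / r))))" using Vi by simp
    show "AE \<zeta>' in lborel. norm (V k' l \<zeta>' * (LINT \<xi>|lborel. V k j \<xi> * S j l (\<xi> + \<zeta>'))) \<le> norm (norm (V k' l \<zeta>') * ((LINT \<xi>|lborel. norm (V k j \<xi>)) * (2 * (1 + 1 / r))))"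
    proof (rule AE_I2)
      fix \<zeta>'
      have "norm (V k' l \<zeta>' * (LINT \<xi>|lborel. V k j \<xi> * S j l (\<xi> + \<zeta>'))) \<le> norm (V k' l \<zeta>') * ((LINT \<xi>|lborel. norm (V k j \<xi>)) * (2 * (1 + 1 / r)))"
        unfolding norm_mult[of "V k' l \<zeta>'"] by (rule mult_left_mono[OF in1b norm_ge_zero])
      also have "\<dots> \<le> norm \<dots>" unfolding real_norm_def by (rule abs_ge_self)
      finally show "norm (V k' l \<zeta>' * (LINT \<xi>|lborel. V k j \<xi> * S j l (\<xi> + \<zeta>'))) \<le> norm (norm (V k' l \<zeta>') * ((LINT \<xi>|lborel. norm (V k j \<xi>)) * (2 * (1 + 1 / r))))" .
    qed
  qed measurable
  have "complex_of_real (\<Sum>j\<in>UNIV. \<Sum>l\<in>UNIV. LINT y|lborel. oseen_kernel r i j l (x - y) * (v k y $ j * v k' y $ l)) =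
    (\<Sum>j\<in>UNIV. \<Sum>l\<in>UNIV. (LINT \<zeta>'|lborel. V k' l \<zeta>' * (LINT \<xi>|lborel. V k j \<xi> * S j l (\<xi> + \<zeta>'))))"
    unfolding of_real_sum
  proof (intro sum.cong refl)
    fix j l
    have "complex_of_real (LINT y|lborel. oseen_kernel r i j l (x - y) * (v k y $ j * v k' y $ l)) =
      (LINT y|lborel. complex_of_real (oseen_kernel r i j l (x - y)) * (ft (V k j) y * ft (V k' l) y))"
      by (simp only: integral_complex_of_real[symmetric] of_real_mult of_real_v)
    also have "\<dots> = (LINT \<zeta>'|lborel. V k' l \<zeta>' * (LINT \<xi>|lborel. V k j \<xi> * S j l (\<xi> + \<zeta>')))"
      unfolding S_def by (rule conv_ft_prod[OF Ki Vi Vi oseen_kernel_ft[OF r]])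
    finally show "complex_of_real (LINT y|lborel. oseen_kernel r i j l (x - y) * (v k y $ j * v k' y $ l)) = \<dots>" .
  qed
  also have "\<dots> = (LINT \<zeta>'|lborel. LINT \<xi>|lborel. (\<Sum>j\<in>UNIV. \<Sum>l\<in>UNIV. V k' l \<zeta>' * (V k j \<xi> * S j l (\<xi> + \<zeta>'))))"
  proof -
    have "(\<Sum>j\<in>UNIV. \<Sum>l\<in>UNIV. (LINT \<zeta>'|lborel. V k' l \<zeta>' * (LINT \<xi>|lborel. V k j \<xi> * S j l (\<xi> + \<zeta>')))) =
      (LINT \<zeta>'|lborel. (\<Sum>j\<in>UNIV. \<Sum>l\<in>UNIV. V k' l \<zeta>' * (LINT \<xi>|lborel. V k j \<xi> * S j l (\<xi> + \<zeta>'))))"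
      using in2 by (simp add: Bochner_Integration.integral_sum Bochner_Integration.integrable_sum)
    also have "\<dots> = (LINT \<zeta>'|lborel. LINT \<xi>|lborel. (\<Sum>j\<in>UNIV. \<Sum>l\<in>UNIV. V k' l \<zeta>' * (V k j \<xi> * S j l (\<xi> + \<zeta>'))))"
    proof (intro Bochner_Integration.integral_cong refl)
      fix \<zeta>'
      have in3: "integrable lborel (\<lambda>\<xi>. V k' l \<zeta>' * (V k j \<xi> * S j l (\<xi> + \<zeta>')))" for j l by (rule integrable_mult_right[OF in1])
      show "(\<Sum>j\<in>UNIV. \<Sum>l\<in>UNIV. V k' l \<zeta>' * (LINT \<xi>|lborel. V k j \<xi> * S j l (\<xi> + \<zeta>'))) =
        (LINT \<xi>|lborel. (\<Sum>j\<in>UNIV. \<Sum>l\<in>UNIV. V k' l \<zeta>' * (V k j \<xi> * S j l (\<xi> + \<zeta>'))))"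
        unfolding integral_mult_right_zero[symmetric] using in3
        by (simp only: Bochner_Integration.integral_sum Bochner_Integration.integrable_sum)
    qed
    finally show ?thesis .
  qed
  also have "norm \<dots> \<le> (LINT \<zeta>'|lborel. (LINT \<xi>|lborel. (32 * \<rho> * ((kap k)\<^sup>2 + (kap k')\<^sup>2)) * norm (Psi k' \<zeta>') * norm (Psi k \<xi>)))"
  proof (rule integral_norm_le')
    show "integrable lborel (\<lambda>\<zeta>'. (LINT \<xi>|lborel. (32 * \<rho> * ((kap k)\<^sup>2 + (kap k')\<^sup>2)) * norm (Psi k' \<zeta>') * norm (Psi k \<xi>)))"
      using Pi[of k'] by simp
    fix \<zeta>'
    show "norm (LINT \<xi>|lborel. (\<Sum>j\<in>UNIV. \<Sum>l\<in>UNIV. V k' l \<zeta>' * (V k j \<xi> * S j l (\<xi> + \<zeta>')))) \<le> (LINT \<xi>|lborel. (32 * \<rho> * ((kap k)\<^sup>2 + (kap k')\<^sup>2)) * norm (Psi k' \<zeta>') * norm (Psi k \<xi>))"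
    proof (rule integral_norm_le')
      show "integrable lborel (\<lambda>\<xi>. (32 * \<rho> * ((kap k)\<^sup>2 + (kap k')\<^sup>2)) * norm (Psi k' \<zeta>') * norm (Psi k \<xi>))" using Pi[of k] by simp
      fix \<xi>
      define E where "E = complex_of_real (exp (- r * (norm (\<xi> + \<zeta>'))\<^sup>2))"
      have E: "norm E \<le> 1" using r by (simp add: E_def)
      define P where "P j = complex_of_real (helmholtz_symbol i j (\<xi> + \<zeta>'))" for j
      have P: "norm (P j) \<le> 2" for j using abs_helmholtz_symbol_le[of i j "\<xi> + \<zeta>'"] by (simp add: P_def)
      have "(\<Sum>j\<in>UNIV. \<Sum>l\<in>UNIV. V k' l \<zeta>' * (V k j \<xi> * S j l (\<xi> + \<zeta>'))) =
        (\<Sum>j\<in>UNIV. \<Sum>l\<in>UNIV. (cis ((\<xi> + \<zeta>') \<bullet> x) * E * \<i> * Psi k' \<zeta>' * Psi k \<xi>) * ((P j * perp j \<xi>) * (of_real ((\<xi> + \<zeta>') $ l) * perp l \<zeta>')))"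
        by (intro sum.cong refl) (simp add: V_def S_def oseen_symbol_def E_def P_def mult_ac)
      also have "\<dots> = (cis ((\<xi> + \<zeta>') \<bullet> x) * E * \<i> * Psi k' \<zeta>' * Psi k \<xi>) * ((\<Sum>j\<in>UNIV. P j * perp j \<xi>) * (\<Sum>l\<in>UNIV. of_real ((\<xi> + \<zeta>') $ l) * perp l \<zeta>'))"
        unfolding sum_product by (simp only: sum_distrib_left)
      finally have eq: "norm (\<Sum>j\<in>UNIV. \<Sum>l\<in>UNIV. V k' l \<zeta>' * (V k j \<xi> * S j l (\<xi> + \<zeta>'))) =
        (norm E * norm (Psi k' \<zeta>') * norm (Psi k \<xi>)) * (norm (\<Sum>j\<in>UNIV. P j * perp j \<xi>) * \<bar>\<zeta>' $ a * \<xi> $ b - \<zeta>' $ b * \<xi> $ a\<bar>)"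
        by (simp only: perp_contract) (simp add: norm_mult del: of_real_diff of_real_mult)
      show "norm (\<Sum>j\<in>UNIV. \<Sum>l\<in>UNIV. V k' l \<zeta>' * (V k j \<xi> * S j l (\<xi> + \<zeta>'))) \<le> 32 * \<rho> * ((kap k)\<^sup>2 + (kap k')\<^sup>2) * norm (Psi k' \<zeta>') * norm (Psi k \<xi>)"
      proof (cases "Psi k \<xi> = 0 \<or> Psi k' \<zeta>' = 0")
        case True
        then show ?thesis unfolding eq by auto
      next
        case False
        then have P1: "Psi k \<xi> \<noteq> 0" and P2: "Psi k' \<zeta>' \<noteq> 0" by auto
        have n1: "norm \<xi> \<le> 2 * kap k" using Psi_norm(2)[OF P1] rho_kap(2)[OF k] rho_ge by linarith
        have n2: "norm \<zeta>' \<le> 2 * kap k'" using Psi_norm(2)[OF P2] rho_kap(2)[OF k'] rho_ge by linarith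
        have a1: "\<bar>\<zeta>' $ a * \<xi> $ b - \<zeta>' $ b * \<xi> $ a\<bar> \<le> 2 * kap k' * \<rho> + \<rho> * (2 * kap k)"
        proof -
          have "\<bar>\<zeta>' $ a * \<xi> $ b - \<zeta>' $ b * \<xi> $ a\<bar> \<le> \<bar>\<zeta>' $ a\<bar> * \<bar>\<xi> $ b\<bar> + \<bar>\<zeta>' $ b\<bar> * \<bar>\<xi> $ a\<bar>"
            unfolding abs_mult[symmetric] by linarith
          also have "\<dots> \<le> 2 * kap k' * \<rho> + \<rho> * (2 * kap k)"
            using rho_ge Psi_norm(3)[OF P1] Psi_norm(3)[OF P2] component_le_norm_cart[of \<xi> a] component_le_norm_cart[of \<zeta>' a] n1 n2
            by (intro add_mono mult_mono) (auto simp: less_imp_le)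
          finally show ?thesis .
        qed
        have a2: "norm (\<Sum>j\<in>UNIV. P j * perp j \<xi>) \<le> 4 * (2 * kap k)"
          using norm_sum_perp_le[of P \<xi>] P n1 by fastforce
        have "norm (\<Sum>j\<in>UNIV. P j * perp j \<xi>) * \<bar>\<zeta>' $ a * \<xi> $ b - \<zeta>' $ b * \<xi> $ a\<bar> \<le> (4 * (2 * kap k)) * (2 * kap k' * \<rho> + \<rho> * (2 * kap k))"
          using a1 a2 by (intro mult_mono) (auto simp: less_imp_le)
        also have "\<dots> = 16 * \<rho> * ((kap k)\<^sup>2 + kap k * kap k')" by (simp add: power2_eq_square algebra_simps)
        also have "\<dots> \<le> 16 * \<rho> * (2 * ((kap k)\<^sup>2 + (kap k')\<^sup>2))"
        proof (intro mult_left_mono)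
          have "2 * kap k * kap k' \<le> (kap k)\<^sup>2 + (kap k')\<^sup>2" by (rule sum_squares_bound)
          moreover have "0 \<le> kap k * kap k'" "0 \<le> (kap k)\<^sup>2" "0 \<le> (kap k')\<^sup>2" by (simp_all add: less_imp_le)
          ultimately show "(kap k)\<^sup>2 + kap k * kap k' \<le> 2 * ((kap k)\<^sup>2 + (kap k')\<^sup>2)" by argo
        qed (use rho_ge in auto)
        also have "\<dots> = 32 * \<rho> * ((kap k)\<^sup>2 + (kap k')\<^sup>2)" by (simp add: algebra_simps)
        finally have m: "norm (\<Sum>j\<in>UNIV. P j * perp j \<xi>) * \<bar>\<zeta>' $ a * \<xi> $ b - \<zeta>' $ b * \<xi> $ a\<bar> \<le> 32 * \<rho> * ((kap k)\<^sup>2 + (kap k')\<^sup>2)" .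
        have "norm (\<Sum>j\<in>UNIV. \<Sum>l\<in>UNIV. V k' l \<zeta>' * (V k j \<xi> * S j l (\<xi> + \<zeta>'))) \<le> (1 * norm (Psi k' \<zeta>') * norm (Psi k \<xi>)) * (32 * \<rho> * ((kap k)\<^sup>2 + (kap k')\<^sup>2))"
          unfolding eq
        proof (rule mult_mono[OF _ m])
          show "norm E * norm (Psi k' \<zeta>') * norm (Psi k \<xi>) \<le> 1 * norm (Psi k' \<zeta>') * norm (Psi k \<xi>)"
            by (intro mult_right_mono E) auto
        qed auto
        then show ?thesis by (simp add: mult_ac)
      qed
    qed
  qed
  also have "\<dots> = (32 * \<rho> * ((kap k)\<^sup>2 + (kap k')\<^sup>2)) * ((LINT \<zeta>'|lborel. norm (Psi k' \<zeta>')) * (LINT \<xi>|lborel. norm (Psi k \<xi>)))"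
    by simp
  also have "\<dots> \<le> (32 * \<rho> * ((kap k)\<^sup>2 + (kap k')\<^sup>2)) * ((real L * c0) * (real L * c0))"
    using rho_ge c0_pos by (intro mult_left_mono mult_mono integral_norm_Psi) auto
  finally show ?thesis by (simp only: norm_of_real power2_eq_square)
qed

lemma heat_P_div_U_component:
  assumes r: "r > 0"
  shows "heat_P_div r (\<lambda>y. tensor (U \<alpha> \<tau> y) (U \<alpha> \<tau> y)) x $ i =
    (\<Sum>k\<in>ks. \<Sum>k'\<in>ks. cf \<alpha> \<tau> k * cf \<alpha> \<tau> k' * (\<Sum>j\<in>UNIV. \<Sum>l\<in>UNIV. LINT y|lborel. oseen_kernel r i j l (x - y) * (v k y $ j * v k' y $ l)))"
proof -
  have ii: "integrable lborel (\<lambda>y. oseen_kernel r i j l (x - y) * (v k y $ j * v k' y $ l))" if "k \<in> ks" "k' \<in> ks" for j l k k'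
  proof (rule integrable_oseen_conv[OF r])
    show "AE y in lborel. \<bar>v k y $ j * v k' y $ l\<bar> \<le> (C1 * kap k) * (C1 * kap k')"
      using C1_pos unfolding abs_mult
      by (intro AE_I2 mult_mono order_trans[OF component_le_norm_cart norm_v_le(1)] that) (auto simp: less_imp_le)
  qed measurable
  have "heat_P_div r (\<lambda>y. tensor (U \<alpha> \<tau> y) (U \<alpha> \<tau> y)) x $ i =
    (\<Sum>j\<in>UNIV. \<Sum>l\<in>UNIV. LINT y|lborel. (\<Sum>k\<in>ks. \<Sum>k'\<in>ks. cf \<alpha> \<tau> k * cf \<alpha> \<tau> k' * (oseen_kernel r i j l (x - y) * (v k y $ j * v k' y $ l))))"
    unfolding heat_P_div_def tensor_component U_component vec_lambda_beta sum_product
    by (simp only: sum_distrib_left mult_ac)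
  also have "\<dots> = (\<Sum>j\<in>UNIV. \<Sum>l\<in>UNIV. \<Sum>k\<in>ks. \<Sum>k'\<in>ks. cf \<alpha> \<tau> k * cf \<alpha> \<tau> k' * (LINT y|lborel. oseen_kernel r i j l (x - y) * (v k y $ j * v k' y $ l)))"
  proof (intro sum.cong refl)
    fix j l
    show "(LINT y|lborel. (\<Sum>k\<in>ks. \<Sum>k'\<in>ks. cf \<alpha> \<tau> k * cf \<alpha> \<tau> k' * (oseen_kernel r i j l (x - y) * (v k y $ j * v k' y $ l)))) =
      (\<Sum>k\<in>ks. \<Sum>k'\<in>ks. cf \<alpha> \<tau> k * cf \<alpha> \<tau> k' * (LINT y|lborel. oseen_kernel r i j l (x - y) * (v k y $ j * v k' y $ l)))"
      by (subst Bochner_Integration.integral_sum, intro Bochner_Integration.integrable_sum integrable_mult_right ii, assumption+,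
          intro sum.cong refl, subst Bochner_Integration.integral_sum, intro integrable_mult_right ii, assumption+,
          intro sum.cong refl, rule integral_mult_right_zero)
  qed
  also have "\<dots> = (\<Sum>k\<in>ks. \<Sum>k'\<in>ks. \<Sum>j\<in>UNIV. \<Sum>l\<in>UNIV. cf \<alpha> \<tau> k * cf \<alpha> \<tau> k' * (LINT y|lborel. oseen_kernel r i j l (x - y) * (v k y $ j * v k' y $ l)))"
  proof -
    have "(\<Sum>j\<in>A. \<Sum>l\<in>B. \<Sum>k\<in>C. \<Sum>m\<in>D. f j l k m) = (\<Sum>k\<in>C. \<Sum>m\<in>D. \<Sum>j\<in>A. \<Sum>l\<in>B. f j l k m)"
      for A :: "'n set" and B :: "'n set" and C D :: "nat set" and f :: "'n \<Rightarrow> 'n \<Rightarrow> nat \<Rightarrow> nat \<Rightarrow> real"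
    proof -
      have "(\<Sum>j\<in>A. \<Sum>l\<in>B. \<Sum>k\<in>C. \<Sum>m\<in>D. f j l k m) = (\<Sum>j\<in>A. \<Sum>k\<in>C. \<Sum>l\<in>B. \<Sum>m\<in>D. f j l k m)"
        by (intro sum.cong refl) (rule sum.swap)
      also have "\<dots> = (\<Sum>k\<in>C. \<Sum>j\<in>A. \<Sum>l\<in>B. \<Sum>m\<in>D. f j l k m)" by (rule sum.swap)
      also have "\<dots> = (\<Sum>k\<in>C. \<Sum>j\<in>A. \<Sum>m\<in>D. \<Sum>l\<in>B. f j l k m)" by (intro sum.cong refl) (rule sum.swap)
      also have "\<dots> = (\<Sum>k\<in>C. \<Sum>m\<in>D. \<Sum>j\<in>A. \<Sum>l\<in>B. f j l k m)" by (intro sum.cong refl) (rule sum.swap)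
      finally show ?thesis .
    qed
    then show ?thesis .
  qed
  finally show ?thesis by (simp only: sum_distrib_left)
qed

text \<open>The factor \<kappa>^2 + \<kappa>'^2 in the bound for a pair of blocks is exactly the
  decay rate of the product of their coefficients. Hence each pair contributes O(1) after
  integration in time, whatever its frequencies.\<close>

lemma norm_duhamel_U_le:
  assumes s: "s > 0" and \<alpha>: "\<alpha> \<ge> 0"
  shows "norm (LINT \<tau>:{0<..<s}|lborel. heat_P_div (s - \<tau>) (\<lambda>y. tensor (U \<alpha> \<tau> y) (U \<alpha> \<tau> y)) x) \<le>
    real CARD('n) * ((real K)\<^sup>2 * (32 * \<rho> * (real L * c0)\<^sup>2 * \<alpha>\<^sup>2))"
proof -
  define D where "D = 32 * \<rho> * (real L * c0)\<^sup>2 * \<alpha>\<^sup>2"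
  have D: "D \<ge> 0" using rho_ge by (simp add: D_def)
  define h where "h k k' \<tau> = ((kap k)\<^sup>2 + (kap k')\<^sup>2) * (indicator {0<..<s} \<tau> * exp (- ((kap k)\<^sup>2 + (kap k')\<^sup>2) * \<tau>))" for k k' \<tau>
  have c: "(kap k)\<^sup>2 + (kap k')\<^sup>2 > 0" for k k' by (intro add_pos_pos zero_less_power kap_pos)
  have hi: "integrable lborel (h k k')" for k k'
    unfolding h_def by (intro integrable_mult_right exp_interval_integral_le(1) c)
  have hl: "(LINT \<tau>|lborel. h k k' \<tau>) \<le> 1" for k k'
  proof -
    have "(LINT \<tau>|lborel. h k k' \<tau>) \<le> ((kap k)\<^sup>2 + (kap k')\<^sup>2) * (1 / ((kap k)\<^sup>2 + (kap k')\<^sup>2))"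
      unfolding h_def integral_mult_right_zero using c[of k k'] by (intro mult_left_mono exp_interval_integral_le(2)) auto
    then show ?thesis using c[of k k'] by (simp split: if_splits)
  qed
  have "norm (LINT \<tau>:{0<..<s}|lborel. heat_P_div (s - \<tau>) (\<lambda>y. tensor (U \<alpha> \<tau> y) (U \<alpha> \<tau> y)) x)
    \<le> (LINT \<tau>|lborel. real CARD('n) * (\<Sum>k\<in>ks. \<Sum>k'\<in>ks. D * h k k' \<tau>))"
    unfolding set_lebesgue_integral_def
  proof (rule integral_norm_le')
    show "integrable lborel (\<lambda>\<tau>. real CARD('n) * (\<Sum>k\<in>ks. \<Sum>k'\<in>ks. D * h k k' \<tau>))"
      by (intro integrable_mult_right Bochner_Integration.integrable_sum hi)
    fix \<tau>
    show "norm (indicat_real {0<..<s} \<tau> *\<^sub>R heat_P_div (s - \<tau>) (\<lambda>y. tensor (U \<alpha> \<tau> y) (U \<alpha> \<tau> y)) x) \<le> real CARD('n) * (\<Sum>k\<in>ks. \<Sum>k'\<in>ks. D * h k k' \<tau>)"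
    proof (cases "\<tau> \<in> {0<..<s}")
      case True
      then have st: "s - \<tau> > 0" and t0: "\<tau> > 0" by auto
      have "\<bar>heat_P_div (s - \<tau>) (\<lambda>y. tensor (U \<alpha> \<tau> y) (U \<alpha> \<tau> y)) x $ i\<bar> \<le> (\<Sum>k\<in>ks. \<Sum>k'\<in>ks. D * h k k' \<tau>)" for i
        unfolding heat_P_div_U_component[OF st]
      proof (intro order_trans[OF sum_abs] sum_mono)
        fix k k' assume k: "k \<in> ks" and k': "k' \<in> ks"
        have e: "cf \<alpha> \<tau> k * cf \<alpha> \<tau> k' = \<alpha>\<^sup>2 * exp (- ((kap k)\<^sup>2 + (kap k')\<^sup>2) * \<tau>)"
          using t0 by (simp add: cf_def power2_eq_square exp_add[symmetric] algebra_simps)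
        have "\<bar>cf \<alpha> \<tau> k * cf \<alpha> \<tau> k' * (\<Sum>j\<in>UNIV. \<Sum>l\<in>UNIV. LINT y|lborel. oseen_kernel (s - \<tau>) i j l (x - y) * (v k y $ j * v k' y $ l))\<bar>
          \<le> (\<alpha>\<^sup>2 * exp (- ((kap k)\<^sup>2 + (kap k')\<^sup>2) * \<tau>)) * (32 * \<rho> * ((kap k)\<^sup>2 + (kap k')\<^sup>2) * (real L * c0)\<^sup>2)"
          unfolding e abs_mult[of "\<alpha>\<^sup>2 * exp (- ((kap k)\<^sup>2 + (kap k')\<^sup>2) * \<tau>)"]
          by (rule mult_mono) (use oseen_pair_bound[OF st k k'] in auto)
        then show "\<bar>cf \<alpha> \<tau> k * cf \<alpha> \<tau> k' * (\<Sum>j\<in>UNIV. \<Sum>l\<in>UNIV. LINT y|lborel. oseen_kernel (s - \<tau>) i j l (x - y) * (v k y $ j * v k' y $ l))\<bar> \<le> D * h k k' \<tau>"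
          using True by (simp add: D_def h_def algebra_simps)
      qed
      then have "(\<Sum>i\<in>UNIV. \<bar>heat_P_div (s - \<tau>) (\<lambda>y. tensor (U \<alpha> \<tau> y) (U \<alpha> \<tau> y)) x $ i\<bar>) \<le> real CARD('n) * (\<Sum>k\<in>ks. \<Sum>k'\<in>ks. D * h k k' \<tau>)"
        by (rule order_trans[OF sum_bounded_above]) auto
      then show ?thesis using True norm_le_l1_cart[of "heat_P_div (s - \<tau>) (\<lambda>y. tensor (U \<alpha> \<tau> y) (U \<alpha> \<tau> y)) x"]
        by simp
    next
      case False
      have "0 \<le> D * h k k' \<tau>" for k k' using D c[of k k'] by (simp add: h_def)
      then have "0 \<le> real CARD('n) * (\<Sum>k\<in>ks. \<Sum>k'\<in>ks. D * h k k' \<tau>)"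
        by (intro mult_nonneg_nonneg[of "real CARD('n)"] sum_nonneg) auto
      then show ?thesis using False by auto
    qed
  qed
  also have "\<dots> = real CARD('n) * (\<Sum>k\<in>ks. \<Sum>k'\<in>ks. D * (LINT \<tau>|lborel. h k k' \<tau>))"
    by (simp add: hi Bochner_Integration.integral_sum Bochner_Integration.integrable_sum)
  also have "\<dots> \<le> real CARD('n) * (\<Sum>k\<in>ks. \<Sum>k'\<in>ks. D * 1)"
    using D hl by (intro mult_left_mono sum_mono) auto
  also have "\<dots> = real CARD('n) * ((real K)\<^sup>2 * D)" by (simp add: power2_eq_square)
  finally show ?thesis unfolding D_def .
qed

text \<open>The distance A of the bootstrap. The power L^4 covers K^2 L^2 from the pairs of blocks
  with K \<le> L.\<close>

definition Abd :: "real \<Rightarrow> real" where "Abd \<alpha> = \<alpha> * \<rho> * real L ^ 4 * CA"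

lemma Abd_pos: "\<alpha> > 0 \<Longrightarrow> Abd \<alpha> > 0"
  using CA_pos rho_ge L by (simp add: Abd_def)

text \<open>The defect of U in the integral equation, in the form of the hypothesis
  \<open>base\<close> of the bootstrap: linear part plus quadratic part, with \<alpha> \<le> 1 used
  to make the quadratic one linear in \<alpha>.\<close>

lemma base_estimate:
  assumes s: "s > 0" and \<alpha>: "0 \<le> \<alpha>" "\<alpha> \<le> 1"
  shows "norm (heat_semigroup s (v0 \<alpha>) x -
       (LINT \<tau>:{0<..<s}|lborel. heat_P_div (s - \<tau>) (\<lambda>y. tensor (U \<alpha> \<tau> y) (U \<alpha> \<tau> y)) x) - U \<alpha> s x) \<le> Abd \<alpha>"
proof -
  define I where "I = (LINT \<tau>:{0<..<s}|lborel. heat_P_div (s - \<tau>) (\<lambda>y. tensor (U \<alpha> \<tau> y) (U \<alpha> \<tau> y)) x)"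
  have L1: "real L \<ge> 1" and K1: "real K \<le> real L" using L K by auto
  have "norm (heat_semigroup s (v0 \<alpha>) x - I - U \<alpha> s x) = norm ((heat_semigroup s (v0 \<alpha>) x - U \<alpha> s x) - I)"
    by (rule arg_cong[where f=norm]) simp
  also have "\<dots> \<le> norm (heat_semigroup s (v0 \<alpha>) x - U \<alpha> s x) + norm I" by (rule norm_triangle_ineq4)
  also have "\<dots> \<le> real CARD('n) * (\<alpha> * real K * (12 * \<rho> * (real L * c0))) + real CARD('n) * ((real K)\<^sup>2 * (32 * \<rho> * (real L * c0)\<^sup>2 * \<alpha>\<^sup>2))"
    unfolding I_def by (intro add_mono heat_v0_minus_U norm_duhamel_U_le s \<alpha>)
  also have "\<dots> = real CARD('n) * \<alpha> * \<rho> * (real K * real L * (12 * c0) + (real K)\<^sup>2 * (real L)\<^sup>2 * \<alpha> * (32 * c0\<^sup>2))"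
    by (simp add: power2_eq_square algebra_simps)
  also have "\<dots> \<le> real CARD('n) * \<alpha> * \<rho> * (real L ^ 4 * (12 * c0) + real L ^ 4 * (32 * c0\<^sup>2))"
  proof (intro mult_left_mono add_mono mult_right_mono)
    have "real K * real L \<le> real L * real L" using K1 by (intro mult_right_mono) auto
    also have "\<dots> = real L ^ 2" by (simp add: power2_eq_square)
    also have "\<dots> \<le> real L ^ 4" using L1 by (intro power_increasing) auto
    finally show "real K * real L \<le> real L ^ 4" .
    have "(real K)\<^sup>2 * (real L)\<^sup>2 * \<alpha> \<le> (real L)\<^sup>2 * (real L)\<^sup>2 * 1"
      using \<alpha> K1 by (intro mult_mono power_mono) auto
    also have "\<dots> = real L ^ 4" by (simp flip: power_add)
    finally show "(real K)\<^sup>2 * (real L)\<^sup>2 * \<alpha> \<le> real L ^ 4" .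
  qed (use c0_pos \<alpha> rho_ge in auto)
  also have "\<dots> = Abd \<alpha>" by (simp add: Abd_def CA_def algebra_simps)
  finally show ?thesis unfolding I_def .
qed

text \<open>The observation time. It exceeds the lifetime \<open>kap k\<close>^(-2) of every block
  in \<open>ks\<close> by a factor of at least 4, but sqrt \<open>tt\<close> still beats all powers
  of \<rho> and L that occur.\<close>

definition tt :: real where "tt = 1 / 4 ^ (100 * L)"

lemma tt_pos: "tt > 0" by (simp add: tt_def)

lemma sqrt_tt: "sqrt tt = 1 / 2 ^ (100 * L)"
proof -
  have "tt = (1 / 2 ^ (100 * L))\<^sup>2" by (simp add: tt_def power2_eq_square flip: power_mult_distrib)
  then show ?thesis by (simp add: real_sqrt_unique)
qed

end

section \<open>The tested quadratic term\<close>

lemma schwartz_norm_square: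
  fixes f :: "real^'n \<Rightarrow> complex"
  assumes "schwartz f"
  shows "schwartz (\<lambda>\<xi>. of_real ((norm \<xi>)\<^sup>2) * f \<xi>)"
proof -
  have "schwartz (\<lambda>\<xi>. \<Sum>j\<in>UNIV. of_real (\<xi> $ j) * (of_real (\<xi> $ j) * f \<xi>))"
    by (intro schwartz_sum schwartz_coord assms)
  moreover have "(\<Sum>j\<in>UNIV. of_real (\<xi> $ j) * (of_real (\<xi> $ j) * f \<xi>)) = of_real ((norm \<xi>)\<^sup>2) * f \<xi>" for \<xi> :: "real^'n"
  proof -
    have r: "(norm \<xi>)\<^sup>2 = (\<Sum>j\<in>UNIV. \<xi> $ j * \<xi> $ j)"
      unfolding norm_vec_sum_power2 by (simp add: power2_eq_square)
    have "complex_of_real ((norm \<xi>)\<^sup>2) = (\<Sum>j\<in>UNIV. of_real (\<xi> $ j) * of_real (\<xi> $ j))"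
      by (subst r) simp
    then show ?thesis by (simp only: sum_distrib_right mult.assoc)
  qed
  ultimately show ?thesis by simp
qed

text \<open>Testing reflects the kernel, hence the symbol is taken at - \<xi>.\<close>

lemma oseen_adjoint_ft:
  fixes N :: "real^'n \<Rightarrow> complex"
  assumes s: "s > 0" and N: "integrable lborel N"
  shows "(LINT x|lborel. of_real (oseen_kernel s i j k (x - y)) * ft N x) = ft (\<lambda>\<xi>. oseen_symbol s i j k (- \<xi>) * N \<xi>) y"
proof -
  have K: "integrable lborel (\<lambda>z. complex_of_real (oseen_kernel s i j k z))"
    using oseen_kernel_integrable[OF s, of i j k] by (simp only: complex_of_real_integrable_eq)
  have K': "integrable lborel (\<lambda>z. complex_of_real (oseen_kernel s i j k (- z)))"
    using integrable_lborel_reflect[OF K, of 0] by simp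
  have m: "(LINT z|lborel. complex_of_real (oseen_kernel s i j k (- z)) * cis (- \<xi> \<bullet> z)) = oseen_symbol s i j k (- \<xi>)" for \<xi>
  proof -
    have i: "integrable lborel (\<lambda>z. complex_of_real (oseen_kernel s i j k z) * cis (- (- \<xi>) \<bullet> z))"
      using integrable_cis_mult[OF K, of "\<xi>"] by (simp add: mult.commute inner_commute)
    from integral_lborel_reflect[OF i, of 0] show ?thesis
      unfolding oseen_kernel_ft[OF s] by simp
  qed
  show ?thesis using conv_ft(1)[OF K' N m, of y] by simp
qed

text \<open>Sums of frequencies of the two factors that never meet the reflected spectrum of q
  contribute exactly zero. All non-resonant interactions are discarded by this, without any decay
  estimate.\<close>

lemma triple_ft_zero:
  fixes f g q :: "real^'n \<Rightarrow> complex"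
  assumes "integrable lborel f" "integrable lborel g" "integrable lborel (ft q)"
    and "\<And>x. ft (ft q) x = of_real ((2 * pi) ^ CARD('n)) * q (- x)"
    and z: "\<And>\<xi> \<eta>. f \<xi> \<noteq> 0 \<Longrightarrow> g \<eta> \<noteq> 0 \<Longrightarrow> q (- (\<xi> + \<eta>)) = 0"
  shows "(LINT y|lborel. ft f y * ft g y * ft q y) = 0"
proof -
  have "g \<eta> * (LINT \<xi>|lborel. f \<xi> * q (- (\<xi> + \<eta>))) = 0" for \<eta>
  proof (cases "g \<eta> = 0")
    case False
    then have "f \<xi> * q (- (\<xi> + \<eta>)) = 0" for \<xi> using z[of \<xi> \<eta>] by (cases "f \<xi> = 0") auto
    then have "(LINT \<xi>|lborel. f \<xi> * q (- (\<xi> + \<eta>))) = 0" by (simp only: integral_zero)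
    then show ?thesis by simp
  qed simp
  then have "(LINT \<eta>|lborel. g \<eta> * (LINT \<xi>|lborel. f \<xi> * q (- (\<xi> + \<eta>)))) = 0" by (simp only: integral_zero)
  then show ?thesis unfolding triple_ft[OF assms(1-4)] by simp
qed

lemma gaussian_mult_inversion:
  fixes q :: "real^'n \<Rightarrow> complex"
  assumes s: "s \<ge> 0" and q: "schwartz q"
  shows "ft (ft (\<lambda>\<xi>. of_real (exp (- s * (norm \<xi>)\<^sup>2)) * q \<xi>)) x = of_real ((2 * pi) ^ CARD('n)) * (of_real (exp (- s * (norm (- x))\<^sup>2)) * q (- x))"
proof -
  have [measurable]: "q \<in> borel_measurable borel" using q by measurable
  obtain B where B: "\<And>x. norm (q x) \<le> B" using schwartz_bounded[OF q] by blast
  have le: "norm (of_real (exp (- s * (norm \<xi>)\<^sup>2)) * q \<xi>) \<le> norm (q \<xi>)" for \<xi>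
    using s by (simp add: norm_mult mult_left_le_one_le)
  show ?thesis
  proof (rule fourier_inversion)
    show "integrable lborel (\<lambda>\<xi>. of_real (exp (- s * (norm \<xi>)\<^sup>2)) * q \<xi>)"
      by (rule Bochner_Integration.integrable_bound[OF schwartz_integrable[OF q]]) (use le in auto)
    show "integrable lborel (ft (\<lambda>\<xi>. of_real (exp (- s * (norm \<xi>)\<^sup>2)) * q \<xi>))"
      by (rule integral_norm_ft_gaussian_le(2)[OF s q])
    show "norm (of_real (exp (- s * (norm \<xi>)\<^sup>2)) * q \<xi>) \<le> B" for \<xi> by (rule order_trans[OF le B])
    show "isCont (\<lambda>\<xi>. of_real (exp (- s * (norm \<xi>)\<^sup>2)) * q \<xi>) (- x)"
      by (intro continuous_intros schwartz_isCont q)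
  qed
qed

section \<open>Test functions concentrated at the frequency 8^l\<close>

context bump
begin

text \<open>Supported in a ball of radius 1/4 around the unit vector \<zeta>, hence in the annulus
  between 3/4 and 5/4, which is where the unscaled Littlewood-Paley symbol equals 1.\<close>

definition P0 :: "real^'n \<Rightarrow> complex" where "P0 \<xi> = chi (\<xi> - \<zeta>)"

text \<open>The factor \<open>|\<xi>|\<^sup>2\<close> cancels the denominator of the Helmholtz symbol, so that the adjoint of
  \<open>e\<^sup>s\<^sup>\<Delta> \<P> \<nabla>\<cdot>\<close> maps the test function with transform \<open>N0\<close> to Schwartz functions with transforms
  \<open>exp (- s |\<xi>|\<^sup>2) Q0\<close>.\<close>

definition N0 :: "real^'n \<Rightarrow> complex" where "N0 \<xi> = (-1) * (of_real ((norm \<xi>)\<^sup>2) * P0 \<xi>)"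

definition Q0 :: "'n \<Rightarrow> 'n \<Rightarrow> real^'n \<Rightarrow> complex" where
  "Q0 j k \<xi> = \<i> * ((if j = b then 1 else 0) * (of_real ((norm \<xi>)\<^sup>2) * (of_real (\<xi> $ k) * P0 \<xi>)) +
     (-1) * (of_real (\<xi> $ b) * (of_real (\<xi> $ j) * (of_real (\<xi> $ k) * P0 \<xi>))))"

lemma P0_schwartz: "schwartz P0"
  unfolding P0_def[abs_def] by (intro schwartz_shift chi_schwartz)

lemma N0_schwartz: "schwartz N0"
  unfolding N0_def[abs_def] by (intro schwartz_cmult schwartz_norm_square P0_schwartz)

lemma Q0_schwartz: "schwartz (Q0 j k)"
  unfolding Q0_def[abs_def] by (intro schwartz_cmult schwartz_add schwartz_norm_square schwartz_coord P0_schwartz)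

lemma P0_support: "P0 \<xi> \<noteq> 0 \<Longrightarrow> norm (\<xi> - \<zeta>) \<le> 1/4"
  unfolding P0_def using chi_zero[of "\<xi> - \<zeta>"] by fastforce

lemma P0_norm: "P0 \<xi> \<noteq> 0 \<Longrightarrow> 3/4 \<le> norm \<xi> \<and> norm \<xi> \<le> 5/4"
  using P0_support[of \<xi>] norm_triangle_ineq2[of \<xi> \<zeta>] norm_triangle_ineq2[of \<zeta> \<xi>] by (simp add: norm_minus_commute)

lemma P0_le: "norm (P0 \<xi>) \<le> 1"
  using chir_nonneg[of "\<xi> - \<zeta>"] chir_le_1[of "\<xi> - \<zeta>"] by (simp add: P0_def chi_def)

lemma Q0_P0: "P0 \<xi> = 0 \<Longrightarrow> Q0 j k \<xi> = 0" and N0_P0: "P0 \<xi> = 0 \<Longrightarrow> N0 \<xi> = 0"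
  by (simp_all add: Q0_def N0_def)

lemma norm_Q0_le: "norm (Q0 j k \<xi>) \<le> 16"
proof (cases "P0 \<xi> = 0")
  case False
  define r where "r = norm \<xi>"
  have r: "0 \<le> r" "r \<le> 2" using P0_norm[OF False] by (auto simp: r_def)
  have c: "\<bar>\<xi> $ i\<bar> \<le> r" for i unfolding r_def by (rule component_le_norm_cart)
  have 1: "norm ((if j = b then 1 else 0) * (of_real ((norm \<xi>)\<^sup>2) * (of_real (\<xi> $ k) * P0 \<xi>))) \<le> r\<^sup>2 * (r * 1)"
  proof -
    have "norm ((if j = b then 1 else 0) * (of_real ((norm \<xi>)\<^sup>2) * (of_real (\<xi> $ k) * P0 \<xi>))) \<le> r\<^sup>2 * (\<bar>\<xi> $ k\<bar> * norm (P0 \<xi>))"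
      by (simp add: norm_mult norm_power r_def)
    also have "\<dots> \<le> r\<^sup>2 * (r * 1)" using r by (intro mult_left_mono mult_mono c P0_le) auto
    finally show ?thesis .
  qed
  have 2: "norm ((-1) * (of_real (\<xi> $ b) * (of_real (\<xi> $ j) * (of_real (\<xi> $ k) * P0 \<xi>)))) \<le> r * (r * (r * 1))"
  proof -
    have "norm ((-1) * (of_real (\<xi> $ b) * (of_real (\<xi> $ j) * (of_real (\<xi> $ k) * P0 \<xi>)))) = \<bar>\<xi> $ b\<bar> * (\<bar>\<xi> $ j\<bar> * (\<bar>\<xi> $ k\<bar> * norm (P0 \<xi>)))"
      by (simp add: norm_mult)
    also have "\<dots> \<le> r * (r * (r * 1))" using r by (intro mult_mono c P0_le) auto
    finally show ?thesis .
  qed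
  have "norm (Q0 j k \<xi>) \<le> r\<^sup>2 * (r * 1) + r * (r * (r * 1))"
    unfolding Q0_def norm_mult norm_ii mult_1_left
    by (rule order_trans[OF norm_triangle_ineq]) (use 1 2 in \<open>simp add: norm_mult\<close>)
  also have "\<dots> = 2 * r ^ 3" by (simp add: power2_eq_square power3_eq_cube)
  also have "\<dots> \<le> 2 * 2 ^ 3" using r by (intro mult_left_mono power_mono) auto
  finally show ?thesis by simp
qed (simp add: Q0_P0)

definition CQ :: real where "CQ = 1 + (\<Sum>j\<in>UNIV. \<Sum>k\<in>UNIV. LINT x|lborel. norm (ft (Q0 j k) x))"

definition CN :: real where "CN = 1 + (LINT x|lborel. norm (ft N0 x))"

lemma CQ_pos: "CQ > 0" and CN_pos: "CN > 0"
  unfolding CQ_def CN_def by (auto intro!: add_pos_nonneg sum_nonneg)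

lemma Q0_L1: "(LINT x|lborel. norm (ft (Q0 j k) x)) \<le> CQ"
proof -
  have "(LINT x|lborel. norm (ft (Q0 j k) x)) \<le> (\<Sum>k\<in>UNIV. LINT x|lborel. norm (ft (Q0 j k) x))"
    by (rule member_le_sum[of k UNIV "\<lambda>k. LINT x|lborel. norm (ft (Q0 j k) x)"]) auto
  also have "\<dots> \<le> (\<Sum>j\<in>UNIV. \<Sum>k\<in>UNIV. LINT x|lborel. norm (ft (Q0 j k) x))"
    by (rule member_le_sum[of j UNIV "\<lambda>j. \<Sum>k\<in>UNIV. LINT x|lborel. norm (ft (Q0 j k) x)"]) (auto intro!: sum_nonneg)
  finally show ?thesis by (simp add: CQ_def)
qed

definition rr :: "nat \<Rightarrow> real" where "rr l = 2 ^ (3 * l)"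

lemma rr_pos [simp]: "rr l > 0" and rr_nonzero [simp]: "rr l \<noteq> 0" by (simp_all add: rr_def)

text \<open>Dilated to the frequency 8^l and translated to the position of the bump with the same
  index, so that the phases cancel in the resonant product. The dilation leaves the integral of the
  modulus of the transform independent of l.\<close>

definition Nl :: "nat \<Rightarrow> real^'n \<Rightarrow> complex" where
  "Nl l \<xi> = cis (\<xi> \<bullet> - pos l) * N0 (inverse (rr l) *\<^sub>R \<xi>)"

text \<open>The factor \<open>rr l\<close> reflects the one derivative in the Oseen operator:
  \<open>Q0\<close> has a prefactor of degree 3, \<open>N0\<close> one of degree 2.\<close>

definition Ql :: "nat \<Rightarrow> 'n \<Rightarrow> 'n \<Rightarrow> real^'n \<Rightarrow> complex" where
  "Ql l j k \<xi> = of_real (rr l) * (cis (\<xi> \<bullet> - pos l) * Q0 j k (inverse (rr l) *\<^sub>R \<xi>))"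

lemma Nl_schwartz: "schwartz (Nl l)"
  unfolding Nl_def[abs_def] by (intro schwartz_cis schwartz_scale N0_schwartz) simp

lemma Ql_schwartz: "schwartz (Ql l j k)"
  unfolding Ql_def[abs_def] by (intro schwartz_cmult schwartz_cis schwartz_scale Q0_schwartz) simp

lemma integral_norm_ft_scale_shift:
  assumes f: "schwartz f" and c: "c > 0"
  shows "(LINT x|lborel. norm (ft (\<lambda>\<xi>. cis (\<xi> \<bullet> - v) * f (c *\<^sub>R \<xi>)) x)) = (LINT x|lborel. norm (ft f x))"
proof -
  have fc: "schwartz (\<lambda>\<xi>. f (c *\<^sub>R \<xi>))" using c by (intro schwartz_scale f) simp
  have "(LINT x|lborel. norm (ft (\<lambda>\<xi>. cis (\<xi> \<bullet> - v) * f (c *\<^sub>R \<xi>)) x)) = (LINT x|lborel. norm (ft (\<lambda>\<xi>. f (c *\<^sub>R \<xi>)) (x - v)))"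
    unfolding ft_modulate by simp
  also have "\<dots> = (LINT x|lborel. norm (ft (\<lambda>\<xi>. f (c *\<^sub>R \<xi>)) x))"
    by (rule integral_lborel_shift[OF integrable_norm[OF schwartz_ft_integrable[OF fc]]])
  also have "\<dots> = (LINT x|lborel. norm (ft f x))"
    by (rule integral_norm_ft_scale[OF schwartz_integrable[OF f] schwartz_ft_integrable[OF f] c])
  finally show ?thesis .
qed

lemma Nl_L1: "(LINT x|lborel. norm (ft (Nl l) x)) \<le> CN"
  unfolding Nl_def[abs_def] using rr_pos[of l] by (subst integral_norm_ft_scale_shift[OF N0_schwartz]) (auto simp: CN_def)

lemma Ql_L1: "(LINT x|lborel. norm (ft (Ql l j k) x)) \<le> rr l * CQ"
proof -
  have "(LINT x|lborel. norm (ft (Ql l j k) x)) = rr l * (LINT x|lborel. norm (ft (Q0 j k) x))"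
    unfolding Ql_def[abs_def] ft_cmult norm_mult[of "of_real (rr l)"] integral_mult_right_zero
    using rr_pos[of l] by (subst integral_norm_ft_scale_shift[OF Q0_schwartz]) (auto simp: less_imp_le)
  also have "\<dots> \<le> rr l * CQ" by (intro mult_left_mono Q0_L1) (simp add: less_imp_le)
  finally show ?thesis .
qed

lemma scaled_support:
  assumes "P0 (inverse (rr l) *\<^sub>R \<xi>) \<noteq> 0"
  shows "norm (\<xi> - rr l *\<^sub>R \<zeta>) \<le> rr l / 4" "3/4 * rr l \<le> norm \<xi>" "norm \<xi> \<le> 5/4 * rr l"
proof -
  have r: "rr l > 0" by simp
  have "\<xi> - rr l *\<^sub>R \<zeta> = rr l *\<^sub>R (inverse (rr l) *\<^sub>R \<xi> - \<zeta>)" by (simp add: scaleR_diff_right)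
  then have "norm (\<xi> - rr l *\<^sub>R \<zeta>) = rr l * norm (inverse (rr l) *\<^sub>R \<xi> - \<zeta>)" using r by (simp only: norm_scaleR abs_of_pos[OF r])
  also have "\<dots> \<le> rr l * (1/4)" using r by (intro mult_left_mono P0_support assms) (simp add: less_imp_le)
  finally show "norm (\<xi> - rr l *\<^sub>R \<zeta>) \<le> rr l / 4" by simp
  have n: "norm (inverse (rr l) *\<^sub>R \<xi>) = norm \<xi> / rr l"
    unfolding norm_scaleR abs_of_pos[OF positive_imp_inverse_positive[OF r]] by (simp add: divide_inverse mult.commute)
  show "3/4 * rr l \<le> norm \<xi>" "norm \<xi> \<le> 5/4 * rr l"
    using P0_norm[OF assms] r unfolding n by (simp_all add: field_simps)
qed

lemma Ql_support: "Ql l j k \<xi> \<noteq> 0 \<Longrightarrow> P0 (inverse (rr l) *\<^sub>R \<xi>) \<noteq> 0"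
  unfolding Ql_def using Q0_P0 by fastforce

lemma Nl_support: "Nl l \<xi> \<noteq> 0 \<Longrightarrow> P0 (inverse (rr l) *\<^sub>R \<xi>) \<noteq> 0"
  unfolding Nl_def using N0_P0 by fastforce

lemma norm_Ql_le: "norm (Ql l j k \<xi>) \<le> 16 * rr l"
  using mult_left_mono[OF norm_Q0_le[of j k "inverse (rr l) *\<^sub>R \<xi>"], of "rr l"] rr_pos[of l]
  by (simp add: Ql_def norm_mult less_imp_le mult.commute del: rr_pos)

text \<open>The factor |\<xi>|^2 in \<open>N0\<close> clears the denominator of the Helmholtz
  symbol. The sign in \<open>N0\<close> compensates the odd factor - \<xi>_k, so that the resonant
  entry of \<open>Q0\<close> comes out as \<i> times a nonnegative function. At \<xi> = 0 both sides
  vanish.\<close>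

lemma oseen_symbol_Nl: "oseen_symbol s b j k (- \<xi>) * Nl l \<xi> = of_real (exp (- s * (norm \<xi>)\<^sup>2)) * Ql l j k \<xi>"
proof (cases "\<xi> = 0")
  case True
  then show ?thesis by (simp add: oseen_symbol_def Ql_def Q0_def)
next
  case False
  define r where "r = complex_of_real (rr l)"
  have r: "r \<noteq> 0" using rr_pos[of l] by (simp add: r_def del: rr_pos)
  define n where "n = complex_of_real (norm \<xi>)"
  have n: "n \<noteq> 0" using False by (simp add: n_def)
  define p where "p = P0 (inverse (rr l) *\<^sub>R \<xi>)"
  define E where "E = complex_of_real (exp (- s * (norm \<xi>)\<^sup>2))"
  define xb xj xk where "xb = complex_of_real (\<xi> $ b)" and "xj = complex_of_real (\<xi> $ j)" and "xk = complex_of_real (\<xi> $ k)"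
  define d where "d = (if j = b then 1 else 0 :: complex)"
  have N: "N0 (inverse (rr l) *\<^sub>R \<xi>) = - (n\<^sup>2 / r\<^sup>2 * p)"
    using rr_pos[of l] by (simp add: N0_def p_def n_def r_def power_mult_distrib divide_inverse power_inverse mult_ac del: rr_pos)
  have Q: "Q0 j k (inverse (rr l) *\<^sub>R \<xi>) = \<i> * (d * (n\<^sup>2 / r\<^sup>2 * (xk / r * p)) - xb / r * (xj / r * (xk / r * p)))"
    using rr_pos[of l] by (simp add: Q0_def p_def n_def r_def d_def xb_def xj_def xk_def power_mult_distrib divide_inverse power_inverse mult_ac del: rr_pos)
  have S: "oseen_symbol s b j k (- \<xi>) = E * (d - xb * xj / n\<^sup>2) * (\<i> * (- xk))"
    by (simp add: oseen_symbol_def helmholtz_symbol_def E_def d_def n_def xb_def xj_def xk_def)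
  have "(d - xb * xj / n\<^sup>2) * (- xk) * (- (n\<^sup>2 / r\<^sup>2 * p)) = r * (d * (n\<^sup>2 / r\<^sup>2 * (xk / r * p)) - xb / r * (xj / r * (xk / r * p)))"
    using r n by (simp add: field_simps power2_eq_square)
  then have "E * (d - xb * xj / n\<^sup>2) * (\<i> * (- xk)) * (cis (\<xi> \<bullet> - pos l) * (- (n\<^sup>2 / r\<^sup>2 * p))) =
     E * (r * (cis (\<xi> \<bullet> - pos l) * (\<i> * (d * (n\<^sup>2 / r\<^sup>2 * (xk / r * p)) - xb / r * (xj / r * (xk / r * p))))))"
  proof -
    have "E * D * (\<i> * X) * (C * M) = E * (r * (C * (\<i> * B)))" if "D * X * M = r * B" for D X M B C :: complex
    proof -
      have "E * D * (\<i> * X) * (C * M) = E * C * \<i> * (D * X * M)" by (simp only: mult_ac)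
      then show ?thesis unfolding that by (simp only: mult_ac)
    qed
    then show ?thesis if "(d - xb * xj / n\<^sup>2) * (- xk) * (- (n\<^sup>2 / r\<^sup>2 * p)) = r * (d * (n\<^sup>2 / r\<^sup>2 * (xk / r * p)) - xb / r * (xj / r * (xk / r * p)))"
      using that by blast
  qed
  then show ?thesis unfolding S Nl_def Ql_def N Q r_def[symmetric] E_def[symmetric] .
qed

section \<open>Products of two bumps tested at the frequency 8^l\<close>

lemma Gl_support:
  assumes "Gl m \<xi> \<noteq> 0"
  obtains \<epsilon> where "\<epsilon> = 1 \<or> \<epsilon> = -1" "norm (\<xi> - (\<epsilon> * rr m / 2) *\<^sub>R \<zeta>) \<le> 1/4"
proof -
  have "chi (\<xi> - frq m) \<noteq> 0 \<or> chi (\<xi> - - frq m) \<noteq> 0" using assms unfolding Gl_def by auto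
  then show thesis
  proof
    assume "chi (\<xi> - frq m) \<noteq> 0"
    then have "norm (\<xi> - frq m) \<le> 1/4" using chi_zero[of "\<xi> - frq m"] by fastforce
    then show thesis by (intro that[of 1]) (simp_all add: frq_def rr_def)
  next
    assume "chi (\<xi> - - frq m) \<noteq> 0"
    then have "norm (\<xi> + frq m) \<le> 1/4" using chi_zero[of "\<xi> + frq m"] by fastforce
    then show thesis by (intro that[of "-1"]) (simp_all add: frq_def rr_def)
  qed
qed

lemma rr_less: "m < l \<Longrightarrow> 8 * rr m \<le> rr l"
proof -
  assume "m < l"
  then have "(2::real) ^ (3 + 3 * m) \<le> 2 ^ (3 * l)" by (intro power_increasing) auto
  then show ?thesis by (simp add: rr_def power_add)
qed

text \<open>The frequencies of the product of two bumps are \<open>(\<plusminus> 8\<^sup>m \<plusminus> 8\<^bsup>m'\<^esup>) / 2\<close>; only \<open>m = m' = l\<close> reaches \<open>8\<^sup>l\<close>.\<close>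

lemma resonance:
  assumes l: "l \<ge> 1" and ml: "m \<noteq> l \<or> m' \<noteq> l" and e: "\<epsilon> = 1 \<or> \<epsilon> = -1" "\<epsilon>' = 1 \<or> \<epsilon>' = -1"
  shows "\<bar>\<epsilon> * rr m / 2 + \<epsilon>' * rr m' / 2 + rr l\<bar> > rr l / 4 + 1/2"
proof -
  have "rr l \<ge> 8"
  proof -
    have "(2::real) ^ 3 \<le> 2 ^ (3 * l)" using l by (intro power_increasing) auto
    then show ?thesis by (simp add: rr_def)
  qed
  define x y z where "x = rr m" and "y = rr m'" and "z = rr l"
  have p: "x > 0" "y > 0" "z \<ge> 8" using \<open>rr l \<ge> 8\<close> by (auto simp: x_def y_def z_def)
  \<comment> \<open>Different levels differ at least by a factor 8; the last alternative records
    that m or m' is not l. With this finite list the four sign patterns become linear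
    arithmetic.\<close>
  have c: "8 * x \<le> z \<or> x = z \<or> 8 * z \<le> x" "8 * y \<le> z \<or> y = z \<or> 8 * z \<le> y" "8 * x \<le> y \<or> x = y \<or> 8 * y \<le> x"
    "8 * x \<le> z \<or> 8 * z \<le> x \<or> 8 * y \<le> z \<or> 8 * z \<le> y"
    using rr_less[of m l] rr_less[of l m] rr_less[of m' l] rr_less[of l m'] rr_less[of m m'] rr_less[of m' m] ml
    unfolding x_def y_def z_def by (metis linorder_neqE_nat)+
  have "\<bar>\<epsilon> * x / 2 + \<epsilon>' * y / 2 + z\<bar> > z / 4 + 1/2" using e
  proof (elim disjE)
    assume "\<epsilon> = 1" "\<epsilon>' = 1"
    then show ?thesis using p by simp
  next
    assume e: "\<epsilon> = -1" "\<epsilon>' = 1"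
    have "\<not> (\<epsilon> * x / 2 + \<epsilon>' * y / 2 + z \<le> z / 4 + 1/2 \<and> - (\<epsilon> * x / 2 + \<epsilon>' * y / 2 + z) \<le> z / 4 + 1/2)"
      unfolding e using c p by argo
    then show ?thesis by linarith
  next
    assume e: "\<epsilon> = 1" "\<epsilon>' = -1"
    have "\<not> (\<epsilon> * x / 2 + \<epsilon>' * y / 2 + z \<le> z / 4 + 1/2 \<and> - (\<epsilon> * x / 2 + \<epsilon>' * y / 2 + z) \<le> z / 4 + 1/2)"
      unfolding e using c p by argo
    then show ?thesis by linarith
  next
    assume e: "\<epsilon> = -1" "\<epsilon>' = -1"
    have "\<not> (\<epsilon> * x / 2 + \<epsilon>' * y / 2 + z \<le> z / 4 + 1/2 \<and> - (\<epsilon> * x / 2 + \<epsilon>' * y / 2 + z) \<le> z / 4 + 1/2)"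
      unfolding e using c p by argo
    then show ?thesis by linarith
  qed
  then show ?thesis by (simp only: x_def y_def z_def)
qed

text \<open>All three spectra lie near multiples of the unit vector \<zeta>, so the question reduces
  to the scalar coefficients. The tolerances 1/4, 1/4 and \<open>rr l / 4\<close> add up to the gap
  provided by \<open>resonance\<close>.\<close>

lemma Gl_Gl_Ql_zero:
  assumes "l \<ge> 1" "m \<noteq> l \<or> m' \<noteq> l"
  shows "(LINT y|lborel. ft (Gl m) y * ft (Gl m') y * ft (Ql l j k) y) = 0"
proof (rule triple_ft_zero)
  show "integrable lborel (Gl m)" "integrable lborel (Gl m')" by (intro schwartz_integrable Gl_schwartz)+
  show "integrable lborel (ft (Ql l j k))" by (rule schwartz_ft_integrable[OF Ql_schwartz])
  show "ft (ft (Ql l j k)) x = of_real ((2 * pi) ^ CARD('n)) * Ql l j k (- x)" for x by (rule schwartz_inversion[OF Ql_schwartz])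
  fix \<xi> \<eta> assume 1: "Gl m \<xi> \<noteq> 0" and 2: "Gl m' \<eta> \<noteq> 0"
  obtain \<epsilon> where e: "\<epsilon> = 1 \<or> \<epsilon> = -1" "norm (\<xi> - (\<epsilon> * rr m / 2) *\<^sub>R \<zeta>) \<le> 1/4" by (rule Gl_support[OF 1])
  obtain \<epsilon>' where e': "\<epsilon>' = 1 \<or> \<epsilon>' = -1" "norm (\<eta> - (\<epsilon>' * rr m' / 2) *\<^sub>R \<zeta>) \<le> 1/4" by (rule Gl_support[OF 2])
  show "Ql l j k (- (\<xi> + \<eta>)) = 0"
  proof (rule ccontr)
    assume "Ql l j k (- (\<xi> + \<eta>)) \<noteq> 0"
    from scaled_support(1)[OF Ql_support[OF this]] have 3: "norm (- (\<xi> + \<eta>) - rr l *\<^sub>R \<zeta>) \<le> rr l / 4" .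
    define c where "c = \<epsilon> * rr m / 2 + \<epsilon>' * rr m' / 2 + rr l"
    have cz: "c *\<^sub>R \<zeta> = - ((\<xi> - (\<epsilon> * rr m / 2) *\<^sub>R \<zeta>) + (\<eta> - (\<epsilon>' * rr m' / 2) *\<^sub>R \<zeta>) + (- (\<xi> + \<eta>) - rr l *\<^sub>R \<zeta>))"
      by (simp add: c_def algebra_simps)
    have "\<bar>c\<bar> = norm (c *\<^sub>R \<zeta>)" by simp
    also have "\<dots> = norm ((\<xi> - (\<epsilon> * rr m / 2) *\<^sub>R \<zeta>) + (\<eta> - (\<epsilon>' * rr m' / 2) *\<^sub>R \<zeta>) + (- (\<xi> + \<eta>) - rr l *\<^sub>R \<zeta>))"
      unfolding cz by (rule norm_minus_cancel)
    also have "\<dots> \<le> norm (\<xi> - (\<epsilon> * rr m / 2) *\<^sub>R \<zeta>) + norm (\<eta> - (\<epsilon>' * rr m' / 2) *\<^sub>R \<zeta>) + norm (- (\<xi> + \<eta>) - rr l *\<^sub>R \<zeta>)"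
      by (intro order_trans[OF norm_triangle_ineq] add_right_mono norm_triangle_ineq)
    also have "\<dots> \<le> 1/4 + 1/4 + rr l / 4" by (intro add_mono e e' 3)
    finally show False using resonance[OF assms e(1) e'(1)] unfolding c_def by simp
  qed
qed

text \<open>The entry (b, b) of \<open>Q0\<close> without the factor \<i>. Its first factor is
  |\<eta>|^2 times the Helmholtz symbol; near \<zeta> it is positive because \<zeta> has a component
  along a, and \<eta>_b is positive because \<zeta> has one along b.\<close>

definition q0 :: "real^'n \<Rightarrow> real" where "q0 \<eta> = ((norm \<eta>)\<^sup>2 - (\<eta> $ b)\<^sup>2) * \<eta> $ b * chir (\<eta> - \<zeta>)"

lemma Q0_bb: "Q0 b b \<eta> = \<i> * of_real (q0 \<eta>)"
  by (simp add: Q0_def q0_def P0_def chi_def algebra_simps power2_eq_square)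

lemma norm_square_ge: "(norm \<eta>)\<^sup>2 - (\<eta> $ b)\<^sup>2 \<ge> (\<eta> $ a)\<^sup>2"
proof -
  have "(\<Sum>i\<in>{a, b}. (\<eta> $ i)\<^sup>2) \<le> (\<Sum>i\<in>UNIV. (\<eta> $ i)\<^sup>2)" by (intro sum_mono2) auto
  then show ?thesis using ab unfolding norm_vec_sum_power2 by simp
qed

lemma q0_nonneg: "q0 \<eta> \<ge> 0"
proof (cases "chir (\<eta> - \<zeta>) = 0")
  case False
  then have "norm (\<eta> - \<zeta>) \<le> 1/4" using chir_zero[of "\<eta> - \<zeta>"] by fastforce
  then have "\<bar>(\<eta> - \<zeta>) $ b\<bar> \<le> 1/4" using component_le_norm_cart[of "\<eta> - \<zeta>" b] by linarith
  then have "\<eta> $ b \<ge> 0" unfolding vector_minus_component zeta_b by linarith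
  moreover have "(norm \<eta>)\<^sup>2 - (\<eta> $ b)\<^sup>2 \<ge> 0" using norm_square_ge[of \<eta>] zero_le_power2[of "\<eta> $ a"] by linarith
  ultimately show ?thesis unfolding q0_def using chir_nonneg by (intro mult_nonneg_nonneg)
qed (simp add: q0_def)

lemma q0_ge:
  assumes "norm (\<eta> - \<zeta>) \<le> 1/16"
  shows "q0 \<eta> \<ge> 1/8"
proof -
  have "\<bar>(\<eta> - \<zeta>) $ a\<bar> \<le> 1/16" "\<bar>(\<eta> - \<zeta>) $ b\<bar> \<le> 1/16"
    using component_le_norm_cart[of "\<eta> - \<zeta>" a] component_le_norm_cart[of "\<eta> - \<zeta>" b] assms by linarith+
  then have ea: "\<eta> $ a \<ge> 1/2" and eb: "\<eta> $ b \<ge> 1/2" unfolding vector_minus_component zeta_a zeta_b by linarith+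
  have "(1/2)\<^sup>2 \<le> (\<eta> $ a)\<^sup>2" using ea by (intro power_mono) auto
  then have "1/4 \<le> (norm \<eta>)\<^sup>2 - (\<eta> $ b)\<^sup>2" using norm_square_ge[of \<eta>] by (simp add: power2_eq_square)
  then have "0 \<le> (norm \<eta>)\<^sup>2 - (\<eta> $ b)\<^sup>2" by linarith
  note * = \<open>1/4 \<le> (norm \<eta>)\<^sup>2 - (\<eta> $ b)\<^sup>2\<close> this
  then have "(1/4) * (1/2) \<le> ((norm \<eta>)\<^sup>2 - (\<eta> $ b)\<^sup>2) * \<eta> $ b" using eb * by (intro mult_mono) linarith+
  moreover have "chir (\<eta> - \<zeta>) = 1" using assms by (intro chir_one) auto
  ultimately show ?thesis by (simp add: q0_def)
qed

lemma q0_measurable [measurable]: "q0 \<in> borel_measurable borel"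
  unfolding q0_def[abs_def] by measurable

lemma q0_le: "q0 \<eta> \<le> 16"
  using norm_Q0_le[of b b \<eta>] q0_nonneg[of \<eta>] by (simp add: Q0_bb norm_mult)

text \<open>Once the phases have cancelled, the integrand on the frequency side is \<i> times a
  nonnegative function. It may therefore be bounded below by the part where both frequencies are
  near - \<open>frq l\<close>; their sum is then near - 8^l \<zeta>, where q is at least
  1/8.\<close>

lemma Gl_Gl_Ql_diag:
  assumes l: "l \<ge> 1"
  shows "Im (LINT y|lborel. ft (Gl l) y * ft (Gl l) y * ft (Ql l b b) y) \<ge> (2 * pi) ^ CARD('n) * (rr l * c0\<^sup>2 / 32)"
proof -
  define h where "h \<xi> = chir (\<xi> - frq l) + chir (\<xi> + frq l)" for \<xi> :: "real^'n"
  define r where "r = rr l"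
  have r8: "r \<ge> 8"
  proof -
    have "(2::real) ^ 3 \<le> 2 ^ (3 * l)" using l by (intro power_increasing) auto
    then show ?thesis by (simp add: rr_def r_def)
  qed
  define q where "q \<eta> = q0 (inverse r *\<^sub>R (- \<eta>))" for \<eta> :: "real^'n"
  have ci: "integrable lborel (\<lambda>\<xi>. chir (\<xi> + v))" for v using integrable_lborel_shift[OF chir_integrable, of "- v"] by simp
  have hi: "integrable lborel h" unfolding h_def using ci[of "- frq l"] ci[of "frq l"] by simp
  have h0: "h \<xi> \<ge> 0" for \<xi> using chir_nonneg by (simp add: h_def)
  have hm[measurable]: "h \<in> borel_measurable borel" using hi by auto
  have qm[measurable]: "q \<in> borel_measurable borel" unfolding q_def by measurable
  have qb: "0 \<le> q \<eta>" "q \<eta> \<le> 16" for \<eta> using q0_nonneg q0_le by (auto simp: q_def)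
  have hq: "integrable lborel (\<lambda>\<xi>. h \<xi> * q (\<xi> + \<eta>))" for \<eta>
  proof (rule Bochner_Integration.integrable_bound)
    show "integrable lborel (\<lambda>\<xi>. h \<xi> * 16)" using hi by simp
    show "AE \<xi> in lborel. norm (h \<xi> * q (\<xi> + \<eta>)) \<le> norm (h \<xi> * 16)"
      using h0 qb by (intro AE_I2) (auto simp: abs_mult intro!: mult_mono)
  qed measurable
  define J where "J \<eta> = (LINT \<xi>|lborel. h \<xi> * q (\<xi> + \<eta>))" for \<eta>
  have Jm[measurable]: "J \<in> borel_measurable borel" unfolding J_def by measurable
  have J0: "0 \<le> J \<eta>" for \<eta> unfolding J_def by (rule integral_nonneg_AE) (use h0 qb in auto)
  have Jb: "J \<eta> \<le> (LINT \<xi>|lborel. h \<xi> * 16)" for \<eta>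
    unfolding J_def using hi h0 qb by (intro integral_mono hq mult_left_mono) auto
  have hJ: "integrable lborel (\<lambda>\<eta>. h \<eta> * J \<eta>)"
  proof (rule Bochner_Integration.integrable_bound)
    show "integrable lborel (\<lambda>\<eta>. h \<eta> * (LINT \<xi>|lborel. h \<xi> * 16))" using hi by simp
    show "AE \<eta> in lborel. norm (h \<eta> * J \<eta>) \<le> norm (h \<eta> * (LINT \<xi>|lborel. h \<xi> * 16))"
      using h0 J0 Jb by (intro AE_I2) (auto simp: abs_mult intro!: mult_left_mono order_trans[OF Jb abs_ge_self])
  qed measurable
  have eq: "Gl l \<eta> * (LINT \<xi>|lborel. Gl l \<xi> * Ql l b b (- (\<xi> + \<eta>))) = \<i> * of_real ((r / 4) * (h \<eta> * J \<eta>))" for \<eta>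
  proof -
    have "Gl l \<eta> * (LINT \<xi>|lborel. Gl l \<xi> * Ql l b b (- (\<xi> + \<eta>))) = (LINT \<xi>|lborel. Gl l \<eta> * (Gl l \<xi> * Ql l b b (- (\<xi> + \<eta>))))"
      by (rule integral_mult_right_zero[symmetric])
    also have "\<dots> = (LINT \<xi>|lborel. \<i> * complex_of_real ((r / 4) * (h \<eta> * (h \<xi> * q (\<xi> + \<eta>)))))"
    proof (intro Bochner_Integration.integral_cong refl)
      fix \<xi>
      \<comment> \<open>Both bumps and the test function sit at \<open>pos l\<close>, and the three
        frequencies add up to zero.\<close>
      have cc: "cis (\<eta> \<bullet> - pos l) * (cis (\<xi> \<bullet> - pos l) * cis (- (\<xi> + \<eta>) \<bullet> - pos l)) = 1"
        by (simp add: cis_mult inner_add_left inner_diff_left)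
      have "Gl l \<eta> * (Gl l \<xi> * Ql l b b (- (\<xi> + \<eta>))) =
        (cis (\<eta> \<bullet> - pos l) * (cis (\<xi> \<bullet> - pos l) * cis (- (\<xi> + \<eta>) \<bullet> - pos l))) *
        ((1/2) * of_real (h \<eta>) * ((1/2) * of_real (h \<xi>)) * (of_real r * (\<i> * of_real (q (\<xi> + \<eta>)))))"
        by (simp only: Gl_def Ql_def Q0_bb q_def r_def h_def chi_def diff_minus_eq_add of_real_add mult_ac)
      then show "Gl l \<eta> * (Gl l \<xi> * Ql l b b (- (\<xi> + \<eta>))) = \<i> * complex_of_real ((r / 4) * (h \<eta> * (h \<xi> * q (\<xi> + \<eta>))))"
        unfolding cc by simp
    qed
    also have "\<dots> = \<i> * complex_of_real ((r / 4) * (h \<eta> * J \<eta>))"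
      unfolding J_def by (simp only: integral_mult_right_zero integral_complex_of_real)
    finally show ?thesis .
  qed
  have "(LINT y|lborel. ft (Gl l) y * ft (Gl l) y * ft (Ql l b b) y) =
    of_real ((2 * pi) ^ CARD('n)) * (LINT \<eta>|lborel. Gl l \<eta> * (LINT \<xi>|lborel. Gl l \<xi> * Ql l b b (- (\<xi> + \<eta>))))"
    by (rule triple_ft[OF _ _ _ schwartz_inversion[OF Ql_schwartz]])
       (intro schwartz_integrable Gl_schwartz schwartz_ft(1) Ql_schwartz)+
  also have "\<dots> = \<i> * of_real ((2 * pi) ^ CARD('n) * ((r / 4) * (LINT \<eta>|lborel. h \<eta> * J \<eta>)))"
    unfolding eq integral_mult_right_zero integral_complex_of_real by simp
  finally have I0: "(LINT y|lborel. ft (Gl l) y * ft (Gl l) y * ft (Ql l b b) y) = \<i> * of_real ((2 * pi) ^ CARD('n) * ((r / 4) * (LINT \<eta>|lborel. h \<eta> * J \<eta>)))" .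
  have I: "Im (LINT y|lborel. ft (Gl l) y * ft (Gl l) y * ft (Ql l b b) y) = (2 * pi) ^ CARD('n) * ((r / 4) * (LINT \<eta>|lborel. h \<eta> * J \<eta>))"
    by (simp only: I0 Im_i_times Re_complex_of_real)
  have c: "(LINT \<xi>|lborel. chir (\<xi> + frq l)) = c0"
    using integral_lborel_shift[OF chir_integrable, of "- frq l"] by (simp add: c0_def)
  have Jl: "c0 / 8 \<le> J \<eta>" if "chir (\<eta> + frq l) \<noteq> 0" for \<eta>
  proof -
    have "c0 / 8 = (LINT \<xi>|lborel. chir (\<xi> + frq l) * (1/8))" using c by simp
    also have "\<dots> \<le> J \<eta>" unfolding J_def
    proof (rule integral_mono)
      show "integrable lborel (\<lambda>\<xi>. chir (\<xi> + frq l) * (1/8))" using ci by simp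
      show "integrable lborel (\<lambda>\<xi>. h \<xi> * q (\<xi> + \<eta>))" by (rule hq)
      fix \<xi>
      show "chir (\<xi> + frq l) * (1/8) \<le> h \<xi> * q (\<xi> + \<eta>)"
      proof (cases "chir (\<xi> + frq l) = 0")
        case True
        then show ?thesis using h0 qb by simp
      next
        case False
        have n1: "norm (\<xi> + frq l) \<le> 1/4" using False chir_zero[of "\<xi> + frq l"] by fastforce
        have n2: "norm (\<eta> + frq l) \<le> 1/4" using that chir_zero[of "\<eta> + frq l"] by fastforce
        have "inverse r *\<^sub>R (- (\<xi> + \<eta>)) - \<zeta> = - (inverse r *\<^sub>R ((\<xi> + frq l) + (\<eta> + frq l)))"
        proof -
          have "frq l + frq l = r *\<^sub>R \<zeta>" unfolding frq_def r_def rr_def by (simp flip: scaleR_add_left)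
          then have "(\<xi> + frq l) + (\<eta> + frq l) = \<xi> + \<eta> + r *\<^sub>R \<zeta>" by (metis (no_types, opaque_lifting) add.assoc add.commute)
          then show ?thesis using r8 by (simp add: scaleR_add_right scaleR_diff_right)
        qed
        then have "norm (inverse r *\<^sub>R (- (\<xi> + \<eta>)) - \<zeta>) = inverse r * norm ((\<xi> + frq l) + (\<eta> + frq l))"
          using r8 by simp
        also have "\<dots> \<le> inverse r * (1/4 + 1/4)"
          using norm_triangle_ineq[of "\<xi> + frq l" "\<eta> + frq l"] n1 n2 r8 by (intro mult_left_mono) (linarith, simp)
        \<comment> \<open>The deviation 1/4 + 1/4 shrinks by the dilation factor r, which is at
          least 8 because l \<ge> 1.\<close>
        also have "\<dots> \<le> 1/16" using r8 by (simp add: field_simps)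
        finally have "1/8 \<le> q (\<xi> + \<eta>)" unfolding q_def by (rule q0_ge)
        moreover have "chir (\<xi> + frq l) \<le> h \<xi>" using chir_nonneg by (simp add: h_def)
        ultimately show ?thesis using chir_nonneg h0 by (intro mult_mono) auto
      qed
    qed
    finally show ?thesis .
  qed
  have "c0\<^sup>2 / 8 = (LINT \<eta>|lborel. chir (\<eta> + frq l) * (c0 / 8))" using c by (simp add: power2_eq_square)
  also have "\<dots> \<le> (LINT \<eta>|lborel. h \<eta> * J \<eta>)"
  proof (rule integral_mono[OF _ hJ])
    show "integrable lborel (\<lambda>\<eta>. chir (\<eta> + frq l) * (c0 / 8))" using ci by simp
    fix \<eta>
    show "chir (\<eta> + frq l) * (c0 / 8) \<le> h \<eta> * J \<eta>"
    proof (cases "chir (\<eta> + frq l) = 0")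
      case True
      then show ?thesis using h0 J0 by simp
    next
      case False
      moreover have "chir (\<eta> + frq l) \<le> h \<eta>" using chir_nonneg by (simp add: h_def)
      ultimately show ?thesis using Jl chir_nonneg h0 c0_pos by (intro mult_mono) auto
    qed
  qed
  finally have "c0\<^sup>2 / 8 \<le> (LINT \<eta>|lborel. h \<eta> * J \<eta>)" .
  then have "(2 * pi) ^ CARD('n) * ((r / 4) * (c0\<^sup>2 / 8)) \<le> (2 * pi) ^ CARD('n) * ((r / 4) * (LINT \<eta>|lborel. h \<eta> * J \<eta>))"
    using r8 by (intro mult_left_mono) auto
  then show ?thesis unfolding I by (simp add: r_def)
qed

end

lemma triple_ft_le:
  fixes f g q :: "real^'n \<Rightarrow> complex"
  assumes f: "integrable lborel f" and g: "integrable lborel g" and q: "integrable lborel (ft q)"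
    and inv: "\<And>x. ft (ft q) x = of_real ((2 * pi) ^ CARD('n)) * q (- x)"
    and B: "\<And>\<xi>. norm (q \<xi>) \<le> B"
  shows "norm (LINT y|lborel. ft f y * ft g y * ft q y) \<le> (2 * pi) ^ CARD('n) * (B * (LINT \<xi>|lborel. norm (f \<xi>)) * (LINT \<xi>|lborel. norm (g \<xi>)))"
proof -
  have "norm (LINT \<zeta>|lborel. g \<zeta> * (LINT \<xi>|lborel. f \<xi> * q (- (\<xi> + \<zeta>)))) \<le> (LINT \<zeta>|lborel. norm (g \<zeta>) * (B * (LINT \<xi>|lborel. norm (f \<xi>))))"
  proof (rule integral_norm_le')
    show "integrable lborel (\<lambda>\<zeta>. norm (g \<zeta>) * (B * (LINT \<xi>|lborel. norm (f \<xi>))))" using g by simp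
    fix \<zeta>
    have "norm (LINT \<xi>|lborel. f \<xi> * q (- (\<xi> + \<zeta>))) \<le> (LINT \<xi>|lborel. norm (f \<xi>) * B)"
      by (rule integral_norm_le') (use f B in \<open>auto simp: norm_mult intro!: mult_left_mono\<close>)
    then show "norm (g \<zeta> * (LINT \<xi>|lborel. f \<xi> * q (- (\<xi> + \<zeta>)))) \<le> norm (g \<zeta>) * (B * (LINT \<xi>|lborel. norm (f \<xi>)))"
      by (simp add: norm_mult mult_left_mono mult.commute)
  qed
  also have "\<dots> = B * (LINT \<xi>|lborel. norm (f \<xi>)) * (LINT \<xi>|lborel. norm (g \<xi>))" by simp
  finally show ?thesis
    unfolding triple_ft[OF f g q inv] norm_mult norm_of_real by (intro mult_mono) auto
qed

lemma norm_integral_of_real_mult_le: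
  fixes h :: "'a \<Rightarrow> complex"
  assumes h: "integrable M h" and f: "AE x in M. \<bar>f x\<bar> \<le> B" and B: "B \<ge> 0" and H: "(LINT x|M. norm (h x)) \<le> H"
  shows "norm (LINT x|M. of_real (f x) * h x) \<le> B * H"
proof (cases "integrable M (\<lambda>x. of_real (f x) * h x)")
  case True
  have "norm (LINT x|M. of_real (f x) * h x) \<le> (LINT x|M. norm (of_real (f x) * h x))" by (rule integral_norm_bound)
  also have "\<dots> \<le> (LINT x|M. B * norm (h x))"
    by (rule integral_mono_AE[OF integrable_norm[OF True]])
       (use f h in \<open>auto simp: norm_mult intro!: mult_right_mono\<close>)
  also have "\<dots> \<le> B * H" using B H by (simp add: mult_left_mono)
  finally show ?thesis .
next
  case False
  have "0 \<le> (LINT x|M. norm (h x))" by simp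
  then have "0 \<le> H" using H by linarith
  then show ?thesis unfolding not_integrable_integral_eq[OF False] using B by simp
qed

section \<open>Test functions under the adjoint heat flow\<close>

context bump
begin

text \<open>Frequency side of the test function after the adjoint Oseen operator has acted for the
  remaining time s.\<close>

definition Qs :: "real \<Rightarrow> nat \<Rightarrow> 'n \<Rightarrow> 'n \<Rightarrow> real^'n \<Rightarrow> complex" where
  "Qs s l j k \<xi> = of_real (exp (- s * (norm \<xi>)\<^sup>2)) * Ql l j k \<xi>"

lemma Qs_0: "Qs 0 l j k = Ql l j k"
  by (simp add: Qs_def fun_eq_iff)

lemma ft_Qs_integrable: "s \<ge> 0 \<Longrightarrow> integrable lborel (ft (Qs s l j k))"
  unfolding Qs_def[abs_def] by (rule integral_norm_ft_gaussian_le(2)[OF _ Ql_schwartz])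

lemma ft_Qs_L1: "s \<ge> 0 \<Longrightarrow> (LINT x|lborel. norm (ft (Qs s l j k) x)) \<le> rr l * CQ"
  unfolding Qs_def[abs_def] by (rule order_trans[OF integral_norm_ft_gaussian_le(1)[OF _ Ql_schwartz] Ql_L1])

lemma ft_Qs_inversion: "s \<ge> 0 \<Longrightarrow> ft (ft (Qs s l j k)) x = of_real ((2 * pi) ^ CARD('n)) * Qs s l j k (- x)"
  unfolding Qs_def[abs_def] by (rule gaussian_mult_inversion[OF _ Ql_schwartz])

lemma Qs_integrable: "s \<ge> 0 \<Longrightarrow> integrable lborel (Qs s l j k)"
proof -
  assume s: "s \<ge> 0"
  have [measurable]: "Ql l j k \<in> borel_measurable borel" using Ql_schwartz by measurable
  show ?thesis unfolding Qs_def[abs_def]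
    by (rule Bochner_Integration.integrable_bound[OF schwartz_integrable[OF Ql_schwartz[of l j k]]])
       (use s in \<open>auto simp: norm_mult mult_right_le_one_le mult_left_le_one_le\<close>)
qed

lemma Qs_zero: "norm \<xi> > 5/4 * rr l \<Longrightarrow> Qs s l j k \<xi> = 0"
  using scaled_support(3)[OF Ql_support, of l j k \<xi>] unfolding Qs_def by fastforce

text \<open>On the spectrum |\<xi>| is at most 5/4 \<open>rr l\<close>, so the heat factor differs
  from 1 by at most s (5/4 \<open>rr l\<close>)^2; the other factor is at most 16
  \<open>rr l\<close>, and 25 = (5/4)^2 16. For times up to \<open>tt\<close> this is negligible:
  the low frequencies do not feel the viscosity.\<close>

lemma norm_Qs_diff_le:
  assumes s: "s \<ge> 0"
  shows "norm (Qs s l j k \<xi> - Qs 0 l j k \<xi>) \<le> 25 * s * rr l ^ 3"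
proof (cases "Ql l j k \<xi> = 0")
  case False
  have n: "norm \<xi> \<le> 5/4 * rr l" by (rule scaled_support(3)[OF Ql_support[OF False]])
  have e: "\<bar>exp (- s * (norm \<xi>)\<^sup>2) - 1\<bar> \<le> s * (norm \<xi>)\<^sup>2"
  proof -
    have "1 + (- s * (norm \<xi>)\<^sup>2) \<le> exp (- s * (norm \<xi>)\<^sup>2)" by (rule exp_ge_add_one_self)
    moreover have "exp (- s * (norm \<xi>)\<^sup>2) \<le> 1" using s by simp
    ultimately show ?thesis by simp
  qed
  have "Qs s l j k \<xi> - Qs 0 l j k \<xi> = of_real (exp (- s * (norm \<xi>)\<^sup>2) - 1) * Ql l j k \<xi>"
    by (simp add: Qs_def algebra_simps)
  then have "norm (Qs s l j k \<xi> - Qs 0 l j k \<xi>) = \<bar>exp (- s * (norm \<xi>)\<^sup>2) - 1\<bar> * norm (Ql l j k \<xi>)"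
    by (simp only: norm_mult norm_of_real)
  also have "\<dots> \<le> (s * (5/4 * rr l)\<^sup>2) * (16 * rr l)"
    by (intro mult_mono norm_Ql_le order_trans[OF e] power_mono n mult_nonneg_nonneg s) auto
  also have "\<dots> = 25 * s * rr l ^ 3" by (simp add: power2_eq_square power3_eq_cube)
  finally show ?thesis .
qed (use s in \<open>simp add: Qs_def less_imp_le\<close>)

end

section \<open>The self-interaction of one building block\<close>

context inflation
begin

lemma rr_le: "l \<in> {L..<L+L} \<Longrightarrow> rr l \<le> \<rho>"
  unfolding rr_def \<rho>_def by (intro power_increasing) auto

lemma g_measurable [measurable]: "g \<in> borel_measurable borel"
proof -
  have "(\<lambda>x. Re (ft G x)) \<in> borel_measurable borel"
    using schwartz_ft_integrable[OF G_schwartz] by auto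
  then show ?thesis by (simp add: ft_G)
qed

lemma g_square_Ql:
  assumes l: "l \<in> {L..<L+L}"
  shows "Im (LINT y|lborel. of_real ((g y)\<^sup>2) * ft (Ql l b b) y) \<ge> (2 * pi) ^ CARD('n) * (rr l * c0\<^sup>2 / 32)"
proof -
  have l1: "l \<ge> 1" using l L by simp
  have i: "integrable lborel (\<lambda>y. ft (Gl m) y * ft (Gl m') y * ft (Ql l b b) y)" for m m'
    using integrable_mult_ft[OF integrable_mult_ft[OF schwartz_ft_integrable[OF Ql_schwartz[of l b b]]
      schwartz_integrable[OF Gl_schwartz[of m]]] schwartz_integrable[OF Gl_schwartz[of m']]]
    by (simp add: mult_ac)
  have "(LINT y|lborel. of_real ((g y)\<^sup>2) * ft (Ql l b b) y) =
    (LINT y|lborel. (\<Sum>m\<in>{L..<L+L}. \<Sum>m'\<in>{L..<L+L}. ft (Gl m) y * ft (Gl m') y * ft (Ql l b b) y))"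
  proof (intro Bochner_Integration.integral_cong refl)
    fix y
    have "complex_of_real ((g y)\<^sup>2) = (\<Sum>m\<in>{L..<L+L}. ft (Gl m) y) * (\<Sum>m'\<in>{L..<L+L}. ft (Gl m') y)"
      by (simp add: ft_Gl g_def power2_eq_square)
    then show "of_real ((g y)\<^sup>2) * ft (Ql l b b) y = (\<Sum>m\<in>{L..<L+L}. \<Sum>m'\<in>{L..<L+L}. ft (Gl m) y * ft (Gl m') y * ft (Ql l b b) y)"
      by (simp only: sum_product) (simp only: sum_distrib_right)
  qed
  also have "\<dots> = (\<Sum>m\<in>{L..<L+L}. \<Sum>m'\<in>{L..<L+L}. LINT y|lborel. ft (Gl m) y * ft (Gl m') y * ft (Ql l b b) y)"
    using i by (simp add: Bochner_Integration.integral_sum Bochner_Integration.integrable_sum)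
  also have "\<dots> = (\<Sum>m\<in>{L..<L+L}. \<Sum>m'\<in>{L..<L+L}. if m = l then (if m' = l then LINT y|lborel. ft (Gl l) y * ft (Gl l) y * ft (Ql l b b) y else 0) else 0)"
    by (intro sum.cong refl) (use Gl_Gl_Ql_zero[OF l1] in auto)
  also have "\<dots> = (LINT y|lborel. ft (Gl l) y * ft (Gl l) y * ft (Ql l b b) y)"
  proof -
    have "(\<Sum>m\<in>A. \<Sum>m'\<in>A. if m = l then (if m' = l then c else 0) else 0) = c" if "finite A" "l \<in> A" for A and c :: complex
    proof -
      have "(\<Sum>m'\<in>A. if m = l then (if m' = l then c else 0) else 0) = (if m = l then c else 0)" for m
        using that by (cases "m = l") (simp_all add: sum.delta)
      then show ?thesis using that by (simp add: sum.delta)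
    qed
    from this[OF _ l] show ?thesis by simp
  qed
  finally show ?thesis using Gl_Gl_Ql_diag[OF l1] by simp
qed

text \<open>The oscillating half of cos^2 shifts one factor g by twice \<open>kap k\<close>, far
  beyond the spectrum of the test function. Hence cos^2 may be replaced by its mean 1/2 without
  error.\<close>

lemma high_frequency_zero:
  assumes l: "l \<in> {L..<L+L}" and k: "k \<in> ks"
  shows "(LINT y|lborel. of_real ((g y)\<^sup>2 * cos (2 * kap k * y $ a)) * ft (Ql l b b) y) = 0"
proof -
  define w where "w = (2 * kap k) *\<^sub>R e1"
  define H where "H \<xi> = (1/2) * (G (\<xi> - w) + G (\<xi> - - w))" for \<xi>
  have Hs: "schwartz H" unfolding H_def by (intro schwartz_cmult schwartz_add schwartz_shift G_schwartz)
  have fH: "ft H y = of_real (g y * cos (2 * kap k * y $ a))" for y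
  proof -
    have wy: "w \<bullet> y = 2 * kap k * y $ a" by (simp add: w_def e1_def inner_axis')
    have i: "integrable lborel (\<lambda>\<xi>. G (\<xi> - v))" for v by (intro schwartz_integrable schwartz_shift G_schwartz)
    have "ft H y = (1/2) * (cis (w \<bullet> y) * of_real (g y) + cis (- w \<bullet> y) * of_real (g y))"
      unfolding H_def ft_cmult
      by (subst ft_add[OF i i]) (simp only: ft_shift[OF schwartz_integrable[OF G_schwartz]] ft_G)
    also have "\<dots> = of_real (g y * cos (2 * kap k * y $ a))"
      unfolding wy inner_minus_left by (simp add: complex_eq_iff)
    finally show ?thesis .
  qed
  have "(LINT y|lborel. ft H y * ft G y * ft (Ql l b b) y) = 0"
  proof (rule triple_ft_zero)
    show "integrable lborel H" "integrable lborel G" by (intro schwartz_integrable Hs G_schwartz)+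
    show "integrable lborel (ft (Ql l b b))" by (rule schwartz_ft_integrable[OF Ql_schwartz])
    show "ft (ft (Ql l b b)) x = of_real ((2 * pi) ^ CARD('n)) * Ql l b b (- x)" for x by (rule schwartz_inversion[OF Ql_schwartz])
    fix \<xi> \<eta> assume 1: "H \<xi> \<noteq> 0" and 2: "G \<eta> \<noteq> 0"
    have n2: "norm \<eta> \<le> \<rho>" using 2 G_zero[of \<eta>] by fastforce
    have nw: "norm w = 2 * kap k" unfolding w_def norm_scaleR using kap_pos[of k] by (simp add: less_imp_le)
    have "G (\<xi> - w) \<noteq> 0 \<or> G (\<xi> - - w) \<noteq> 0" using 1 unfolding H_def by auto
    then have "norm \<xi> \<ge> 2 * kap k - \<rho>"
    proof
      assume "G (\<xi> - w) \<noteq> 0"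
      then have "norm (\<xi> - w) \<le> \<rho>" using G_zero[of "\<xi> - w"] by fastforce
      then show ?thesis using nw norm_triangle_ineq2[of w \<xi>] by (simp add: norm_minus_commute)
    next
      assume "G (\<xi> - - w) \<noteq> 0"
      then have "norm (\<xi> + w) \<le> \<rho>" using G_zero[of "\<xi> + w"] by fastforce
      then show ?thesis using nw norm_diff_ineq[of w \<xi>] by (simp add: add.commute)
    qed
    then have "norm (\<xi> + \<eta>) \<ge> 2 * kap k - \<rho> - \<rho>" using n2 norm_triangle_ineq2[of \<xi> "- \<eta>"] by simp
    then have "norm (- (\<xi> + \<eta>)) > 5/4 * rr l"
      unfolding norm_minus_cancel using rho_kap(2)[OF k] rho_ge rr_le[OF l] by linarith
    then have "Qs 0 l b b (- (\<xi> + \<eta>)) = 0" by (rule Qs_zero)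
    then show "Ql l b b (- (\<xi> + \<eta>)) = 0" by (simp only: Qs_0)
  qed
  then show ?thesis by (simp add: fH ft_G power2_eq_square mult_ac)
qed

text \<open>For k < k' the frequencies of the product have size at least \<open>kap k\<close> - 2
  \<rho>, as \<open>kap k'\<close> is at least twice \<open>kap k\<close>. The tested interaction of
  different blocks vanishes exactly.\<close>

lemma cross_zero:
  assumes l: "l \<in> {L..<L+L}" and k: "k \<in> ks" "k' \<in> ks" "k < k'" and s: "s \<ge> 0"
  shows "(LINT y|lborel. of_real (v k y $ i * v k' y $ i') * ft (Qs s l j m) y) = 0"
proof -
  have "(LINT y|lborel. ft (V k i) y * ft (V k' i') y * ft (Qs s l j m) y) = 0"
  proof (rule triple_ft_zero)
    show "integrable lborel (V k i)" "integrable lborel (V k' i')" by (intro schwartz_integrable V_schwartz)+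
    show "integrable lborel (ft (Qs s l j m))" by (rule ft_Qs_integrable[OF s])
    show "ft (ft (Qs s l j m)) x = of_real ((2 * pi) ^ CARD('n)) * Qs s l j m (- x)" for x by (rule ft_Qs_inversion[OF s])
    fix \<xi> \<eta> assume 1: "V k i \<xi> \<noteq> 0" and 2: "V k' i' \<eta> \<noteq> 0"
    have n: "norm \<xi> \<le> kap k + \<rho>" "norm \<eta> \<ge> kap k' - \<rho>"
      using 1 2 Psi_norm(2)[of k \<xi>] Psi_norm(1)[of k' \<eta>] unfolding V_def by auto
    have "kap (Suc k) \<le> kap k'" unfolding kap_def using k by (intro power_increasing) auto
    then have "2 * kap k \<le> kap k'" by (simp add: kap_def)
    then have "norm (\<xi> + \<eta>) \<ge> kap k - \<rho> - \<rho>" using n norm_triangle_ineq2[of \<eta> "- \<xi>"] by (simp add: add.commute)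
    then have "norm (- (\<xi> + \<eta>)) > 5/4 * rr l"
      unfolding norm_minus_cancel using rho_kap(2)[OF k(1)] rho_ge rr_le[OF l] by linarith
    then show "Qs s l j m (- (\<xi> + \<eta>)) = 0" by (rule Qs_zero)
  qed
  then show ?thesis by (simp only: of_real_v[symmetric] of_real_mult)
qed

lemma integrable_v_v_Qs:
  assumes "s \<ge> 0"
  shows "integrable lborel (\<lambda>y. of_real (v k y $ i * v k' y $ i') * ft (Qs s l j m) y)"
  using integrable_mult_ft[OF integrable_mult_ft[OF ft_Qs_integrable[OF assms, of l j m]
      schwartz_integrable[OF V_schwartz[of k i]]] schwartz_integrable[OF V_schwartz[of k' i']]]
  by (simp add: of_real_v mult_ac)

definition Iv :: "nat \<Rightarrow> nat \<Rightarrow> real \<Rightarrow> complex" where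
  "Iv l k s = (\<Sum>j\<in>UNIV. \<Sum>m\<in>UNIV. LINT y|lborel. of_real (v k y $ j * v k y $ m) * ft (Qs s l j m) y)"

lemma integral_norm_V:
  assumes "k \<in> ks"
  shows "(LINT \<xi>|lborel. norm (V k i \<xi>)) \<le> 2 * kap k * (real L * c0)"
proof -
  have "(LINT \<xi>|lborel. norm (V k i \<xi>)) \<le> (LINT \<xi>|lborel. 2 * kap k * norm (Psi k \<xi>))"
    by (intro integral_mono norm_V_le[OF assms] integrable_norm integrable_mult_right schwartz_integrable V_schwartz Psi_schwartz)
  also have "\<dots> = 2 * kap k * (LINT \<xi>|lborel. norm (Psi k \<xi>))" by (rule integral_mult_right_zero)
  also have "\<dots> \<le> 2 * kap k * (real L * c0)" using kap_pos[of k] by (intro mult_left_mono integral_norm_Psi) (simp add: less_imp_le)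
  finally show ?thesis .
qed

text \<open>Here the crude bound of the transforms by their integrals is sufficient, because the
  heat factor supplies the small quantity s \<open>rr l\<close>^3; the losses L^2 and the square of
  \<open>kap k\<close> are affordable.\<close>

lemma Iv_diff_le:
  assumes k: "k \<in> ks" and s: "s \<ge> 0"
  shows "norm (Iv l k s - Iv l k 0) \<le> (real CARD('n))\<^sup>2 * ((2 * pi) ^ CARD('n) * (100 * s * rr l ^ 3 * (kap k)\<^sup>2 * (real L * c0)\<^sup>2))"
proof -
  have t: "norm ((LINT y|lborel. of_real (v k y $ j * v k y $ m) * ft (Qs s l j m) y) - (LINT y|lborel. of_real (v k y $ j * v k y $ m) * ft (Qs 0 l j m) y))
    \<le> (2 * pi) ^ CARD('n) * (100 * s * rr l ^ 3 * (kap k)\<^sup>2 * (real L * c0)\<^sup>2)" for j m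
  proof -
    define q where "q \<xi> = Qs s l j m \<xi> - Qs 0 l j m \<xi>" for \<xi>
    have fq: "ft q = (\<lambda>y. ft (Qs s l j m) y - ft (Qs 0 l j m) y)"
      unfolding q_def by (rule ext) (rule ft_diff; intro Qs_integrable s order_refl)
    have "norm (LINT y|lborel. ft (V k j) y * ft (V k m) y * ft q y) \<le>
      (2 * pi) ^ CARD('n) * ((25 * s * rr l ^ 3) * (LINT \<xi>|lborel. norm (V k j \<xi>)) * (LINT \<xi>|lborel. norm (V k m \<xi>)))"
    proof (rule triple_ft_le)
      show "integrable lborel (V k j)" "integrable lborel (V k m)" by (intro schwartz_integrable V_schwartz)+
      show "integrable lborel (ft q)" unfolding fq by (intro Bochner_Integration.integrable_diff ft_Qs_integrable s order_refl)
      show "ft (ft q) x = of_real ((2 * pi) ^ CARD('n)) * q (- x)" for x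
        unfolding fq by (subst ft_diff, intro ft_Qs_integrable s, intro ft_Qs_integrable order_refl)
          (simp only: ft_Qs_inversion[OF s] ft_Qs_inversion[OF order_refl] q_def right_diff_distrib)
      show "norm (q \<xi>) \<le> 25 * s * rr l ^ 3" for \<xi> unfolding q_def by (rule norm_Qs_diff_le[OF s])
    qed
    also have "\<dots> \<le> (2 * pi) ^ CARD('n) * ((25 * s * rr l ^ 3) * (2 * kap k * (real L * c0)) * (2 * kap k * (real L * c0)))"
      using s kap_pos[of k] c0_pos
      by (intro mult_left_mono mult_mono integral_norm_V[OF k]) (auto simp: less_imp_le intro!: mult_nonneg_nonneg)
    also have "\<dots> = (2 * pi) ^ CARD('n) * (100 * s * rr l ^ 3 * (kap k)\<^sup>2 * (real L * c0)\<^sup>2)"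
      by (simp add: power2_eq_square)
    also have "(LINT y|lborel. ft (V k j) y * ft (V k m) y * ft q y) =
      (LINT y|lborel. of_real (v k y $ j * v k y $ m) * ft (Qs s l j m) y - of_real (v k y $ j * v k y $ m) * ft (Qs 0 l j m) y)"
      by (simp only: fq of_real_v[symmetric] of_real_mult right_diff_distrib)
    also have "\<dots> = (LINT y|lborel. of_real (v k y $ j * v k y $ m) * ft (Qs s l j m) y) - (LINT y|lborel. of_real (v k y $ j * v k y $ m) * ft (Qs 0 l j m) y)"
      by (rule Bochner_Integration.integral_diff; intro integrable_v_v_Qs s order_refl)
    finally show ?thesis .
  qed
  have "norm (Iv l k s - Iv l k 0) \<le> (\<Sum>j\<in>(UNIV::'n set). \<Sum>m\<in>(UNIV::'n set). (2 * pi) ^ CARD('n) * (100 * s * rr l ^ 3 * (kap k)\<^sup>2 * (real L * c0)\<^sup>2))"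
    by (simp only: Iv_def flip: sum_subtractf) (intro sum_norm_le t)
  then show ?thesis by (simp add: power2_eq_square mult_ac)
qed

text \<open>Only the b-component is of order \<open>kap k\<close>; every other one is of order
  \<rho> L. So all entries except (b, b) are smaller by the factor \<rho> L / \<open>kap k\<close>,
  and in (b, b) the same holds for the correction to the cosine term.\<close>

lemma v_tensor_approx:
  assumes k: "k \<in> ks"
  shows "\<bar>v k y $ j * v k y $ m - (if j = b \<and> m = b then (kap k)\<^sup>2 * ((g y)\<^sup>2 * (cos (kap k * y $ a))\<^sup>2) else 0)\<bar> \<le> 2 * (\<rho> * (real L * c0)) * (C1 * kap k)"
proof -
  define E where "E = \<rho> * (real L * c0)"
  have E: "E \<ge> 0" using rho_ge c0_pos by (simp add: E_def)
  have B: "0 \<le> C1 * kap k" using C1_pos kap_pos[of k] by (simp add: less_imp_le)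
  have c: "\<bar>v k y $ i\<bar> \<le> C1 * kap k" for i using component_le_norm_cart[of "v k y" i] norm_v_le(1)[OF k, of y] by linarith
  have o: "\<bar>v k y $ i\<bar> \<le> E" if "i \<noteq> b" for i
    using that abs_v_a_le[of k y] v_other[of i k y] E by (cases "i = a") (auto simp: E_def)
  show ?thesis
  proof (cases "j = b \<and> m = b")
    case True
    define d where "d = kap k * g y * cos (kap k * y $ a)"
    have d1: "\<bar>v k y $ b - d\<bar> \<le> E" unfolding d_def E_def by (rule v_b_approx)
    have "\<bar>d\<bar> \<le> kap k * (4 * Ct) * 1"
      unfolding d_def abs_mult using abs_g_le[of y] kap_pos[of k] Ct_pos by (intro mult_mono) (auto simp: less_imp_le)
    also have "\<dots> \<le> C1 * kap k" using mult_nonneg_nonneg[OF less_imp_le[OF c0_pos] less_imp_le[OF kap_pos[of k]]] by (simp add: C1_def algebra_simps)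
    finally have d2: "\<bar>d\<bar> \<le> C1 * kap k" .
    have "\<bar>v k y $ b * v k y $ b - d\<^sup>2\<bar> = \<bar>v k y $ b - d\<bar> * \<bar>v k y $ b + d\<bar>"
      unfolding abs_mult[symmetric] by (simp add: power2_eq_square algebra_simps)
    also have "\<dots> \<le> E * (C1 * kap k + C1 * kap k)"
      using d1 d2 c[of b] E by (intro mult_mono order_trans[OF abs_triangle_ineq] add_mono) auto
    finally show ?thesis using True by (simp add: d_def E_def power_mult_distrib mult_ac)
  next
    case False
    have "\<bar>v k y $ j * v k y $ m\<bar> \<le> E * (C1 * kap k)"
    proof (cases "j = b")
      case True
      then have "m \<noteq> b" using False by simp
      then have "\<bar>v k y $ m\<bar> * \<bar>v k y $ j\<bar> \<le> E * (C1 * kap k)" using o c E by (intro mult_mono) auto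
      then show ?thesis by (simp add: abs_mult mult.commute)
    next
      case False
      then show ?thesis unfolding abs_mult using o c E by (intro mult_mono) auto
    qed
    moreover have "0 \<le> E * (C1 * kap k)" using E B by simp
    ultimately have "\<bar>v k y $ j * v k y $ m\<bar> \<le> 2 * E * (C1 * kap k)" by linarith
    then show ?thesis using False by (auto simp: E_def)
  qed
qed

text \<open>After replacing the tensor by its leading entry, only the mean of cos^2 and the resonant
  pair of bumps are left. The error is linear in \<open>kap k\<close>, the main term
  quadratic.\<close>

lemma Im_Iv_0_ge:
  assumes k: "k \<in> ks" and l: "l \<in> {L..<L+L}"
  shows "Im (Iv l k 0) \<ge> 2 * c1 * (kap k)\<^sup>2 * rr l - (real CARD('n))\<^sup>2 * (2 * (\<rho> * (real L * c0)) * (C1 * kap k) * (rr l * CQ))"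
proof -
  define D where "D y j m = (if j = b \<and> m = b then (kap k)\<^sup>2 * ((g y)\<^sup>2 * (cos (kap k * y $ a))\<^sup>2) else 0)" for y and j m :: 'n
  define M where "M = 2 * (\<rho> * (real L * c0)) * (C1 * kap k) * (rr l * CQ)"
  have Di: "integrable lborel (\<lambda>y. of_real (D y j m) * ft (Ql l j m) y)" for j m
  proof (rule Bochner_Integration.integrable_bound)
    show "integrable lborel (\<lambda>y. ((kap k)\<^sup>2 * (4 * Ct)\<^sup>2) * norm (ft (Ql l j m) y))"
      by (intro integrable_mult_right integrable_norm schwartz_integrable schwartz_ft(1) Ql_schwartz)
    have [measurable]: "ft (Ql l j m) \<in> borel_measurable borel" using schwartz_ft_integrable[OF Ql_schwartz[of l j m]] by auto
    show "(\<lambda>y. of_real (D y j m) * ft (Ql l j m) y) \<in> borel_measurable lborel" unfolding D_def by measurable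
    have "\<bar>D y j m\<bar> \<le> (kap k)\<^sup>2 * (4 * Ct)\<^sup>2" for y
    proof -
      have "(g y)\<^sup>2 \<le> (4 * Ct)\<^sup>2" using power_mono[OF abs_g_le[of y], of 2] by simp
      moreover have "(cos (kap k * y $ a))\<^sup>2 \<le> 1" by (simp add: abs_square_le_1)
      ultimately have "(g y)\<^sup>2 * (cos (kap k * y $ a))\<^sup>2 \<le> (4 * Ct)\<^sup>2 * 1" by (intro mult_mono) auto
      then show ?thesis by (auto simp: D_def abs_mult intro!: mult_left_mono)
    qed
    then show "AE y in lborel. norm (of_real (D y j m) * ft (Ql l j m) y) \<le> norm (((kap k)\<^sup>2 * (4 * Ct)\<^sup>2) * norm (ft (Ql l j m) y))"
      by (intro AE_I2) (auto simp: norm_mult intro!: mult_right_mono)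
  qed
  have t: "norm ((LINT y|lborel. of_real (v k y $ j * v k y $ m) * ft (Qs 0 l j m) y) - (LINT y|lborel. of_real (D y j m) * ft (Ql l j m) y)) \<le> M" for j m
  proof -
    have "(LINT y|lborel. of_real (v k y $ j * v k y $ m) * ft (Qs 0 l j m) y) - (LINT y|lborel. of_real (D y j m) * ft (Ql l j m) y) =
      (LINT y|lborel. of_real (v k y $ j * v k y $ m) * ft (Qs 0 l j m) y - of_real (D y j m) * ft (Ql l j m) y)"
      by (rule Bochner_Integration.integral_diff[symmetric, OF integrable_v_v_Qs[OF order_refl] Di])
    also have "\<dots> = (LINT y|lborel. of_real (v k y $ j * v k y $ m - D y j m) * ft (Qs 0 l j m) y)"
      by (simp only: Qs_0 of_real_diff left_diff_distrib)
    also have "norm \<dots> \<le> (2 * (\<rho> * (real L * c0)) * (C1 * kap k)) * (rr l * CQ)"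
    proof (rule norm_integral_of_real_mult_le[OF ft_Qs_integrable[OF order_refl] _ _ ft_Qs_L1[OF order_refl]])
      show "AE y in lborel. \<bar>v k y $ j * v k y $ m - D y j m\<bar> \<le> 2 * (\<rho> * (real L * c0)) * (C1 * kap k)"
        unfolding D_def by (intro AE_I2 v_tensor_approx k)
      show "0 \<le> 2 * (\<rho> * (real L * c0)) * (C1 * kap k)"
        using rho_ge c0_pos C1_pos kap_pos[of k] by (simp add: less_imp_le)
    qed
    finally show ?thesis unfolding M_def .
  qed
  have S: "(\<Sum>j\<in>UNIV. \<Sum>m\<in>UNIV. LINT y|lborel. of_real (D y j m) * ft (Ql l j m) y) = (LINT y|lborel. of_real (D y b b) * ft (Ql l b b) y)"
  proof -
    define c where "c = (LINT y|lborel. of_real (D y b b) * ft (Ql l b b) y)"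
    have z: "(LINT y|lborel. of_real (D y j m) * ft (Ql l j m) y) = (if j = b then (if m = b then c else 0) else 0)" for j m
      unfolding c_def by (auto simp: D_def)
    have "(\<Sum>m\<in>UNIV. if j = b then (if m = b then c else 0) else 0) = (if j = b then c else 0)" for j :: 'n and c :: complex
      by (cases "j = b") (simp_all add: sum.delta)
    then show ?thesis unfolding z c_def[symmetric] by (simp add: sum.delta)
  qed
  have N: "norm (Iv l k 0 - (LINT y|lborel. of_real (D y b b) * ft (Ql l b b) y)) \<le> (real CARD('n))\<^sup>2 * M"
  proof -
    have "norm (Iv l k 0 - (LINT y|lborel. of_real (D y b b) * ft (Ql l b b) y)) \<le> (\<Sum>j\<in>(UNIV::'n set). \<Sum>m\<in>(UNIV::'n set). M)"
      by (simp only: Iv_def S[symmetric] flip: sum_subtractf) (intro sum_norm_le t)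
    then show ?thesis by (simp add: power2_eq_square mult_ac)
  qed
  have i1: "integrable lborel (\<lambda>y. of_real ((g y)\<^sup>2) * ft (Ql l b b) y)"
    using integrable_mult_ft[OF integrable_mult_ft[OF schwartz_ft_integrable[OF Ql_schwartz[of l b b]]
      schwartz_integrable[OF G_schwartz]] schwartz_integrable[OF G_schwartz]]
    by (simp add: ft_G power2_eq_square mult_ac)
  have i2: "integrable lborel (\<lambda>y. of_real ((g y)\<^sup>2 * cos (2 * kap k * y $ a)) * ft (Ql l b b) y)"
    by (rule Bochner_Integration.integrable_bound[OF i1])
       (use schwartz_ft_integrable[OF Ql_schwartz[of l b b]] in \<open>auto simp: norm_mult abs_mult intro!: mult_right_mono mult_left_le\<close>)
  have "(LINT y|lborel. of_real (D y b b) * ft (Ql l b b) y) =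
    (LINT y|lborel. of_real ((kap k)\<^sup>2 / 2) * (of_real ((g y)\<^sup>2) * ft (Ql l b b) y + of_real ((g y)\<^sup>2 * cos (2 * kap k * y $ a)) * ft (Ql l b b) y))"
  proof (intro Bochner_Integration.integral_cong refl)
    fix y
    have "(cos (kap k * y $ a))\<^sup>2 = (1 + cos (2 * kap k * y $ a)) / 2" using cos_double_cos[of "kap k * y $ a"] by (simp add: mult.assoc)
    then have "D y b b = (kap k)\<^sup>2 / 2 * ((g y)\<^sup>2 + (g y)\<^sup>2 * cos (2 * kap k * y $ a))"
      by (simp only: D_def simp_thms if_True) (simp add: algebra_simps)
    then show "of_real (D y b b) * ft (Ql l b b) y = of_real ((kap k)\<^sup>2 / 2) * (of_real ((g y)\<^sup>2) * ft (Ql l b b) y + of_real ((g y)\<^sup>2 * cos (2 * kap k * y $ a)) * ft (Ql l b b) y)"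
      by (simp only: of_real_mult of_real_add distrib_right mult.assoc)
  qed
  also have "\<dots> = of_real ((kap k)\<^sup>2 / 2) * (LINT y|lborel. of_real ((g y)\<^sup>2) * ft (Ql l b b) y)"
    by (simp only: integral_mult_right_zero Bochner_Integration.integral_add[OF i1 i2] high_frequency_zero[OF l k] add_0_right)
  finally have "Im (LINT y|lborel. of_real (D y b b) * ft (Ql l b b) y) = (kap k)\<^sup>2 / 2 * Im (LINT y|lborel. of_real ((g y)\<^sup>2) * ft (Ql l b b) y)"
    by (simp only: times_complex.sel Re_complex_of_real Im_complex_of_real mult_zero_left add_0_right)
  also have "\<dots> \<ge> (kap k)\<^sup>2 / 2 * ((2 * pi) ^ CARD('n) * (rr l * c0\<^sup>2 / 32))"
    by (intro mult_left_mono g_square_Ql l) simp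
  also have "(kap k)\<^sup>2 / 2 * ((2 * pi) ^ CARD('n) * (rr l * c0\<^sup>2 / 32)) = 2 * c1 * (kap k)\<^sup>2 * rr l" by (simp add: c1_def)
  finally have "2 * c1 * (kap k)\<^sup>2 * rr l \<le> Im (LINT y|lborel. of_real (D y b b) * ft (Ql l b b) y)" .
  moreover have "\<bar>Im (Iv l k 0 - (LINT y|lborel. of_real (D y b b) * ft (Ql l b b) y))\<bar> \<le> (real CARD('n))\<^sup>2 * M"
    using abs_Im_le_cmod N by (rule order_trans)
  ultimately show ?thesis unfolding M_def minus_complex.sel by linarith
qed

end

lemma exp_interval_integral_ge:
  fixes c s :: real
  assumes c: "c > 0" and s: "1 / (2 * c) \<le> s"
  shows "1 / (4 * c) \<le> (LINT \<tau>|lborel. indicator {0<..<s} \<tau> * exp (- c * \<tau>))"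
proof -
  have "1 / (4 * c) = (LINT \<tau>|lborel. (1/2) * indicator {0<..<1 / (2 * c)} \<tau>)" using c by simp
  also have "\<dots> \<le> (LINT \<tau>|lborel. indicator {0<..<s} \<tau> * exp (- c * \<tau>))"
  proof (rule integral_mono[OF _ exp_interval_integral_le(1)[OF c]])
    show "integrable lborel (\<lambda>\<tau>. (1/2) * indicator {0<..<1 / (2 * c)} \<tau> :: real)"
      by (intro integrable_mult_right) (use c in simp)
    fix \<tau> :: real
    show "(1/2) * indicator {0<..<1 / (2 * c)} \<tau> \<le> indicator {0<..<s} \<tau> * exp (- c * \<tau>)"
    proof (cases "\<tau> \<in> {0<..<1 / (2 * c)}")
      case True
      then have "c * \<tau> \<le> 1 / 2" using c by (simp add: field_simps)
      moreover have "1 + (- c * \<tau>) \<le> exp (- c * \<tau>)" by (rule exp_ge_add_one_self)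
      ultimately have "1 / 2 \<le> exp (- c * \<tau>)" by simp
      then show ?thesis using True s by simp
    qed simp
  qed
  finally show ?thesis .
qed

lemma integrable_of_real_mult:
  fixes h :: "'a \<Rightarrow> complex"
  assumes "integrable M h" and [measurable]: "f \<in> borel_measurable M" and "\<And>x. \<bar>f x\<bar> \<le> B"
  shows "integrable M (\<lambda>x. of_real (f x) * h x)"
proof (rule Bochner_Integration.integrable_bound)
  show "integrable M (\<lambda>x. B * norm (h x))" using assms by simp
  show "AE x in M. norm (of_real (f x) * h x) \<le> norm (B * norm (h x))"
  proof (rule AE_I2)
    fix x
    have "\<bar>f x\<bar> * norm (h x) \<le> B * norm (h x)" by (rule mult_right_mono[OF assms(3)]) simp
    then show "norm (of_real (f x) * h x) \<le> norm (B * norm (h x))" by (simp add: norm_mult)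
  qed
qed (use assms in measurable)

section \<open>Thresholds and the tested Duhamel term\<close>

context bump
begin

definition CB :: real where "CB = heat_P_div_const TYPE('n)"

text \<open>The four summands are the constants that the small quantity \<open>ee\<close> has to
  beat: for the leading entry of the tensor, for dropping the heat factor on the test function, for
  replacing u by U, and for the second smallness condition of the bootstrap.\<close>

definition Mc :: real where
  "Mc = 4 * (real CARD('n))\<^sup>2 * c0 * C1 * CQ / c1 + 200 * (real CARD('n))\<^sup>2 * (2 * pi) ^ CARD('n) * c0\<^sup>2 / c1 +
     16 * (real CARD('n))\<^sup>2 * CQ * (32 * CA * C1 + 4 * CA\<^sup>2) / c1 + 32 * CB * CA"

lemma CB_pos: "CB > 0" by (simp add: CB_def heat_P_div_const_pos)

lemma Mc_ge:
  "4 * (real CARD('n))\<^sup>2 * c0 * C1 * CQ / c1 \<le> Mc"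
  "200 * (real CARD('n))\<^sup>2 * (2 * pi) ^ CARD('n) * c0\<^sup>2 / c1 \<le> Mc"
  "16 * (real CARD('n))\<^sup>2 * CQ * (32 * CA * C1 + 4 * CA\<^sup>2) / c1 \<le> Mc"
  "32 * CB * CA \<le> Mc"
proof -
  have "0 \<le> 4 * (real CARD('n))\<^sup>2 * c0 * C1 * CQ / c1" "0 \<le> 200 * (real CARD('n))\<^sup>2 * (2 * pi) ^ CARD('n) * c0\<^sup>2 / c1"
    "0 \<le> 16 * (real CARD('n))\<^sup>2 * CQ * (32 * CA * C1 + 4 * CA\<^sup>2) / c1" "0 \<le> 32 * CB * CA"
    using c0_pos C1_pos CQ_pos c1_pos CA_pos CB_pos by (auto intro!: mult_nonneg_nonneg divide_nonneg_nonneg add_nonneg_nonneg)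
  then show "4 * (real CARD('n))\<^sup>2 * c0 * C1 * CQ / c1 \<le> Mc"
    "200 * (real CARD('n))\<^sup>2 * (2 * pi) ^ CARD('n) * c0\<^sup>2 / c1 \<le> Mc"
    "16 * (real CARD('n))\<^sup>2 * CQ * (32 * CA * C1 + 4 * CA\<^sup>2) / c1 \<le> Mc"
    "32 * CB * CA \<le> Mc"
    unfolding Mc_def by linarith+
qed

text \<open>The specialisation to component b, where the Helmholtz denominator has disappeared and
  the adjoint kernel is an explicit integrable transform for all remaining times.\<close>

lemma test_duhamel_Nl:
  fixes F :: "real \<Rightarrow> real^'n \<Rightarrow> real^'n^'n"
  assumes F: "\<And>j k. (\<lambda>z. F (fst z) (snd z) $ j $ k) \<in> borel_measurable (borel \<Otimes>\<^sub>M borel)"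
    and B: "\<And>\<tau> y j k. \<bar>F \<tau> y $ j $ k\<bar> \<le> B" and s: "s > 0"
  fixes l
  defines "H \<equiv> \<lambda>\<tau>. (\<Sum>j\<in>UNIV. \<Sum>k\<in>UNIV. LINT y|lborel. of_real (F \<tau> y $ j $ k) * ft (Qs (s - \<tau>) l j k) y)"
  shows "integrable lborel (\<lambda>\<tau>. of_real (indicator {0<..<s} \<tau>) * H \<tau>)"
    and "(LINT x|lborel. ft (Nl l) x * of_real ((LINT \<tau>:{0<..<s}|lborel. heat_P_div (s - \<tau>) (F \<tau>) x) $ b)) =
    (LINT \<tau>|lborel. of_real (indicator {0<..<s} \<tau>) * H \<tau>)"
proof -
  note \<eta> = schwartz_ft_integrable[OF Nl_schwartz[of l]]
  have e: "of_real (indicator {0<..<s} \<tau>) * (\<Sum>j\<in>UNIV. \<Sum>k\<in>UNIV. LINT y|lborel. of_real (F \<tau> y $ j $ k) *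
      (LINT x|lborel. of_real (oseen_kernel (s - \<tau>) b j k (x - y)) * ft (Nl l) x)) = of_real (indicator {0<..<s} \<tau>) * H \<tau>" for \<tau>
  proof (cases "\<tau> \<in> {0<..<s}")
    case True
    then have st: "s - \<tau> > 0" by simp
    show ?thesis
      unfolding H_def oseen_adjoint_ft[OF st schwartz_integrable[OF Nl_schwartz]] oseen_symbol_Nl Qs_def[abs_def] ..
  qed simp
  show "integrable lborel (\<lambda>\<tau>. of_real (indicator {0<..<s} \<tau>) * H \<tau>)"
    using test_duhamel(1)[OF F B s \<eta>, where i=b] unfolding e .
  show "(LINT x|lborel. ft (Nl l) x * of_real ((LINT \<tau>:{0<..<s}|lborel. heat_P_div (s - \<tau>) (F \<tau>) x) $ b)) =
    (LINT \<tau>|lborel. of_real (indicator {0<..<s} \<tau>) * H \<tau>)"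
    using test_duhamel(2)[OF F B s \<eta>, where i=b] unfolding e .
qed

end

locale large_inflation = inflation \<phi> a b L K for \<phi> :: "real \<Rightarrow> real" and a b :: "'n::finite" and L K +
  assumes big: "Mc \<le> 2 ^ L"
begin

text \<open>The common size of all relative errors. Its exponents are 6 L from \<rho> and at most 4
  L from L^4, so that even after multiplication by 2^L it is below 2^(11L) / 2^(100L).\<close>

definition ee :: real where "ee = \<rho> * real L ^ 4 * sqrt tt"

lemma ee_pos: "ee > 0" and ee_le: "ee \<le> 1 / 2 ^ L" and ee_le_1: "ee \<le> 1"
proof -
  show "ee > 0" using L tt_pos rho_ge by (simp add: ee_def)
  have "real L \<le> 2 ^ L" by (simp add: of_nat_less_two_power less_imp_le)
  then have "real L ^ 4 \<le> (2 ^ L) ^ 4" by (rule power_mono) simp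
  also have "\<dots> = 2 ^ (4 * L)" by (simp add: power_mult[symmetric] mult.commute)
  finally have "\<rho> * real L ^ 4 * 2 ^ L \<le> 2 ^ (6 * L) * 2 ^ (4 * L) * 2 ^ L" by (simp add: \<rho>_def)
  also have "\<dots> = 2 ^ (11 * L)" by (simp flip: power_add)
  also have "\<dots> \<le> 2 ^ (100 * L)" by (intro power_increasing) auto
  finally show "ee \<le> 1 / 2 ^ L" by (simp add: ee_def sqrt_tt field_simps)
  then show "ee \<le> 1" by (rule order_trans) simp
qed

lemma Mc_ee: "x \<le> Mc \<Longrightarrow> x * ee \<le> 1"
proof -
  assume "x \<le> Mc"
  then have "x * ee \<le> 2 ^ L * ee" using big ee_pos by (intro mult_right_mono) auto
  also have "\<dots> \<le> 2 ^ L * (1 / 2 ^ L)" by (intro mult_left_mono ee_le) auto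
  finally show ?thesis by simp
qed

lemma rho_L_le: "\<rho> * real L \<le> ee * 2 ^ (100 * L)"
proof -
  have "real L ^ 1 \<le> real L ^ 4" using L by (intro power_increasing) auto
  then have "\<rho> * real L \<le> \<rho> * real L ^ 4" using rho_ge by (intro mult_left_mono) auto
  then show ?thesis by (simp add: ee_def sqrt_tt)
qed

lemma rho_L_square: "tt * \<rho>\<^sup>2 * (real L)\<^sup>2 \<le> ee"
proof -
  have "(\<rho> * real L)\<^sup>2 \<le> (ee * 2 ^ (100 * L))\<^sup>2" using rho_ge by (intro power_mono rho_L_le) auto
  then have "tt * (\<rho> * real L)\<^sup>2 \<le> tt * (ee * 2 ^ (100 * L))\<^sup>2" using tt_pos by (intro mult_left_mono) auto
  also have "\<dots> = (sqrt tt * 2 ^ (100 * L))\<^sup>2 * ee\<^sup>2" using tt_pos by (simp add: power_mult_distrib)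
  also have "\<dots> = ee\<^sup>2" by (simp add: sqrt_tt)
  also have "\<dots> \<le> ee" using ee_pos ee_le_1 by (simp add: power2_eq_square mult_left_le)
  finally show ?thesis by (simp add: power_mult_distrib mult.assoc)
qed

text \<open>Each of the two errors takes a quarter of the main term \<open>2 * c1\<close> times the
  square of \<open>kap k\<close> times \<open>rr l\<close>, and one half is left.\<close>

lemma Iv_ge:
  assumes k: "k \<in> ks" and l: "l \<in> {L..<L+L}" and s: "0 \<le> s" "s \<le> tt"
  shows "c1 * (kap k)\<^sup>2 * rr l \<le> Im (Iv l k s)"
proof -
  define n2 where "n2 = (real CARD('n))\<^sup>2"
  have n2: "n2 \<ge> 0" by (simp add: n2_def)
  have kk: "kap k > 0" "rr l > 0" by simp_all
  have k100: "2 ^ (100 * L) \<le> kap k" unfolding kap_def using k by (intro power_increasing) (auto simp: ks_def)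
  have pos: "c0 \<ge> 0" "C1 \<ge> 0" "CQ \<ge> 0" "c1 > 0" using c0_pos C1_pos CQ_pos c1_pos by auto
  have 1: "n2 * (2 * (\<rho> * (real L * c0)) * (C1 * kap k) * (rr l * CQ)) \<le> c1 / 2 * (kap k)\<^sup>2 * rr l"
  proof -
    have "4 * n2 * c0 * C1 * CQ / c1 * ee \<le> 1" using Mc_ee[OF Mc_ge(1)] by (simp add: n2_def)
    then have e: "4 * n2 * c0 * C1 * CQ * ee \<le> c1" using pos by (simp add: field_simps)
    have "n2 * (2 * (\<rho> * (real L * c0)) * (C1 * kap k) * (rr l * CQ)) = (2 * n2 * c0 * C1 * CQ) * (\<rho> * real L) * (kap k * rr l)"
      by (simp only: mult_ac)
    also have "\<dots> \<le> (2 * n2 * c0 * C1 * CQ) * (ee * kap k) * (kap k * rr l)"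
      using n2 pos kk ee_pos
      by (intro mult_left_mono mult_right_mono order_trans[OF rho_L_le] k100 mult_nonneg_nonneg) (auto simp: less_imp_le)
    also have "\<dots> = (4 * n2 * c0 * C1 * CQ * ee) / 2 * ((kap k)\<^sup>2 * rr l)" by (simp add: power2_eq_square)
    also have "\<dots> \<le> c1 / 2 * ((kap k)\<^sup>2 * rr l)" using e kk by (intro mult_right_mono divide_right_mono) (auto simp: less_imp_le)
    finally show ?thesis by (simp only: mult.assoc)
  qed
  have 2: "n2 * ((2 * pi) ^ CARD('n) * (100 * s * rr l ^ 3 * (kap k)\<^sup>2 * (real L * c0)\<^sup>2)) \<le> c1 / 2 * (kap k)\<^sup>2 * rr l"
  proof -
    have "200 * n2 * (2 * pi) ^ CARD('n) * c0\<^sup>2 / c1 * ee \<le> 1" using Mc_ee[OF Mc_ge(2)] by (simp add: n2_def)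
    then have e: "200 * n2 * (2 * pi) ^ CARD('n) * c0\<^sup>2 * ee \<le> c1" using pos by (simp add: field_simps)
    have "s * (rr l)\<^sup>2 \<le> tt * \<rho>\<^sup>2" using s rr_le[OF l] kk by (intro mult_mono power_mono) (auto simp: less_imp_le)
    then have "s * (rr l)\<^sup>2 * (real L)\<^sup>2 \<le> tt * \<rho>\<^sup>2 * (real L)\<^sup>2" by (rule mult_right_mono) simp
    then have e2: "s * (rr l)\<^sup>2 * (real L)\<^sup>2 \<le> ee" using rho_L_square by linarith
    have "n2 * ((2 * pi) ^ CARD('n) * (100 * s * rr l ^ 3 * (kap k)\<^sup>2 * (real L * c0)\<^sup>2)) =
      (100 * n2 * (2 * pi) ^ CARD('n) * c0\<^sup>2) * (s * (rr l)\<^sup>2 * (real L)\<^sup>2) * ((kap k)\<^sup>2 * rr l)"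
      by (simp add: power2_eq_square power3_eq_cube)
    also have "\<dots> \<le> (100 * n2 * (2 * pi) ^ CARD('n) * c0\<^sup>2) * ee * ((kap k)\<^sup>2 * rr l)"
      using n2 kk by (intro mult_left_mono mult_right_mono e2) (auto simp: less_imp_le)
    also have "\<dots> = (200 * n2 * (2 * pi) ^ CARD('n) * c0\<^sup>2 * ee) / 2 * ((kap k)\<^sup>2 * rr l)" by simp
    also have "\<dots> \<le> c1 / 2 * ((kap k)\<^sup>2 * rr l)" using e kk by (intro mult_right_mono divide_right_mono) (auto simp: less_imp_le)
    finally show ?thesis by (simp only: mult.assoc)
  qed
  have "\<bar>Im (Iv l k s - Iv l k 0)\<bar> \<le> n2 * ((2 * pi) ^ CARD('n) * (100 * s * rr l ^ 3 * (kap k)\<^sup>2 * (real L * c0)\<^sup>2))"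
    using order_trans[OF abs_Im_le_cmod Iv_diff_le[OF k s(1)]] by (simp only: n2_def)
  moreover have "Im (Iv l k 0) \<ge> 2 * c1 * (kap k)\<^sup>2 * rr l - n2 * (2 * (\<rho> * (real L * c0)) * (C1 * kap k) * (rr l * CQ))"
    using Im_Iv_0_ge[OF k l] by (simp only: n2_def)
  moreover have "2 * c1 * (kap k)\<^sup>2 * rr l = c1 * (kap k)\<^sup>2 * rr l + c1 / 2 * (kap k)\<^sup>2 * rr l + c1 / 2 * (kap k)\<^sup>2 * rr l" by simp
  ultimately show ?thesis using 1 2 unfolding minus_complex.sel by linarith
qed

definition HU :: "nat \<Rightarrow> real \<Rightarrow> real \<Rightarrow> complex" where
  "HU l \<alpha> \<tau> = (\<Sum>j\<in>UNIV. \<Sum>m\<in>UNIV. LINT y|lborel. of_real (tensor (U \<alpha> \<tau> y) (U \<alpha> \<tau> y) $ j $ m) * ft (Qs (tt - \<tau>) l j m) y)"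

text \<open>The vanishing of the cross terms makes the tested quadratic form exactly diagonal in the
  blocks, so their contributions add up without cancellation.\<close>

lemma HU_eq:
  assumes l: "l \<in> {L..<L+L}" and \<tau>: "\<tau> \<le> tt"
  shows "HU l \<alpha> \<tau> = (\<Sum>k\<in>ks. of_real ((cf \<alpha> \<tau> k)\<^sup>2) * Iv l k (tt - \<tau>))"
proof -
  have st: "0 \<le> tt - \<tau>" using \<tau> by simp
  define X where "X k j m = (LINT y|lborel. of_real (v k y $ j * v k y $ m) * ft (Qs (tt - \<tau>) l j m) y)" for k j m
  have "(LINT y|lborel. of_real (tensor (U \<alpha> \<tau> y) (U \<alpha> \<tau> y) $ j $ m) * ft (Qs (tt - \<tau>) l j m) y) =
    (\<Sum>k\<in>ks. of_real ((cf \<alpha> \<tau> k)\<^sup>2) * X k j m)" for j m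
  proof -
    define c where "c k k' = complex_of_real (cf \<alpha> \<tau> k * cf \<alpha> \<tau> k')" for k k'
    have z: "(LINT y|lborel. of_real (v k y $ j * v k' y $ m) * ft (Qs (tt - \<tau>) l j m) y) = (if k = k' then X k j m else 0)"
      if "k \<in> ks" "k' \<in> ks" for k k'
    proof (cases k k' rule: linorder_cases)
      case less
      then show ?thesis using cross_zero[OF l that less st] by simp
    next
      case equal
      then show ?thesis by (simp add: X_def)
    next
      case greater
      then show ?thesis using cross_zero[OF l that(2,1) greater st, of m j j m] by (simp add: mult.commute)
    qed
    have "(LINT y|lborel. of_real (tensor (U \<alpha> \<tau> y) (U \<alpha> \<tau> y) $ j $ m) * ft (Qs (tt - \<tau>) l j m) y) =
      (LINT y|lborel. (\<Sum>k\<in>ks. \<Sum>k'\<in>ks. c k k' * (of_real (v k y $ j * v k' y $ m) * ft (Qs (tt - \<tau>) l j m) y)))"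
    proof (intro Bochner_Integration.integral_cong refl)
      fix y
      have "tensor (U \<alpha> \<tau> y) (U \<alpha> \<tau> y) $ j $ m = (\<Sum>k\<in>ks. \<Sum>k'\<in>ks. (cf \<alpha> \<tau> k * cf \<alpha> \<tau> k') * (v k y $ j * v k' y $ m))"
        unfolding tensor_component U_component sum_product by (intro sum.cong refl) simp
      then have "complex_of_real (tensor (U \<alpha> \<tau> y) (U \<alpha> \<tau> y) $ j $ m) = (\<Sum>k\<in>ks. \<Sum>k'\<in>ks. c k k' * of_real (v k y $ j * v k' y $ m))"
        by (simp only: c_def of_real_sum of_real_mult)
      then show "of_real (tensor (U \<alpha> \<tau> y) (U \<alpha> \<tau> y) $ j $ m) * ft (Qs (tt - \<tau>) l j m) y =
        (\<Sum>k\<in>ks. \<Sum>k'\<in>ks. c k k' * (of_real (v k y $ j * v k' y $ m) * ft (Qs (tt - \<tau>) l j m) y))"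
        by (simp only: sum_distrib_right mult.assoc)
    qed
    also have "\<dots> = (\<Sum>k\<in>ks. \<Sum>k'\<in>ks. c k k' * (LINT y|lborel. of_real (v k y $ j * v k' y $ m) * ft (Qs (tt - \<tau>) l j m) y))"
      by (subst Bochner_Integration.integral_sum, intro Bochner_Integration.integrable_sum integrable_mult_right integrable_v_v_Qs st,
          subst Bochner_Integration.integral_sum, intro integrable_mult_right integrable_v_v_Qs st) (simp only: integral_mult_right_zero)
    also have "\<dots> = (\<Sum>k\<in>ks. \<Sum>k'\<in>ks. if k = k' then c k k * X k j m else 0)"
      by (intro sum.cong refl) (simp only: z, simp)
    also have "\<dots> = (\<Sum>k\<in>ks. of_real ((cf \<alpha> \<tau> k)\<^sup>2) * X k j m)"
      by (simp add: c_def power2_eq_square)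
    finally show ?thesis .
  qed
  then have "HU l \<alpha> \<tau> = (\<Sum>j\<in>UNIV. \<Sum>m\<in>UNIV. \<Sum>k\<in>ks. of_real ((cf \<alpha> \<tau> k)\<^sup>2) * X k j m)"
    unfolding HU_def by simp
  also have "\<dots> = (\<Sum>j\<in>UNIV. \<Sum>k\<in>ks. \<Sum>m\<in>UNIV. of_real ((cf \<alpha> \<tau> k)\<^sup>2) * X k j m)"
    by (intro sum.cong refl) (rule sum.swap)
  also have "\<dots> = (\<Sum>k\<in>ks. \<Sum>j\<in>UNIV. \<Sum>m\<in>UNIV. of_real ((cf \<alpha> \<tau> k)\<^sup>2) * X k j m)" by (rule sum.swap)
  also have "\<dots> = (\<Sum>k\<in>ks. of_real ((cf \<alpha> \<tau> k)\<^sup>2) * Iv l k (tt - \<tau>))"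
    unfolding Iv_def X_def sum_distrib_left ..
  finally show ?thesis .
qed

lemma Im_HU_ge:
  assumes l: "l \<in> {L..<L+L}" and \<tau>: "0 < \<tau>" "\<tau> < tt"
  shows "(\<Sum>k\<in>ks. \<alpha>\<^sup>2 * c1 * rr l * ((kap k)\<^sup>2 * exp (- (2 * (kap k)\<^sup>2) * \<tau>))) \<le> Im (HU l \<alpha> \<tau>)"
proof -
  have e: "(cf \<alpha> \<tau> k)\<^sup>2 = \<alpha>\<^sup>2 * exp (- (2 * (kap k)\<^sup>2) * \<tau>)" for k
    using \<tau> by (simp add: cf_def power_mult_distrib exp_double[symmetric] mult.assoc)
  have "(\<Sum>k\<in>ks. \<alpha>\<^sup>2 * c1 * rr l * ((kap k)\<^sup>2 * exp (- (2 * (kap k)\<^sup>2) * \<tau>))) = (\<Sum>k\<in>ks. (cf \<alpha> \<tau> k)\<^sup>2 * (c1 * (kap k)\<^sup>2 * rr l))"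
    unfolding e by (intro sum.cong refl) (simp only: mult_ac)
  also have "\<dots> \<le> (\<Sum>k\<in>ks. (cf \<alpha> \<tau> k)\<^sup>2 * Im (Iv l k (tt - \<tau>)))"
    using \<tau> by (intro sum_mono mult_left_mono Iv_ge l) auto
  also have "\<dots> = Im (HU l \<alpha> \<tau>)"
    using \<tau> by (simp add: HU_eq[OF l] power2_eq_square)
  finally show ?thesis .
qed

lemma U_tensor:
  shows "\<And>j k. (\<lambda>z. tensor (U \<alpha> (fst z) (snd z)) (U \<alpha> (fst z) (snd z)) $ j $ k) \<in> borel_measurable (borel \<Otimes>\<^sub>M borel)"
    and "\<alpha> \<ge> 0 \<Longrightarrow> \<bar>tensor (U \<alpha> \<tau> y) (U \<alpha> \<tau> y) $ j $ k\<bar> \<le> UB \<alpha> * UB \<alpha>"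
  by (rule tensor_measurable[OF U_measurable]) (intro abs_tensor_le norm_U_le_UB)

text \<open>For each block the square of \<open>kap k\<close> times the integral of exp (- 2
  \<open>kap k\<close>^2 \<tau>) over (0, \<open>tt\<close>) is at least 1/8, because
  \<open>tt\<close> exceeds the lifetime. All K blocks push in the same direction, whence the factor
  K.\<close>

lemma Im_integral_HU_ge:
  assumes l: "l \<in> {L..<L+L}" and \<alpha>: "\<alpha> \<ge> 0"
  shows "\<alpha>\<^sup>2 * c1 * rr l * (real K / 8) \<le> Im (LINT \<tau>|lborel. of_real (indicator {0<..<tt} \<tau>) * HU l \<alpha> \<tau>)"
proof -
  have i: "integrable lborel (\<lambda>\<tau>. of_real (indicator {0<..<tt} \<tau>) * HU l \<alpha> \<tau>)"
    using test_duhamel_Nl(1)[where F="\<lambda>\<tau> y. tensor (U \<alpha> \<tau> y) (U \<alpha> \<tau> y)", OF U_tensor(1) U_tensor(2)[OF \<alpha>] tt_pos, of l]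
    unfolding HU_def .
  define P where "P = \<alpha>\<^sup>2 * c1 * rr l"
  have P: "P \<ge> 0" using c1_pos by (simp add: P_def less_imp_le)
  define h where "h k \<tau> = indicator {0<..<tt} \<tau> * exp (- (2 * (kap k)\<^sup>2) * \<tau>)" for k and \<tau> :: real
  have c: "2 * (kap k)\<^sup>2 > 0" for k by (simp add: kap_def)
  have hi: "integrable lborel (h k)" for k unfolding h_def by (rule exp_interval_integral_le(1)[OF c])
  have hl: "1 / 8 \<le> (kap k)\<^sup>2 * (LINT \<tau>|lborel. h k \<tau>)" if k: "k \<in> ks" for k
  proof -
    have "(4::real) ^ (100 * L) \<le> 4 ^ k" using k by (intro power_increasing) (auto simp: ks_def)
    moreover have "0 < (4::real) ^ k" by simp
    ultimately have "(4::real) ^ (100 * L) \<le> 4 * 4 ^ k" by linarith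
    then have "1 / (4 * (kap k)\<^sup>2) \<le> tt" unfolding tt_def kap_square by (intro frac_le) auto
    then have "1 / (4 * (2 * (kap k)\<^sup>2)) \<le> (LINT \<tau>|lborel. h k \<tau>)"
      unfolding h_def by (intro exp_interval_integral_ge[OF c]) simp
    then have "(kap k)\<^sup>2 * (1 / (4 * (2 * (kap k)\<^sup>2))) \<le> (kap k)\<^sup>2 * (LINT \<tau>|lborel. h k \<tau>)"
      by (rule mult_left_mono) simp
    moreover have "kap k \<noteq> 0" by (simp add: kap_def)
    ultimately show ?thesis by simp
  qed
  have "P * (real K / 8) = (\<Sum>k\<in>ks. P * (1 / 8))" by simp
  also have "\<dots> \<le> (\<Sum>k\<in>ks. P * ((kap k)\<^sup>2 * (LINT \<tau>|lborel. h k \<tau>)))"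
    by (intro sum_mono mult_left_mono hl P)
  also have "\<dots> = (LINT \<tau>|lborel. (\<Sum>k\<in>ks. P * ((kap k)\<^sup>2 * h k \<tau>)))"
    by (subst Bochner_Integration.integral_sum) (auto intro!: integrable_mult_right hi)
  also have "\<dots> \<le> (LINT \<tau>|lborel. Im (of_real (indicator {0<..<tt} \<tau>) * HU l \<alpha> \<tau>))"
  proof (rule integral_mono)
    show "integrable lborel (\<lambda>\<tau>. \<Sum>k\<in>ks. P * ((kap k)\<^sup>2 * h k \<tau>))"
      by (intro Bochner_Integration.integrable_sum integrable_mult_right hi)
    show "integrable lborel (\<lambda>\<tau>. Im (of_real (indicator {0<..<tt} \<tau>) * HU l \<alpha> \<tau>))"
      by (rule integrable_Im[OF i])
    fix \<tau>
    show "(\<Sum>k\<in>ks. P * ((kap k)\<^sup>2 * h k \<tau>)) \<le> Im (of_real (indicator {0<..<tt} \<tau>) * HU l \<alpha> \<tau>)"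
      using Im_HU_ge[OF l, of \<tau> \<alpha>] by (cases "\<tau> \<in> {0<..<tt}") (simp_all add: h_def P_def)
  qed
  also have "\<dots> = Im (LINT \<tau>|lborel. of_real (indicator {0<..<tt} \<tau>) * HU l \<alpha> \<tau>)"
    by (rule integral_Im[OF i])
  finally show ?thesis unfolding P_def .
qed

text \<open>The heat flow keeps the spectrum of the data, which lies beyond that of the test
  function. Thus the component of the solution at 8^l is due to the Duhamel term alone.\<close>

lemma heat_v0_Nl_zero:
  assumes \<alpha>: "\<alpha> \<ge> 0" and s: "s > 0" and l: "l \<in> {L..<L+L}"
  shows "(LINT x|lborel. ft (Nl l) x * of_real (heat_semigroup s (v0 \<alpha>) x $ b)) = 0"
proof -
  have s0: "s \<ge> 0" using s by simp
  define q where "q k \<xi> = of_real (exp (- s * (norm \<xi>)\<^sup>2)) * V k b \<xi>" for k \<xi>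
  have fq: "integrable lborel (ft (q k))" for k unfolding q_def by (rule integral_norm_ft_gaussian_le(2)[OF s0 V_schwartz])
  have Ni: "integrable lborel (Nl l)" by (rule schwartz_integrable[OF Nl_schwartz])
  have ii: "integrable lborel (\<lambda>x. ft (Nl l) x * ft (q k) x)" for k
    using integrable_mult_ft[OF fq Ni] by (simp add: mult.commute)
  have z: "(LINT x|lborel. ft (Nl l) x * ft (q k) x) = 0" if k: "k \<in> ks" for k
  proof -
    have "(LINT x|lborel. ft (Nl l) x * ft (q k) x) = (LINT \<xi>|lborel. Nl l \<xi> * ft (ft (q k)) \<xi>)"
      by (rule ft_swap[OF Ni fq])
    also have "\<dots> = (LINT \<xi>|(lborel :: (real^'n) measure). 0)"
    proof (intro Bochner_Integration.integral_cong refl)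
      fix \<xi>
      show "Nl l \<xi> * ft (ft (q k)) \<xi> = 0"
      proof (cases "Nl l \<xi> = 0")
        case False
        have "norm \<xi> \<le> 5/4 * rr l" by (rule scaled_support(3)[OF Nl_support[OF False]])
        then have "norm (- \<xi>) < kap k - \<rho>"
          using rho_kap(2)[OF k] rho_ge rr_le[OF l] unfolding norm_minus_cancel by linarith
        then have "V k b (- \<xi>) = 0" using Psi_norm(1)[of k "- \<xi>"] unfolding V_def by fastforce
        then show ?thesis unfolding q_def gaussian_mult_inversion[OF s0 V_schwartz] by simp
      qed simp
    qed
    finally show ?thesis by simp
  qed
  have "(LINT x|lborel. ft (Nl l) x * of_real (heat_semigroup s (v0 \<alpha>) x $ b)) =
    (LINT x|lborel. (\<Sum>k\<in>ks. of_real \<alpha> * (ft (Nl l) x * ft (q k) x)))"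
    unfolding heat_v0_component[OF s \<alpha>] q_def sum_distrib_left by (simp only: mult_ac)
  also have "\<dots> = (\<Sum>k\<in>ks. of_real \<alpha> * (LINT x|lborel. ft (Nl l) x * ft (q k) x))"
    by (subst Bochner_Integration.integral_sum, intro integrable_mult_right ii) (simp only: integral_mult_right_zero)
  also have "\<dots> = 0" using z by simp
  finally show ?thesis .
qed


text \<open>The tested Duhamel term of U yields K / 8, and replacing u by U costs at most 1/16,
  which is at most K / 16. The essential bound of u at the time \<open>tt\<close> is returned as
  well, since the Besov norm is reached through duality with the function u.\<close>

lemma output_lower:
  assumes u: "bounded_mild_solution T (v0 \<alpha>) u" and T: "tt \<le> T" and \<alpha>: "0 < \<alpha>" "\<alpha> \<le> 1"
    and small: "512 * CB * C1 * \<alpha> \<le> 1"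
  obtains Bu where "u tt \<in> borel_measurable borel" "AE x in lborel. norm (u tt x) \<le> Bu"
    "\<And>l. l \<in> {L..<L+L} \<Longrightarrow> \<alpha>\<^sup>2 * real K * (rr l * c1 / 16) \<le> norm (LINT x|lborel. ft (Nl l) x * of_real (u tt x $ b))"
proof -
  obtain w M where wm: "(\<lambda>z. w (fst z) (snd z)) \<in> borel_measurable (borel \<Otimes>\<^sub>M borel)" and "M > 0"
    and wM: "\<And>\<tau> y. norm (w \<tau> y) \<le> M"
    and wu: "AE \<tau> in lborel. \<tau> \<in> {0<..<T} \<longrightarrow> (AE y in lborel. w \<tau> y = u \<tau> y)"
    and eq: "\<And>t. t \<in> {0<..T} \<Longrightarrow> AE x in lborel. u t x = heat_semigroup t (v0 \<alpha>) x -
       (LINT \<tau>:{0<..<t}|lborel. heat_P_div (t - \<tau>) (\<lambda>y. tensor (w \<tau> y) (w \<tau> y)) x)"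
    and um: "\<And>t. t \<in> {0<..T} \<Longrightarrow> u t \<in> borel_measurable borel"
    using bounded_mild_solution_representative[OF u] by blast
  have \<alpha>0: "\<alpha> \<ge> 0" using \<alpha> by simp
  define A where "A = Abd \<alpha>"
  have A: "A > 0" unfolding A_def by (rule Abd_pos[OF \<alpha>(1)])
  define \<beta> where "\<beta> = 4 * C1 * \<alpha>"
  have \<beta>: "\<beta> \<ge> 0" using C1_pos \<alpha> by (simp add: \<beta>_def)
  have A_sqrt: "A * sqrt tt = \<alpha> * CA * ee" by (simp add: A_def Abd_def ee_def)
  have close: "AE x in lborel. norm (u s x - U \<alpha> s x) \<le> 2 * A" if s: "s \<in> {0<..tt}" for s
  proof (rule mild_solution_close[OF wm wM wu eq U_measurable norm_U_le_UB[OF \<alpha>0] norm_U_le[OF \<alpha>0, folded \<beta>_def] _ tt_pos T A \<beta> _ _ s])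
    show "norm (heat_semigroup s (v0 \<alpha>) x - (LINT \<tau>:{0<..<s}|lborel. heat_P_div (s - \<tau>) (\<lambda>y. tensor (U \<alpha> \<tau> y) (U \<alpha> \<tau> y)) x) - U \<alpha> s x) \<le> A"
      if "s \<in> {0<..tt}" for s x unfolding A_def using that by (intro base_estimate \<alpha>0 \<alpha>(2)) simp
    \<comment> \<open>The hypothesis has 512 = 128 * 4, the factor 4 being the one in
      \<beta>.\<close>
    show "128 * heat_P_div_const TYPE('n) * \<beta> \<le> 1" using small by (simp add: CB_def \<beta>_def mult_ac)
    have "32 * CB * A * sqrt tt = \<alpha> * (32 * CB * CA * ee)" using A_sqrt by (simp add: mult_ac)
    also have "\<dots> \<le> 1 * 1" using \<alpha> Mc_ee[OF Mc_ge(4)] by (intro mult_mono) (auto simp: CB_pos CA_pos ee_pos less_imp_le)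
    finally show "32 * heat_P_div_const TYPE('n) * A * sqrt tt \<le> 1" by (simp add: CB_def)
  qed
  have ttT: "tt \<in> {0<..T}" "tt \<in> {0<..tt}" using tt_pos T by auto
  have um': "u tt \<in> borel_measurable borel" by (rule um[OF ttT(1)])
  note [measurable] = um'
  have ub: "AE x in lborel. norm (u tt x) \<le> UB \<alpha> + 2 * A"
    using close[OF ttT(2)]
  proof eventually_elim
    case (elim x)
    then show ?case using norm_triangle_sub[of "u tt x" "U \<alpha> tt x"] norm_U_le_UB[OF \<alpha>0, of tt x] by linarith
  qed
  show thesis
  proof (rule that[OF um' ub])
    fix l assume l: "l \<in> {L..<L+L}"
    define FW where "FW \<tau> y = tensor (w \<tau> y) (w \<tau> y)" for \<tau> y
    define FU where "FU \<tau> y = tensor (U \<alpha> \<tau> y) (U \<alpha> \<tau> y)" for \<tau> y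
    define HW where "HW \<tau> = (\<Sum>j\<in>UNIV. \<Sum>k\<in>UNIV. LINT y|lborel. of_real (FW \<tau> y $ j $ k) * ft (Qs (tt - \<tau>) l j k) y)" for \<tau>
    note FWm = tensor_measurable[OF wm, folded FW_def]
    note FUm = U_tensor(1)[of \<alpha>, folded FU_def]
    have FWb: "\<bar>FW \<tau> y $ j $ k\<bar> \<le> M * M" for \<tau> y j k unfolding FW_def by (intro abs_tensor_le wM)
    have FUb: "\<bar>FU \<tau> y $ j $ k\<bar> \<le> UB \<alpha> * UB \<alpha>" for \<tau> y j k unfolding FU_def by (rule U_tensor(2)[OF \<alpha>0])
    note FWs = section_measurable[where f="\<lambda>\<tau> y. FW \<tau> y $ _ $ _", OF FWm]
    note FUs = section_measurable[where f="\<lambda>\<tau> y. FU \<tau> y $ _ $ _", OF FUm]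
    have HWi: "integrable lborel (\<lambda>\<tau>. of_real (indicator {0<..<tt} \<tau>) * HW \<tau>)"
      unfolding HW_def by (rule test_duhamel_Nl(1)[OF FWm FWb tt_pos])
    have HUi: "integrable lborel (\<lambda>\<tau>. of_real (indicator {0<..<tt} \<tau>) * HU l \<alpha> \<tau>)"
      using test_duhamel_Nl(1)[OF FUm FUb tt_pos] unfolding HU_def FU_def .
    define n2 where "n2 = (real CARD('n))\<^sup>2"
    have n2: "n2 \<ge> 0" by (simp add: n2_def)
    have diff: "AE \<tau> in lborel. norm (of_real (indicator {0<..<tt} \<tau>) * HW \<tau> - of_real (indicator {0<..<tt} \<tau>) * HU l \<alpha> \<tau>) \<le>
      n2 * (rr l * CQ) * (4 * A * \<beta> * (indicator {0<..<tt} \<tau> / sqrt \<tau>) + 4 * A\<^sup>2 * indicator {0<..<tt} \<tau>)"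
      using wu
    proof eventually_elim
      case (elim \<tau>)
      show ?case
      proof (cases "\<tau> \<in> {0<..<tt}")
        case True
        then have st: "0 \<le> tt - \<tau>" by simp
        have "AE y in lborel. w \<tau> y = u \<tau> y" using elim True T by auto
        then have cl: "AE y in lborel. norm (w \<tau> y - U \<alpha> \<tau> y) \<le> 2 * A"
          using close[of \<tau>] True by (auto elim: AE_mp)
        define D where "D = \<beta> / sqrt \<tau> * (4 * A) + 4 * A\<^sup>2"
        have D: "D \<ge> 0" using \<beta> A True by (simp add: D_def)
        have t: "norm ((LINT y|lborel. of_real (FW \<tau> y $ j $ k) * ft (Qs (tt - \<tau>) l j k) y) - (LINT y|lborel. of_real (FU \<tau> y $ j $ k) * ft (Qs (tt - \<tau>) l j k) y)) \<le> D * (rr l * CQ)" for j k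
        proof -
          have [measurable]: "(\<lambda>y. FW \<tau> y $ j $ k) \<in> borel_measurable lborel" "(\<lambda>y. FU \<tau> y $ j $ k) \<in> borel_measurable lborel"
            using FWs[of \<tau> j k] FUs[of \<tau> j k] by simp_all
          have i: "integrable lborel (\<lambda>y. of_real (FW \<tau> y $ j $ k) * ft (Qs (tt - \<tau>) l j k) y)"
            "integrable lborel (\<lambda>y. of_real (FU \<tau> y $ j $ k) * ft (Qs (tt - \<tau>) l j k) y)"
            by (rule integrable_of_real_mult[OF ft_Qs_integrable[OF st] _ FWb], measurable)
               (rule integrable_of_real_mult[OF ft_Qs_integrable[OF st] _ FUb], measurable)
          have "(LINT y|lborel. of_real (FW \<tau> y $ j $ k) * ft (Qs (tt - \<tau>) l j k) y) - (LINT y|lborel. of_real (FU \<tau> y $ j $ k) * ft (Qs (tt - \<tau>) l j k) y) =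
            (LINT y|lborel. of_real ((FW \<tau> y - FU \<tau> y) $ j $ k) * ft (Qs (tt - \<tau>) l j k) y)"
            unfolding Bochner_Integration.integral_diff[OF i, symmetric] by (simp add: left_diff_distrib)
          also have "norm \<dots> \<le> D * (rr l * CQ)"
          proof (rule norm_integral_of_real_mult_le[OF ft_Qs_integrable[OF st] _ D ft_Qs_L1[OF st]])
            show "AE y in lborel. \<bar>(FW \<tau> y - FU \<tau> y) $ j $ k\<bar> \<le> D"
              using cl
            proof eventually_elim
              case (elim y)
              have "\<bar>(FW \<tau> y - FU \<tau> y) $ j $ k\<bar> \<le> 2 * norm (U \<alpha> \<tau> y) * norm (w \<tau> y - U \<alpha> \<tau> y) + (norm (w \<tau> y - U \<alpha> \<tau> y))\<^sup>2"
                unfolding FW_def FU_def by (rule abs_tensor_diff_le)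
              also have "\<dots> \<le> 2 * (\<beta> / sqrt \<tau>) * (2 * A) + (2 * A)\<^sup>2"
                using elim norm_U_le[OF \<alpha>0, of \<tau> y] True A \<beta>
                by (intro add_mono mult_mono power_mono) (auto simp: \<beta>_def)
              also have "\<dots> = D" by (simp add: D_def power2_eq_square)
              finally show ?case .
            qed
          qed
          finally show ?thesis .
        qed
        have "norm (HW \<tau> - HU l \<alpha> \<tau>) \<le> (\<Sum>j\<in>(UNIV::'n set). \<Sum>m\<in>(UNIV::'n set). D * (rr l * CQ))"
          unfolding HW_def HU_def FU_def[symmetric]
          by (simp only: flip: sum_subtractf) (intro sum_norm_le t)
        also have "\<dots> = n2 * (rr l * CQ) * D" by (simp add: n2_def power2_eq_square mult_ac)
        finally have "norm (HW \<tau> - HU l \<alpha> \<tau>) \<le> n2 * (rr l * CQ) * D" .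
        then show ?thesis using True by (simp add: D_def mult_ac)
      qed simp
    qed
    have nd: "norm ((LINT \<tau>|lborel. of_real (indicator {0<..<tt} \<tau>) * HW \<tau>) - (LINT \<tau>|lborel. of_real (indicator {0<..<tt} \<tau>) * HU l \<alpha> \<tau>)) \<le>
      n2 * (rr l * CQ) * (8 * A * \<beta> * sqrt tt + 4 * A\<^sup>2 * tt)"
    proof -
      have h: "has_bochner_integral lborel (\<lambda>\<tau>. n2 * (rr l * CQ) * (4 * A * \<beta> * (indicator {0<..<tt} \<tau> / sqrt \<tau>) + 4 * A\<^sup>2 * indicator {0<..<tt} \<tau>))
        (n2 * (rr l * CQ) * (4 * A * \<beta> * (2 * sqrt tt) + 4 * A\<^sup>2 * tt))"
      proof (intro has_bochner_integral_mult_right has_bochner_integral_add)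
        show "has_bochner_integral lborel (\<lambda>\<tau>. indicator {0<..<tt} \<tau> / sqrt \<tau>) (2 * sqrt tt)"
          using tt_pos by (intro has_bochner_integral_inverse_sqrt) simp
        show "has_bochner_integral lborel (\<lambda>\<tau>. indicator {0<..<tt} \<tau> :: real) tt"
          using has_bochner_integral_real_indicator[of "{0<..<tt}" lborel] tt_pos by simp
      qed
      have "norm (LINT \<tau>|lborel. of_real (indicator {0<..<tt} \<tau>) * HW \<tau> - of_real (indicator {0<..<tt} \<tau>) * HU l \<alpha> \<tau>) \<le>
        (LINT \<tau>|lborel. norm (of_real (indicator {0<..<tt} \<tau>) * HW \<tau> - of_real (indicator {0<..<tt} \<tau>) * HU l \<alpha> \<tau>))"
        by (rule integral_norm_bound)
      also have "\<dots> \<le> (LINT \<tau>|lborel. n2 * (rr l * CQ) * (4 * A * \<beta> * (indicator {0<..<tt} \<tau> / sqrt \<tau>) + 4 * A\<^sup>2 * indicator {0<..<tt} \<tau>))"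
        using h by (intro integral_mono_AE diff integrable_norm Bochner_Integration.integrable_diff HWi HUi) (simp add: has_bochner_integral_iff)
      also have "\<dots> = n2 * (rr l * CQ) * (4 * A * \<beta> * (2 * sqrt tt) + 4 * A\<^sup>2 * tt)"
        using h by (simp only: has_bochner_integral_iff)
      finally show ?thesis unfolding Bochner_Integration.integral_diff[OF HWi HUi] by (simp add: mult_ac)
    qed
    also have "n2 * (rr l * CQ) * (8 * A * \<beta> * sqrt tt + 4 * A\<^sup>2 * tt) \<le> \<alpha>\<^sup>2 * rr l * (c1 / 16)"
    proof -
      have "tt = sqrt tt * sqrt tt" using tt_pos by simp
      then have "8 * A * \<beta> * sqrt tt + 4 * A\<^sup>2 * tt = 8 * (A * sqrt tt) * \<beta> + 4 * (A * sqrt tt)\<^sup>2"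
        using tt_pos by (simp add: power_mult_distrib)
      \<comment> \<open>A and \<beta> are both linear in \<alpha>, so the error is quadratic in
        \<alpha> just like the main term, and the comparison is uniform in \<alpha>.\<close>
      also have "\<dots> = \<alpha>\<^sup>2 * (32 * CA * C1 * ee + 4 * CA\<^sup>2 * ee\<^sup>2)"
        unfolding A_sqrt \<beta>_def by (simp add: power2_eq_square algebra_simps)
      also have "\<dots> \<le> \<alpha>\<^sup>2 * (32 * CA * C1 * ee + 4 * CA\<^sup>2 * ee)"
        using ee_pos ee_le_1 by (intro mult_left_mono add_left_mono) (auto simp: power2_eq_square mult_left_le)
      also have "\<dots> = \<alpha>\<^sup>2 * ((32 * CA * C1 + 4 * CA\<^sup>2) * ee)" by (simp add: algebra_simps)
      finally have "n2 * (rr l * CQ) * (8 * A * \<beta> * sqrt tt + 4 * A\<^sup>2 * tt) \<le> n2 * (rr l * CQ) * (\<alpha>\<^sup>2 * ((32 * CA * C1 + 4 * CA\<^sup>2) * ee))"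
        using n2 CQ_pos rr_pos[of l] by (intro mult_left_mono mult_nonneg_nonneg) (auto simp: less_imp_le)
      also have "\<dots> = \<alpha>\<^sup>2 * rr l * (c1 / 16) * (16 * n2 * CQ * (32 * CA * C1 + 4 * CA\<^sup>2) / c1 * ee)"
        using c1_pos by (simp add: field_simps)
      also have "\<dots> \<le> \<alpha>\<^sup>2 * rr l * (c1 / 16) * 1"
        using c1_pos rr_pos[of l] Mc_ee[OF Mc_ge(3)] by (intro mult_left_mono) (auto simp: n2_def less_imp_le intro!: mult_nonneg_nonneg)
      finally show ?thesis by simp
    qed
    also have "\<dots> \<le> \<alpha>\<^sup>2 * rr l * (c1 / 16) * real K"
      using K c1_pos rr_pos[of l] by (intro mult_left_mono[of 1 "real K", unfolded mult_1_right]) (auto simp: less_imp_le intro!: mult_nonneg_nonneg)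
    finally have nd: "norm ((LINT \<tau>|lborel. of_real (indicator {0<..<tt} \<tau>) * HW \<tau>) - (LINT \<tau>|lborel. of_real (indicator {0<..<tt} \<tau>) * HU l \<alpha> \<tau>)) \<le> \<alpha>\<^sup>2 * rr l * (c1 / 16) * real K" .
    have main: "\<alpha>\<^sup>2 * c1 * rr l * (real K / 8) \<le> Im (LINT \<tau>|lborel. of_real (indicator {0<..<tt} \<tau>) * HU l \<alpha> \<tau>)"
      by (rule Im_integral_HU_ge[OF l \<alpha>0])
    define Du where "Du x = (LINT \<tau>:{0<..<tt}|lborel. heat_P_div (tt - \<tau>) (FW \<tau>) x)" for x
    have eq': "AE x in lborel. u tt x = heat_semigroup tt (v0 \<alpha>) x - Du x"
      using eq[OF ttT(1)] unfolding Du_def FW_def .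
    have hm: "(\<lambda>z. heat_P_div (tt - snd z) (FW (snd z)) (fst z)) \<in> borel_measurable (lborel \<Otimes>\<^sub>M lborel)"
      by (rule heat_P_div_measurable[OF FWm]) auto
    have [measurable]: "Du \<in> borel_measurable borel"
    proof -
      have "(\<lambda>(x, \<tau>). indicat_real {0<..<tt} \<tau> *\<^sub>R heat_P_div (tt - \<tau>) (FW \<tau>) x) \<in> borel_measurable (lborel \<Otimes>\<^sub>M lborel)"
        unfolding split_beta' using hm by measurable
      from lborel.borel_measurable_lebesgue_integral[OF this] show ?thesis
        unfolding Du_def[abs_def] set_lebesgue_integral_def by simp
    qed
    have [measurable]: "heat_semigroup tt (v0 \<alpha>) \<in> borel_measurable borel"
      unfolding heat_semigroup_def by measurable
    have [measurable]: "ft (Nl l) \<in> borel_measurable borel" using schwartz_ft_integrable[OF Nl_schwartz[of l]] by auto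
    have Ni: "integrable lborel (ft (Nl l))" by (rule schwartz_ft_integrable[OF Nl_schwartz])
    have iu: "integrable lborel (\<lambda>x. ft (Nl l) x * of_real (u tt x $ b))"
    proof (rule Bochner_Integration.integrable_bound)
      show "integrable lborel (\<lambda>x. norm (ft (Nl l) x) * (UB \<alpha> + 2 * A))" using Ni by simp
      show "AE x in lborel. norm (ft (Nl l) x * of_real (u tt x $ b)) \<le> norm (norm (ft (Nl l) x) * (UB \<alpha> + 2 * A))"
        using ub
      proof eventually_elim
        case (elim x)
        then have "norm (ft (Nl l) x) * \<bar>u tt x $ b\<bar> \<le> norm (ft (Nl l) x) * (UB \<alpha> + 2 * A)"
          using component_le_norm_cart[of "u tt x" b] by (intro mult_left_mono) auto
        then show ?case by (simp add: norm_mult)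
      qed
    qed measurable
    have ih: "integrable lborel (\<lambda>x. ft (Nl l) x * of_real (heat_semigroup tt (v0 \<alpha>) x $ b))"
      unfolding heat_v0_component[OF tt_pos \<alpha>0] sum_distrib_left
      by (intro Bochner_Integration.integrable_sum, subst mult.left_commute)
         (intro integrable_mult_right integrable_mult_ft Ni integrable_exp_V less_imp_le[OF tt_pos])
    have "(LINT x|lborel. ft (Nl l) x * of_real (heat_semigroup tt (v0 \<alpha>) x $ b)) - (LINT x|lborel. ft (Nl l) x * of_real (u tt x $ b)) =
      (LINT x|lborel. ft (Nl l) x * of_real (heat_semigroup tt (v0 \<alpha>) x $ b) - ft (Nl l) x * of_real (u tt x $ b))"
      by (rule Bochner_Integration.integral_diff[OF ih iu, symmetric])
    also have "\<dots> = (LINT x|lborel. ft (Nl l) x * of_real (Du x $ b))"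
    proof (rule integral_cong_AE)
      show "AE x in lborel. ft (Nl l) x * of_real (heat_semigroup tt (v0 \<alpha>) x $ b) - ft (Nl l) x * of_real (u tt x $ b) = ft (Nl l) x * of_real (Du x $ b)"
        using eq' by eventually_elim (simp add: right_diff_distrib)
    qed measurable
    also have "\<dots> = (LINT \<tau>|lborel. of_real (indicator {0<..<tt} \<tau>) * HW \<tau>)"
      unfolding Du_def HW_def by (rule test_duhamel_Nl(2)[OF FWm FWb tt_pos])
    finally have "(LINT x|lborel. ft (Nl l) x * of_real (u tt x $ b)) = - (LINT \<tau>|lborel. of_real (indicator {0<..<tt} \<tau>) * HW \<tau>)"
      unfolding heat_v0_Nl_zero[OF \<alpha>0 tt_pos l] by (simp add: minus_equation_iff)
    then have "norm (LINT x|lborel. ft (Nl l) x * of_real (u tt x $ b)) = norm (LINT \<tau>|lborel. of_real (indicator {0<..<tt} \<tau>) * HW \<tau>)" by simp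
    moreover have "norm (LINT \<tau>|lborel. of_real (indicator {0<..<tt} \<tau>) * HU l \<alpha> \<tau>) \<ge> \<alpha>\<^sup>2 * c1 * rr l * (real K / 8)"
      using main abs_Im_le_cmod[of "LINT \<tau>|lborel. of_real (indicator {0<..<tt} \<tau>) * HU l \<alpha> \<tau>"] by linarith
    moreover have "\<alpha>\<^sup>2 * c1 * rr l * (real K / 8) = \<alpha>\<^sup>2 * real K * (rr l * c1 / 16) + \<alpha>\<^sup>2 * rr l * (c1 / 16) * real K" by simp
    ultimately show "\<alpha>\<^sup>2 * real K * (rr l * c1 / 16) \<le> norm (LINT x|lborel. ft (Nl l) x * of_real (u tt x $ b))"
      using nd norm_triangle_ineq2[of "LINT \<tau>|lborel. of_real (indicator {0<..<tt} \<tau>) * HU l \<alpha> \<tau>" "LINT \<tau>|lborel. of_real (indicator {0<..<tt} \<tau>) * HW \<tau>"]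
      by (simp only: norm_minus_commute)
  qed
qed

end

section \<open>Besov norms\<close>

lemma norm_vector_scalar_mult: "norm (c *s (v :: complex^'m)) = norm c * norm v"
  by (simp add: norm_vec_def norm_mult L2_set_right_distrib)

lemma norm_vec_of_real: "norm (\<chi> i. complex_of_real (v $ i)) = norm (v :: real^'m)"
  by (simp add: norm_vec_def)

lemma LP_multiplier_apply:
  fixes T :: "('n::finite, 'm::finite) dist"
  shows "dist_inv_fourier (dist_mult m (dist_fourier T)) \<eta> =
    T (\<lambda>x. ft (\<lambda>\<xi>. of_real (m \<xi>) * (ft \<eta> \<xi> / of_real ((2 * pi) ^ CARD('n)))) (- x))"
  by (simp add: dist_inv_fourier_def dist_mult_def dist_fourier_def fourier_def[abs_def] inv_fourier_def[abs_def] ft_def[abs_def] inner_commute)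

lemma dist_Lp_norm_infinity_le:
  assumes [measurable]: "f \<in> borel_measurable borel" and B: "\<And>x. norm (f x) \<le> B"
    and T: "\<And>\<eta>. schwartz \<eta> \<Longrightarrow> T \<eta> = regular_dist f \<eta>"
  shows "dist_Lp_norm \<infinity> T \<le> ennreal B"
proof -
  have le: "Lp_norm \<infinity> f \<le> ennreal B"
    unfolding Lp_norm_def by (auto intro!: esssup_I ennreal_leI B)
  have "dist_Lp_norm \<infinity> T \<le> Lp_norm \<infinity> f"
    unfolding dist_Lp_norm_def by (rule INF_lower) (use T le in \<open>auto simp: top.extremum_strict intro: le_less_trans[OF _ ennreal_less_top]\<close>)
  then show ?thesis using le by (rule order_trans)
qed

text \<open>Duality: the estimate holds for every representing function, hence for the infimum,
  including the value \<infinity> when there is none. No representative of the block of u has to be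
  constructed.\<close>

lemma dist_Lp_norm_infinity_ge:
  fixes T :: "('n::finite, 'm::finite) dist"
  assumes \<eta>: "schwartz \<eta>" and N: "N > 0" "(LINT x|lborel. norm (\<eta> x)) \<le> N" and X: "X \<le> norm (T \<eta> $ i)"
  shows "ennreal (X / N) \<le> dist_Lp_norm \<infinity> T"
  unfolding dist_Lp_norm_def
proof (rule INF_greatest)
  fix f :: "real^'n \<Rightarrow> complex^'m"
  assume "f \<in> {f \<in> borel_measurable lborel. Lp_norm \<infinity> f < \<infinity> \<and> (\<forall>\<eta>. schwartz \<eta> \<longrightarrow> T \<eta> = regular_dist f \<eta>)}"
  then have fin: "Lp_norm \<infinity> f < \<infinity>" and T: "T \<eta> = regular_dist f \<eta>" using \<eta> by auto
  define S where "S = enn2real (Lp_norm \<infinity> f)"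
  have S: "Lp_norm \<infinity> f = ennreal S" "S \<ge> 0" using fin by (simp_all add: S_def)
  have ae: "AE x in lborel. norm (f x) \<le> S"
  proof -
    have "AE x in lborel. ennreal (norm (f x)) \<le> Lp_norm \<infinity> f"
      unfolding Lp_norm_def by (simp add: esssup_AE)
    then show ?thesis using S by (simp add: ennreal_le_iff)
  qed
  have "X \<le> norm (regular_dist f \<eta>)" using X Finite_Cartesian_Product.norm_nth_le[of "T \<eta>" i] T by simp
  also have "\<dots> \<le> (LINT x|lborel. norm (\<eta> x *s f x))" unfolding regular_dist_def by (rule integral_norm_bound)
  also have "\<dots> \<le> (LINT x|lborel. norm (\<eta> x) * S)"
  proof (rule integral_mono_AE')
    show "integrable lborel (\<lambda>x. norm (\<eta> x) * S)" using schwartz_integrable[OF \<eta>] by simp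
    show "AE x in lborel. norm (\<eta> x *s f x) \<le> norm (\<eta> x) * S"
      using ae by eventually_elim (auto simp: norm_vector_scalar_mult intro!: mult_left_mono)
  qed (use S in simp)
  also have "\<dots> \<le> N * S" using N S by (simp add: mult_right_mono)
  finally have "X / N \<le> S" using N by (simp add: field_simps)
  then show "ennreal (X / N) \<le> Lp_norm \<infinity> f" unfolding S by (rule ennreal_leI)
qed

lemma real_dist_component:
  fixes f :: "real^'n::finite \<Rightarrow> real^'m::finite"
  assumes "integrable lborel (\<lambda>x. norm (\<eta> x) * norm (f x))" and [measurable]: "\<eta> \<in> borel_measurable borel" "f \<in> borel_measurable borel"
  shows "real_dist f \<eta> $ i = (LINT x|lborel. \<eta> x * of_real (f x $ i))"
proof -
  have e: "\<eta> x *s (\<chi> i. complex_of_real (f x $ i)) = (\<chi> i. \<eta> x * of_real (f x $ i))" for x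
    by (simp add: vec_eq_iff)
  have "integrable lborel (\<lambda>x. \<eta> x *s (\<chi> i. complex_of_real (f x $ i)))"
  proof (rule Bochner_Integration.integrable_bound[OF assms(1)])
    show "(\<lambda>x. \<eta> x *s (\<chi> i. complex_of_real (f x $ i))) \<in> borel_measurable lborel" unfolding e by measurable
    show "AE x in lborel. norm (\<eta> x *s (\<chi> i. complex_of_real (f x $ i))) \<le> norm (norm (\<eta> x) * norm (f x))"
      by (simp add: norm_vector_scalar_mult norm_vec_of_real)
  qed
  from integral_bounded_linear[OF bounded_linear_vec_nth this, of i] show ?thesis
    by (simp add: real_dist_def regular_dist_def)
qed

lemma ft_reflect:
  assumes "integrable lborel f"
  shows "ft (\<lambda>\<xi>. f (- \<xi>)) (- x) = ft f x"
  using integral_lborel_reflect[OF integrable_cis_mult[OF assms, of x], of 0] by (simp add: ft_def)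

text \<open>Swapping the transform twice, with an inversion in between, moves the multiplier from
  the test function to the explicit frequency side W of f. The cutoff may therefore enter as a
  bounded measurable function.\<close>

lemma multiplier_real_dist:
  fixes f f' :: "real^'n \<Rightarrow> real^'m" and m :: "real^'n \<Rightarrow> real"
  assumes f: "schwartz f" and m[measurable]: "m \<in> borel_measurable borel" and mB: "\<And>\<xi>. \<bar>m \<xi>\<bar> \<le> B"
    and W: "\<And>i. schwartz (W i)" and fW: "\<And>x i. of_real (f x $ i) = ft (W i) x"
    and f': "\<And>x i. of_real (f' x $ i) = ft (\<lambda>\<xi>. of_real (m \<xi>) * W i \<xi>) x" and f'i: "integrable lborel f'" "\<And>x. norm (f' x) \<le> B'"
    and \<eta>: "schwartz \<eta>"
  shows "dist_inv_fourier (dist_mult m (dist_fourier (real_dist f))) \<eta> = real_dist f' \<eta>"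
proof -
  define h where "h \<xi> = of_real (m \<xi>) * (ft \<eta> \<xi> / of_real ((2 * pi) ^ CARD('n)))" for \<xi>
  have fe: "schwartz (ft \<eta>)" by (rule schwartz_ft(1)[OF \<eta>])
  have h: "integrable lborel h"
    unfolding h_def by (rule integrable_of_real_mult[OF _ _ mB]) (use schwartz_integrable[OF fe] in auto)
  have hm[measurable]: "h \<in> borel_measurable borel" using h by auto
  have fm[measurable]: "f \<in> borel_measurable borel" using f by measurable
  have f'm[measurable]: "f' \<in> borel_measurable borel" using f'i by auto
  have em[measurable]: "\<eta> \<in> borel_measurable borel" using \<eta> by measurable
  have Wi: "integrable lborel (W i)" and fWi: "integrable lborel (ft (W i))" for i
    by (intro schwartz_integrable schwartz_ft(1) W)+
  have mWi: "integrable lborel (\<lambda>\<xi>. of_real (m \<xi>) * W i \<xi>)" for i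
    by (rule integrable_of_real_mult[OF Wi _ mB]) simp
  have i1: "integrable lborel (\<lambda>x. norm (ft h (- x)) * norm (f x))"
  proof (rule Bochner_Integration.integrable_bound)
    show "integrable lborel (\<lambda>x. (LINT \<xi>|lborel. norm (h \<xi>)) * norm (f x))" using schwartz_integrable[OF f] by simp
    show "AE x in lborel. norm (norm (ft h (- x)) * norm (f x)) \<le> norm ((LINT \<xi>|lborel. norm (h \<xi>)) * norm (f x))"
      by (intro AE_I2) (auto simp: abs_mult intro!: mult_right_mono norm_ft_le)
  qed measurable
  obtain E where E: "\<And>x. norm (\<eta> x) \<le> E" using schwartz_bounded[OF \<eta>] by blast
  have i2: "integrable lborel (\<lambda>x. norm (\<eta> x) * norm (f' x))"
  proof (rule Bochner_Integration.integrable_bound)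
    show "integrable lborel (\<lambda>x. E * norm (f' x))" using f'i(1) by simp
    show "AE x in lborel. norm (norm (\<eta> x) * norm (f' x)) \<le> norm (E * norm (f' x))"
      by (intro AE_I2) (auto simp: abs_mult intro!: mult_right_mono order_trans[OF E abs_ge_self])
  qed measurable
  have "real_dist f (\<lambda>x. ft h (- x)) $ i = real_dist f' \<eta> $ i" for i
  proof -
    have "real_dist f (\<lambda>x. ft h (- x)) $ i = (LINT x|lborel. ft h (- x) * ft (W i) x)"
      using i1 by (subst real_dist_component) (auto simp: fW)
    also have "\<dots> = (LINT x|lborel. ft (\<lambda>\<xi>. h (- \<xi>)) x * ft (W i) x)"
    proof (intro Bochner_Integration.integral_cong refl)
      fix x
      show "ft h (- x) * ft (W i) x = ft (\<lambda>\<xi>. h (- \<xi>)) x * ft (W i) x"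
        using ft_reflect[OF h, of "- x"] by simp
    qed
    also have "\<dots> = (LINT \<xi>|lborel. h (- \<xi>) * ft (ft (W i)) \<xi>)"
      by (rule ft_swap[OF _ fWi]) (use integrable_lborel_reflect[OF h, of 0] in simp)
    also have "\<dots> = (LINT \<xi>|lborel. h (- \<xi>) * (of_real ((2 * pi) ^ CARD('n)) * W i (- \<xi>)))"
      unfolding schwartz_inversion[OF W] ..
    also have "\<dots> = (LINT \<xi>|lborel. (of_real (m (- \<xi>)) * W i (- \<xi>)) * ft \<eta> (- \<xi>))"
      by (simp add: h_def mult_ac)
    also have "\<dots> = (LINT \<xi>|lborel. (of_real (m \<xi>) * W i \<xi>) * ft \<eta> \<xi>)"
      using integral_lborel_reflect[OF integrable_mult_ft[OF mWi schwartz_integrable[OF \<eta>]], of 0 i] by simp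
    also have "\<dots> = (LINT x|lborel. ft (\<lambda>\<xi>. of_real (m \<xi>) * W i \<xi>) x * \<eta> x)"
      by (rule ft_swap[OF mWi schwartz_integrable[OF \<eta>], symmetric])
    also have "\<dots> = real_dist f' \<eta> $ i"
      using i2 by (subst real_dist_component) (auto simp: f'[symmetric] mult.commute)
    finally show ?thesis .
  qed
  then show ?thesis unfolding LP_multiplier_apply h_def[symmetric] by (simp add: vec_eq_iff)
qed

lemma partial_bounded_linear:
  assumes "bounded_linear h" "f differentiable (at x)"
  shows "partial i (\<lambda>x. h (f x)) x = h (partial i f x)"
  using partial_eq[OF bounded_linear.has_derivative[OF assms(1) assms(2)[unfolded frechet_derivative_works]], of i]
  by (simp add: partial_def)

section \<open>Littlewood-Paley multipliers and sequence norms\<close>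

lemma LP_cutoff_values:
  assumes "LP_cutoff \<phi>"
  shows "0 \<le> t \<Longrightarrow> t \<le> 5/4 \<Longrightarrow> \<phi> t = 1" "t \<ge> 3/2 \<Longrightarrow> \<phi> t = 0" "t \<ge> 0 \<Longrightarrow> \<bar>\<phi> t\<bar> \<le> 1"
  using assms unfolding LP_cutoff_def by auto

lemma LP_cutoff_measurable:
  assumes "LP_cutoff \<phi>" and c: "c \<ge> 0"
  shows "(\<lambda>\<xi>::real^'n. \<phi> (c * norm \<xi>)) \<in> borel_measurable borel"
proof -
  have "continuous_on {0..} \<phi>"
    using assms unfolding LP_cutoff_def smooth_half_line_def continuous_on_eq_continuous_within
    by (metis atLeast_iff has_field_derivative_imp_has_derivative has_derivative_continuous)
  then have "continuous_on UNIV (\<lambda>\<xi>::real^'n. \<phi> (c * norm \<xi>))"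
    by (rule continuous_on_compose2) (use c in \<open>auto intro!: continuous_intros\<close>)
  then show ?thesis by (rule borel_measurable_continuous_onI)
qed

lemma LP_psi_scaled: "c > 0 \<Longrightarrow> LP_psi \<phi> ((1 / c) *\<^sub>R \<xi>) = \<phi> ((1 / c) * norm \<xi>) - \<phi> ((2 / c) * norm \<xi>)"
  by (simp add: LP_psi_def)

text \<open>In units of c the outer cutoff is still 1 up to 5/4, and the inner one has vanished from
  3/4 on.\<close>

lemma LP_psi_one:
  assumes "LP_cutoff \<phi>" "3/4 * c \<le> norm \<xi>" "norm \<xi> \<le> 5/4 * c" "c > 0"
  shows "LP_psi \<phi> ((1 / c) *\<^sub>R \<xi>) = 1"
proof -
  have "0 \<le> (1 / c) * norm \<xi>" "(1 / c) * norm \<xi> \<le> 5/4" "3/2 \<le> (2 / c) * norm \<xi>" using assms by (simp_all add: field_simps)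
  then show ?thesis
    unfolding LP_psi_scaled[OF assms(4)] using LP_cutoff_values[OF assms(1)] by simp
qed

lemma LP_psi_zero:
  assumes "LP_cutoff \<phi>" "c > 0" "norm \<xi> \<le> 5/8 * c \<or> 3/2 * c \<le> norm \<xi>"
  shows "LP_psi \<phi> ((1 / c) *\<^sub>R \<xi>) = 0"
  using assms(3)
proof
  assume "norm \<xi> \<le> 5/8 * c"
  then have "0 \<le> (1 / c) * norm \<xi>" "(1 / c) * norm \<xi> \<le> 5/4" "0 \<le> (2 / c) * norm \<xi>" "(2 / c) * norm \<xi> \<le> 5/4"
    using assms(2) by (simp_all add: field_simps)
  then show ?thesis
    unfolding LP_psi_scaled[OF assms(2)] using LP_cutoff_values(1)[OF assms(1)] by simp
next
  assume n: "3/2 * c \<le> norm \<xi>"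
  have "3/2 \<le> (1 / c) * norm \<xi>" using assms(2) n by (simp add: field_simps)
  moreover have "3/2 \<le> (2 / c) * norm \<xi>" using assms(2) n norm_ge_zero[of \<xi>] by (simp add: field_simps)
  ultimately show ?thesis
    unfolding LP_psi_scaled[OF assms(2)] using LP_cutoff_values(2)[OF assms(1)] by simp
qed

lemma abs_LP_psi_le: "LP_cutoff \<phi> \<Longrightarrow> \<bar>LP_psi \<phi> \<xi>\<bar> \<le> 2"
  using LP_cutoff_values(3)[of \<phi> "norm \<xi>"] LP_cutoff_values(3)[of \<phi> "2 * norm \<xi>"] by (simp add: LP_psi_def)

lemma LP_psi_measurable:
  assumes "LP_cutoff \<phi>" "c > 0"
  shows "(\<lambda>\<xi>::real^'n. LP_psi \<phi> ((1 / c) *\<^sub>R \<xi>)) \<in> borel_measurable borel"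
proof -
  have "(\<lambda>\<xi>::real^'n. \<phi> ((1 / c) * norm \<xi>)) \<in> borel_measurable borel" "(\<lambda>\<xi>::real^'n. \<phi> ((2 / c) * norm \<xi>)) \<in> borel_measurable borel"
    using assms by (intro LP_cutoff_measurable; simp)+
  then show ?thesis unfolding LP_psi_scaled[OF assms(2)] by (rule borel_measurable_diff)
qed

lemma enn2real_inverse:
  assumes "1 \<le> q" "q \<noteq> \<infinity>"
  shows "enn2real (1 / q) = 1 / enn2real q" "enn2real q \<ge> 1"
proof -
  obtain r where r: "q = ennreal r" "r \<ge> 0" using assms by (cases q) auto
  then have "r \<ge> 1" using assms by (simp add: ennreal_1[symmetric] ennreal_le_iff del: ennreal_1)
  then show "enn2real (1 / q) = 1 / enn2real q" "enn2real q \<ge> 1"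
    using r divide_ennreal[of 1 r] by simp_all
qed

lemma ennreal_powr_ennreal: "x \<ge> 0 \<Longrightarrow> ennreal_powr (ennreal x) r = ennreal (x powr r)"
  by (simp add: ennreal_powr_def)

lemma ennreal_powr_mono: "x \<le> y \<Longrightarrow> r > 0 \<Longrightarrow> ennreal_powr x r \<le> ennreal_powr y r"
  by (cases x; cases y) (auto simp: ennreal_powr_ennreal ennreal_powr_def top_unique intro!: ennreal_leI powr_mono2)

text \<open>For q = \<infinity> the exponent 1/q is 0 and the power of the cardinality is 1 because
  S is nonempty; so one formula covers all q.\<close>

lemma lq_norm_le:
  assumes q: "1 \<le> q" and S: "finite S" "S \<noteq> {}" and X: "X \<ge> 0"
    and a: "\<And>k. k \<in> S \<Longrightarrow> a k \<le> ennreal X" "\<And>k. k \<notin> S \<Longrightarrow> a k = 0"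
  shows "lq_norm q a \<le> ennreal (X * real (card S) powr enn2real (1 / q))"
proof (cases "q = \<infinity>")
  case True
  have c: "card S \<noteq> 0" using S by simp
  have "a k \<le> ennreal X" for k using a[of k] by (cases "k \<in> S") auto
  then have "(SUP k. a k) \<le> ennreal X" by (rule SUP_least)
  then show ?thesis using True c by (simp add: lq_norm_def)
next
  case False
  define r where "r = enn2real q"
  have r: "enn2real (1 / q) = 1 / r" "r \<ge> 1" using enn2real_inverse[OF q False] by (simp_all add: r_def)
  have z: "ennreal_powr 0 r = 0" using r ennreal_powr_ennreal[of 0 r] by simp
  have "(\<Sum>k. ennreal_powr (a k) r) = (\<Sum>k\<in>S. ennreal_powr (a k) r)"
    by (rule suminf_finite[OF S(1)]) (simp add: a z)
  also have "\<dots> \<le> (\<Sum>k\<in>S. ennreal (X powr r))"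
    using r X by (intro sum_mono) (auto simp: ennreal_powr_ennreal[symmetric] intro!: ennreal_powr_mono a)
  also have "\<dots> = ennreal (real (card S) * X powr r)"
    by (simp add: ennreal_of_nat_eq_real_of_nat ennreal_mult)
  finally have "ennreal_powr (\<Sum>k. ennreal_powr (a k) r) (1 / r) \<le> ennreal_powr (ennreal (real (card S) * X powr r)) (1 / r)"
    using r by (intro ennreal_powr_mono) auto
  also have "\<dots> = ennreal (X * real (card S) powr (1 / r))"
    using r X by (simp add: ennreal_powr_ennreal powr_mult powr_powr mult.commute)
  finally show ?thesis using False by (simp add: lq_norm_def r(1)) (simp add: r_def)
qed

lemma lq_norm_ge:
  assumes q: "1 \<le> q" and S: "finite S" "S \<noteq> {}" and X: "X \<ge> 0"
    and a: "\<And>k. k \<in> S \<Longrightarrow> ennreal X \<le> a k"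
  shows "ennreal (X * real (card S) powr enn2real (1 / q)) \<le> lq_norm q a"
proof (cases "q = \<infinity>")
  case True
  have c: "card S \<noteq> 0" using S by simp
  obtain k where "k \<in> S" using S by blast
  then have "ennreal X \<le> (SUP k. a k)" using a by (meson SUP_upper2 UNIV_I)
  then show ?thesis using True c by (simp add: lq_norm_def)
next
  case False
  define r where "r = enn2real q"
  have r: "enn2real (1 / q) = 1 / r" "r \<ge> 1" using enn2real_inverse[OF q False] by (simp_all add: r_def)
  have "ennreal (real (card S) * X powr r) = (\<Sum>k\<in>S. ennreal (X powr r))"
    by (simp add: ennreal_of_nat_eq_real_of_nat ennreal_mult)
  also have "\<dots> \<le> (\<Sum>k\<in>S. ennreal_powr (a k) r)"
    using r X by (intro sum_mono) (auto simp: ennreal_powr_ennreal[symmetric] intro!: ennreal_powr_mono a)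
  also have "\<dots> \<le> (\<Sum>k. ennreal_powr (a k) r)"
    by (rule sum_le_suminf) (auto simp: S)
  finally have "ennreal_powr (ennreal (real (card S) * X powr r)) (1 / r) \<le> ennreal_powr (\<Sum>k. ennreal_powr (a k) r) (1 / r)"
    using r by (intro ennreal_powr_mono) auto
  also have "ennreal_powr (ennreal (real (card S) * X powr r)) (1 / r) = ennreal (X * real (card S) powr (1 / r))"
    using r X by (simp add: ennreal_powr_ennreal powr_mult powr_powr mult.commute)
  finally show ?thesis using False by (simp add: lq_norm_def r(1)) (simp add: r_def)
qed

section \<open>The initial data in the Besov space\<close>

context inflation
begin

lemma v_eq_sum: "v k x = (\<Sum>i\<in>UNIV. Re (ft (V k i) x) *\<^sub>R axis i 1)"
  unfolding v_def by (simp add: vec_eq_iff axis_def if_distrib cong: if_cong)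

lemma v_schwartz: "schwartz (v k)"
proof -
  have "bounded_linear (\<lambda>z. Re z *\<^sub>R (axis i 1 :: real^'n))" for i
    by (rule bounded_linear_compose[OF bounded_linear_scaleR_left bounded_linear_Re])
  then have "schwartz (\<lambda>x. \<Sum>i\<in>UNIV. Re (ft (V k i) x) *\<^sub>R (axis i 1 :: real^'n))"
    by (intro schwartz_sum schwartz_bounded_linear[where h="\<lambda>z. Re z *\<^sub>R _"] schwartz_ft(1) V_schwartz)
  then show ?thesis by (simp only: v_eq_sum[symmetric])
qed

lemma v0_schwartz: "schwartz (v0 \<alpha>)"
  unfolding v0_def[abs_def]
  by (intro schwartz_bounded_linear[OF bounded_linear_scaleR_right] schwartz_sum v_schwartz)

definition W :: "real \<Rightarrow> 'n \<Rightarrow> real^'n \<Rightarrow> complex" where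
  "W \<alpha> i \<xi> = (\<Sum>k\<in>ks. of_real \<alpha> * V k i \<xi>)"

lemma W_schwartz: "schwartz (W \<alpha> i)"
  unfolding W_def[abs_def] by (intro schwartz_sum schwartz_cmult V_schwartz)

lemma v0_W: "of_real (v0 \<alpha> x $ i) = ft (W \<alpha> i) x"
  unfolding W_def[abs_def] by (rule of_real_v0)

text \<open>On the frequency side the divergence contracts \<xi> with \<open>perp\<close>, which
  vanishes; this is the contraction identity with one of the two frequencies equal to 0.\<close>

lemma divergence_v0: "divergence (v0 \<alpha>) x = 0"
proof -
  have p: "partial i (v0 \<alpha>) x $ i = Re (ft (\<lambda>\<xi>. \<i> * of_real (\<xi> $ i) * W \<alpha> i \<xi>) x)" for i
  proof -
    have "partial i (v0 \<alpha>) x $ i = partial i (\<lambda>x. v0 \<alpha> x $ i) x"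
      by (rule partial_bounded_linear[OF bounded_linear_vec_nth schwartz_differentiable[OF v0_schwartz], symmetric])
    also have "(\<lambda>x. v0 \<alpha> x $ i) = (\<lambda>x. Re (ft (W \<alpha> i) x))" by (simp add: v0_W[symmetric])
    also have "partial i \<dots> x = Re (partial i (ft (W \<alpha> i)) x)"
      by (rule partial_bounded_linear[OF bounded_linear_Re schwartz_differentiable[OF schwartz_ft(1)[OF W_schwartz]]])
    also have "partial i (ft (W \<alpha> i)) = ft (\<lambda>\<xi>. \<i> * of_real (\<xi> $ i) * W \<alpha> i \<xi>)" by (rule partial_ft[OF W_schwartz])
    finally show ?thesis .
  qed
  have i: "integrable lborel (\<lambda>\<xi>. \<i> * of_real (\<xi> $ i) * W \<alpha> i \<xi>)" for i
    using schwartz_integrable[OF schwartz_cmult[OF schwartz_coord[OF W_schwartz[of \<alpha> i]], of \<i> i]] by (simp add: mult.assoc)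
  have "(\<Sum>i\<in>UNIV. \<i> * of_real (\<xi> $ i) * W \<alpha> i \<xi>) = 0" for \<xi>
  proof -
    have "(\<Sum>i\<in>UNIV. \<i> * of_real (\<xi> $ i) * W \<alpha> i \<xi>) = (\<Sum>k\<in>ks. \<Sum>i\<in>UNIV. \<i> * of_real (\<xi> $ i) * (of_real \<alpha> * V k i \<xi>))"
      unfolding W_def sum_distrib_left by (rule sum.swap)
    also have "\<dots> = (\<Sum>k\<in>ks. (\<i> * of_real \<alpha> * Psi k \<xi>) * (\<Sum>i\<in>UNIV. of_real (\<xi> $ i) * perp i \<xi>))"
      unfolding V_def sum_distrib_left by (intro sum.cong refl) (simp only: mult_ac)
    also have "\<dots> = 0" using perp_contract[of 0 \<xi>] by simp
    finally show ?thesis .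
  qed
  then have "ft (\<lambda>\<xi>. \<Sum>i\<in>UNIV. \<i> * of_real (\<xi> $ i) * W \<alpha> i \<xi>) x = 0" by (simp add: ft_def)
  then have "(\<Sum>i\<in>UNIV. ft (\<lambda>\<xi>. \<i> * of_real (\<xi> $ i) * W \<alpha> i \<xi>) x) = 0"
    by (subst (asm) ft_sum) (use i in auto)
  then show ?thesis unfolding divergence_def p by (simp only: Re_sum[symmetric] zero_complex.sel)
qed

lemma V_annulus:
  assumes "k \<in> ks" "V k i \<xi> \<noteq> 0"
  shows "63/64 * 2 ^ k \<le> norm \<xi>" "norm \<xi> \<le> 65/64 * 2 ^ k"
proof -
  have "Psi k \<xi> \<noteq> 0" using assms(2) by (auto simp: V_def)
  then show "63/64 * 2 ^ k \<le> norm \<xi>" "norm \<xi> \<le> 65/64 * 2 ^ k"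
    using Psi_norm[of k \<xi>] rho_kap(2)[OF assms(1)] by (simp_all add: kap_def)
qed

text \<open>The spectrum of block k lies between 63/64 and 65/64 times 2^k. This is inside the
  region where the symbol k is 1 and outside the supports of all other symbols, which start above
  5/4 2^k or end at 3/4 2^k.\<close>

lemma multiplier_V:
  assumes k: "k \<in> ks"
  shows "of_real (LP_psi \<phi> ((1 / 2 ^ j) *\<^sub>R \<xi>)) * V k i \<xi> = (if k = j then V k i \<xi> else 0)"
proof (cases "V k i \<xi> = 0")
  case False
  note n = V_annulus[OF k False]
  have p: "(2::real) ^ j > 0" "(2::real) ^ k > 0" by simp_all
  consider "k = j" | "k < j" | "j < k" by linarith
  then show ?thesis
  proof cases
    case 1
    have "LP_psi \<phi> ((1 / 2 ^ j) *\<^sub>R \<xi>) = 1" using n p 1 by (intro LP_psi_one[OF cutoff]) auto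
    then show ?thesis using 1 by simp
  next
    case 2
    then have "(2::real) ^ Suc k \<le> 2 ^ j" by (intro power_increasing) auto
    then have "LP_psi \<phi> ((1 / 2 ^ j) *\<^sub>R \<xi>) = 0" using n p by (intro LP_psi_zero[OF cutoff]) auto
    then show ?thesis using 2 by simp
  next
    case 3
    then have "(2::real) ^ Suc j \<le> 2 ^ k" by (intro power_increasing) auto
    then have "LP_psi \<phi> ((1 / 2 ^ j) *\<^sub>R \<xi>) = 0" using n p by (intro LP_psi_zero[OF cutoff]) auto
    then show ?thesis using 3 by simp
  qed
qed auto

lemma S0_v0:
  assumes "schwartz \<eta>"
  shows "LP_S0 \<phi> (real_dist (v0 \<alpha>)) \<eta> = real_dist (\<lambda>x. 0) \<eta>"
  unfolding LP_S0_def
proof (rule multiplier_real_dist[OF v0_schwartz _ _ W_schwartz v0_W _ _ _ assms])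
  show "(\<lambda>\<xi>::real^'n. \<phi> (norm \<xi>)) \<in> borel_measurable borel" using LP_cutoff_measurable[OF cutoff, of 1] by simp
  show "\<bar>\<phi> (norm \<xi>)\<bar> \<le> 1" for \<xi> :: "real^'n" by (rule LP_cutoff_values(3)[OF cutoff]) simp
  have "complex_of_real (\<phi> (norm \<xi>)) * W \<alpha> i \<xi> = 0" for \<xi> i
  proof -
    have "complex_of_real (\<phi> (norm \<xi>)) * (of_real \<alpha> * V k i \<xi>) = 0" if k: "k \<in> ks" for k
    proof (cases "V k i \<xi> = 0")
      case False
      have "(2::real) ^ 1 \<le> 2 ^ k" using k by (intro power_increasing) (auto simp: ks_def)
      then have "norm \<xi> \<ge> 3/2" using V_annulus(1)[OF k False] by simp
      then show ?thesis using LP_cutoff_values(2)[OF cutoff] by simp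
    qed simp
    then show ?thesis unfolding W_def sum_distrib_left by (intro sum.neutral ballI)
  qed
  then have z: "(\<lambda>\<xi>. complex_of_real (\<phi> (norm \<xi>)) * W \<alpha> i \<xi>) = (\<lambda>\<xi>. 0)" for i by blast
  show "of_real ((0::real^'n) $ i) = ft (\<lambda>\<xi>. of_real (\<phi> (norm \<xi>)) * W \<alpha> i \<xi>) x" for x i
    unfolding z by (simp add: ft_def)
  show "norm (0::real^'n) \<le> 0" by simp
qed simp

lemma Delta_v0:
  assumes "schwartz \<eta>"
  shows "LP_Delta \<phi> j (real_dist (v0 \<alpha>)) \<eta> = real_dist (\<lambda>x. if j \<in> ks then \<alpha> *\<^sub>R v j x else 0) \<eta>"
  unfolding LP_Delta_def
proof (rule multiplier_real_dist[OF v0_schwartz _ _ W_schwartz v0_W _ _ _ assms])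
  show "(\<lambda>\<xi>::real^'n. LP_psi \<phi> ((1 / 2 ^ j) *\<^sub>R \<xi>)) \<in> borel_measurable borel" by (rule LP_psi_measurable[OF cutoff]) simp
  show "\<bar>LP_psi \<phi> ((1 / 2 ^ j) *\<^sub>R \<xi>)\<bar> \<le> 2" for \<xi> :: "real^'n" by (rule abs_LP_psi_le[OF cutoff])
  have e: "complex_of_real (LP_psi \<phi> ((1 / 2 ^ j) *\<^sub>R \<xi>)) * W \<alpha> i \<xi> = (if j \<in> ks then of_real \<alpha> * V j i \<xi> else 0)" for \<xi> i
  proof -
    have "complex_of_real (LP_psi \<phi> ((1 / 2 ^ j) *\<^sub>R \<xi>)) * W \<alpha> i \<xi> =
      (\<Sum>k\<in>ks. of_real \<alpha> * (of_real (LP_psi \<phi> ((1 / 2 ^ j) *\<^sub>R \<xi>)) * V k i \<xi>))"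
      unfolding W_def sum_distrib_left by (simp only: mult.left_commute)
    also have "\<dots> = (\<Sum>k\<in>ks. if k = j then of_real \<alpha> * V j i \<xi> else 0)"
      by (intro sum.cong refl) (simp add: multiplier_V)
    also have "\<dots> = (if j \<in> ks then of_real \<alpha> * V j i \<xi> else 0)" by (simp add: sum.delta)
    finally show ?thesis .
  qed
  show "of_real ((if j \<in> ks then \<alpha> *\<^sub>R v j x else 0) $ i) = ft (\<lambda>\<xi>. of_real (LP_psi \<phi> ((1 / 2 ^ j) *\<^sub>R \<xi>)) * W \<alpha> i \<xi>) x" for x i
    unfolding e by (simp add: ft_cmult of_real_v[symmetric]) (simp add: ft_def)
  show "integrable lborel (\<lambda>x. if j \<in> ks then \<alpha> *\<^sub>R v j x else 0)"
    using schwartz_integrable[OF v_schwartz[of j]] by (cases "j \<in> ks") auto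
  show "norm (if j \<in> ks then \<alpha> *\<^sub>R v j x else 0) \<le> \<bar>\<alpha>\<bar> * (C1 * kap j)" for x
    using norm_v_le(1)[of j x] C1_pos kap_pos[of j] by (auto simp: less_imp_le intro!: mult_left_mono)
qed

text \<open>Each of the K active blocks has sup norm at most \<alpha> C1 2^j, so the weight 2^(-j)
  leaves a constant; the active indices are at most 102 L, because K \<le> L and L \<ge> 1.\<close>

lemma besov_input:
  assumes q: "1 \<le> q" and \<sigma>: "0 \<le> \<sigma>" and \<alpha>: "0 \<le> \<alpha>"
  shows "besov_norm \<phi> (- 1) \<sigma> \<infinity> q (real_dist (v0 \<alpha>)) \<le> ennreal (\<alpha> * C1 * (102 * real L) powr \<sigma> * real K powr enn2real (1 / q))"
proof -
  define X where "X = \<alpha> * C1 * (102 * real L) powr \<sigma>"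
  have X: "X \<ge> 0" using \<alpha> C1_pos by (simp add: X_def)
  have D: "dist_Lp_norm \<infinity> T \<le> ennreal B"
    if T: "\<And>\<eta>. schwartz \<eta> \<Longrightarrow> T \<eta> = real_dist f \<eta>" and B: "\<And>x. norm (f x) \<le> B" and [measurable]: "f \<in> borel_measurable borel"
    for T and f :: "real^'n \<Rightarrow> real^'n" and B
    by (rule dist_Lp_norm_infinity_le[where f="\<lambda>x. \<chi> i. complex_of_real (f x $ i)"])
       (use T B in \<open>auto simp: norm_vec_of_real real_dist_def\<close>)
  have S0: "dist_Lp_norm \<infinity> (LP_S0 \<phi> (real_dist (v0 \<alpha>))) = 0"
    using D[OF S0_v0, of 0] by simp
  have De: "dist_Lp_norm \<infinity> (LP_Delta \<phi> j (real_dist (v0 \<alpha>))) \<le> ennreal (if j \<in> ks then \<alpha> * (C1 * 2 ^ j) else 0)" for j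
    by (rule D[OF Delta_v0]) (use norm_v_le(1)[of j] \<alpha> in \<open>auto simp: kap_def intro!: mult_left_mono\<close>)
  \<comment> \<open>The sequence in the norm is shifted by one, so entry k belongs to block k +
    1.\<close>
  define S where "S = (\<lambda>k. k - 1) ` ks"
  have S: "finite S" "card S = K" "S \<noteq> {}"
  proof -
    have "inj_on (\<lambda>k. k - 1) ks" by (auto simp: inj_on_def ks_def)
    then show "card S = K" by (simp add: S_def card_image)
    then show "S \<noteq> {}" using K by auto
  qed (simp add: S_def)
  have mem: "k \<in> S \<longleftrightarrow> Suc k \<in> ks" for k
    unfolding S_def by (auto simp: ks_def image_iff intro: bexI[of _ "Suc k"])
  define f where "f k = (let j = Suc k in ennreal (2 powr (real j * - 1) * real j powr \<sigma>) * dist_Lp_norm \<infinity> (LP_Delta \<phi> j (real_dist (v0 \<alpha>))))" for k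
  have "lq_norm q f \<le> ennreal (X * real (card S) powr enn2real (1 / q))"
  proof (rule lq_norm_le[OF q S(1,3) X])
    fix k assume "k \<in> S"
    then have k: "Suc k \<in> ks" using mem by simp
    define j where "j = Suc k"
    have j: "j \<in> ks" using k by (simp add: j_def)
    have "f k \<le> ennreal (2 powr (real j * - 1) * real j powr \<sigma>) * ennreal (\<alpha> * (C1 * 2 ^ j))"
      unfolding f_def Let_def j_def[symmetric] using De[of j] j by (intro mult_left_mono) auto
    also have "\<dots> = ennreal (2 powr (real j * - 1) * real j powr \<sigma> * (\<alpha> * (C1 * 2 ^ j)))"
      using \<alpha> C1_pos by (intro ennreal_mult[symmetric]) auto
    also have "2 powr (real j * - 1) * real j powr \<sigma> * (\<alpha> * (C1 * 2 ^ j)) = \<alpha> * C1 * real j powr \<sigma>"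
      by (simp add: powr_minus powr_realpow field_simps)
    also have "ennreal (\<alpha> * C1 * real j powr \<sigma>) \<le> ennreal X"
      unfolding X_def
    proof (intro ennreal_leI mult_left_mono powr_mono2 \<sigma>)
      have "j \<le> 102 * L" using j K L by (simp add: ks_def)
      then show "real j \<le> 102 * real L" by (metis of_nat_le_iff of_nat_mult of_nat_numeral)
    qed (use \<alpha> C1_pos in auto)
    finally show "f k \<le> ennreal X" .
  next
    fix k assume "k \<notin> S"
    then show "f k = 0" using De[of "Suc k"] by (simp add: f_def mem)
  qed
  then show ?thesis unfolding besov_norm_def S0 f_def[symmetric] by (simp add: S(2) X_def)
qed

end

section \<open>The solution in the Besov space\<close>

lemma (in bump) LP_psi_Nl: "Nl l \<xi> \<noteq> 0 \<Longrightarrow> LP_psi \<phi> ((1 / 2 ^ (3 * l)) *\<^sub>R (- \<xi>)) = 1"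
  using scaled_support(2,3)[OF Nl_support, of l \<xi>] by (intro LP_psi_one[OF cutoff]) (auto simp: rr_def)

text \<open>The symbol of block 3 l is 1 on the spectrum of the test function, as 8^l = 2^(3 l).
  Testing the block therefore equals testing the function itself.\<close>

lemma (in bump) Delta_Nl:
  fixes f :: "real^'n \<Rightarrow> real^'m"
  assumes [measurable]: "f \<in> borel_measurable borel" and B: "AE x in lborel. norm (f x) \<le> B"
  shows "LP_Delta \<phi> (3 * l) (real_dist f) (ft (Nl l)) $ i = (LINT x|lborel. ft (Nl l) x * of_real (f x $ i))"
proof -
  have Ns: "schwartz (ft (Nl l))" by (rule schwartz_ft(1)[OF Nl_schwartz])
  have [measurable]: "ft (Nl l) \<in> borel_measurable borel" using Ns by measurable
  have "(\<lambda>\<xi>. complex_of_real (LP_psi \<phi> ((1 / 2 ^ (3 * l)) *\<^sub>R \<xi>)) * (ft (ft (Nl l)) \<xi> / of_real ((2 * pi) ^ CARD('n)))) = (\<lambda>\<xi>. Nl l (- \<xi>))"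
  proof
    fix \<xi>
    show "complex_of_real (LP_psi \<phi> ((1 / 2 ^ (3 * l)) *\<^sub>R \<xi>)) * (ft (ft (Nl l)) \<xi> / of_real ((2 * pi) ^ CARD('n))) = Nl l (- \<xi>)"
      unfolding schwartz_inversion[OF Nl_schwartz] using LP_psi_Nl[of l "- \<xi>"] by (cases "Nl l (- \<xi>) = 0") auto
  qed
  then have "LP_Delta \<phi> (3 * l) (real_dist f) (ft (Nl l)) = real_dist f (ft (Nl l))"
    unfolding LP_Delta_def LP_multiplier_apply by (simp only: ft_reflect[OF schwartz_integrable[OF Nl_schwartz]])
  also have "\<dots> $ i = (LINT x|lborel. ft (Nl l) x * of_real (f x $ i))"
  proof (rule real_dist_component)
    show "integrable lborel (\<lambda>x. norm (ft (Nl l) x) * norm (f x))"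
    proof (rule Bochner_Integration.integrable_bound)
      show "integrable lborel (\<lambda>x. norm (ft (Nl l) x) * B)" using schwartz_integrable[OF Ns] by simp
      show "AE x in lborel. norm (norm (ft (Nl l) x) * norm (f x)) \<le> norm (norm (ft (Nl l) x) * B)"
        using B by eventually_elim (auto simp: abs_mult intro!: mult_left_mono)
    qed measurable
  qed measurable
  finally show ?thesis .
qed

text \<open>The L blocks 3 l have sup norm at least of order \<alpha>^2 K 8^l, so the weight 2^(-3
  l) leaves \<alpha>^2 K; the logarithmic weight is at least L^\<sigma> since 3 l \<ge> L.\<close>

lemma (in large_inflation) besov_output:
  assumes q: "1 \<le> q" and \<sigma>: "0 \<le> \<sigma>"
    and u: "bounded_mild_solution T (v0 \<alpha>) u" and T: "tt \<le> T" and \<alpha>: "0 < \<alpha>" "\<alpha> \<le> 1"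
    and small: "512 * CB * C1 * \<alpha> \<le> 1"
  shows "ennreal (\<alpha>\<^sup>2 * real K * (c1 / (16 * CN)) * real L powr \<sigma> * real L powr enn2real (1 / q)) \<le> besov_norm \<phi> (- 1) \<sigma> \<infinity> q (real_dist (u tt))"
proof -
  obtain Bu where um: "u tt \<in> borel_measurable borel" and ub: "AE x in lborel. norm (u tt x) \<le> Bu"
    and lower: "\<And>l. l \<in> {L..<L+L} \<Longrightarrow> \<alpha>\<^sup>2 * real K * (rr l * c1 / 16) \<le> norm (LINT x|lborel. ft (Nl l) x * of_real (u tt x $ b))"
    using output_lower[OF u T \<alpha> small] by blast
  define Y where "Y = \<alpha>\<^sup>2 * real K * (c1 / (16 * CN))"
  have Y: "Y \<ge> 0" using c1_pos CN_pos by (simp add: Y_def)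
  define S where "S = (\<lambda>l. 3 * l - 1) ` {L..<L+L}"
  have S: "finite S" "card S = L" "S \<noteq> {}"
  proof -
    have "inj_on (\<lambda>l. 3 * l - 1) {L..<L+L}" using L by (auto simp: inj_on_def)
    then show "card S = L" by (simp add: S_def card_image)
    then show "S \<noteq> {}" using L by auto
  qed (simp add: S_def)
  define f where "f k = (let j = Suc k in ennreal (2 powr (real j * - 1) * real j powr \<sigma>) * dist_Lp_norm \<infinity> (LP_Delta \<phi> j (real_dist (u tt))))" for k
  have "ennreal ((Y * real L powr \<sigma>) * real (card S) powr enn2real (1 / q)) \<le> lq_norm q f"
  proof (rule lq_norm_ge[OF q S(1,3)])
    show "0 \<le> Y * real L powr \<sigma>" using Y by simp
    fix k assume "k \<in> S"
    then obtain l where l: "l \<in> {L..<L+L}" and kl: "k = 3 * l - 1" by (auto simp: S_def)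
    have j: "Suc k = 3 * l" using kl l L by auto
    have "ennreal (\<alpha>\<^sup>2 * real K * (rr l * c1 / 16) / CN) \<le> dist_Lp_norm \<infinity> (LP_Delta \<phi> (3 * l) (real_dist (u tt)))"
      by (rule dist_Lp_norm_infinity_ge[where \<eta>="ft (Nl l)" and i=b, OF schwartz_ft(1)[OF Nl_schwartz] CN_pos Nl_L1])
         (use lower[OF l] Delta_Nl[OF um ub, of l b] in simp)
    then have "ennreal (2 powr (real (3 * l) * - 1) * real (3 * l) powr \<sigma>) * ennreal (\<alpha>\<^sup>2 * real K * (rr l * c1 / 16) / CN) \<le> f k"
      unfolding f_def Let_def j by (rule mult_left_mono) simp
    moreover have "ennreal (2 powr (real (3 * l) * - 1) * real (3 * l) powr \<sigma>) * ennreal (\<alpha>\<^sup>2 * real K * (rr l * c1 / 16) / CN) =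
      ennreal (2 powr (real (3 * l) * - 1) * real (3 * l) powr \<sigma> * (\<alpha>\<^sup>2 * real K * (rr l * c1 / 16) / CN))"
      using c1_pos CN_pos rr_pos[of l] by (intro ennreal_mult[symmetric]) (auto simp: less_imp_le intro!: divide_nonneg_pos mult_nonneg_nonneg)
    moreover have "2 powr (real (3 * l) * - 1) * real (3 * l) powr \<sigma> * (\<alpha>\<^sup>2 * real K * (rr l * c1 / 16) / CN) = Y * real (3 * l) powr \<sigma>"
    proof -
      have "2 powr (real (3 * l) * - 1) = 1 / rr l"
        using powr_realpow[of "2::real" "3 * l"] by (simp add: powr_minus rr_def divide_inverse)
      then show ?thesis using rr_nonzero[of l] CN_pos unfolding Y_def by (simp only: ) (simp add: field_simps)
    qed
    moreover have "ennreal (Y * real L powr \<sigma>) \<le> ennreal (Y * real (3 * l) powr \<sigma>)"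
      using Y \<sigma> l by (intro ennreal_leI mult_left_mono powr_mono2) auto
    ultimately show "ennreal (Y * real L powr \<sigma>) \<le> f k" by (metis order_trans)
  qed
  also have "lq_norm q f \<le> besov_norm \<phi> (- 1) \<sigma> \<infinity> q (real_dist (u tt))"
    unfolding besov_norm_def f_def[symmetric] by simp
  finally show ?thesis by (simp add: S(2) Y_def)
qed

theorem theorem1p3:
  fixes \<phi> :: "real \<Rightarrow> real" and q :: ennreal and \<sigma> :: real
  assumes "LP_cutoff \<phi>"
    and "CARD('n::finite) \<ge> 2"
    and "1 \<le> q"
    and "0 \<le> \<sigma>" and "\<sigma> < sigma_crit q"
  shows "\<exists>C c \<delta>0 N0 :: real. C > 0 \<and> c > 0 \<and> \<delta>0 > 0 \<and> N0 > 0 \<and>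
    (\<forall>\<delta> N :: real. 0 < \<delta> \<and> \<delta> < \<delta>0 \<and> N > N0 \<longrightarrow>
      (\<exists>u0 :: real^'n \<Rightarrow> real^'n.
         schwartz u0 \<and> (\<forall>x. divergence u0 x = 0) \<and>
         besov_norm \<phi> (-1) \<sigma> \<infinity> q (real_dist u0) \<le> ennreal C \<and>
         (\<forall>u. bounded_mild_solution (1 / N) (\<lambda>x. \<delta> *\<^sub>R u0 x) u \<longrightarrow>
            (\<exists>t. 0 < t \<and> t \<le> 1 / N \<and>
               besov_norm \<phi> (-1) \<sigma> \<infinity> q (real_dist (u t))
                 \<ge> ennreal (c * ln N powr (sigma_crit q - \<sigma>))))))"
proof -
  have "\<not> CARD('n) \<le> Suc 0" using assms(2) by simp
  then obtain a b :: 'n where ab: "a \<noteq> b" by (auto simp: card_le_Suc0_iff_eq)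
  interpret bump \<phi> a b by unfold_locales (fact assms(1), fact ab)
  define \<iota> where "\<iota> = enn2real (1 / q)"
  define \<epsilon> where "\<epsilon> = sigma_crit q - \<sigma>"
  have \<epsilon>: "\<epsilon> > 0" using assms(5) by (simp add: \<epsilon>_def)
  have crit: "sigma_crit q = (if \<iota> \<le> 1/2 then 1 - \<iota> else \<iota>)"
    by (simp add: sigma_crit_def \<iota>_def[symmetric] min_def)
  define c where "c = c1 / (16 * CN)"
  have c: "c > 0" using c1_pos CN_pos by (simp add: c_def)
  define C where "C = C1 * 102 powr \<sigma>"
  have C: "C > 0" using C1_pos by (simp add: C_def)
  \<comment> \<open>The second bound is the smallness required by the bootstrap. It involves neither
    L nor N because the bound on sqrt \<tau> |U| is uniform in both L and K.\<close>
  define \<delta>0 where "\<delta>0 = min 1 (1 / (512 * CB * C1))"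
  have \<delta>0: "\<delta>0 > 0" using CB_pos C1_pos by (simp add: \<delta>0_def)
  have main: "\<exists>u0 :: real^'n \<Rightarrow> real^'n. schwartz u0 \<and> (\<forall>x. divergence u0 x = 0) \<and>
         besov_norm \<phi> (-1) \<sigma> \<infinity> q (real_dist u0) \<le> ennreal C \<and>
         (\<forall>u. bounded_mild_solution (1 / N) (\<lambda>x. \<delta> *\<^sub>R u0 x) u \<longrightarrow>
            (\<exists>t. 0 < t \<and> t \<le> 1 / N \<and>
               besov_norm \<phi> (-1) \<sigma> \<infinity> q (real_dist (u t)) \<ge> ennreal (c * ln N powr \<epsilon>)))"
    if \<delta>: "0 < \<delta>" "\<delta> < \<delta>0" and N: "N > 1" for \<delta> N :: real
  proof -
    \<comment> \<open>The target for L^\<epsilon>: beyond this value the factor \<delta>^2 of the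
      quadratic response is compensated.\<close>
    define Z where "Z = ln N powr \<epsilon> / \<delta>\<^sup>2"
    have Z: "Z \<ge> 0" by (simp add: Z_def)
    \<comment> \<open>L dominates at once the threshold \<open>Mc\<close>, the number N (so that
      \<open>tt\<close> is at most 1 / N) and the \<epsilon>-th root of Z.\<close>
    obtain L :: nat where L: "1 + \<bar>Mc\<bar> + N + Z powr (1 / \<epsilon>) \<le> real L" using real_arch_simple by blast
    have Zp: "Z powr (1 / \<epsilon>) \<ge> 0" by simp
    have L1: "real L \<ge> 1" and LM: "Mc \<le> real L" and LN: "N \<le> real L" and LZ: "Z powr (1 / \<epsilon>) \<le> real L"
      using L N Zp by linarith+
    define K where "K = (if \<iota> \<le> 1/2 then L else 1)"
    have L2: "real L \<le> 2 ^ L" by (simp add: of_nat_less_two_power less_imp_le)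
    interpret large_inflation \<phi> a b L K
      by unfold_locales (use L1 order_trans[OF LM L2] in \<open>auto simp: K_def\<close>)
    \<comment> \<open>Normalises the data: it cancels L^\<sigma> K^(1/q) in
      \<open>besov_input\<close>, up to the constant 102^\<sigma>.\<close>
    define a0 where "a0 = real L powr (- \<sigma>) * real K powr (- \<iota>)"
    have K1: "real K \<ge> 1" using K by simp
    have a0: "0 < a0" "a0 \<le> 1"
    proof -
      show "0 < a0" using L1 K1 by (simp add: a0_def)
      have "real L powr (- \<sigma>) \<le> 1" "real K powr (- \<iota>) \<le> 1"
        using L1 K1 assms(4) powr_mono[of "- \<sigma>" 0 "real L"] powr_mono[of "- \<iota>" 0 "real K"] by (auto simp: \<iota>_def)
      then show "a0 \<le> 1" unfolding a0_def by (intro mult_le_one) auto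
    qed
    have ttN: "tt \<le> 1 / N"
    proof -
      have "real L \<le> 2 ^ L" by (rule L2)
      also have "\<dots> \<le> 2 ^ (100 * L)" by (intro power_increasing) auto
      also have "\<dots> \<le> 4 ^ (100 * L)" by (intro power_mono) auto
      finally have "N \<le> 4 ^ (100 * L)" using LN by (rule order_trans[rotated])
      then show ?thesis unfolding tt_def using N by (intro frac_le) auto
    qed
    have \<alpha>: "0 < \<delta> * a0" "\<delta> * a0 \<le> 1" "512 * CB * C1 * (\<delta> * a0) \<le> 1"
    proof -
      show "0 < \<delta> * a0" using \<delta> a0 by simp
      have "\<delta> * a0 \<le> \<delta> * 1" using \<delta> a0 by (intro mult_left_mono) auto
      moreover have "\<delta> \<le> 1" "\<delta> \<le> 1 / (512 * CB * C1)" using \<delta> by (auto simp: \<delta>0_def)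
      ultimately have le: "\<delta> * a0 \<le> 1" "\<delta> * a0 \<le> 1 / (512 * CB * C1)" by linarith+
      show "\<delta> * a0 \<le> 1" by (rule le)
      have "512 * CB * C1 > 0" using CB_pos C1_pos by simp
      then show "512 * CB * C1 * (\<delta> * a0) \<le> 1" using le(2) by (simp add: pos_le_divide_eq mult.commute)
    qed
    have size: "c * ln N powr \<epsilon> \<le> (\<delta> * a0)\<^sup>2 * real K * (c1 / (16 * CN)) * real L powr \<sigma> * real L powr enn2real (1 / q)"
    proof -
      have "a0\<^sup>2 * real K * real L powr \<sigma> * real L powr \<iota> = real L powr \<epsilon>"
      proof -
        have "a0\<^sup>2 = real L powr (- 2 * \<sigma>) * real K powr (- 2 * \<iota>)"
          unfolding a0_def power_mult_distrib unfolding power2_eq_square powr_add[symmetric] by simp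
        then have "a0\<^sup>2 * real K * real L powr \<sigma> * real L powr \<iota> =
          (real L powr (- 2 * \<sigma>) * real L powr \<sigma> * real L powr \<iota>) * (real K powr (- 2 * \<iota>) * real K powr 1)"
          using K1 by simp
        also have "\<dots> = real L powr (\<iota> - \<sigma>) * real K powr (1 - 2 * \<iota>)"
          unfolding powr_add[symmetric] by (simp add: algebra_simps)
        \<comment> \<open>For 1/q \<le> 1/2 and K = L the exponents add to 1 - 1/q - \<sigma>;
          otherwise K = 1 leaves 1/q - \<sigma>. Both equal \<epsilon> by the two cases of the
          critical exponent.\<close>
        also have "\<dots> = real L powr \<epsilon>"
          using L1 by (cases "\<iota> \<le> 1/2") (simp_all add: K_def \<epsilon>_def crit algebra_simps flip: powr_add)
        finally show ?thesis .
      qed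
      then have "(\<delta> * a0)\<^sup>2 * real K * (c1 / (16 * CN)) * real L powr \<sigma> * real L powr enn2real (1 / q) = c * (\<delta>\<^sup>2 * real L powr \<epsilon>)"
        unfolding \<iota>_def[symmetric] c_def[symmetric] power_mult_distrib by (metis (no_types, opaque_lifting) mult.assoc mult.left_commute)
      moreover have "Z \<le> real L powr \<epsilon>"
      proof -
        have "Z = (Z powr (1 / \<epsilon>)) powr \<epsilon>" using \<epsilon> Z by (simp add: powr_powr)
        also have "\<dots> \<le> real L powr \<epsilon>" using \<epsilon> LZ by (intro powr_mono2) auto
        finally show ?thesis .
      qed
      then have "ln N powr \<epsilon> \<le> \<delta>\<^sup>2 * real L powr \<epsilon>" using \<delta> by (simp add: Z_def field_simps)
      then have "c * ln N powr \<epsilon> \<le> c * (\<delta>\<^sup>2 * real L powr \<epsilon>)" using c by (intro mult_left_mono) auto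
      ultimately show ?thesis by simp
    qed
    show ?thesis
    proof (intro exI[of _ "v0 a0"] conjI allI impI)
      show "schwartz (v0 a0)" by (rule v0_schwartz)
      show "divergence (v0 a0) x = 0" for x by (rule divergence_v0)
      have "a0 * C1 * (102 * real L) powr \<sigma> * real K powr \<iota> = C * (real L powr (- \<sigma>) * real L powr \<sigma>) * (real K powr (- \<iota>) * real K powr \<iota>)"
        by (simp add: a0_def C_def powr_mult)
      also have "\<dots> = C" using L1 K1 by (simp flip: powr_add)
      finally show "besov_norm \<phi> (-1) \<sigma> \<infinity> q (real_dist (v0 a0)) \<le> ennreal C"
        using besov_input[OF assms(3,4), of a0] a0 by (simp add: \<iota>_def)
      fix u assume "bounded_mild_solution (1 / N) (\<lambda>x. \<delta> *\<^sub>R v0 a0 x) u"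
      then have u: "bounded_mild_solution (1 / N) (v0 (\<delta> * a0)) u" by (simp add: v0_def[abs_def])
      have "ennreal (c * ln N powr \<epsilon>) \<le> besov_norm \<phi> (-1) \<sigma> \<infinity> q (real_dist (u tt))"
        by (rule order_trans[OF ennreal_leI[OF size] besov_output[OF assms(3,4) u ttN \<alpha>]])
      then show "\<exists>t. 0 < t \<and> t \<le> 1 / N \<and> besov_norm \<phi> (-1) \<sigma> \<infinity> q (real_dist (u t)) \<ge> ennreal (c * ln N powr \<epsilon>)"
        using tt_pos ttN by blast
    qed
  qed
  show ?thesis
    by (rule exI[of _ C], rule exI[of _ c], rule exI[of _ \<delta>0], rule exI[of _ 1])
       (use C c \<delta>0 main in \<open>simp add: \<epsilon>_def\<close>)
qed

end
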